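(* Let $d_X$ be either the Manhattan distance $d_X(a,b)=\|a-b\|_1$ or the Euclidean distance $d_X(a,b)=\|a-b\|_2$ on $\mathbb{R}^d$. There is a randomized algorithm (the algorithm $\texttt{Chamfer-Estimate}$) which, given as input two finite sets $A,B\subset\mathbb{R}^d$ with $|A|,|B|\le n$ and an accuracy parameter $0<\varepsilon<1$, runs in time $O(nd\log(n)/\varepsilon^2)$ and outputs a number $\eta$ such that, with probability at least $99/100$, $$(1-\varepsilon)\,\mathrm{CH}(A,B)\le \eta\le (1+\varepsilon)\,\mathrm{CH}(A,B).$$
   Context: For finite sets $A,B$ in a metric space with distance $d_X$, the Chamfer distance from $A$ to $B$ is $\mathrm{CH}(A,B)=\sum_{a\in A}\min_{b\in B} d_X(a,b)$. *)

theory Defs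
  imports "HOL-Probability.Probability"
begin

section \<open>Points, distances and the Chamfer distance\<close>

text \<open>The dimension is an input of the algorithm, so a point of \<open>\<real>\<^sup>d\<close> is a list of
  \<open>d\<close> coordinates. Both distances are only used on lists of equal length.\<close>

definition Rd :: "nat \<Rightarrow> real list set" where
  "Rd d = {x. length x = d}"

definition manhattan_dist :: "real list \<Rightarrow> real list \<Rightarrow> real" where
  "manhattan_dist a b = (\<Sum>i<length a. \<bar>a ! i - b ! i\<bar>)"

definition euclidean_dist :: "real list \<Rightarrow> real list \<Rightarrow> real" where
  "euclidean_dist a b = L2_set (\<lambda>i. a ! i - b ! i) {..<length a}"

text \<open>Meaningful for finite \<open>A\<close> and finite nonempty \<open>B\<close>.\<close>

definition chamfer :: "('a \<Rightarrow> 'a \<Rightarrow> real) \<Rightarrow> 'a set \<Rightarrow> 'a set \<Rightarrow> real" where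
  "chamfer dX A B = (\<Sum>a\<in>A. MIN b\<in>B. dX a b)"


section \<open>A randomized real RAM\<close>

text \<open>The machine has an integer memory, used for counters and addresses, and a real memory,
  both addressed by natural numbers, with indirect addressing. Integers can be added,
  subtracted (truncating at 0), compared and converted to reals. Reals admit exact field
  arithmetic, square roots and comparisons. There is no rounding from reals to integers and no
  integer multiplication at unit cost, which would make unit-cost computation unrealistically
  powerful, and the only real constants a program can mention are natural numbers.\<close>

datatype nexp =
    NConst nat
  | NLoad nexp
  | NAdd nexp nexp
  | NSub nexp nexp

datatype rexp =
    ROfNat nexp
  | RLoad nexp
  | RAdd rexp rexp
  | RSub rexp rexp
  | RMult rexp rexp
  | RDiv rexp rexp
  | RSqrt rexp

datatype bexp =
    NLess nexp nexp
  | RLess rexp rexp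
  | BNot bexp
  | BAnd bexp bexp

text \<open>The first argument of \<open>NStore\<close>, \<open>RStore\<close> and \<open>Sample\<close> is the address written to.\<close>

datatype com =
    Skip
  | NStore nexp nexp
  | RStore nexp rexp
  | Sample nexp
  | Seq com com
  | Cond bexp com com
  | While bexp com

text \<open>\<open>pos\<close> is the number of random values consumed so far.\<close>

record state =
  nmem :: "nat \<Rightarrow> nat"
  rmem :: "nat \<Rightarrow> real"
  pos :: nat

fun nval :: "nexp \<Rightarrow> state \<Rightarrow> nat" where
  "nval (NConst n) s = n"
| "nval (NLoad a) s = nmem s (nval a s)"
| "nval (NAdd e f) s = nval e s + nval f s"
| "nval (NSub e f) s = nval e s - nval f s"

fun rval :: "rexp \<Rightarrow> state \<Rightarrow> real" where
  "rval (ROfNat e) s = real (nval e s)"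
| "rval (RLoad a) s = rmem s (nval a s)"
| "rval (RAdd e f) s = rval e s + rval f s"
| "rval (RSub e f) s = rval e s - rval f s"
| "rval (RMult e f) s = rval e s * rval f s"
| "rval (RDiv e f) s = rval e s / rval f s"
| "rval (RSqrt e) s = sqrt (rval e s)"

fun bval :: "bexp \<Rightarrow> state \<Rightarrow> bool" where
  "bval (NLess e f) s = (nval e s < nval f s)"
| "bval (RLess e f) s = (rval e s < rval f s)"
| "bval (BNot b) s = (\<not> bval b s)"
| "bval (BAnd b c) s = (bval b s \<and> bval c s)"

text \<open>\<open>exec \<omega> c s k s'\<close>: started in \<open>s\<close> with the sequence \<open>\<omega>\<close> of random values, \<open>c\<close> terminates in
  \<open>s'\<close> after \<open>k\<close> time units. Each store, sampling step and test is charged one unit; the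
  expressions evaluated there are part of the program text, so their sizes, unlike the sizes of
  the inputs, only contribute a constant factor.\<close>

inductive exec :: "(nat \<Rightarrow> real) \<Rightarrow> com \<Rightarrow> state \<Rightarrow> nat \<Rightarrow> state \<Rightarrow> bool" for \<omega> where
  Skip: "exec \<omega> Skip s 1 s"
| NStore: "exec \<omega> (NStore a e) s 1 (s\<lparr>nmem := (nmem s)(nval a s := nval e s)\<rparr>)"
| RStore: "exec \<omega> (RStore a e) s 1 (s\<lparr>rmem := (rmem s)(nval a s := rval e s)\<rparr>)"
| Sample: "exec \<omega> (Sample a) s 1
    (s\<lparr>rmem := (rmem s)(nval a s := \<omega> (pos s)), pos := Suc (pos s)\<rparr>)"
| Seq: "exec \<omega> c s k s' \<Longrightarrow> exec \<omega> c' s' k' s'' \<Longrightarrow> exec \<omega> (Seq c c') s (k + k') s''"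
| CondTrue: "bval b s \<Longrightarrow> exec \<omega> c s k s' \<Longrightarrow> exec \<omega> (Cond b c c') s (Suc k) s'"
| CondFalse: "\<not> bval b s \<Longrightarrow> exec \<omega> c' s k s' \<Longrightarrow> exec \<omega> (Cond b c c') s (Suc k) s'"
| WhileFalse: "\<not> bval b s \<Longrightarrow> exec \<omega> (While b c) s 1 s"
| WhileTrue: "bval b s \<Longrightarrow> exec \<omega> c s k s' \<Longrightarrow> exec \<omega> (While b c) s' k' s'' \<Longrightarrow>
    exec \<omega> (While b c) s (Suc (k + k')) s''"

inductive_cases exec_cases [elim!]:
  "exec \<omega> Skip s k t" "exec \<omega> (NStore a e) s k t" "exec \<omega> (RStore a e) s k t"
  "exec \<omega> (Sample a) s k t" "exec \<omega> (Seq c c') s k t" "exec \<omega> (Cond b c c') s k t"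

inductive_cases While_exec: "exec \<omega> (While b c) s k t"

lemma exec_deterministic:
  "exec \<omega> c s k t \<Longrightarrow> exec \<omega> c s k' t' \<Longrightarrow> k' = k \<and> t' = t"
proof (induction arbitrary: k' t' rule: exec.induct)
  case (WhileFalse b s c)
  from WhileFalse.prems show ?case
    by (rule While_exec) (use WhileFalse.hyps in simp_all)
next
  case (WhileTrue b s c k s' l s'')
  from WhileTrue.prems show ?case
    by (rule While_exec) (use WhileTrue.hyps WhileTrue.IH in blast)+
qed (blast | fastforce)+

definition halts_within :: "com \<Rightarrow> (nat \<Rightarrow> real) \<Rightarrow> state \<Rightarrow> real \<Rightarrow> bool" where
  "halts_within c \<omega> s t \<longleftrightarrow> (\<exists>k s'. exec \<omega> c s k s' \<and> real k \<le> t)"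

text \<open>The result of a run is the final content of real cell 0.\<close>

definition outputs :: "com \<Rightarrow> (nat \<Rightarrow> real) \<Rightarrow> state \<Rightarrow> real \<Rightarrow> bool" where
  "outputs c \<omega> s y \<longleftrightarrow> (\<exists>k s'. exec \<omega> c s k s' \<and> rmem s' 0 = y)"

text \<open>Independent uniform samples from \<open>[0, 1]\<close>.\<close>

definition random_source :: "(nat \<Rightarrow> real) measure" where
  "random_source = (\<Pi>\<^sub>M i\<in>UNIV. restrict_space lborel {0..1})"

lemma space_random_source: "space random_source = {\<omega>. \<forall>i. \<omega> i \<in> {0..1}}"
  by (auto simp: random_source_def space_PiM space_restrict_space PiE_def)

lemma prob_space_random_source: "prob_space random_source"
  unfolding random_source_def
  by (intro prob_space_PiM prob_space_restrict_space) auto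

text \<open>The points of the two sets are listed one after the other, without repetition but in an
  arbitrary order. The integer cells 0, 1, 2 hold the two cardinalities and the dimension; the
  real memory holds the accuracy parameter, followed by all coordinates. All other cells are 0.\<close>

definition input_state :: "nat \<Rightarrow> real list list \<Rightarrow> real list list \<Rightarrow> real \<Rightarrow> state" where
  "input_state d xs ys \<epsilon> =
    (let ns = [length xs, length ys, d]; rs = \<epsilon> # concat (xs @ ys)
     in \<lparr>nmem = (\<lambda>i. if i < length ns then ns ! i else 0),
         rmem = (\<lambda>i. if i < length rs then rs ! i else 0),
         pos = 0\<rparr>)"

definition enumerates :: "'a list \<Rightarrow> 'a set \<Rightarrow> bool" where
  "enumerates xs A \<longleftrightarrow> distinct xs \<and> set xs = A"

end

theory Submission
  imports Defs
begin

text \<open>Let \<open>N = |A| + |B|\<close> and \<open>q = O(log N)\<close> with \<open>2\<^sup>q \<ge> N\<close>. A crude upper bound \<open>D a\<close> of the distance from \<open>a\<close> to \<open>B\<close> is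
  found by mapping all points to the line. In every coordinate, each gap between consecutive values is divided by an
  independent uniform variable and raised to the power \<open>q\<close>; the image of a point is the sum over its coordinates, with
  uniform random coefficients, of the transformed gaps below it. A sum of at most \<open>N d\<close> such powers is governed by its largest term, which behaves
  like a race of exponential clocks, so that the points of \<open>B\<close> next to \<open>a\<close> on the line are, up to a factor \<open>O(q)\<close>
  with heavy tail, as close to \<open>a\<close> as its nearest neighbour. For the Euclidean distance the same holds in dimension
  \<open>O(q)\<close>, which a random projection achieves. The best of four independent copies has finite mean, hence
  \<open>\<Sum>a. D a = O(q) CH(A, B)\<close>.

  Sampling \<open>O(q / \<epsilon>\<^sup>2)\<close> points \<open>a\<close> with probability proportional to \<open>D a\<close> and computing their exact distances to \<open>B\<close>
  in time \<open>O(N d)\<close> each gives an unbiased estimator, to which Chebyshev's inequality applies. Each of the two phases takes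
  time \<open>O(N d q)\<close>, up to the factor \<open>1 / \<epsilon>\<^sup>2\<close>.\<close>

subsection \<open>Resampling coordinates of the random source\<close>

text \<open>Grids and hashing round real numbers, which this machine cannot do; comparisons and
  field arithmetic remain. Sorting on a line costs only \<open>O(N log N)\<close> per coordinate,
  but a plain map to the line does not respect neighbourhoods. The power \<open>q\<close> repairs
  this: a loss polynomial in \<open>N\<close>, such as that of a union bound over all pairs, becomes
  a constant after taking the \<open>q\<close>-th root. Dividing a gap \<open>l\<close> by a uniform
  \<open>u\<close> makes \<open>l / u\<close> exceed \<open>s\<close> with probability at most
  \<open>l / s\<close>, and makes all of several independent quotients stay below \<open>z\<close>
  with probability at most \<open>exp (- L / z)\<close>, where \<open>L\<close> is the sum of their
  gaps. These two tails meet at the l1 distance, the sum of the gaps between two points, up to a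
  factor \<open>O(q)\<close>. For the Euclidean distance the conversion costs a factor
  \<open>k\<close> in dimension \<open>k\<close>, which is why \<open>k\<close> must be
  \<open>O(q)\<close>. An overestimate by \<open>O(q)\<close> is harmless, because it enters only
  the variance of the importance sampling and thus the number of samples.\<close>

abbreviation unif :: "real measure" where "unif \<equiv> restrict_space lborel {0..1}"

text \<open>Replacing the coordinates in \<open>J\<close> by those of an independent copy expresses
  conditioning on the coordinates outside \<open>J\<close>: \<open>\<omega>\<close> stays fixed and
  \<open>\<omega>'\<close> is integrated. The sequence space is never split into two product
  spaces.\<close>

definition mrg :: "nat set \<Rightarrow> (nat \<Rightarrow> real) \<Rightarrow> (nat \<Rightarrow> real) \<Rightarrow> nat \<Rightarrow> real" where
  "mrg J \<omega> \<omega>' = (\<lambda>j. if j \<in> J then \<omega>' j else \<omega> j)"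

interpretation unif: prob_space unif
  by (intro prob_space_restrict_space) auto

interpretation src: product_prob_space "\<lambda>_::nat. unif" "UNIV :: nat set"
  by unfold_locales

interpretation S: prob_space random_source
  by (rule prob_space_random_source)

lemma space_unif [simp]: "space unif = {0..1}"
  by (simp add: space_restrict_space)

lemma mem_space_source: "\<omega> \<in> space random_source \<Longrightarrow> 0 \<le> \<omega> j \<and> \<omega> j \<le> 1"
  by (auto simp: space_random_source)

lemma mrg_space: "\<omega> \<in> space random_source \<Longrightarrow> \<omega>' \<in> space random_source \<Longrightarrow> mrg J \<omega> \<omega>' \<in> space random_source"
  by (auto simp: space_random_source mrg_def)

lemma coord_unif_measurable: "(\<lambda>\<omega>. \<omega> j) \<in> measurable random_source unif"
  unfolding random_source_def by (rule measurable_component_singleton) simp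

lemma coord_measurable [measurable (raw)]: "(\<lambda>\<omega>. \<omega> j) \<in> borel_measurable random_source"
proof -
  have "(\<lambda>x. x) \<in> measurable unif borel" by (rule measurable_restrict_space1) simp
  from measurable_compose[OF coord_unif_measurable this] show ?thesis .
qed

lemma mrg_measurable: "(\<lambda>(\<omega>, \<omega>'). mrg J \<omega> \<omega>') \<in> measurable (random_source \<Otimes>\<^sub>M random_source) random_source"
proof -
  have "(\<lambda>p j. mrg J (fst p) (snd p) j) \<in> measurable (random_source \<Otimes>\<^sub>M random_source) (Pi\<^sub>M UNIV (\<lambda>_. unif))"
    unfolding mrg_def
  proof (rule measurable_PiM_single')
    fix j
    show "(\<lambda>p. if j \<in> J then snd p j else fst p j) \<in> measurable (random_source \<Otimes>\<^sub>M random_source) unif"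
      using measurable_compose[OF measurable_fst coord_unif_measurable[of j], of random_source]
        measurable_compose[OF measurable_snd coord_unif_measurable[of j], of random_source]
      by (cases "j \<in> J") auto
  qed (auto simp: space_pair_measure space_random_source)
  then show ?thesis by (simp add: random_source_def[symmetric] case_prod_unfold)
qed

lemma mrg_measurable1:
  assumes "\<omega> \<in> space random_source"
  shows "(\<lambda>\<omega>'. mrg J \<omega> \<omega>') \<in> measurable random_source random_source"
  using measurable_compose[OF measurable_Pair1'[OF assms] mrg_measurable[of J]] by simp

text \<open>Both measures are compared on cylinders. The preimage of a cylinder over
  \<open>K\<close> is a product of cylinders over \<open>K - J\<close> and
  \<open>K \<inter> J\<close>, so its measure is again the product of the one-dimensional
  measures.\<close>

lemma distr_mrg: "distr (random_source \<Otimes>\<^sub>M random_source) random_source (\<lambda>(\<omega>, \<omega>'). mrg J \<omega> \<omega>') = random_source"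
  (is "?D = _")
proof -
  interpret PP: pair_prob_space random_source random_source ..
  have "?D = Pi\<^sub>M UNIV (\<lambda>_. unif)"
  proof (rule src.PiM_eq)
    fix K :: "nat set" and E assume K: "finite K" "K \<subseteq> UNIV" "\<And>j. j \<in> K \<Longrightarrow> E j \<in> sets unif"
    let ?X = "prod_emb UNIV (\<lambda>_. unif) K (\<Pi>\<^sub>E j\<in>K. E j)"
    let ?E = "prod_emb UNIV (\<lambda>_. unif) (K - J) (\<Pi>\<^sub>E j\<in>K-J. E j)"
    let ?F = "prod_emb UNIV (\<lambda>_. unif) (K \<inter> J) (\<Pi>\<^sub>E j\<in>K\<inter>J. E j)"
    have X: "?X \<in> sets random_source" "?E \<in> sets random_source" "?F \<in> sets random_source"
      unfolding random_source_def using K by (auto intro!: sets_PiM_I)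
    have X_iff: "\<omega> \<in> prod_emb UNIV (\<lambda>_. unif) L (\<Pi>\<^sub>E j\<in>L. E j) \<longleftrightarrow> \<omega> \<in> space random_source \<and> (\<forall>j\<in>L. \<omega> j \<in> E j)" for \<omega> and L :: "nat set"
      by (auto simp: prod_emb_def random_source_def space_PiM PiE_iff)
    have "(\<lambda>(\<omega>, \<omega>'). mrg J \<omega> \<omega>') -` ?X \<inter> space (random_source \<Otimes>\<^sub>M random_source) = ?E \<times> ?F"
    proof (intro set_eqI iffI)
      fix p :: "(nat \<Rightarrow> real) \<times> (nat \<Rightarrow> real)"
      assume "p \<in> (\<lambda>(\<omega>, \<omega>'). mrg J \<omega> \<omega>') -` ?X \<inter> space (random_source \<Otimes>\<^sub>M random_source)"
      then have 1: "\<forall>j\<in>K. mrg J (fst p) (snd p) j \<in> E j" "fst p \<in> space random_source" "snd p \<in> space random_source"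
        by (auto simp: X_iff space_pair_measure)
      have "\<forall>j\<in>K-J. fst p j \<in> E j" "\<forall>j\<in>K\<inter>J. snd p j \<in> E j"
        using 1(1) by (force simp: mrg_def)+
      then show "p \<in> ?E \<times> ?F" using 1 by (auto simp: X_iff mem_Times_iff)
    next
      fix p :: "(nat \<Rightarrow> real) \<times> (nat \<Rightarrow> real)"
      assume "p \<in> ?E \<times> ?F"
      then have 1: "\<forall>j\<in>K-J. fst p j \<in> E j" "\<forall>j\<in>K\<inter>J. snd p j \<in> E j"
         "fst p \<in> space random_source" "snd p \<in> space random_source"
        by (auto simp: X_iff)
      then have "\<forall>j\<in>K. mrg J (fst p) (snd p) j \<in> E j" by (auto simp: mrg_def)
      then show "p \<in> (\<lambda>(\<omega>, \<omega>'). mrg J \<omega> \<omega>') -` ?X \<inter> space (random_source \<Otimes>\<^sub>M random_source)"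
        using 1 mrg_space by (auto simp: X_iff space_pair_measure split_beta mem_Times_iff)
    qed
    then have "emeasure ?D ?X = emeasure (random_source \<Otimes>\<^sub>M random_source) (?E \<times> ?F)"
      using X by (subst emeasure_distr[OF mrg_measurable]) auto
    also have "\<dots> = emeasure random_source ?E * emeasure random_source ?F"
      using X by (intro S.emeasure_pair_measure_Times) auto
    also have "emeasure random_source ?E = (\<Prod>j\<in>K-J. emeasure unif (E j))"
      unfolding random_source_def using K by (intro src.emeasure_PiM_emb) auto
    also have "emeasure random_source ?F = (\<Prod>j\<in>K\<inter>J. emeasure unif (E j))"
      unfolding random_source_def using K by (intro src.emeasure_PiM_emb) auto
    also have "(\<Prod>j\<in>K-J. emeasure unif (E j)) * (\<Prod>j\<in>K\<inter>J. emeasure unif (E j)) = (\<Prod>j\<in>K. emeasure unif (E j))"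
      using K by (subst prod.union_disjoint[symmetric]) (auto intro!: prod.cong)
    finally show "emeasure ?D ?X = (\<Prod>j\<in>K. emeasure unif (E j))" .
  qed (simp add: random_source_def)
  then show ?thesis by (simp add: random_source_def)
qed

lemma nn_integral_mrg:
  assumes [measurable]: "f \<in> borel_measurable random_source"
  shows "(\<integral>\<^sup>+\<omega>. f \<omega> \<partial>random_source) = (\<integral>\<^sup>+\<omega>. \<integral>\<^sup>+\<omega>'. f (mrg J \<omega> \<omega>') \<partial>random_source \<partial>random_source)"
proof -
  have "(\<integral>\<^sup>+\<omega>. f \<omega> \<partial>random_source) = (\<integral>\<^sup>+\<omega>. f \<omega> \<partial>distr (random_source \<Otimes>\<^sub>M random_source) random_source (\<lambda>(\<omega>, \<omega>'). mrg J \<omega> \<omega>'))"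
    by (simp add: distr_mrg)
  also have "\<dots> = (\<integral>\<^sup>+p. f (mrg J (fst p) (snd p)) \<partial>(random_source \<Otimes>\<^sub>M random_source))"
    by (subst nn_integral_distr[OF mrg_measurable]) (auto simp: case_prod_unfold)
  also have "\<dots> = (\<integral>\<^sup>+\<omega>. \<integral>\<^sup>+\<omega>'. f (mrg J \<omega> \<omega>') \<partial>random_source \<partial>random_source)"
    using measurable_compose[OF mrg_measurable[of J] assms]
    by (subst S.nn_integral_fst[symmetric]) (auto simp: case_prod_unfold)
  finally show ?thesis .
qed

lemma mrg_vimage_sets:
  assumes "\<omega> \<in> space random_source" "E \<in> sets random_source"
  shows "{\<omega>' \<in> space random_source. mrg J \<omega> \<omega>' \<in> E} \<in> sets random_source"
  using measurable_sets[OF mrg_measurable1[OF assms(1)] assms(2)] by (simp add: vimage_def Int_def conj_commute)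

lemma emeasure_mrg:
  assumes E: "E \<in> sets random_source"
  shows "emeasure random_source E = (\<integral>\<^sup>+\<omega>. emeasure random_source {\<omega>' \<in> space random_source. mrg J \<omega> \<omega>' \<in> E} \<partial>random_source)"
proof -
  have "emeasure random_source E = (\<integral>\<^sup>+\<omega>. indicator E \<omega> \<partial>random_source)"
    using E by simp
  also have "\<dots> = (\<integral>\<^sup>+\<omega>. \<integral>\<^sup>+\<omega>'. indicator E (mrg J \<omega> \<omega>') \<partial>random_source \<partial>random_source)"
    using E by (intro nn_integral_mrg) simp
  also have "\<dots> = (\<integral>\<^sup>+\<omega>. emeasure random_source {\<omega>' \<in> space random_source. mrg J \<omega> \<omega>' \<in> E} \<partial>random_source)"
  proof (rule nn_integral_cong)
    fix \<omega> assume w: "\<omega> \<in> space random_source"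
    have "(\<integral>\<^sup>+\<omega>'. indicator E (mrg J \<omega> \<omega>') \<partial>random_source)
      = (\<integral>\<^sup>+\<omega>'. indicator {\<omega>' \<in> space random_source. mrg J \<omega> \<omega>' \<in> E} \<omega>' \<partial>random_source)"
      by (intro nn_integral_cong) (auto simp: indicator_def)
    then show "(\<integral>\<^sup>+\<omega>'. indicator E (mrg J \<omega> \<omega>') \<partial>random_source)
      = emeasure random_source {\<omega>' \<in> space random_source. mrg J \<omega> \<omega>' \<in> E}"
      using mrg_vimage_sets[OF w E] by simp
  qed
  finally show ?thesis .
qed

text \<open>A bound valid for every fixed choice of the coordinates outside \<open>J\<close>
  survives averaging over them. It serves to randomise some coefficients while everything else is
  frozen.\<close>

lemma prob_le_mrg:
  assumes E: "E \<in> sets random_source"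
    and le: "\<And>\<omega>. \<omega> \<in> space random_source \<Longrightarrow> measure random_source {\<omega>' \<in> space random_source. mrg J \<omega> \<omega>' \<in> E} \<le> b"
  shows "measure random_source E \<le> b"
proof -
  have b0: "0 \<le> b"
  proof -
    obtain \<omega> where "\<omega> \<in> space random_source" using S.not_empty by blast
    then show ?thesis using le[of \<omega>] measure_nonneg order_trans by blast
  qed
  have "emeasure random_source E \<le> (\<integral>\<^sup>+\<omega>. ennreal b \<partial>random_source)"
    unfolding emeasure_mrg[OF E, of J]
    by (intro nn_integral_mono) (auto simp: S.emeasure_eq_measure intro!: ennreal_leI le)
  also have "\<dots> = ennreal b" by (simp add: S.emeasure_space_1)
  finally show ?thesis using b0 by (simp add: S.emeasure_eq_measure)
qed

text \<open>This is for runs in two stages: \<open>A\<close> says that the earlier randomness is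
  good, and given it the later one fails with probability at most \<open>\<beta>\<close>. The
  failures add because
  \<open>(1 - \<alpha>) * (1 - \<beta>) \<ge> 1 - \<alpha> - \<beta>\<close>.\<close>

lemma prob_ge_mrg:
  assumes E: "E \<in> sets random_source" and A: "A \<in> sets random_source" "measure random_source A \<ge> 1 - \<alpha>"
    and le: "\<And>\<omega>. \<omega> \<in> A \<Longrightarrow> measure random_source {\<omega>' \<in> space random_source. mrg J \<omega> \<omega>' \<in> E} \<ge> 1 - \<beta>"
    and ab: "0 \<le> \<alpha>" "0 \<le> \<beta>" "\<beta> \<le> 1"
  shows "measure random_source E \<ge> 1 - \<alpha> - \<beta>"
proof -
  have "ennreal (1 - \<beta>) * emeasure random_source A = (\<integral>\<^sup>+\<omega>. ennreal (1 - \<beta>) * indicator A \<omega> \<partial>random_source)"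
    using A by (simp add: nn_integral_cmult_indicator)
  also have "\<dots> \<le> emeasure random_source E"
    unfolding emeasure_mrg[OF E, of J]
    by (intro nn_integral_mono) (auto simp: S.emeasure_eq_measure indicator_def intro!: ennreal_leI le)
  finally have "(1 - \<beta>) * measure random_source A \<le> measure random_source E"
    using ab by (simp add: S.emeasure_eq_measure ennreal_mult[symmetric])
  moreover have "(1 - \<beta>) * measure random_source A \<ge> (1 - \<beta>) * (1 - \<alpha>)"
    using A(2) ab by (intro mult_left_mono) auto
  moreover have "(1 - \<beta>) * (1 - \<alpha>) \<ge> 1 - \<alpha> - \<beta>" using ab by (simp add: algebra_simps)
  ultimately show ?thesis by linarith
qed

subsection \<open>Bounded random variables\<close>

text \<open>Bounded measurable functions form an algebra of integrable functions, so integrability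
  need not be argued for individual expressions.\<close>

definition bm :: "((nat \<Rightarrow> real) \<Rightarrow> real) \<Rightarrow> bool" where
  "bm f \<longleftrightarrow> f \<in> borel_measurable random_source \<and> (\<exists>B. \<forall>\<omega>\<in>space random_source. \<bar>f \<omega>\<bar> \<le> B)"

text \<open>Independence is reduced to dependence on disjoint sets of coordinates, which is checked
  pointwise and without sigma-algebras.\<close>

definition dep :: "nat set \<Rightarrow> ((nat \<Rightarrow> real) \<Rightarrow> 'b) \<Rightarrow> bool" where
  "dep J f \<longleftrightarrow> (\<forall>\<omega> \<omega>'. (\<forall>j\<in>J. \<omega> j = \<omega>' j) \<longrightarrow> f \<omega> = f \<omega>')"

lemma bm_measurable: "bm f \<Longrightarrow> f \<in> borel_measurable random_source"
  by (simp add: bm_def)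

lemma bm_integrable: "bm f \<Longrightarrow> integrable random_source f"
  unfolding bm_def by (auto intro!: S.integrable_const_bound AE_I2)

lemma bm_const [simp]: "bm (\<lambda>_. c)"
  by (auto simp: bm_def)

lemma bm_coord [simp]: "bm (\<lambda>\<omega>. \<omega> j)"
  unfolding bm_def by (auto simp: space_random_source intro!: exI[of _ 1])

lemma bm_add: "bm f \<Longrightarrow> bm g \<Longrightarrow> bm (\<lambda>\<omega>. f \<omega> + g \<omega>)"
  unfolding bm_def
proof (elim conjE exE, intro conjI)
  fix B C assume "\<forall>\<omega>\<in>space random_source. \<bar>f \<omega>\<bar> \<le> B" "\<forall>\<omega>\<in>space random_source. \<bar>g \<omega>\<bar> \<le> C"
  then show "\<exists>B. \<forall>\<omega>\<in>space random_source. \<bar>f \<omega> + g \<omega>\<bar> \<le> B"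
    by (intro exI[of _ "B + C"] ballI) (smt (verit))
qed auto

lemma bm_mult: "bm f \<Longrightarrow> bm g \<Longrightarrow> bm (\<lambda>\<omega>. f \<omega> * g \<omega>)"
  unfolding bm_def
proof (elim conjE exE, intro conjI)
  fix B C assume *: "\<forall>\<omega>\<in>space random_source. \<bar>f \<omega>\<bar> \<le> B" "\<forall>\<omega>\<in>space random_source. \<bar>g \<omega>\<bar> \<le> C"
  then show "\<exists>B. \<forall>\<omega>\<in>space random_source. \<bar>f \<omega> * g \<omega>\<bar> \<le> B"
    by (intro exI[of _ "B * C"] ballI) (auto simp: abs_mult intro!: mult_mono order_trans[OF abs_ge_zero])
qed auto

lemma bm_cmult: "bm f \<Longrightarrow> bm (\<lambda>\<omega>. c * f \<omega>)"
  by (rule bm_mult) auto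

lemma bm_diff: "bm f \<Longrightarrow> bm g \<Longrightarrow> bm (\<lambda>\<omega>. f \<omega> - g \<omega>)"
  using bm_add[of f "\<lambda>\<omega>. -1 * g \<omega>"] bm_cmult[of g "-1"] by simp

lemma bm_power: "bm f \<Longrightarrow> bm (\<lambda>\<omega>. f \<omega> ^ n)"
  by (induction n) (auto intro: bm_mult)

lemma bm_sum: "(\<And>i. i \<in> I \<Longrightarrow> bm (f i)) \<Longrightarrow> bm (\<lambda>\<omega>. \<Sum>i\<in>I. f i \<omega>)"
  by (induction I rule: infinite_finite_induct) (auto intro: bm_add)

lemma bm_prod: "(\<And>i. i \<in> I \<Longrightarrow> bm (f i)) \<Longrightarrow> bm (\<lambda>\<omega>. \<Prod>i\<in>I. f i \<omega>)"
  by (induction I rule: infinite_finite_induct) (auto intro: bm_mult)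

lemma bm_ind: "A \<in> sets random_source \<Longrightarrow> bm (\<lambda>\<omega>. indicator A \<omega>)"
  unfolding bm_def by (auto intro!: exI[of _ 1] simp: indicator_def)

lemma dep_mono: "dep J f \<Longrightarrow> J \<subseteq> K \<Longrightarrow> dep K f"
  unfolding dep_def by blast

text \<open>After splicing at \<open>J\<close> the two factors see different independent sources,
  and Fubini separates them.\<close>

lemma integral_indep:
  assumes f: "bm f" "dep (-J) f" and g: "bm g" "dep J g"
  shows "(\<integral>\<omega>. f \<omega> * g \<omega> \<partial>random_source) = (\<integral>\<omega>. f \<omega> \<partial>random_source) * (\<integral>\<omega>. g \<omega> \<partial>random_source)"
proof -
  interpret PP: pair_prob_space random_source random_source ..
  have fg: "bm (\<lambda>\<omega>. f \<omega> * g \<omega>)" using f g by (intro bm_mult)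
  note [measurable] = bm_measurable[OF f(1)] bm_measurable[OF g(1)] bm_measurable[OF fg]
  have eq: "f (mrg J \<omega> \<omega>') = f \<omega>" "g (mrg J \<omega> \<omega>') = g \<omega>'" for \<omega> \<omega>'
    using f(2) g(2) by (auto simp: dep_def mrg_def)
  have "(\<integral>\<omega>. f \<omega> * g \<omega> \<partial>random_source) = (\<integral>\<omega>. f \<omega> * g \<omega> \<partial>distr (random_source \<Otimes>\<^sub>M random_source) random_source (\<lambda>(\<omega>, \<omega>'). mrg J \<omega> \<omega>'))"
    by (simp add: distr_mrg)
  also have "\<dots> = (\<integral>p. f (fst p) * g (snd p) \<partial>(random_source \<Otimes>\<^sub>M random_source))"
    by (subst integral_distr[OF mrg_measurable]) (auto simp: case_prod_unfold eq)
  also have "\<dots> = (\<integral>\<omega>. (\<integral>\<omega>'. f \<omega> * g \<omega>' \<partial>random_source) \<partial>random_source)"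
  proof -
    obtain B C where B: "\<forall>\<omega>\<in>space random_source. \<bar>f \<omega>\<bar> \<le> B" and C: "\<forall>\<omega>\<in>space random_source. \<bar>g \<omega>\<bar> \<le> C"
      using f g unfolding bm_def by blast
    have "integrable (random_source \<Otimes>\<^sub>M random_source) (\<lambda>p. f (fst p) * g (snd p))"
    proof (rule PP.integrable_const_bound[of _ "B * C"])
      show "AE p in random_source \<Otimes>\<^sub>M random_source. norm (f (fst p) * g (snd p)) \<le> B * C"
        using B C by (auto simp: space_pair_measure abs_mult intro!: AE_I2 mult_mono order_trans[OF abs_ge_zero])
    qed measurable
    from PP.integral_fst'[OF this] show ?thesis by simp
  qed
  also have "\<dots> = (\<integral>\<omega>. f \<omega> \<partial>random_source) * (\<integral>\<omega>. g \<omega> \<partial>random_source)"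
    by simp
  finally show ?thesis .
qed

lemma integral_prod_indep:
  assumes "finite I" "\<And>i. i \<in> I \<Longrightarrow> bm (f i)" "\<And>i. i \<in> I \<Longrightarrow> dep (J i) (f i)"
    and "disjoint_family_on J I"
  shows "(\<integral>\<omega>. (\<Prod>i\<in>I. f i \<omega>) \<partial>random_source) = (\<Prod>i\<in>I. \<integral>\<omega>. f i \<omega> \<partial>random_source)"
  using assms
proof (induction I rule: finite_induct)
  case (insert i I)
  have "(\<integral>\<omega>. (\<Prod>i\<in>I. f i \<omega>) * f i \<omega> \<partial>random_source)
     = (\<integral>\<omega>. (\<Prod>i\<in>I. f i \<omega>) \<partial>random_source) * (\<integral>\<omega>. f i \<omega> \<partial>random_source)"
  proof (rule integral_indep[where J = "J i"])
    show "dep (- J i) (\<lambda>\<omega>. \<Prod>i\<in>I. f i \<omega>)"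
      unfolding dep_def
    proof (intro allI impI prod.cong refl)
      fix \<omega> \<omega>' :: "nat \<Rightarrow> real" and x assume e: "\<forall>j\<in>- J i. \<omega> j = \<omega>' j" and x: "x \<in> I"
      then have "J x \<inter> J i = {}" using insert.prems(3) insert.hyps(2) by (auto simp: disjoint_family_on_def)
      then show "f x \<omega> = f x \<omega>'" using e insert.prems(2)[of x] x unfolding dep_def by blast
    qed
  qed (use insert.prems in \<open>auto intro!: bm_prod\<close>)
  moreover have "disjoint_family_on J I"
    using insert.prems(3) by (rule disjoint_family_on_mono[rotated]) auto
  ultimately show ?case using insert by (simp add: mult.commute)
qed (simp add: S.prob_space)

lemma distr_coord: "distr random_source unif (\<lambda>\<omega>. \<omega> j) = unif"
  unfolding random_source_def by (rule src.PiM_component) simp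

lemma integral_coord:
  fixes f :: "real \<Rightarrow> real"
  assumes "f \<in> borel_measurable borel"
  shows "(\<integral>\<omega>. f (\<omega> j) \<partial>random_source) = (\<integral>u. f u \<partial>unif)"
proof -
  have "(\<integral>u. f u \<partial>unif) = (\<integral>u. f u \<partial>distr random_source unif (\<lambda>\<omega>. \<omega> j))" by (simp add: distr_coord)
  also have "\<dots> = (\<integral>\<omega>. f (\<omega> j) \<partial>random_source)"
    by (rule integral_distr[OF coord_unif_measurable]) (use assms in \<open>auto intro: measurable_restrict_space1\<close>)
  finally show ?thesis by simp
qed

lemma prob_coord:
  assumes "A \<in> sets borel"
  shows "measure random_source {\<omega> \<in> space random_source. \<omega> j \<in> A} = measure lborel (A \<inter> {0..1})"
proof -
  have "A \<inter> {0..1} \<in> sets unif" using assms by (auto simp: sets_restrict_space)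
  then have "measure unif (A \<inter> {0..1}) = measure random_source ((\<lambda>\<omega>. \<omega> j) -` (A \<inter> {0..1}) \<inter> space random_source)"
    by (subst distr_coord[of j, symmetric]) (rule measure_distr[OF coord_unif_measurable])
  also have "(\<lambda>\<omega>. \<omega> j) -` (A \<inter> {0..1}) \<inter> space random_source = {\<omega> \<in> space random_source. \<omega> j \<in> A}"
    by (auto simp: space_random_source)
  finally show ?thesis by (simp add: measure_restrict_space)
qed

lemma prob_coord_le:
  assumes "0 \<le> x"
  shows "measure random_source {\<omega> \<in> space random_source. \<omega> j < x} \<le> x"
proof -
  have "measure random_source {\<omega> \<in> space random_source. \<omega> j \<in> {..<x}} = measure lborel ({..<x} \<inter> {0..1})"
    by (rule prob_coord) simp
  also have "\<dots> \<le> measure lborel {0..x}"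
    by (rule measure_mono_fmeasurable) (auto simp: fmeasurable_def emeasure_lborel_Icc_eq)
  finally show ?thesis using assms by simp
qed

lemma prob_coord_zero: "measure random_source {\<omega> \<in> space random_source. \<omega> j = 0} = 0"
proof -
  have "{0::real} \<inter> {0..1} = {0}" by auto
  then show ?thesis using prob_coord[of "{0}" j] by simp
qed

lemma integral_coord_has_integral:
  fixes f F :: "real \<Rightarrow> real"
  assumes "\<And>x. x \<in> {0..1} \<Longrightarrow> (F has_real_derivative f x) (at x)" "continuous_on {0..1} f" "f \<in> borel_measurable borel"
  shows "(\<integral>\<omega>. f (\<omega> j) \<partial>random_source) = F 1 - F 0"
proof -
  have "(\<integral>u. f u \<partial>unif) = (\<integral>u. indicator {0..1} u *\<^sub>R f u \<partial>lborel)"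
    by (rule integral_restrict_space) auto
  also have "\<dots> = F 1 - F 0"
  proof (rule integral_FTC_Icc)
    fix x :: real assume "0 \<le> x" "x \<le> 1"
    then have "(F has_vector_derivative f x) (at x)"
      using assms(1)[of x] by (simp add: has_real_derivative_iff_has_vector_derivative)
    then show "(F has_vector_derivative f x) (at x within {0..1})"
      by (rule has_vector_derivative_at_within)
  qed (use assms(2) in auto)
  finally show ?thesis using integral_coord[OF assms(3)] by simp
qed

lemma prob_union_le:
  assumes "finite I" "\<And>i. i \<in> I \<Longrightarrow> A i \<in> sets random_source" "\<And>i. i \<in> I \<Longrightarrow> measure random_source (A i) \<le> b i"
  shows "measure random_source (\<Union>i\<in>I. A i) \<le> (\<Sum>i\<in>I. b i)"
  using S.finite_measure_subadditive_finite[of I A] assms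
  by (intro order_trans[OF S.finite_measure_subadditive_finite sum_mono]) auto

subsection \<open>Sorted lists\<close>

text \<open>With repeated values \<open>c\<close> has to be the last position of \<open>x\<close>;
  only then are the entries up to \<open>x\<close> exactly an initial segment.\<close>

lemma sorted_initial_segment:
  fixes zs :: "real list"
  assumes "sorted zs" "x \<in> set zs"
  obtains c where "{e. e < length zs \<and> zs ! e \<le> x} = {..c}" "zs ! c = x" "c < length zs"
proof -
  let ?A = "{e. e < length zs \<and> zs ! e \<le> x}"
  obtain e0 where e0: "e0 < length zs" "zs ! e0 = x" using assms(2) by (auto simp: in_set_conv_nth)
  have fin: "finite ?A" and ne: "?A \<noteq> {}" using e0 by auto
  define c where "c = Max ?A"
  have c: "c \<in> ?A" unfolding c_def using fin ne by (rule Max_in)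
  have "e0 \<le> c" unfolding c_def using fin e0 by (intro Max_ge) auto
  then have "zs ! c = x" using assms(1) c e0 sorted_nth_mono[of zs e0 c] by auto
  moreover have "?A = {..c}"
  proof (intro set_eqI iffI)
    fix e assume "e \<in> ?A" then show "e \<in> {..c}" unfolding c_def using fin by (auto intro: Max_ge)
  next
    fix e assume "e \<in> {..c}" then show "e \<in> ?A" using c assms(1) sorted_nth_mono[of zs e c] by auto
  qed
  ultimately show thesis using that c by blast
qed

lemma sorted_interval:
  fixes zs :: "real list"
  assumes "sorted zs" "x \<in> set zs" "y \<in> set zs" "x \<le> y"
  obtains c d where "{e. e < length zs \<and> x < zs ! e \<and> zs ! e \<le> y} = {c<..d}" "zs ! c = x" "zs ! d = y" "c \<le> d" "d < length zs"
proof -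
  obtain c where c: "{e. e < length zs \<and> zs ! e \<le> x} = {..c}" "zs ! c = x" "c < length zs"
    by (rule sorted_initial_segment[OF assms(1,2)])
  obtain d where d: "{e. e < length zs \<and> zs ! e \<le> y} = {..d}" "zs ! d = y" "d < length zs"
    by (rule sorted_initial_segment[OF assms(1,3)])
  have "c \<in> {..d}" unfolding d(1)[symmetric] using c assms(4) by simp
  moreover have "{e. e < length zs \<and> x < zs ! e \<and> zs ! e \<le> y} = {..d} - {..c}"
    unfolding d(1)[symmetric] c(1)[symmetric] using assms(4) by auto
  moreover have "{..d} - {..c} = {c<..d}" by auto
  ultimately show thesis using that[of c d] c d by simp
qed

lemma telescope_gaps:
  fixes f :: "nat \<Rightarrow> real"
  assumes "c \<le> d"
  shows "(\<Sum>e\<in>{c<..d}. f e - f (e - 1)) = f d - f c"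
  using assms
proof (induction d rule: dec_induct)
  case (step d)
  have "{c<..Suc d} = insert (Suc d) {c<..d}" using step by auto
  then show ?case using step by simp
qed simp

subsection \<open>Heavy tails\<close>

text \<open>On \<open>l / s \<le> u\<close> the base \<open>l / u\<close> is at most
  \<open>s\<close>, so \<open>q - 2\<close> of the factors may be replaced by \<open>s\<close>. What
  remains is the integral of \<open>l^2 / u^2\<close> from \<open>l / s\<close> to 1, which is at
  most \<open>l * s\<close>.\<close>

lemma heavy_tail_truncated_mean:
  fixes l s :: real
  assumes "0 < l" "0 < s" "2 \<le> q"
  shows "(\<integral>\<omega>. (if l / s \<le> \<omega> j then (l / \<omega> j) ^ q else 0) \<partial>random_source) \<le> l * s ^ (q - 1)"
    and "bm (\<lambda>\<omega>. if l / s \<le> \<omega> j then (l / \<omega> j) ^ q else 0)"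
proof -
  let ?g = "\<lambda>u. if l / s \<le> u then (l / u) ^ q else 0"
  let ?th = "l / s"
  have th: "0 < ?th" using assms by simp
  have le: "l / u \<le> s" if "?th \<le> u" for u
    using that assms th by (smt (verit) divide_le_eq mult.commute)
  have lu: "0 \<le> l / u" if "?th \<le> u" for u
    using that th assms(1) by (intro divide_nonneg_nonneg) linarith+
  have g0: "0 \<le> ?g u" for u using lu by simp
  have gs: "?g u \<le> s ^ q" for u using le[of u] lu[of u] assms(2) by (auto intro!: power_mono simp del: power_divide)
  show "bm (\<lambda>\<omega>. ?g (\<omega> j))"
    unfolding bm_def by (intro conjI exI[of _ "s ^ q"] ballI) (use g0 gs in auto)
  have gq: "?g u \<le> s ^ (q - 2) * (l\<^sup>2 / u\<^sup>2)" if "?th \<le> u" for u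
  proof -
    have "(l / u) ^ q = (l / u) ^ (q - 2) * (l / u)\<^sup>2"
      using assms(3) by (metis power_add le_add_diff_inverse2)
    also have "\<dots> \<le> s ^ (q - 2) * (l / u)\<^sup>2"
      using le[OF that] lu[OF that] assms(2) by (intro mult_right_mono power_mono) auto
    finally show ?thesis using that by (simp add: power_divide)
  qed
  have "(\<integral>\<omega>. ?g (\<omega> j) \<partial>random_source) = (\<integral>u. ?g u \<partial>unif)"
    by (rule integral_coord) measurable
  also have "\<dots> = (\<integral>u. indicator {0..1} u *\<^sub>R ?g u \<partial>lborel)"
    by (rule integral_restrict_space) auto
  also have "\<dots> \<le> l * s ^ (q - 1)"
  proof (cases "?th \<le> 1")
    case False
    then have "(\<lambda>u. indicator {0..1} u *\<^sub>R ?g u) = (\<lambda>_. 0)"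
      by (auto simp: fun_eq_iff indicator_def)
    then show ?thesis using assms by simp
  next
    case True
    let ?f = "\<lambda>u. s ^ (q - 2) * (l\<^sup>2 / u\<^sup>2)"
    let ?F = "\<lambda>u. - (s ^ (q - 2) * l\<^sup>2 / u)"
    have der: "(?F has_real_derivative ?f u) (at u)" if "?th \<le> u" for u
      using that th by (auto intro!: derivative_eq_intros simp: power2_eq_square field_simps)
    have cont: "continuous_on {?th..1} ?f"
      using th by (intro continuous_intros) auto
    have vd: "(?F has_vector_derivative ?f u) (at u within {?th..1})" if "?th \<le> u" "u \<le> 1" for u
      using der[OF that(1)] by (simp add: has_real_derivative_iff_has_vector_derivative has_vector_derivative_at_within)
    have int: "integrable lborel (\<lambda>u. indicator {?th..1} u *\<^sub>R ?f u)"
      using borel_integrable_compact[OF _ cont] by (simp add: set_integrable_def)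
    have val: "(\<integral>u. indicator {?th..1} u *\<^sub>R ?f u \<partial>lborel) = ?F 1 - ?F ?th"
      by (rule integral_FTC_Icc[OF True vd cont])
    have "(\<integral>u. indicator {0..1} u *\<^sub>R ?g u \<partial>lborel) \<le> (\<integral>u. indicator {?th..1} u *\<^sub>R ?f u \<partial>lborel)"
    proof (rule integral_mono[OF _ int])
      show "indicator {0..1} u *\<^sub>R ?g u \<le> indicator {?th..1} u *\<^sub>R ?f u" for u
        using gq[of u] th by (auto simp: indicator_def)
      have "integrable lborel (\<lambda>u. s ^ q * indicator {0..1::real} u)" by simp
      moreover have "(\<lambda>u. indicator {0..1} u *\<^sub>R ?g u) \<in> borel_measurable lborel" by measurable
      ultimately show "integrable lborel (\<lambda>u. indicator {0..1} u *\<^sub>R ?g u)"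
      proof (rule Bochner_Integration.integrable_bound)
        show "AE u in lborel. norm (indicator {0..1} u *\<^sub>R ?g u) \<le> norm (s ^ q * indicator {0..1} u)"
        proof (rule AE_I2)
          fix u :: real
          have "\<bar>?g u\<bar> \<le> s ^ q" using g0[of u] gs[of u] by linarith
          then show "norm (indicator {0..1} u *\<^sub>R ?g u) \<le> norm (s ^ q * indicator {0..1} u)"
            using assms(2) by (cases "u \<in> {0..1}") auto
        qed
      qed
    qed
    also have "\<dots> = s ^ (q - 2) * l\<^sup>2 * (s / l) - s ^ (q - 2) * l\<^sup>2"
      unfolding val by simp
    also have "\<dots> \<le> s ^ (q - 2) * l\<^sup>2 * (s / l)" using assms by simp
    also have "\<dots> = l * (s ^ (q - 2) * s)" using assms by (simp add: power2_eq_square)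
    also have "s ^ (q - 2) * s = s ^ (q - 1)" using assms(3) by (metis Suc_diff_le diff_Suc_Suc numeral_2_eq_2 power_Suc2 One_nat_def)
    finally show ?thesis .
  qed
  finally show "(\<integral>\<omega>. ?g (\<omega> j) \<partial>random_source) \<le> l * s ^ (q - 1)" .
qed

text \<open>The untruncated mean is infinite, so the values below \<open>l e / s\<close> are
  excluded first, at a cost of \<open>l e / s\<close> each. Markov's inequality for the truncated
  sum costs the same total once more, whence the factor 2, which depends neither on \<open>q\<close>
  nor on the number of terms.\<close>

lemma heavy_tail_sum:
  fixes l :: "'i \<Rightarrow> real" and s :: real
  assumes fin: "finite I" and l0: "\<And>e. e \<in> I \<Longrightarrow> 0 \<le> l e" and s: "0 < s" and q: "2 \<le> q"
  shows "measure random_source {\<omega> \<in> space random_source. s ^ q < (\<Sum>e\<in>I. (l e / \<omega> (p e)) ^ q)} \<le> 2 * (\<Sum>e\<in>I. l e) / s"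
proof -
  \<comment> \<open>The truncated mean is available only for positive \<open>l e\<close>; all other
    terms vanish because \<open>q\<close> is positive.\<close>
  define I' where "I' = {e \<in> I. 0 < l e}"
  have fin': "finite I'" using fin by (simp add: I'_def)
  let ?g = "\<lambda>e \<omega>. if l e / s \<le> \<omega> (p e) then (l e / \<omega> (p e)) ^ q else 0"
  let ?G = "\<lambda>\<omega>. \<Sum>e\<in>I'. ?g e \<omega>"
  let ?B = "\<Union>e\<in>I'. {\<omega> \<in> space random_source. \<omega> (p e) < l e / s}"
  let ?C = "{\<omega> \<in> space random_source. s ^ q \<le> ?G \<omega>}"
  have sumI': "(\<Sum>e\<in>I'. l e) = (\<Sum>e\<in>I. l e)"
    using l0 fin by (intro sum.mono_neutral_left) (auto simp: I'_def order_less_le)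
  have bG: "bm ?G" using heavy_tail_truncated_mean(2)[OF _ s q] by (intro bm_sum) (auto simp: I'_def)
  note [measurable] = bm_measurable[OF bG]
  have "{\<omega> \<in> space random_source. s ^ q < (\<Sum>e\<in>I. (l e / \<omega> (p e)) ^ q)} \<subseteq> ?B \<union> ?C"
  proof (intro subsetI)
    fix \<omega> assume w: "\<omega> \<in> {\<omega> \<in> space random_source. s ^ q < (\<Sum>e\<in>I. (l e / \<omega> (p e)) ^ q)}"
    have "(\<Sum>e\<in>I. (l e / \<omega> (p e)) ^ q) = (\<Sum>e\<in>I'. (l e / \<omega> (p e)) ^ q)"
      using l0 fin q by (intro sum.mono_neutral_right) (auto simp: I'_def order_less_le)
    moreover have "(\<Sum>e\<in>I'. (l e / \<omega> (p e)) ^ q) = ?G \<omega>" if "\<omega> \<notin> ?B"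
      using that w by (intro sum.cong) (auto simp: not_less)
    ultimately show "\<omega> \<in> ?B \<union> ?C" using w by fastforce
  qed
  then have "measure random_source {\<omega> \<in> space random_source. s ^ q < (\<Sum>e\<in>I. (l e / \<omega> (p e)) ^ q)}
      \<le> measure random_source (?B \<union> ?C)"
    using fin' by (intro S.finite_measure_mono sets.Un sets.finite_UN) measurable
  also have "\<dots> \<le> measure random_source ?B + measure random_source ?C"
    using fin' by (intro measure_Un_le sets.finite_UN) measurable
  also have "measure random_source ?B \<le> (\<Sum>e\<in>I'. l e / s)"
    using fin' s by (intro prob_union_le prob_coord_le) (auto simp: I'_def)
  also have "(\<Sum>e\<in>I'. l e / s) = (\<Sum>e\<in>I. l e) / s"
    by (simp add: sumI'[symmetric] sum_divide_distrib)
  also have "measure random_source ?C \<le> (\<integral>\<omega>. ?G \<omega> \<partial>random_source) / s ^ q"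
    using s l0 by (intro integral_Markov_inequality_measure[where A = "space random_source"] bm_integrable bG)
      (auto intro!: AE_I2 sum_nonneg simp: I'_def mem_space_source)
  also have "(\<integral>\<omega>. ?G \<omega> \<partial>random_source) = (\<Sum>e\<in>I'. \<integral>\<omega>. ?g e \<omega> \<partial>random_source)"
    using heavy_tail_truncated_mean(2)[OF _ s q] by (intro Bochner_Integration.integral_sum bm_integrable) (auto simp: I'_def)
  also have "\<dots> \<le> (\<Sum>e\<in>I'. l e * s ^ (q - 1))"
    by (intro sum_mono heavy_tail_truncated_mean s q) (simp add: I'_def)
  also have "(\<Sum>e\<in>I'. l e * s ^ (q - 1)) / s ^ q = (\<Sum>e\<in>I. l e) / s"
  proof -
    have "s ^ q = s ^ (q - 1) * s" using q by (metis One_nat_def Suc_diff_Suc diff_zero less_eq_Suc_le numeral_2_eq_2 power_Suc2 Suc_le_lessD le_trans lessI less_imp_le)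
    then show ?thesis using s by (simp add: sumI'[symmetric] sum_distrib_right[symmetric])
  qed
  finally show ?thesis using s by (simp add: divide_right_mono)
qed

text \<open>The condition \<open>l / u \<le> \<zeta>\<close> amounts to
  \<open>u \<ge> l / \<zeta>\<close>, of probability at most \<open>exp (- l / \<zeta>)\<close>. By
  independence these factors multiply and the exponents add, just as the rates of exponential clocks
  do.\<close>

lemma all_small_prob:
  fixes l :: "'i \<Rightarrow> real"
  assumes fin: "finite I" and l0: "\<And>e. e \<in> I \<Longrightarrow> 0 \<le> l e" and z: "0 < \<zeta>" and inj: "inj_on p I"
  shows "measure random_source {\<omega> \<in> space random_source. \<forall>e\<in>I. l e / \<omega> (p e) \<le> \<zeta>} \<le> exp (- (\<Sum>e\<in>I. l e) / \<zeta>)"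
proof -
  \<comment> \<open>Division by zero yields 0, so \<open>u = 0\<close> satisfies the condition as
    well; this point has measure zero.\<close>
  let ?A = "\<lambda>e. {0} \<union> {l e / \<zeta>..}"
  let ?f = "\<lambda>e \<omega>. indicator (?A e) (\<omega> (p e)) :: real"
  let ?E = "{\<omega> \<in> space random_source. \<forall>e\<in>I. l e / \<omega> (p e) \<le> \<zeta>}"
  have mE: "?E \<in> sets random_source" using fin by measurable
  have bf: "bm (?f e)" for e
    unfolding bm_def by (auto intro!: exI[of _ 1] simp: indicator_def)
  have "measure random_source ?E = (\<integral>\<omega>. indicator ?E \<omega> \<partial>random_source)" using mE by simp
  also have "\<dots> \<le> (\<integral>\<omega>. (\<Prod>e\<in>I. ?f e \<omega>) \<partial>random_source)"
  proof (intro integral_mono bm_integrable bm_ind mE bm_prod bf)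
    fix \<omega> assume w: "\<omega> \<in> space random_source"
    show "indicator ?E \<omega> \<le> (\<Prod>e\<in>I. ?f e \<omega>)"
    proof (cases "\<omega> \<in> ?E")
      case True
      have "\<omega> (p e) \<in> ?A e" if "e \<in> I" for e
      proof -
        have "0 \<le> \<omega> (p e)" using w by (rule conjunct1[OF mem_space_source])
        moreover have "l e / \<omega> (p e) \<le> \<zeta>" using True that by auto
        ultimately show ?thesis using z by (cases "\<omega> (p e) = 0") (auto simp: field_simps)
      qed
      then have "(\<Prod>e\<in>I. ?f e \<omega>) = 1" by (intro prod.neutral) auto
      then show ?thesis using True by simp
    qed (auto intro!: prod_nonneg)
  qed
  also have "\<dots> = (\<Prod>e\<in>I. \<integral>\<omega>. ?f e \<omega> \<partial>random_source)"
    using inj by (intro integral_prod_indep[where J = "\<lambda>e. {p e}"] fin bf)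
      (auto simp: dep_def disjoint_family_on_def inj_on_def)
  also have "\<dots> \<le> (\<Prod>e\<in>I. exp (- (l e / \<zeta>)))"
  proof (intro prod_mono conjI)
    fix e assume e: "e \<in> I"
    have t0: "0 \<le> l e / \<zeta>" using l0[OF e] z by simp
    have "(\<integral>\<omega>. ?f e \<omega> \<partial>random_source) = (\<integral>\<omega>. indicator {\<omega> \<in> space random_source. \<omega> (p e) \<in> ?A e} \<omega> \<partial>random_source)"
      by (intro Bochner_Integration.integral_cong) (auto simp: indicator_def)
    also have "\<dots> = measure random_source {\<omega> \<in> space random_source. \<omega> (p e) \<in> ?A e}"
      by simp
    also have "\<dots> = measure lborel (?A e \<inter> {0..1})" by (rule prob_coord) auto
    also have "\<dots> \<le> measure lborel ({0} \<union> {l e / \<zeta>..1})"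
    proof (rule measure_mono_fmeasurable)
      show "{0} \<union> {l e / \<zeta>..1} \<in> fmeasurable lborel"
        by (intro fmeasurable.Un) (auto simp: fmeasurable_def emeasure_lborel_Icc_eq)
    qed auto
    also have "\<dots> \<le> measure lborel {0::real} + measure lborel {l e / \<zeta>..1}"
      by (intro measure_Un_le) auto
    also have "\<dots> \<le> max 0 (1 - l e / \<zeta>)" by (cases "l e / \<zeta> \<le> 1") auto
    also have "\<dots> \<le> exp (- (l e / \<zeta>))"
      using exp_ge_add_one_self[of "- (l e / \<zeta>)"] by auto
    finally show "(\<integral>\<omega>. ?f e \<omega> \<partial>random_source) \<le> exp (- (l e / \<zeta>))" .
  qed (auto intro!: integral_nonneg_AE)
  also have "\<dots> = exp (- (\<Sum>e\<in>I. l e) / \<zeta>)"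
    by (simp add: exp_sum[OF fin, symmetric] sum_divide_distrib sum_negf)
  finally show ?thesis .
qed

text \<open>Resampling the coefficient of the dominant term alone spreads the sum over an interval.\<close>

lemma anticoncentration:
  fixes \<Delta> :: "nat \<Rightarrow> real"
  assumes inj: "inj_on c {..<k}" and i: "i < k" and nz: "\<Delta> i \<noteq> 0" and d: "0 \<le> \<delta>"
  shows "measure random_source {\<omega> \<in> space random_source. \<bar>\<Sum>i<k. \<omega> (c i) * \<Delta> i\<bar> < \<delta> * \<bar>\<Delta> i\<bar>} \<le> 2 * \<delta>"
    (is "measure _ ?E \<le> _")
proof (rule prob_le_mrg[where J = "{c i}"])
  show "?E \<in> sets random_source" by measurable
next
  fix \<omega> assume w: "\<omega> \<in> space random_source"
  define R where "R = (\<Sum>i'\<in>{..<k} - {i}. \<omega> (c i') * \<Delta> i') / \<Delta> i"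
  have "(\<Sum>i'<k. mrg {c i} \<omega> \<omega>' (c i') * \<Delta> i') = (\<omega>' (c i) + R) * \<Delta> i" for \<omega>'
  proof -
    have "(\<Sum>i'<k. mrg {c i} \<omega> \<omega>' (c i') * \<Delta> i')
      = \<omega>' (c i) * \<Delta> i + (\<Sum>i'\<in>{..<k} - {i}. mrg {c i} \<omega> \<omega>' (c i') * \<Delta> i')"
      using i by (subst sum.remove[of _ i]) (auto simp: mrg_def)
    also have "(\<Sum>i'\<in>{..<k} - {i}. mrg {c i} \<omega> \<omega>' (c i') * \<Delta> i') = (\<Sum>i'\<in>{..<k} - {i}. \<omega> (c i') * \<Delta> i')"
      using inj i by (intro sum.cong) (auto simp: mrg_def inj_on_def)
    finally show ?thesis using nz by (simp add: R_def distrib_right)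
  qed
  then have "{\<omega>' \<in> space random_source. mrg {c i} \<omega> \<omega>' \<in> ?E} \<subseteq> {\<omega>' \<in> space random_source. \<omega>' (c i) \<in> {- R - \<delta>..- R + \<delta>}}"
    using nz by (auto simp: abs_mult)
  then have "measure random_source {\<omega>' \<in> space random_source. mrg {c i} \<omega> \<omega>' \<in> ?E}
    \<le> measure random_source {\<omega>' \<in> space random_source. \<omega>' (c i) \<in> {- R - \<delta>..- R + \<delta>}}"
    by (intro S.finite_measure_mono) measurable
  also have "\<dots> = measure lborel ({- R - \<delta>..- R + \<delta>} \<inter> {0..1})"
    by (rule prob_coord) simp
  also have "\<dots> \<le> measure lborel {- R - \<delta>..- R + \<delta>}"
    by (rule measure_mono_fmeasurable) (auto simp: fmeasurable_def emeasure_lborel_Icc_eq)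
  finally show "measure random_source {\<omega>' \<in> space random_source. mrg {c i} \<omega> \<omega>' \<in> ?E} \<le> 2 * \<delta>"
    using d by simp
qed

subsection \<open>Random maps to the line\<close>

definition l1n :: "nat \<Rightarrow> (nat \<Rightarrow> real) \<Rightarrow> (nat \<Rightarrow> real) \<Rightarrow> real" where
  "l1n k x y = (\<Sum>i<k. \<bar>x i - y i\<bar>)"

lemma l1n_nonneg: "0 \<le> l1n k x y"
  by (simp add: l1n_def sum_nonneg)

text \<open>\<open>X j i\<close> is coordinate \<open>i\<close> of point \<open>j\<close>. The
  points of both sets are indexed together, because the gaps that separate them must come from their
  joint order.\<close>

locale gap_system =
  fixes k N q :: nat and X :: "nat \<Rightarrow> nat \<Rightarrow> real"
  assumes q2: "2 \<le> q"
begin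

definition zs :: "nat \<Rightarrow> real list" where
  "zs i = sort (map (\<lambda>j. X j i) [0..<N])"

text \<open>\<open>gap i 0 = 0\<close>, because \<open>0 - 1 = 0\<close>.\<close>

definition gap :: "nat \<Rightarrow> nat \<Rightarrow> real" where
  "gap i e = zs i ! e - zs i ! (e - 1)"

text \<open>Random values are laid out in the order in which the program draws them: for every
  coordinate its coefficient, then one uniform value for each of the \<open>N\<close> sorted
  positions, including the trivial gap at position 0.\<close>

definition cpos :: "nat \<Rightarrow> nat \<Rightarrow> nat" where
  "cpos \<beta> i = \<beta> + i * Suc N"

definition upos :: "nat \<Rightarrow> nat \<Rightarrow> nat \<Rightarrow> nat" where
  "upos \<beta> i e = \<beta> + i * Suc N + Suc e"

definition Y :: "nat \<Rightarrow> (nat \<Rightarrow> real) \<Rightarrow> nat \<Rightarrow> nat \<Rightarrow> real" where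
  "Y \<beta> \<omega> i e = gap i e / \<omega> (upos \<beta> i e)"

definition phi :: "nat \<Rightarrow> (nat \<Rightarrow> real) \<Rightarrow> nat \<Rightarrow> real \<Rightarrow> real" where
  "phi \<beta> \<omega> i x = (\<Sum>e | e < N \<and> zs i ! e \<le> x. Y \<beta> \<omega> i e ^ q)"

definition pv :: "nat \<Rightarrow> (nat \<Rightarrow> real) \<Rightarrow> nat \<Rightarrow> real" where
  "pv \<beta> \<omega> j = (\<Sum>i<k. \<omega> (cpos \<beta> i) * phi \<beta> \<omega> i (X j i))"

definition Eg :: "nat \<Rightarrow> real \<Rightarrow> real \<Rightarrow> nat set" where
  "Eg i x y = {e. e < N \<and> min x y < zs i ! e \<and> zs i ! e \<le> max x y}"

definition EE :: "nat \<Rightarrow> nat \<Rightarrow> (nat \<times> nat) set" where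
  "EE a b = (SIGMA i:{..<k}. Eg i (X a i) (X b i))"

definition block :: "nat \<Rightarrow> nat set" where
  "block \<beta> = {\<beta>..<\<beta> + k * Suc N}"

lemma sorted_zs: "sorted (zs i)" and length_zs: "length (zs i) = N"
  and mem_zs: "j < N \<Longrightarrow> X j i \<in> set (zs i)"
  by (auto simp: zs_def)

lemma gap_nonneg: "e < N \<Longrightarrow> 0 \<le> gap i e"
  unfolding gap_def using sorted_nth_mono[OF sorted_zs, of "e - 1" e i] length_zs by simp

lemma finite_Eg: "finite (Eg i x y)" and finite_EE: "finite (EE a b)"
  by (auto simp: Eg_def EE_def)

lemma Eg_less: "e \<in> Eg i x y \<Longrightarrow> e < N"
  by (simp add: Eg_def)

lemma EE_bounds: "(i, e) \<in> EE a b \<Longrightarrow> i < k \<and> e < N"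
  by (auto simp: EE_def Eg_def)

lemma Eg_commute: "Eg i x y = Eg i y x"
  by (auto simp: Eg_def)

lemma sum_gap_Eg:
  assumes "x \<in> set (zs i)" "y \<in> set (zs i)"
  shows "(\<Sum>e\<in>Eg i x y. gap i e) = \<bar>x - y\<bar>"
proof -
  have *: "(\<Sum>e\<in>Eg i x y. gap i e) = y - x" if xy: "x \<in> set (zs i)" "y \<in> set (zs i)" "x \<le> y" for x y
  proof -
    obtain c d where c: "{e. e < length (zs i) \<and> x < zs i ! e \<and> zs i ! e \<le> y} = {c<..d}"
      "zs i ! c = x" "zs i ! d = y" "c \<le> d" by (rule sorted_interval[OF sorted_zs xy])
    have "Eg i x y = {c<..d}" using c(1) xy(3) by (simp add: Eg_def length_zs)
    then show ?thesis using telescope_gaps[OF c(4), of "\<lambda>e. zs i ! e"] c by (simp add: gap_def)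
  qed
  show ?thesis
  proof (cases "x \<le> y")
    case False
    then show ?thesis using *[OF assms(2,1)] by (simp add: Eg_commute[of i x y])
  qed (use *[OF assms] in simp)
qed

lemma sum_gap_EE:
  assumes "a < N" "b < N"
  shows "(\<Sum>(i, e)\<in>EE a b. gap i e) = l1n k (X a) (X b)"
proof -
  have "(\<Sum>(i, e)\<in>EE a b. gap i e) = (\<Sum>i<k. \<Sum>e\<in>Eg i (X a i) (X b i). gap i e)"
    unfolding EE_def by (rule sum.Sigma[symmetric]) (auto simp: finite_Eg)
  also have "\<dots> = (\<Sum>i<k. \<bar>X a i - X b i\<bar>)"
    by (intro sum.cong refl sum_gap_Eg mem_zs assms)
  finally show ?thesis by (simp add: l1n_def)
qed

lemma Y_nonneg: "\<omega> \<in> space random_source \<Longrightarrow> e < N \<Longrightarrow> 0 \<le> Y \<beta> \<omega> i e"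
  unfolding Y_def by (intro divide_nonneg_nonneg gap_nonneg conjunct1[OF mem_space_source])

lemma phi_diff:
  "phi \<beta> \<omega> i x - phi \<beta> \<omega> i y = (if y \<le> x then 1 else -1) * (\<Sum>e\<in>Eg i x y. Y \<beta> \<omega> i e ^ q)"
proof -
  have *: "phi \<beta> \<omega> i y = phi \<beta> \<omega> i x + (\<Sum>e\<in>Eg i x y. Y \<beta> \<omega> i e ^ q)" if "x \<le> y" for x y
  proof -
    have "{e. e < N \<and> zs i ! e \<le> y} = {e. e < N \<and> zs i ! e \<le> x} \<union> Eg i x y"
      using that by (auto simp: Eg_def)
    moreover have "{e. e < N \<and> zs i ! e \<le> x} \<inter> Eg i x y = {}" using that by (auto simp: Eg_def)
    ultimately show ?thesis unfolding phi_def by (simp add: sum.union_disjoint finite_Eg)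
  qed
  show ?thesis using *[of x y] *[of y x] by (auto simp: Eg_commute[of i x y])
qed

lemma abs_phi_diff:
  assumes "\<omega> \<in> space random_source"
  shows "\<bar>phi \<beta> \<omega> i x - phi \<beta> \<omega> i y\<bar> = (\<Sum>e\<in>Eg i x y. Y \<beta> \<omega> i e ^ q)"
  using sum_nonneg[of "Eg i x y" "\<lambda>e. Y \<beta> \<omega> i e ^ q"] Y_nonneg[OF assms] Eg_less
  by (auto simp: phi_diff abs_mult)

lemma pv_diff: "pv \<beta> \<omega> a - pv \<beta> \<omega> b = (\<Sum>i<k. \<omega> (cpos \<beta> i) * (phi \<beta> \<omega> i (X a i) - phi \<beta> \<omega> i (X b i)))"
  by (simp add: pv_def sum_subtractf right_diff_distrib)

lemma pv_diff_le:
  assumes w: "\<omega> \<in> space random_source"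
  shows "\<bar>pv \<beta> \<omega> a - pv \<beta> \<omega> b\<bar> \<le> (\<Sum>(i, e)\<in>EE a b. Y \<beta> \<omega> i e ^ q)"
proof -
  have "\<bar>pv \<beta> \<omega> a - pv \<beta> \<omega> b\<bar> \<le> (\<Sum>i<k. \<bar>\<omega> (cpos \<beta> i) * (phi \<beta> \<omega> i (X a i) - phi \<beta> \<omega> i (X b i))\<bar>)"
    unfolding pv_diff by (rule sum_abs)
  also have "\<dots> \<le> (\<Sum>i<k. \<Sum>e\<in>Eg i (X a i) (X b i). Y \<beta> \<omega> i e ^ q)"
  proof (intro sum_mono)
    fix i
    have "\<bar>\<omega> (cpos \<beta> i)\<bar> \<le> 1" using mem_space_source[OF w, of "cpos \<beta> i"] by simp
    then show "\<bar>\<omega> (cpos \<beta> i) * (phi \<beta> \<omega> i (X a i) - phi \<beta> \<omega> i (X b i))\<bar> \<le> (\<Sum>e\<in>Eg i (X a i) (X b i). Y \<beta> \<omega> i e ^ q)"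
      by (simp add: abs_mult abs_phi_diff[OF w, symmetric] mult_left_le_one_le)
  qed
  also have "\<dots> = (\<Sum>(i, e)\<in>EE a b. Y \<beta> \<omega> i e ^ q)"
    unfolding EE_def by (rule sum.Sigma) (auto simp: finite_Eg)
  finally show ?thesis .
qed

lemma block_upos: "i < k \<Longrightarrow> e < N \<Longrightarrow> upos \<beta> i e \<in> block \<beta>"
  and block_cpos: "i < k \<Longrightarrow> cpos \<beta> i \<in> block \<beta>"
proof -
  assume i: "i < k"
  then have "Suc i * Suc N \<le> k * Suc N" by (intro mult_le_mono) auto
  then show "e < N \<Longrightarrow> upos \<beta> i e \<in> block \<beta>" "cpos \<beta> i \<in> block \<beta>"
    by (auto simp: upos_def cpos_def block_def)
qed

lemma upos_eq_iff: "e < N \<Longrightarrow> e' < N \<Longrightarrow> upos \<beta> i e = upos \<beta> i' e' \<longleftrightarrow> i = i' \<and> e = e'"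
proof
  assume "e < N" "e' < N" "upos \<beta> i e = upos \<beta> i' e'"
  then have "Suc e + i * Suc N = Suc e' + i' * Suc N" "Suc e < Suc N" "Suc e' < Suc N"
    by (auto simp: upos_def)
  then have "(Suc e + i * Suc N) mod Suc N = (Suc e' + i' * Suc N) mod Suc N"
     "(Suc e + i * Suc N) div Suc N = (Suc e' + i' * Suc N) div Suc N" by simp_all
  then show "i = i' \<and> e = e'" using \<open>Suc e < Suc N\<close> \<open>Suc e' < Suc N\<close>
    by (simp only: mod_mult_self1 div_mult_self1 mod_less div_less) simp
qed simp

lemma cpos_neq_upos: "e < N \<Longrightarrow> cpos \<beta> i \<noteq> upos \<beta> i' e"
proof
  assume "e < N" "cpos \<beta> i = upos \<beta> i' e"
  then have "i * Suc N = Suc e + i' * Suc N" "Suc e < Suc N" by (auto simp: upos_def cpos_def)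
  then have "(0 + i * Suc N) mod Suc N = (Suc e + i' * Suc N) mod Suc N" by simp
  then show False using \<open>Suc e < Suc N\<close> by (simp only: mod_mult_self1 mod_less)
qed

lemma inj_cpos: "inj_on (cpos \<beta>) A"
  by (auto simp: inj_on_def cpos_def simp del: mult_Suc_right)

lemma Y_cong: "\<forall>j\<in>block \<beta>. \<omega> j = \<omega>' j \<Longrightarrow> i < k \<Longrightarrow> e < N \<Longrightarrow> Y \<beta> \<omega> i e = Y \<beta> \<omega>' i e"
  using block_upos unfolding Y_def by auto

lemma Y_measurable [measurable]: "(\<lambda>\<omega>. Y \<beta> \<omega> i e) \<in> borel_measurable random_source"
  unfolding Y_def by measurable

lemma pv_measurable [measurable]: "(\<lambda>\<omega>. pv \<beta> \<omega> j) \<in> borel_measurable random_source"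
  unfolding pv_def phi_def by measurable

lemma upper_tail:
  assumes "a < N" "b < N" "0 < s"
  shows "measure random_source {\<omega> \<in> space random_source. s ^ q < (\<Sum>(i, e)\<in>EE a b. Y \<beta> \<omega> i e ^ q)}
    \<le> 2 * l1n k (X a) (X b) / s"
  using heavy_tail_sum[of "EE a b" "\<lambda>(i, e). gap i e" s q "\<lambda>(i, e). upos \<beta> i e"] assms q2
    finite_EE gap_nonneg EE_bounds sum_gap_EE[of a b]
  by (force simp: Y_def case_prod_unfold)

text \<open>This is the lower half of the race: the gaps between \<open>a\<close> and
  \<open>b\<close> add up to the l1 distance, so the largest \<open>Y\<close> among them is rarely
  much smaller than that distance.\<close>

lemma clock_lower_tail:
  assumes "a < N" "b < N" "0 < \<zeta>"
  shows "measure random_source {\<omega> \<in> space random_source. \<forall>(i, e)\<in>EE a b. Y \<beta> \<omega> i e \<le> \<zeta>}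
    \<le> exp (- l1n k (X a) (X b) / \<zeta>)"
proof -
  have inj: "inj_on (\<lambda>(i, e). upos \<beta> i e) (EE a b)"
    by (auto simp: inj_on_def upos_eq_iff dest!: EE_bounds)
  show ?thesis
    using all_small_prob[of "EE a b" "\<lambda>(i, e). gap i e" \<zeta> "\<lambda>(i, e). upos \<beta> i e"] assms
      finite_EE gap_nonneg EE_bounds sum_gap_EE[of a b] inj
    by (force simp: Y_def case_prod_unfold)
qed

lemma segment_lower_tail:
  assumes "x \<in> set (zs i)" "y \<in> set (zs i)" "0 < \<zeta>"
  shows "measure random_source {\<omega> \<in> space random_source. \<forall>e\<in>Eg i x y. Y \<beta> \<omega> i e \<le> \<zeta>} \<le> exp (- \<bar>x - y\<bar> / \<zeta>)"
proof -
  have inj: "inj_on (upos \<beta> i) (Eg i x y)"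
    by (auto simp: inj_on_def upos_eq_iff dest!: Eg_less)
  show ?thesis
    using all_small_prob[OF finite_Eg _ assms(3) inj, of "gap i"] sum_gap_Eg[OF assms(1,2)] gap_nonneg Eg_less
    by (auto simp: Y_def)
qed

text \<open>Given all the gap uniforms, the difference of the two images is a random combination of
  the coordinatewise differences. Only the largest of these, which dominates every single power
  \<open>Y ^ q\<close>, has to be protected against cancellation; hence one bad event of probability
  \<open>2 * \<delta>\<close> serves all \<open>(i, e)\<close> at once.\<close>

lemma no_cancellation:
  assumes d: "0 \<le> \<delta>"
  shows "measure random_source {\<omega> \<in> space random_source. \<exists>(i, e)\<in>EE a b. \<bar>pv \<beta> \<omega> a - pv \<beta> \<omega> b\<bar> < \<delta> * Y \<beta> \<omega> i e ^ q} \<le> 2 * \<delta>"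
    (is "measure _ ?E \<le> _")
proof (rule prob_le_mrg[where J = "cpos \<beta> ` {..<k}"])
  show "?E \<in> sets random_source" using finite_EE[of a b] by measurable
next
  fix \<omega> assume w: "\<omega> \<in> space random_source"
  let ?J = "cpos \<beta> ` {..<k}"
  define \<Delta> where "\<Delta> i = phi \<beta> \<omega> i (X a i) - phi \<beta> \<omega> i (X b i)" for i
  have Yeq: "Y \<beta> (mrg ?J \<omega> \<omega>') i e = Y \<beta> \<omega> i e" if "e < N" for \<omega>' i e
    using cpos_neq_upos[OF that] unfolding Y_def mrg_def by (auto simp: image_iff) (metis)
  have phi_eq: "phi \<beta> (mrg ?J \<omega> \<omega>') i x = phi \<beta> \<omega> i x" for \<omega>' i x
    unfolding phi_def by (intro sum.cong refl) (simp add: Yeq)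
  have pv_eq: "pv \<beta> (mrg ?J \<omega> \<omega>') a - pv \<beta> (mrg ?J \<omega> \<omega>') b = (\<Sum>i<k. \<omega>' (cpos \<beta> i) * \<Delta> i)" for \<omega>'
    unfolding pv_diff phi_eq \<Delta>_def by (intro sum.cong) (auto simp: mrg_def)
  have Yle: "Y \<beta> \<omega> i e ^ q \<le> \<bar>\<Delta> i\<bar>" if "(i, e) \<in> EE a b" for i e
    unfolding \<Delta>_def abs_phi_diff[OF w] using that Y_nonneg[OF w] Eg_less
    by (intro member_le_sum) (auto simp: EE_def finite_Eg)
  show "measure random_source {\<omega>' \<in> space random_source. mrg ?J \<omega> \<omega>' \<in> ?E} \<le> 2 * \<delta>"
  proof (cases "\<exists>i<k. \<Delta> i \<noteq> 0")
    case False
    have "\<not> \<bar>\<Sum>i<k. \<omega>' (cpos \<beta> i) * \<Delta> i\<bar> < \<delta> * Y \<beta> \<omega> i e ^ q" if "(i, e) \<in> EE a b" for i e \<omega>'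
    proof -
      have "Y \<beta> \<omega> i e ^ q \<le> 0" using Yle[OF that] False EE_bounds[OF that] by auto
      then have "\<delta> * Y \<beta> \<omega> i e ^ q \<le> 0" using d by (rule mult_nonneg_nonpos[rotated])
      then show ?thesis by linarith
    qed
    then have empty: "{\<omega>' \<in> space random_source. mrg ?J \<omega> \<omega>' \<in> ?E} = {}"
      using EE_bounds by (auto simp: pv_eq Yeq)
    show ?thesis unfolding empty using d by simp
  next
    case True
    define M where "M = Max ((\<lambda>i. \<bar>\<Delta> i\<bar>) ` {..<k})"
    have "M \<in> (\<lambda>i. \<bar>\<Delta> i\<bar>) ` {..<k}" unfolding M_def using True by (intro Max_in) auto
    then obtain m where m: "m < k" "M = \<bar>\<Delta> m\<bar>" by auto
    have le: "\<bar>\<Delta> i\<bar> \<le> \<bar>\<Delta> m\<bar>" if "i < k" for i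
      unfolding m(2)[symmetric] M_def using that by (intro Max_ge) auto
    then have nz: "\<Delta> m \<noteq> 0" using True by fastforce
    have "{\<omega>' \<in> space random_source. mrg ?J \<omega> \<omega>' \<in> ?E}
      \<subseteq> {\<omega>' \<in> space random_source. \<bar>\<Sum>i<k. \<omega>' (cpos \<beta> i) * \<Delta> i\<bar> < \<delta> * \<bar>\<Delta> m\<bar>}"
    proof (intro subsetI CollectI conjI; elim CollectE conjE)
      fix \<omega>' assume "mrg ?J \<omega> \<omega>' \<in> space random_source"
        "\<exists>(i, e)\<in>EE a b. \<bar>pv \<beta> (mrg ?J \<omega> \<omega>') a - pv \<beta> (mrg ?J \<omega> \<omega>') b\<bar> < \<delta> * Y \<beta> (mrg ?J \<omega> \<omega>') i e ^ q"
      then obtain i e where ie: "(i, e) \<in> EE a b" "\<bar>\<Sum>i<k. \<omega>' (cpos \<beta> i) * \<Delta> i\<bar> < \<delta> * Y \<beta> \<omega> i e ^ q"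
        using EE_bounds by (auto simp: pv_eq Yeq)
      have "\<delta> * Y \<beta> \<omega> i e ^ q \<le> \<delta> * \<bar>\<Delta> m\<bar>"
        using d Yle[OF ie(1)] le[of i] EE_bounds[OF ie(1)] by (intro mult_left_mono) auto
      then show "\<bar>\<Sum>i<k. \<omega>' (cpos \<beta> i) * \<Delta> i\<bar> < \<delta> * \<bar>\<Delta> m\<bar>" using ie(2) by linarith
    qed
    then have "measure random_source {\<omega>' \<in> space random_source. mrg ?J \<omega> \<omega>' \<in> ?E}
      \<le> measure random_source {\<omega>' \<in> space random_source. \<bar>\<Sum>i<k. \<omega>' (cpos \<beta> i) * \<Delta> i\<bar> < \<delta> * \<bar>\<Delta> m\<bar>}"
      by (intro S.finite_measure_mono) measurable
    also have "\<dots> \<le> 2 * \<delta>" by (rule anticoncentration[where \<Delta> = \<Delta> and c = "cpos \<beta>"]) (use m nz d inj_cpos in auto)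
    finally show ?thesis .
  qed
qed

end

text \<open>This is a Riemann sum for the integral of \<open>2 * h * exp (- h / \<zeta>)\<close>.
  For two successive values \<open>y \<le> x\<close> of \<open>h / (2 * \<zeta>)\<close>, the
  estimates \<open>x * exp (- x) \<le> 1\<close> and
  \<open>(x - y) * exp (- x) \<le> exp (- y) - exp (- x)\<close> make it telescope. One half of the
  exponential is spent on the factor \<open>h\<close>, and the rescaling produces the 8.\<close>

lemma run_moment_sum:
  fixes h :: "nat \<Rightarrow> real"
  assumes "\<And>m. m < n \<Longrightarrow> h m \<le> h (Suc m)" "0 \<le> h 0" "0 < \<zeta>"
  shows "(\<Sum>m<n. 2 * (h (Suc m) - h m) * h (Suc m) * exp (- h (Suc m) / \<zeta>)) \<le> 8 * \<zeta>\<^sup>2"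
proof -
  have "0 \<le> h n \<and> (\<Sum>m<n. 2 * (h (Suc m) - h m) * h (Suc m) * exp (- h (Suc m) / \<zeta>)) \<le> 8 * \<zeta>\<^sup>2 * (1 - exp (- h n / (2 * \<zeta>)))"
    using assms(1)
  proof (induction n)
    case 0
    then show ?case using assms by simp
  next
    case (Suc n)
    define x where "x = h (Suc n) / (2 * \<zeta>)"
    define y where "y = h n / (2 * \<zeta>)"
    have IH: "0 \<le> h n" "(\<Sum>m<n. 2 * (h (Suc m) - h m) * h (Suc m) * exp (- h (Suc m) / \<zeta>)) \<le> 8 * \<zeta>\<^sup>2 * (1 - exp (- y))"
      using Suc by (auto simp: y_def)
    have yx: "0 \<le> y" "y \<le> x" using IH Suc.prems[of n] assms(3) by (auto simp: x_def y_def divide_right_mono)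
    have hx: "h (Suc n) = 2 * \<zeta> * x" "h n = 2 * \<zeta> * y" using assms(3) by (auto simp: x_def y_def)
    have "x * exp (- x) \<le> exp x * exp (- x)"
      by (rule mult_right_mono) (use exp_ge_add_one_self[of x] in linarith, simp)
    then have "x * exp (- x) \<le> 1" by (simp add: exp_minus)
    moreover have "(x - y) * exp (- x) \<le> exp (- y) - exp (- x)"
    proof -
      have "(1 + (x - y)) * exp (- x) \<le> exp (x - y) * exp (- x)"
        by (intro mult_right_mono exp_ge_add_one_self) simp
      also have "\<dots> = exp (- y)" by (simp add: exp_add[symmetric])
      finally show ?thesis by (simp add: algebra_simps)
    qed
    ultimately have "((x - y) * exp (- x)) * (x * exp (- x)) \<le> (exp (- y) - exp (- x)) * 1"
      using yx by (intro mult_mono) auto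
    moreover have "exp (- (2 * x)) = exp (- x) * exp (- x)" by (simp add: exp_add[symmetric])
    ultimately have "(x - y) * x * exp (- (2 * x)) \<le> exp (- y) - exp (- x)"
      by (simp only: mult_1_right mult.assoc mult.left_commute)
    then have "8 * \<zeta>\<^sup>2 * ((x - y) * x * exp (- (2 * x))) \<le> 8 * \<zeta>\<^sup>2 * (exp (- y) - exp (- x))"
      by (intro mult_left_mono) auto
    also have "8 * \<zeta>\<^sup>2 * ((x - y) * x * exp (- (2 * x))) = 2 * (h (Suc n) - h n) * h (Suc n) * exp (- h (Suc n) / \<zeta>)"
      using assms(3) by (simp add: hx power2_eq_square algebra_simps)
    finally show ?case using IH yx hx(1) assms(3) by (simp add: x_def[symmetric] algebra_simps)
  qed
  moreover have "8 * \<zeta>\<^sup>2 * (1 - exp (- h n / (2 * \<zeta>))) \<le> 8 * \<zeta>\<^sup>2 * 1"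
    by (intro mult_left_mono) auto
  ultimately show ?thesis by simp
qed

section \<open>Second moments of the boxes delimited by large clocks, and the estimates for a single
  copy\<close>

context gap_system
begin

text \<open>The points \<open>w m\<close> move away from \<open>x\<close> to one side, so the event
  that all clocks up to \<open>w m\<close> stay below \<open>\<zeta>\<close> shrinks as
  \<open>m\<close> grows. By telescoping squares, \<open>V\<close> dominates the squared distance of
  the farthest point reached; unlike a supremum it is a finite sum of indicators, whose expectations
  are the exponential tails.\<close>

lemma run_second_moment:
  fixes w :: "nat \<Rightarrow> real"
  assumes i: "i < k" and x: "x \<in> set (zs i)" and w: "\<And>m. m \<le> n \<Longrightarrow> w m \<in> set (zs i)" and w0: "w 0 = x"
    and mono: "\<And>m. m < n \<Longrightarrow> \<bar>w m - x\<bar> \<le> \<bar>w (Suc m) - x\<bar>"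
    and nest: "\<And>m m'. m \<le> m' \<Longrightarrow> m' \<le> n \<Longrightarrow> Eg i x (w m) \<subseteq> Eg i x (w m')"
    and z: "0 < \<zeta>"
  shows "\<exists>V. bm V \<and> dep (block \<beta>) V \<and> (\<forall>\<omega>. 0 \<le> V \<omega>) \<and> (\<integral>\<omega>. V \<omega> \<partial>random_source) \<le> 8 * \<zeta>\<^sup>2 \<and>
    (\<forall>\<omega>. \<forall>m\<le>n. (\<forall>e\<in>Eg i x (w m). Y \<beta> \<omega> i e \<le> \<zeta>) \<longrightarrow> (x - w m)\<^sup>2 \<le> V \<omega>)"
proof -
  define h where "h m = \<bar>w m - x\<bar>" for m
  define R where "R m \<omega> = (\<forall>e\<in>Eg i x (w m). Y \<beta> \<omega> i e \<le> \<zeta>)" for m \<omega>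
  define V where "V \<omega> = (\<Sum>m<n. 2 * (h (Suc m) - h m) * h (Suc m) * of_bool (R (Suc m) \<omega>))" for \<omega>
  have h: "h m \<le> h (Suc m)" "0 \<le> h m" if "m < n" for m using mono[OF that] by (auto simp: h_def)
  have coef: "0 \<le> 2 * (h (Suc m) - h m) * h (Suc m)" if "m < n" for m using h[OF that] by simp
  have mR: "{\<omega> \<in> space random_source. R m \<omega>} \<in> sets random_source" for m
    unfolding R_def using finite_Eg[of i x "w m"] by measurable
  have bR: "bm (\<lambda>\<omega>. of_bool (R m \<omega>))" for m
  proof -
    have "(\<lambda>\<omega>. of_bool (R m \<omega>) :: real) \<in> borel_measurable random_source \<longleftrightarrow>
      (\<lambda>\<omega>. indicator {\<omega> \<in> space random_source. R m \<omega>} \<omega> :: real) \<in> borel_measurable random_source"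
      by (intro measurable_cong) auto
    then show ?thesis unfolding bm_def using mR by (auto intro!: exI[of _ 1])
  qed
  have bV: "bm V" unfolding V_def by (intro bm_sum bm_cmult bR)
  have "dep (block \<beta>) V"
    unfolding dep_def
  proof (intro allI impI)
    fix \<omega> \<omega>' :: "nat \<Rightarrow> real" assume e: "\<forall>j\<in>block \<beta>. \<omega> j = \<omega>' j"
    have "R m \<omega> = R m \<omega>'" for m
      unfolding R_def using Y_cong[OF e i] Eg_less by (intro ball_cong) auto
    then show "V \<omega> = V \<omega>'" by (simp add: V_def)
  qed
  moreover have "(\<integral>\<omega>. V \<omega> \<partial>random_source) \<le> 8 * \<zeta>\<^sup>2"
  proof -
    have "(\<integral>\<omega>. V \<omega> \<partial>random_source) = (\<Sum>m<n. 2 * (h (Suc m) - h m) * h (Suc m) * (\<integral>\<omega>. of_bool (R (Suc m) \<omega>) \<partial>random_source))"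
    proof -
      have "(\<integral>\<omega>. V \<omega> \<partial>random_source) = (\<Sum>m<n. \<integral>\<omega>. 2 * (h (Suc m) - h m) * h (Suc m) * of_bool (R (Suc m) \<omega>) \<partial>random_source)"
        unfolding V_def by (intro Bochner_Integration.integral_sum bm_integrable bm_cmult bR)
      then show ?thesis by (simp only: integral_mult_right_zero)
    qed
    also have "\<dots> \<le> (\<Sum>m<n. 2 * (h (Suc m) - h m) * h (Suc m) * exp (- h (Suc m) / \<zeta>))"
    proof (intro sum_mono mult_left_mono)
      fix m assume m: "m \<in> {..<n}"
      have "(\<integral>\<omega>. of_bool (R (Suc m) \<omega>) \<partial>random_source) = (\<integral>\<omega>. indicat_real {\<omega> \<in> space random_source. R (Suc m) \<omega>} \<omega> \<partial>random_source)"
        by (intro Bochner_Integration.integral_cong) auto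
      also have "\<dots> = measure random_source {\<omega> \<in> space random_source. R (Suc m) \<omega>}" using mR by simp
      also have "\<dots> \<le> exp (- \<bar>x - w (Suc m)\<bar> / \<zeta>)"
        unfolding R_def using m by (intro segment_lower_tail x w z) auto
      finally show "(\<integral>\<omega>. of_bool (R (Suc m) \<omega>) \<partial>random_source) \<le> exp (- h (Suc m) / \<zeta>)"
        by (simp add: h_def abs_minus_commute)
    qed (use coef in auto)
    also have "\<dots> \<le> 8 * \<zeta>\<^sup>2" using h z by (intro run_moment_sum) (auto simp: h_def)
    finally show ?thesis .
  qed
  moreover have "(x - w m)\<^sup>2 \<le> V \<omega>" if m: "m \<le> n" "\<forall>e\<in>Eg i x (w m). Y \<beta> \<omega> i e \<le> \<zeta>" for \<omega> m
  proof -
    have "(x - w m)\<^sup>2 = (h m)\<^sup>2 - (h 0)\<^sup>2" by (simp add: h_def w0 power2_commute)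
    also have "\<dots> = (\<Sum>j<m. (h (Suc j))\<^sup>2 - (h j)\<^sup>2)" by (rule sum_lessThan_telescope[symmetric])
    also have "\<dots> \<le> (\<Sum>j<m. 2 * (h (Suc j) - h j) * h (Suc j) * of_bool (R (Suc j) \<omega>))"
    proof (rule sum_mono)
      fix j assume j: "j \<in> {..<m}"
      have "R (Suc j) \<omega>" unfolding R_def using m nest[of "Suc j" m] j by auto
      moreover have "0 \<le> (h (Suc j) - h j)\<^sup>2" by simp
      ultimately show "(h (Suc j))\<^sup>2 - (h j)\<^sup>2 \<le> 2 * (h (Suc j) - h j) * h (Suc j) * of_bool (R (Suc j) \<omega>)"
        by (simp add: power2_eq_square algebra_simps)
    qed
    also have "\<dots> \<le> V \<omega>" unfolding V_def using m coef by (intro sum_mono2) auto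
    finally show ?thesis .
  qed
  moreover have "0 \<le> V \<omega>" for \<omega> unfolding V_def using coef by (intro sum_nonneg) auto
  ultimately show ?thesis using bV by blast
qed

text \<open>The points reached lie on both sides of \<open>x\<close>: one run to the right and one
  to the left are added, which doubles the constant.\<close>

lemma box_second_moment:
  assumes i: "i < k" and x: "x \<in> set (zs i)" and z: "0 < \<zeta>"
  shows "\<exists>V. bm V \<and> dep (block \<beta>) V \<and> (\<forall>\<omega>. 0 \<le> V \<omega>) \<and> (\<integral>\<omega>. V \<omega> \<partial>random_source) \<le> 16 * \<zeta>\<^sup>2 \<and>
    (\<forall>\<omega>. \<forall>y\<in>set (zs i). (\<forall>e\<in>Eg i x y. Y \<beta> \<omega> i e \<le> \<zeta>) \<longrightarrow> (x - y)\<^sup>2 \<le> V \<omega>)"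
proof -
  obtain c where c: "zs i ! c = x" "c < N"
    using x by (auto simp: in_set_conv_nth length_zs)
  note le = sorted_nth_mono[OF sorted_zs, of _ _ i, unfolded length_zs]
  have "\<exists>V. bm V \<and> dep (block \<beta>) V \<and> (\<forall>\<omega>. 0 \<le> V \<omega>) \<and> (\<integral>\<omega>. V \<omega> \<partial>random_source) \<le> 8 * \<zeta>\<^sup>2 \<and>
    (\<forall>\<omega>. \<forall>m\<le>N - 1 - c. (\<forall>e\<in>Eg i x (zs i ! (c + m)). Y \<beta> \<omega> i e \<le> \<zeta>) \<longrightarrow> (x - zs i ! (c + m))\<^sup>2 \<le> V \<omega>)"
  proof (rule run_second_moment[OF i x _ _ _ _ z])
    fix m m' assume "m \<le> m'" "m' \<le> N - 1 - c"
    then have "zs i ! (c + m) \<le> zs i ! (c + m')" "x \<le> zs i ! (c + m)" using c le[of "c + m" "c + m'"] le[of c "c + m"] by auto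
    then show "Eg i x (zs i ! (c + m)) \<subseteq> Eg i x (zs i ! (c + m'))" by (auto simp: Eg_def)
  next
    fix m assume "m < N - 1 - c"
    then have "c + Suc m < N" by simp
    then show "\<bar>zs i ! (c + m) - x\<bar> \<le> \<bar>zs i ! (c + Suc m) - x\<bar>"
      using c le[of "c + m" "c + Suc m"] le[of c "c + m"] by auto
  qed (use c in \<open>auto simp: length_zs intro!: nth_mem\<close>)
  then obtain V1 where V1: "bm V1" "dep (block \<beta>) V1" "\<forall>\<omega>. 0 \<le> V1 \<omega>" "(\<integral>\<omega>. V1 \<omega> \<partial>random_source) \<le> 8 * \<zeta>\<^sup>2"
    "\<forall>\<omega>. \<forall>m\<le>N - 1 - c. (\<forall>e\<in>Eg i x (zs i ! (c + m)). Y \<beta> \<omega> i e \<le> \<zeta>) \<longrightarrow> (x - zs i ! (c + m))\<^sup>2 \<le> V1 \<omega>" by blast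
  have "\<exists>V. bm V \<and> dep (block \<beta>) V \<and> (\<forall>\<omega>. 0 \<le> V \<omega>) \<and> (\<integral>\<omega>. V \<omega> \<partial>random_source) \<le> 8 * \<zeta>\<^sup>2 \<and>
    (\<forall>\<omega>. \<forall>m\<le>c. (\<forall>e\<in>Eg i x (zs i ! (c - m)). Y \<beta> \<omega> i e \<le> \<zeta>) \<longrightarrow> (x - zs i ! (c - m))\<^sup>2 \<le> V \<omega>)"
  proof (rule run_second_moment[OF i x _ _ _ _ z])
    fix m m' assume "m \<le> m'" "m' \<le> c"
    then have "zs i ! (c - m') \<le> zs i ! (c - m)" "zs i ! (c - m) \<le> x" using c le[of "c - m'" "c - m"] le[of "c - m" c] by auto
    then show "Eg i x (zs i ! (c - m)) \<subseteq> Eg i x (zs i ! (c - m'))" by (auto simp: Eg_def)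
  next
    fix m assume "m < c"
    then have "c - Suc m \<le> c - m" "c - m < N" using c by auto
    then show "\<bar>zs i ! (c - m) - x\<bar> \<le> \<bar>zs i ! (c - Suc m) - x\<bar>"
      using c le[of "c - Suc m" "c - m"] le[of "c - m" c] by auto
  qed (use c in \<open>auto simp: length_zs intro!: nth_mem\<close>)
  then obtain V2 where V2: "bm V2" "dep (block \<beta>) V2" "\<forall>\<omega>. 0 \<le> V2 \<omega>" "(\<integral>\<omega>. V2 \<omega> \<partial>random_source) \<le> 8 * \<zeta>\<^sup>2"
    "\<forall>\<omega>. \<forall>m\<le>c. (\<forall>e\<in>Eg i x (zs i ! (c - m)). Y \<beta> \<omega> i e \<le> \<zeta>) \<longrightarrow> (x - zs i ! (c - m))\<^sup>2 \<le> V2 \<omega>" by blast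
  let ?V = "\<lambda>\<omega>. V1 \<omega> + V2 \<omega>"
  have "(x - y)\<^sup>2 \<le> ?V \<omega>" if y: "y \<in> set (zs i)" and Q: "\<forall>e\<in>Eg i x y. Y \<beta> \<omega> i e \<le> \<zeta>" for \<omega> y
  proof -
    obtain d where d: "zs i ! d = y" "d < N" using y by (auto simp: in_set_conv_nth length_zs)
    show ?thesis
    proof (cases "c \<le> d")
      case True
      then have "(x - y)\<^sup>2 \<le> V1 \<omega>" using V1(5)[rule_format, of "d - c" \<omega>] Q d by auto
      then show ?thesis using V2(3)[rule_format, of \<omega>] by simp
    next
      case False
      then have "(x - y)\<^sup>2 \<le> V2 \<omega>" using V2(5)[rule_format, of "c - d" \<omega>] Q d by auto
      then show ?thesis using V1(3)[rule_format, of \<omega>] by simp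
    qed
  qed
  moreover have "(\<integral>\<omega>. ?V \<omega> \<partial>random_source) \<le> 16 * \<zeta>\<^sup>2"
    using V1(4) V2(4) by (simp add: bm_integrable V1(1) V2(1))
  moreover have "dep (block \<beta>) ?V" using V1(2) V2(2) unfolding dep_def by metis
  ultimately show ?thesis using V1 V2 bm_add[OF V1(1) V2(1)] by (intro exI[of _ ?V]) auto
qed

text \<open>\<open>clear\<close> and \<open>ticking\<close> refer to all pairs of points
  simultaneously. The first turns closeness on the line into small clocks, the second turns small
  clocks into a small l1 distance.\<close>

definition clear :: "real \<Rightarrow> nat \<Rightarrow> (nat \<Rightarrow> real) \<Rightarrow> bool" where
  "clear \<delta> \<beta> \<omega> \<longleftrightarrow> (\<forall>a<N. \<forall>b<N. \<forall>(i, e)\<in>EE a b. \<delta> * Y \<beta> \<omega> i e ^ q \<le> \<bar>pv \<beta> \<omega> a - pv \<beta> \<omega> b\<bar>)"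

definition ticking :: "real \<Rightarrow> nat \<Rightarrow> (nat \<Rightarrow> real) \<Rightarrow> bool" where
  "ticking s \<beta> \<omega> \<longleftrightarrow> (\<forall>a<N. \<forall>b<N. l1n k (X a) (X b) = 0 \<or> (\<exists>(i, e)\<in>EE a b. l1n k (X a) (X b) / s < Y \<beta> \<omega> i e))"

lemma clear_sets: "{\<omega> \<in> space random_source. clear \<delta> \<beta> \<omega>} \<in> sets random_source"
proof -
  have "{\<omega> \<in> space random_source. clear \<delta> \<beta> \<omega>} = {\<omega> \<in> space random_source. \<forall>a\<in>{..<N}. \<forall>b\<in>{..<N}. \<forall>p\<in>EE a b.
      \<delta> * Y \<beta> \<omega> (fst p) (snd p) ^ q \<le> \<bar>pv \<beta> \<omega> a - pv \<beta> \<omega> b\<bar>}"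
    by (simp only: clear_def case_prod_unfold Ball_def lessThan_iff)
  also have "\<dots> \<in> sets random_source"
    by (intro sets.sets_Collect_finite_All finite_EE finite_lessThan) measurable
  finally show ?thesis .
qed

lemma ticking_sets: "{\<omega> \<in> space random_source. ticking s \<beta> \<omega>} \<in> sets random_source"
proof -
  have "{\<omega> \<in> space random_source. ticking s \<beta> \<omega>} = {\<omega> \<in> space random_source. \<forall>a\<in>{..<N}. \<forall>b\<in>{..<N}.
      l1n k (X a) (X b) = 0 \<or> (\<exists>p\<in>EE a b. l1n k (X a) (X b) / s < Y \<beta> \<omega> (fst p) (snd p))}"
    by (simp only: ticking_def case_prod_unfold Ball_def lessThan_iff)
  also have "\<dots> \<in> sets random_source"
    by (intro sets.sets_Collect_finite_All sets.sets_Collect_finite_Ex sets.sets_Collect_disj sets.sets_Collect_const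
      finite_EE finite_lessThan) measurable
  finally show ?thesis .
qed

lemma prob_pairs_le:
  assumes "\<And>a b. a < N \<Longrightarrow> b < N \<Longrightarrow> {\<omega> \<in> space random_source. P a b \<omega>} \<in> sets random_source"
    and "\<And>a b. a < N \<Longrightarrow> b < N \<Longrightarrow> measure random_source {\<omega> \<in> space random_source. P a b \<omega>} \<le> c"
  shows "measure random_source {\<omega> \<in> space random_source. \<exists>a<N. \<exists>b<N. P a b \<omega>} \<le> real N ^ 2 * c"
proof -
  have "{\<omega> \<in> space random_source. \<exists>a<N. \<exists>b<N. P a b \<omega>} = (\<Union>p\<in>{..<N} \<times> {..<N}. {\<omega> \<in> space random_source. P (fst p) (snd p) \<omega>})"
    by fastforce
  also have "measure random_source \<dots> \<le> (\<Sum>p\<in>{..<N} \<times> {..<N}. c)"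
    using assms by (intro prob_union_le) auto
  finally show ?thesis by (simp add: power2_eq_square)
qed

lemma prob_not_clear:
  assumes "0 \<le> \<delta>"
  shows "measure random_source {\<omega> \<in> space random_source. \<not> clear \<delta> \<beta> \<omega>} \<le> real N ^ 2 * (2 * \<delta>)"
proof -
  have "{\<omega> \<in> space random_source. \<not> clear \<delta> \<beta> \<omega>} = {\<omega> \<in> space random_source. \<exists>a<N. \<exists>b<N.
    (\<exists>(i, e)\<in>EE a b. \<bar>pv \<beta> \<omega> a - pv \<beta> \<omega> b\<bar> < \<delta> * Y \<beta> \<omega> i e ^ q)}"
    by (fastforce simp: clear_def not_le)
  also have "measure random_source \<dots> \<le> real N ^ 2 * (2 * \<delta>)"
    by (intro prob_pairs_le no_cancellation assms) (use finite_EE in measurable)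
  finally show ?thesis .
qed

lemma prob_not_ticking:
  assumes s: "0 < s"
  shows "measure random_source {\<omega> \<in> space random_source. \<not> ticking s \<beta> \<omega>} \<le> real N ^ 2 * exp (- s)"
proof -
  have "{\<omega> \<in> space random_source. \<not> ticking s \<beta> \<omega>} = {\<omega> \<in> space random_source. \<exists>a<N. \<exists>b<N.
    l1n k (X a) (X b) \<noteq> 0 \<and> (\<forall>(i, e)\<in>EE a b. Y \<beta> \<omega> i e \<le> l1n k (X a) (X b) / s)}"
    by (fastforce simp: ticking_def not_less)
  also have "measure random_source \<dots> \<le> real N ^ 2 * exp (- s)"
  proof (intro prob_pairs_le)
    fix a b assume ab: "a < N" "b < N"
    show "measure random_source {\<omega> \<in> space random_source. l1n k (X a) (X b) \<noteq> 0 \<and> (\<forall>(i, e)\<in>EE a b. Y \<beta> \<omega> i e \<le> l1n k (X a) (X b) / s)} \<le> exp (- s)"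
    proof (cases "l1n k (X a) (X b) = 0")
      case False
      then have "0 < l1n k (X a) (X b)" using l1n_nonneg[of k "X a" "X b"] by linarith
      then show ?thesis using clock_lower_tail[OF ab, of "l1n k (X a) (X b) / s" \<beta>] s by simp
    qed simp
  qed (use finite_EE in measurable)
  finally show ?thesis .
qed

text \<open>Here the power pays off: the \<open>q\<close>-th root reduces the loss
  \<open>2 ^ (9 * q)\<close> to \<open>2 ^ 9\<close>. On the other hand
  \<open>1 / 2 ^ (9 * q)\<close> is small enough for a union bound over \<open>N ^ 2\<close> pairs
  once \<open>N \<le> 2 ^ q\<close>.\<close>

lemma clear_bound:
  assumes w: "\<omega> \<in> space random_source" and c: "clear (1 / 2 ^ (9 * q)) \<beta> \<omega>" and ab: "a < N" "b < N"
    and le: "\<bar>pv \<beta> \<omega> a - pv \<beta> \<omega> b\<bar> \<le> \<sigma> ^ q" and s: "0 \<le> \<sigma>" and ie: "(i, e) \<in> EE a b"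
  shows "Y \<beta> \<omega> i e \<le> 2 ^ 9 * \<sigma>"
proof -
  have "1 / 2 ^ (9 * q) * Y \<beta> \<omega> i e ^ q \<le> \<sigma> ^ q"
    using c ab ie le unfolding clear_def by fastforce
  then have "Y \<beta> \<omega> i e ^ q \<le> (2 ^ 9 * \<sigma>) ^ q"
    using power_mult[of "2::real" 9 q] by (simp add: power_mult_distrib divide_le_eq mult.commute)
  moreover have "Suc (q - 1) = q" using q2 by simp
  ultimately have "Y \<beta> \<omega> i e ^ Suc (q - 1) \<le> (2 ^ 9 * \<sigma>) ^ Suc (q - 1)" by simp
  then show ?thesis by (rule power_le_imp_le_base) (use s in simp)
qed

lemma zero_gap:
  assumes "a < N" "b < N" "l1n k (X a) (X b) = 0" "(i, e) \<in> EE a b"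
  shows "gap i e = 0"
proof -
  have "\<forall>p\<in>EE a b. (case p of (i, e) \<Rightarrow> gap i e) = 0"
    using sum_gap_EE[OF assms(1,2)] assms(3) gap_nonneg EE_bounds finite_EE
    by (subst sum_nonneg_eq_0_iff[symmetric]) auto
  then show ?thesis using assms(4) by auto
qed

text \<open>The failure probability decays only like \<open>1 / z\<close>, which the four copies
  compensate later. Points at distance 0 are treated apart, since the tail estimate needs a positive
  threshold; their images coincide.\<close>

lemma copy_upper:
  assumes ab: "a < N" "b < N" and z: "0 < z"
  shows "\<exists>P. {\<omega> \<in> space random_source. P \<omega>} \<in> sets random_source \<and> dep (block \<beta>) P \<and>
    measure random_source {\<omega> \<in> space random_source. P \<omega>} \<le> 2 / z \<and>
    (\<forall>\<omega>\<in>space random_source. \<not> P \<omega> \<longrightarrow> \<bar>pv \<beta> \<omega> a - pv \<beta> \<omega> b\<bar> \<le> (z * l1n k (X a) (X b)) ^ q)"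
proof (cases "l1n k (X a) (X b) = 0")
  case True
  have "\<bar>pv \<beta> \<omega> a - pv \<beta> \<omega> b\<bar> \<le> 0" if w: "\<omega> \<in> space random_source" for \<omega>
  proof -
    have "gap i e = 0" if "(i, e) \<in> EE a b" for i e
      by (rule zero_gap[OF ab True that])
    then have "(\<Sum>(i, e)\<in>EE a b. Y \<beta> \<omega> i e ^ q) = 0"
      using q2 by (intro sum.neutral) (auto simp: Y_def)
    then show ?thesis using pv_diff_le[OF w, of \<beta> a b] by simp
  qed
  then show ?thesis using True q2 z by (intro exI[of _ "\<lambda>_. False"]) (auto simp: dep_def)
next
  case False
  then have t: "0 < l1n k (X a) (X b)" using l1n_nonneg[of k "X a" "X b"] by linarith
  let ?P = "\<lambda>\<omega>. (z * l1n k (X a) (X b)) ^ q < (\<Sum>(i, e)\<in>EE a b. Y \<beta> \<omega> i e ^ q)"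
  have "dep (block \<beta>) ?P"
    unfolding dep_def
  proof (intro allI impI)
    fix \<omega> \<omega>' :: "nat \<Rightarrow> real" assume e: "\<forall>j\<in>block \<beta>. \<omega> j = \<omega>' j"
    have "(\<Sum>(i, e)\<in>EE a b. Y \<beta> \<omega> i e ^ q) = (\<Sum>(i, e)\<in>EE a b. Y \<beta> \<omega>' i e ^ q)"
    proof (intro sum.cong refl, clarify)
      fix i e' assume "(i, e') \<in> EE a b"
      then show "Y \<beta> \<omega> i e' ^ q = Y \<beta> \<omega>' i e' ^ q" using Y_cong[OF e] EE_bounds by metis
    qed
    then show "?P \<omega> = ?P \<omega>'" by simp
  qed
  moreover have "measure random_source {\<omega> \<in> space random_source. ?P \<omega>} \<le> 2 / z"
    using upper_tail[OF ab, of "z * l1n k (X a) (X b)" \<beta>] t z by simp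
  moreover have "{\<omega> \<in> space random_source. ?P \<omega>} \<in> sets random_source"
    by (simp add: case_prod_unfold)
  moreover have "\<bar>pv \<beta> \<omega> a - pv \<beta> \<omega> b\<bar> \<le> (z * l1n k (X a) (X b)) ^ q" if "\<omega> \<in> space random_source" "\<not> ?P \<omega>" for \<omega>
    using pv_diff_le[OF that(1), of \<beta> a b] that(2) by linarith
  ultimately show ?thesis by (intro exI[of _ ?P] conjI ballI impI) assumption+
qed

text \<open>If \<open>b\<close> is no farther on the line than \<open>b'\<close>, then all clocks
  between \<open>a\<close> and \<open>b\<close> are at most \<open>2 ^ 9 * z\<close> times the
  distance of \<open>b'\<close>, whereas \<open>ticking\<close> supplies a clock above the distance
  of \<open>b\<close> divided by \<open>s\<close>. The bounds are weakened to
  \<open>z\<^sup>2\<close> and \<open>3 / z\<close> to share the form of the Euclidean case.\<close>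

lemma copy_l1:
  assumes ab: "a < N" "b' < N" and z: "1 \<le> z" and s: "0 < s"
  shows "\<exists>P. {\<omega> \<in> space random_source. P \<omega>} \<in> sets random_source \<and> dep (block \<beta>) P \<and>
    measure random_source {\<omega> \<in> space random_source. P \<omega>} \<le> 3 / z \<and>
    (\<forall>\<omega>\<in>space random_source. \<not> P \<omega> \<longrightarrow> clear (1 / 2 ^ (9 * q)) \<beta> \<omega> \<longrightarrow> ticking s \<beta> \<omega> \<longrightarrow>
      (\<forall>b<N. \<bar>pv \<beta> \<omega> a - pv \<beta> \<omega> b\<bar> \<le> \<bar>pv \<beta> \<omega> a - pv \<beta> \<omega> b'\<bar> \<longrightarrow>
        l1n k (X a) (X b) \<le> z\<^sup>2 * (s * 2 ^ 9 * l1n k (X a) (X b'))))"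
proof -
  have z0: "0 < z" using z by simp
  obtain P where P: "{\<omega> \<in> space random_source. P \<omega>} \<in> sets random_source" "dep (block \<beta>) P"
    "measure random_source {\<omega> \<in> space random_source. P \<omega>} \<le> 2 / z"
    and le: "\<And>\<omega>. \<omega> \<in> space random_source \<Longrightarrow> \<not> P \<omega> \<Longrightarrow> \<bar>pv \<beta> \<omega> a - pv \<beta> \<omega> b'\<bar> \<le> (z * l1n k (X a) (X b')) ^ q"
    using copy_upper[OF ab z0, of \<beta>] by blast
  let ?t = "l1n k (X a) (X b')"
  have t: "0 \<le> ?t" by (rule l1n_nonneg)
  have main: "l1n k (X a) (X b) \<le> z\<^sup>2 * (s * 2 ^ 9 * ?t)"
    if w: "\<omega> \<in> space random_source" "\<not> P \<omega>" "clear (1 / 2 ^ (9 * q)) \<beta> \<omega>" "ticking s \<beta> \<omega>" "b < N"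
      "\<bar>pv \<beta> \<omega> a - pv \<beta> \<omega> b\<bar> \<le> \<bar>pv \<beta> \<omega> a - pv \<beta> \<omega> b'\<bar>" for \<omega> b
  proof (cases "l1n k (X a) (X b) = 0")
    case False
    then obtain i e where ie: "(i, e) \<in> EE a b" "l1n k (X a) (X b) / s < Y \<beta> \<omega> i e"
      using w(4,5) ab unfolding ticking_def by blast
    have "Y \<beta> \<omega> i e \<le> 2 ^ 9 * (z * ?t)"
      using w(6) le[OF w(1,2)] t z by (intro clear_bound[OF w(1,3) ab(1) w(5) _ _ ie(1)]) auto
    then have "l1n k (X a) (X b) / s \<le> 2 ^ 9 * (z * ?t)" using ie(2) by linarith
    then have "l1n k (X a) (X b) \<le> z * (s * 2 ^ 9 * ?t)" using s by (simp add: divide_le_eq algebra_simps)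
    also have "\<dots> \<le> z\<^sup>2 * (s * 2 ^ 9 * ?t)"
      using z t s by (intro mult_right_mono) (auto simp: power2_eq_square)
    finally show ?thesis .
  qed (use t s in auto)
  have "2 / z \<le> 3 / z" using z by (simp add: divide_right_mono)
  then have P3: "measure random_source {\<omega> \<in> space random_source. P \<omega>} \<le> 3 / z" using P(3) by linarith
  show ?thesis
    by (intro exI[of _ P] conjI P(1) P(2) P3) (intro ballI allI impI, rule main)
qed

text \<open>In these cases the threshold for the box moments or the level for Markov's inequality
  would be 0. Instead the null event that some uniform value is 0 is excluded; then a clock that
  does not exceed 0 forces its gap to be 0.\<close>

lemma copy_l2_zero:
  assumes ab: "a < N" "b' < N" and True: "l1n k (X a) (X b') = 0 \<or> k = 0"
  shows "\<exists>P. {\<omega> \<in> space random_source. P \<omega>} \<in> sets random_source \<and> dep (block \<beta>) P \<and>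
    measure random_source {\<omega> \<in> space random_source. P \<omega>} \<le> 0 \<and>
    (\<forall>\<omega>\<in>space random_source. \<not> P \<omega> \<longrightarrow> clear (1 / 2 ^ (9 * q)) \<beta> \<omega> \<longrightarrow>
      (\<forall>b<N. \<bar>pv \<beta> \<omega> a - pv \<beta> \<omega> b\<bar> \<le> \<bar>pv \<beta> \<omega> a - pv \<beta> \<omega> b'\<bar> \<longrightarrow>
        L2_set (\<lambda>i. X a i - X b i) {..<k} \<le> 0))"
proof -
  let ?P = "\<lambda>\<omega>. \<exists>i<k. \<exists>e<N. \<omega> (upos \<beta> i e) = 0"
  let ?A = "\<lambda>i e. {\<omega> \<in> space random_source. \<omega> (upos \<beta> i e) = 0}"
  have eq: "{\<omega> \<in> space random_source. ?P \<omega>} = (\<Union>i\<in>{..<k}. \<Union>e\<in>{..<N}. ?A i e)"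
    by auto
  have "measure random_source (\<Union>e\<in>{..<N}. ?A i e) \<le> (\<Sum>e\<in>{..<N}. 0)" for i
    by (intro prob_union_le) (auto simp: prob_coord_zero)
  then have "measure random_source {\<omega> \<in> space random_source. ?P \<omega>} \<le> (\<Sum>i\<in>{..<k}. 0)"
    unfolding eq by (intro prob_union_le) auto
  then have m0: "measure random_source {\<omega> \<in> space random_source. ?P \<omega>} \<le> 0" by simp
  have d0: "dep (block \<beta>) ?P"
    unfolding dep_def
  proof (intro allI impI)
    fix \<omega> \<omega>' :: "nat \<Rightarrow> real" assume "\<forall>j\<in>block \<beta>. \<omega> j = \<omega>' j"
    then have "\<omega> (upos \<beta> i e) = \<omega>' (upos \<beta> i e)" if "i < k" "e < N" for i e
      using block_upos[OF that] by blast
    then show "?P \<omega> = ?P \<omega>'" by (simp cong: conj_cong)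
  qed
  have main: "L2_set (\<lambda>i. X a i - X b i) {..<k} \<le> 0"
    if w: "\<omega> \<in> space random_source" "\<not> ?P \<omega>" "clear (1 / 2 ^ (9 * q)) \<beta> \<omega>" "b < N"
      "\<bar>pv \<beta> \<omega> a - pv \<beta> \<omega> b\<bar> \<le> \<bar>pv \<beta> \<omega> a - pv \<beta> \<omega> b'\<bar>" for \<omega> b
  proof -
    have "gap i e = 0" if "(i, e) \<in> EE a b'" for i e
      using zero_gap[OF ab _ that] True EE_bounds[OF that] by auto
    then have "(\<Sum>(i, e)\<in>EE a b'. Y \<beta> \<omega> i e ^ q) = 0"
      using q2 by (intro sum.neutral) (auto simp: Y_def)
    then have "\<bar>pv \<beta> \<omega> a - pv \<beta> \<omega> b'\<bar> \<le> 0" using pv_diff_le[OF w(1), of \<beta> a b'] by simp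
    then have zq: "\<bar>pv \<beta> \<omega> a - pv \<beta> \<omega> b\<bar> \<le> 0 ^ q" using w(5) q2 by simp
    have "gap i e = 0" if "(i, e) \<in> EE a b" for i e
    proof -
      have "Y \<beta> \<omega> i e \<le> 0" using clear_bound[OF w(1,3) ab(1) w(4) zq _ that] by simp
      moreover have "\<omega> (upos \<beta> i e) \<noteq> 0" using w(2) EE_bounds[OF that] by blast
      then have "0 < \<omega> (upos \<beta> i e)" using mem_space_source[OF w(1), of "upos \<beta> i e"] by linarith
      ultimately have "gap i e \<le> 0" by (simp add: Y_def divide_le_0_iff)
      then show ?thesis using gap_nonneg[of e i] EE_bounds[OF that] by auto
    qed
    then have "l1n k (X a) (X b) = 0"
      using sum_gap_EE[OF ab(1) w(4)] by (simp add: case_prod_unfold)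
    moreover have "L2_set (\<lambda>i. X a i - X b i) {..<k} \<le> l1n k (X a) (X b)"
      unfolding l1n_def by (rule L2_set_le_sum_abs)
    ultimately show ?thesis by simp
  qed
  have s0: "{\<omega> \<in> space random_source. ?P \<omega>} \<in> sets random_source" by measurable
  show ?thesis
    by (intro exI[of _ ?P] conjI s0 d0 m0) (intro ballI allI impI, rule main)
qed

lemma box_family:
  assumes a: "a < N" and zp: "0 < \<zeta>"
  obtains V where "\<And>i. i < k \<Longrightarrow> bm (V i)" "\<And>i. i < k \<Longrightarrow> dep (block \<beta>) (V i)"
      "\<And>i \<omega>. i < k \<Longrightarrow> 0 \<le> V i \<omega>" "\<And>i. i < k \<Longrightarrow> (\<integral>\<omega>. V i \<omega> \<partial>random_source) \<le> 16 * \<zeta>\<^sup>2"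
      "\<And>i \<omega> y. i < k \<Longrightarrow> y \<in> set (zs i) \<Longrightarrow> (\<forall>e\<in>Eg i (X a i) y. Y \<beta> \<omega> i e \<le> \<zeta>) \<Longrightarrow> (X a i - y)\<^sup>2 \<le> V i \<omega>"
proof -
  have "\<forall>i\<in>{..<k}. \<exists>V. bm V \<and> dep (block \<beta>) V \<and> (\<forall>\<omega>. 0 \<le> V \<omega>) \<and> (\<integral>\<omega>. V \<omega> \<partial>random_source) \<le> 16 * \<zeta>\<^sup>2 \<and>
    (\<forall>\<omega>. \<forall>y\<in>set (zs i). (\<forall>e\<in>Eg i (X a i) y. Y \<beta> \<omega> i e \<le> \<zeta>) \<longrightarrow> (X a i - y)\<^sup>2 \<le> V \<omega>)"
  proof
    fix i assume "i \<in> {..<k}"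
    then have "i < k" by simp
    from box_second_moment[OF this mem_zs[OF a] zp]
    show "\<exists>V. bm V \<and> dep (block \<beta>) V \<and> (\<forall>\<omega>. 0 \<le> V \<omega>) \<and> (\<integral>\<omega>. V \<omega> \<partial>random_source) \<le> 16 * \<zeta>\<^sup>2 \<and>
      (\<forall>\<omega>. \<forall>y\<in>set (zs i). (\<forall>e\<in>Eg i (X a i) y. Y \<beta> \<omega> i e \<le> \<zeta>) \<longrightarrow> (X a i - y)\<^sup>2 \<le> V \<omega>)" .
  qed
  from bchoice[OF this] obtain V where V: "\<forall>i\<in>{..<k}. bm (V i) \<and> dep (block \<beta>) (V i) \<and> (\<forall>\<omega>. 0 \<le> V i \<omega>) \<and> (\<integral>\<omega>. V i \<omega> \<partial>random_source) \<le> 16 * \<zeta>\<^sup>2 \<and>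
    (\<forall>\<omega>. \<forall>y\<in>set (zs i). (\<forall>e\<in>Eg i (X a i) y. Y \<beta> \<omega> i e \<le> \<zeta>) \<longrightarrow> (X a i - y)\<^sup>2 \<le> V i \<omega>)" ..
  show thesis
    by (rule that[of V]) (use V in \<open>simp_all only: Ball_def lessThan_iff simp_thms\<close>)
qed

text \<open>Passing through \<open>ticking\<close> would cost a factor of order
  \<open>q * sqrt (real k)\<close> relative to the Euclidean distance. Summing the box moments over
  the coordinates yields \<open>sqrt (real k)\<close> times an l1 distance, hence only a factor
  \<open>k\<close>.\<close>

lemma copy_l2:
  assumes ab: "a < N" "b' < N" and z: "1 \<le> z"
  shows "\<exists>P. {\<omega> \<in> space random_source. P \<omega>} \<in> sets random_source \<and> dep (block \<beta>) P \<and>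
    measure random_source {\<omega> \<in> space random_source. P \<omega>} \<le> 3 / z \<and>
    (\<forall>\<omega>\<in>space random_source. \<not> P \<omega> \<longrightarrow> clear (1 / 2 ^ (9 * q)) \<beta> \<omega> \<longrightarrow>
      (\<forall>b<N. \<bar>pv \<beta> \<omega> a - pv \<beta> \<omega> b\<bar> \<le> \<bar>pv \<beta> \<omega> a - pv \<beta> \<omega> b'\<bar> \<longrightarrow>
        L2_set (\<lambda>i. X a i - X b i) {..<k} \<le> z\<^sup>2 * (2 ^ 11 * sqrt (real k) * l1n k (X a) (X b'))))"
proof -
  have z0: "0 < z" using z by simp
  let ?t = "l1n k (X a) (X b')"
  have t: "0 \<le> ?t" by (rule l1n_nonneg)
  show ?thesis
  proof (cases "?t = 0 \<or> k = 0")
    case True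
    have n0: "0 \<le> 3 / z" "0 \<le> z\<^sup>2 * (2 ^ 11 * sqrt (real k) * ?t)" using z t by simp_all
    obtain P where P: "{\<omega> \<in> space random_source. P \<omega>} \<in> sets random_source" "dep (block \<beta>) P"
      "measure random_source {\<omega> \<in> space random_source. P \<omega>} \<le> 0"
      and main: "\<forall>\<omega>\<in>space random_source. \<not> P \<omega> \<longrightarrow> clear (1 / 2 ^ (9 * q)) \<beta> \<omega> \<longrightarrow>
      (\<forall>b<N. \<bar>pv \<beta> \<omega> a - pv \<beta> \<omega> b\<bar> \<le> \<bar>pv \<beta> \<omega> a - pv \<beta> \<omega> b'\<bar> \<longrightarrow>
        L2_set (\<lambda>i. X a i - X b i) {..<k} \<le> 0)"
      using copy_l2_zero[OF ab True, of \<beta>] by blast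
    show ?thesis
      by (intro exI[of _ P] conjI P(1) P(2) order_trans[OF P(3) n0(1)])
        (intro ballI allI impI, rule order_trans[OF main[rule_format] n0(2)])
  next
    case False
    then have tp: "0 < ?t" and kp: "0 < k" using t by auto
    obtain P where P: "{\<omega> \<in> space random_source. P \<omega>} \<in> sets random_source" "dep (block \<beta>) P"
      "measure random_source {\<omega> \<in> space random_source. P \<omega>} \<le> 2 / z"
      and le: "\<And>\<omega>. \<omega> \<in> space random_source \<Longrightarrow> \<not> P \<omega> \<Longrightarrow> \<bar>pv \<beta> \<omega> a - pv \<beta> \<omega> b'\<bar> \<le> (z * l1n k (X a) (X b')) ^ q"
      using copy_upper[OF ab z0, of \<beta>] by blast
    define \<zeta> where "\<zeta> = 2 ^ 9 * (z * ?t)"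
    have zp: "0 < \<zeta>" using tp z by (simp add: \<zeta>_def)
    obtain V where V: "\<And>i. i < k \<Longrightarrow> bm (V i)" "\<And>i. i < k \<Longrightarrow> dep (block \<beta>) (V i)"
      "\<And>i \<omega>. i < k \<Longrightarrow> 0 \<le> V i \<omega>" "\<And>i. i < k \<Longrightarrow> (\<integral>\<omega>. V i \<omega> \<partial>random_source) \<le> 16 * \<zeta>\<^sup>2"
      "\<And>i \<omega> y. i < k \<Longrightarrow> y \<in> set (zs i) \<Longrightarrow> (\<forall>e\<in>Eg i (X a i) y. Y \<beta> \<omega> i e \<le> \<zeta>) \<Longrightarrow> (X a i - y)\<^sup>2 \<le> V i \<omega>"
      by (rule box_family[OF ab(1) zp, where \<beta> = \<beta>]) (rule that)
    let ?S = "\<lambda>\<omega>. \<Sum>i<k. V i \<omega>"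
    have bS: "bm ?S" using V(1) by (intro bm_sum) simp
    note [measurable] = bm_measurable[OF bS]
    \<comment> \<open>The moments add up to at most \<open>16 * k * \<zeta>\<^sup>2\<close>, so
      Markov's inequality at this level fails with probability at most \<open>1 / z\<close>. The
      root of \<open>c\<close> is \<open>4 * sqrt k * \<zeta> * sqrt z\<close>, which explains
      \<open>2 ^ 11 = 4 * 2 ^ 9\<close>.\<close>
    define c where "c = 16 * real k * \<zeta>\<^sup>2 * z"
    have c: "0 < c" using kp zp z by (simp add: c_def)
    let ?P = "\<lambda>\<omega>. P \<omega> \<or> c \<le> ?S \<omega>"
    have eq: "{\<omega> \<in> space random_source. ?P \<omega>} = {\<omega> \<in> space random_source. P \<omega>} \<union> {\<omega> \<in> space random_source. c \<le> ?S \<omega>}"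
      by blast
    have sS: "{\<omega> \<in> space random_source. c \<le> ?S \<omega>} \<in> sets random_source" by measurable
    have m: "{\<omega> \<in> space random_source. ?P \<omega>} \<in> sets random_source"
      unfolding eq by (intro sets.Un P(1) sS)
    have "measure random_source {\<omega> \<in> space random_source. c \<le> ?S \<omega>} \<le> (\<integral>\<omega>. ?S \<omega> \<partial>random_source) / c"
      by (rule integral_Markov_inequality_measure[where A = "space random_source"])
        (use V(3) c bS in \<open>auto intro!: AE_I2 sum_nonneg bm_integrable\<close>)
    also have "(\<integral>\<omega>. ?S \<omega> \<partial>random_source) = (\<Sum>i<k. \<integral>\<omega>. V i \<omega> \<partial>random_source)"
      using V(1) by (intro Bochner_Integration.integral_sum bm_integrable) simp
    also have "\<dots> \<le> (\<Sum>i<k. 16 * \<zeta>\<^sup>2)" using V(4) by (intro sum_mono) simp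
    also have "(\<Sum>i<k. 16 * \<zeta>\<^sup>2) / c = 1 / z" using kp zp z by (simp add: c_def field_simps)
    finally have mS: "measure random_source {\<omega> \<in> space random_source. c \<le> ?S \<omega>} \<le> 1 / z"
      using c by (simp add: divide_right_mono)
    have "measure random_source {\<omega> \<in> space random_source. ?P \<omega>} \<le> 2 / z + 1 / z"
      unfolding eq using measure_Un_le[OF P(1) sS] P(3) mS by linarith
    also have "2 / z + 1 / z = 3 / z" by (simp add: add_divide_distrib[symmetric])
    finally have meas: "measure random_source {\<omega> \<in> space random_source. ?P \<omega>} \<le> 3 / z" .
    have dp: "dep (block \<beta>) ?P"
      unfolding dep_def
    proof (intro allI impI)
      fix \<omega> \<omega>' :: "nat \<Rightarrow> real" assume e: "\<forall>j\<in>block \<beta>. \<omega> j = \<omega>' j"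
      have "V i \<omega> = V i \<omega>'" if "i < k" for i using V(2)[OF that] e unfolding dep_def by blast
      then have "?S \<omega> = ?S \<omega>'" by simp
      moreover have "P \<omega> = P \<omega>'" using P(2) e unfolding dep_def by blast
      ultimately show "?P \<omega> = ?P \<omega>'" by simp
    qed
    have main: "L2_set (\<lambda>i. X a i - X b i) {..<k} \<le> z\<^sup>2 * (2 ^ 11 * sqrt (real k) * ?t)"
      if w: "\<omega> \<in> space random_source" "\<not> ?P \<omega>" "clear (1 / 2 ^ (9 * q)) \<beta> \<omega>" "b < N"
        "\<bar>pv \<beta> \<omega> a - pv \<beta> \<omega> b\<bar> \<le> \<bar>pv \<beta> \<omega> a - pv \<beta> \<omega> b'\<bar>" for \<omega> b
    proof -
      have nP: "\<not> P \<omega>" "?S \<omega> < c" using w(2) by auto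
      have pz: "\<bar>pv \<beta> \<omega> a - pv \<beta> \<omega> b\<bar> \<le> (z * ?t) ^ q" using le[OF w(1) nP(1)] w(5) by linarith
      have zt: "0 \<le> z * ?t" using z t by simp
      have Yz: "Y \<beta> \<omega> i e \<le> \<zeta>" if "(i, e) \<in> EE a b" for i e
        unfolding \<zeta>_def by (rule clear_bound[OF w(1,3) ab(1) w(4) pz zt that])
      have "(\<Sum>i<k. (X a i - X b i)\<^sup>2) \<le> ?S \<omega>"
      proof (rule sum_mono)
        fix i assume "i \<in> {..<k}"
        then show "(X a i - X b i)\<^sup>2 \<le> V i \<omega>"
          using Yz mem_zs[OF w(4)] by (intro V(5)) (auto simp: EE_def)
      qed
      also have "\<dots> \<le> c" using nP by simp
      also have "\<dots> \<le> 16 * real k * \<zeta>\<^sup>2 * z\<^sup>2"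
        unfolding c_def using z kp by (intro mult_left_mono) (auto simp: power2_eq_square)
      also have "\<dots> = (4 * sqrt (real k) * \<zeta> * z)\<^sup>2" by (simp add: power_mult_distrib)
      finally have "L2_set (\<lambda>i. X a i - X b i) {..<k} \<le> 4 * sqrt (real k) * \<zeta> * z"
        unfolding L2_set_def using zp z by (intro real_le_lsqrt) (auto intro!: mult_nonneg_nonneg sum_nonneg)
      also have "\<dots> = z\<^sup>2 * (2 ^ 11 * sqrt (real k) * ?t)"
        by (simp add: \<zeta>_def power2_eq_square)
      finally show ?thesis .
    qed
    show ?thesis
      by (intro exI[of _ ?P] conjI m meas dp) (intro ballI allI impI, rule main)
  qed
qed

end

section \<open>Minima over independent copies\<close>

lemma bm_of_bool:
  assumes "{\<omega> \<in> space random_source. P \<omega>} \<in> sets random_source"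
  shows "bm (\<lambda>\<omega>. of_bool (P \<omega>))"
proof -
  have "(\<lambda>\<omega>. of_bool (P \<omega>) :: real) \<in> borel_measurable random_source \<longleftrightarrow>
    (\<lambda>\<omega>. indicator {\<omega> \<in> space random_source. P \<omega>} \<omega> :: real) \<in> borel_measurable random_source"
    by (intro measurable_cong) auto
  then show ?thesis unfolding bm_def using assms by (auto intro!: exI[of _ 1])
qed

lemma integral_of_bool:
  assumes "{\<omega> \<in> space random_source. P \<omega>} \<in> sets random_source"
  shows "(\<integral>\<omega>. of_bool (P \<omega>) \<partial>random_source) = measure random_source {\<omega> \<in> space random_source. P \<omega>}"
proof -
  have "(\<integral>\<omega>. of_bool (P \<omega>) \<partial>random_source) = (\<integral>\<omega>. indicat_real {\<omega> \<in> space random_source. P \<omega>} \<omega> \<partial>random_source)"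
    by (intro Bochner_Integration.integral_cong) auto
  then show ?thesis using assms by simp
qed

lemma prob_all_indep_le:
  assumes P: "\<And>r. r < n \<Longrightarrow> {\<omega> \<in> space random_source. P r \<omega>} \<in> sets random_source"
    "\<And>r. r < n \<Longrightarrow> dep (J r) (P r)" "disjoint_family_on J {..<n}"
    "\<And>r. r < n \<Longrightarrow> measure random_source {\<omega> \<in> space random_source. P r \<omega>} \<le> c"
  shows "measure random_source {\<omega> \<in> space random_source. \<forall>r\<in>{..<n}. P r \<omega>} \<le> c ^ n"
    and "{\<omega> \<in> space random_source. \<forall>r\<in>{..<n}. P r \<omega>} \<in> sets random_source"
proof -
  show s: "{\<omega> \<in> space random_source. \<forall>r\<in>{..<n}. P r \<omega>} \<in> sets random_source"
    using P(1) by (intro sets.sets_Collect_finite_All) auto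
  have "measure random_source {\<omega> \<in> space random_source. \<forall>r\<in>{..<n}. P r \<omega>} = (\<integral>\<omega>. of_bool (\<forall>r\<in>{..<n}. P r \<omega>) \<partial>random_source)"
    by (rule integral_of_bool[OF s, symmetric])
  also have "\<dots> = (\<integral>\<omega>. (\<Prod>r<n. of_bool (P r \<omega>)) \<partial>random_source)"
  proof (intro Bochner_Integration.integral_cong refl)
    fix \<omega>
    show "of_bool (\<forall>r\<in>{..<n}. P r \<omega>) = (\<Prod>r<n. of_bool (P r \<omega>) :: real)"
      by (cases "\<forall>r\<in>{..<n}. P r \<omega>") auto
  qed
  also have "\<dots> = (\<Prod>r<n. \<integral>\<omega>. of_bool (P r \<omega>) \<partial>random_source)"
  proof (rule integral_prod_indep[where J = J])
    show "dep (J r) (\<lambda>\<omega>. of_bool (P r \<omega>))" if "r \<in> {..<n}" for r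
      using P(2)[of r] that unfolding dep_def by (intro allI impI arg_cong[where f = of_bool]) auto
  qed (use P in \<open>auto intro: bm_of_bool\<close>)
  also have "\<dots> \<le> (\<Prod>r<n. c)"
    using P(1,4) by (intro prod_mono) (auto simp: integral_of_bool)
  finally show "measure random_source {\<omega> \<in> space random_source. \<forall>r\<in>{..<n}. P r \<omega>} \<le> c ^ n" by simp
qed

text \<open>A level \<open>j\<close> at which all four copies fail is charged
  \<open>4 ^ Suc j\<close>, and this happens with probability at most
  \<open>(3 / 2 ^ j) ^ 4 = 81 / 16 ^ j\<close>. The ratio \<open>1 / 4\<close> gives
  \<open>324 * 4 / 3 = 432\<close>; with two copies the corresponding terms would not even tend to
  0.\<close>

lemma geometric_quarter_sum: "(\<Sum>j<n. 4 ^ Suc j * (3 / 2 ^ j) ^ 4) \<le> (432 :: real)"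
proof -
  have "(\<Sum>j<n. 4 ^ Suc j * (3 / 2 ^ j) ^ 4) = 324 * (\<Sum>j<n. (1 / 4) ^ j :: real)"
    unfolding sum_distrib_left
  proof (intro sum.cong refl)
    fix j
    have "((2::real) ^ j) ^ 4 = (2 ^ 4) ^ j" by (simp only: power_mult[symmetric] mult.commute)
    also have "\<dots> = 4 ^ j * 4 ^ j" by (simp add: power_mult_distrib[symmetric])
    finally have "((2::real) ^ j) ^ 4 = 4 ^ j * 4 ^ j" .
    then show "4 ^ Suc j * (3 / 2 ^ j) ^ 4 = 324 * (1 / 4 :: real) ^ j"
      by (simp add: power_divide)
  qed
  also have "(\<Sum>j<n. (1 / 4) ^ j :: real) = (1 - (1 / 4) ^ n) / (1 - 1 / 4)"
    by (rule sum_gp_strict[of "1/4 :: real" n, THEN trans]) simp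
  also have "\<dots> \<le> 4 / 3" by simp
  finally show ?thesis by simp
qed

text \<open>A single copy has a heavy tail; the minimum over four independent copies has a finite mean.\<close>

lemma best_of_four:
  fixes \<rho> :: "nat \<Rightarrow> real" and Q :: "nat \<Rightarrow> nat \<Rightarrow> (nat \<Rightarrow> real) \<Rightarrow> real \<Rightarrow> bool"
  assumes tail: "\<And>a r j. a < m \<Longrightarrow> r < 4 \<Longrightarrow> \<exists>P. {\<omega> \<in> space random_source. P \<omega>} \<in> sets random_source \<and> dep (J r) P \<and>
      measure random_source {\<omega> \<in> space random_source. P \<omega>} \<le> 3 / 2 ^ j \<and>
      (\<forall>\<omega>\<in>space random_source. \<not> P \<omega> \<longrightarrow> G \<omega> \<longrightarrow> Q a r \<omega> (4 ^ j * \<rho> a))"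
    and disj: "disjoint_family_on J {..<4::nat}" and \<rho>: "\<And>a. a < m \<Longrightarrow> 0 \<le> \<rho> a"
  shows "\<exists>A\<in>sets random_source. measure random_source A \<ge> 1 - 2 / 1000 \<and>
    (\<forall>\<omega>\<in>A. G \<omega> \<longrightarrow> (\<forall>D. (\<forall>a<m. \<forall>r<4. \<forall>x. Q a r \<omega> x \<longrightarrow> D a \<le> x) \<longrightarrow> (\<Sum>a<m. D a) \<le> 432001 * (\<Sum>a<m. \<rho> a)))"
proof -
  have "\<exists>P. \<forall>a r j. a < m \<longrightarrow> r < 4 \<longrightarrow> {\<omega> \<in> space random_source. P a r j \<omega>} \<in> sets random_source \<and> dep (J r) (P a r j) \<and>
      measure random_source {\<omega> \<in> space random_source. P a r j \<omega>} \<le> 3 / 2 ^ j \<and>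
      (\<forall>\<omega>\<in>space random_source. \<not> P a r j \<omega> \<longrightarrow> G \<omega> \<longrightarrow> Q a r \<omega> (4 ^ j * \<rho> a))"
    using tail by (intro choice allI) meson
  then obtain P where Ps: "\<And>a r j. a < m \<Longrightarrow> r < 4 \<Longrightarrow> {\<omega> \<in> space random_source. P a r j \<omega>} \<in> sets random_source"
    and Pd: "\<And>a r j. a < m \<Longrightarrow> r < 4 \<Longrightarrow> dep (J r) (P a r j)"
    and Pm: "\<And>a r j. a < m \<Longrightarrow> r < 4 \<Longrightarrow> measure random_source {\<omega> \<in> space random_source. P a r j \<omega>} \<le> 3 / 2 ^ j"
    and PQ: "\<And>a r j \<omega>. a < m \<Longrightarrow> r < 4 \<Longrightarrow> \<omega> \<in> space random_source \<Longrightarrow> \<not> P a r j \<omega> \<Longrightarrow> G \<omega> \<Longrightarrow> Q a r \<omega> (4 ^ j * \<rho> a)"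
    by blast
  define R where "R a j \<omega> = (\<forall>r\<in>{..<4}. P a r j \<omega>)" for a j \<omega>
  have Rs: "{\<omega> \<in> space random_source. R a j \<omega>} \<in> sets random_source"
    and Rm: "measure random_source {\<omega> \<in> space random_source. R a j \<omega>} \<le> (3 / 2 ^ j) ^ 4" if "a < m" for a j
    unfolding R_def using prob_all_indep_le[of 4 "\<lambda>r. P a r j" J "3 / 2 ^ j"] Ps Pd Pm disj that by auto
  \<comment> \<open>Levels are cut off at \<open>Jm\<close> to keep \<open>X\<close> bounded. Some
    point still fails at level \<open>Jm\<close> with probability at most
    \<open>81 * m / (2 ^ Jm) ^ 4\<close>, which this choice makes smaller than
    \<open>1 / 1000\<close>.\<close>
  obtain Jm :: nat where Jm: "81000 * real m < 2 ^ Jm" using real_arch_pow[of 2] by auto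
  define X where "X a \<omega> = (\<Sum>j<Jm. 4 ^ Suc j * of_bool (R a j \<omega>) :: real)" for a \<omega>
  have bX: "bm (X a)" if "a < m" for a
    unfolding X_def using Rs[OF that] by (intro bm_sum bm_cmult bm_of_bool)
  have EX: "(\<integral>\<omega>. X a \<omega> \<partial>random_source) \<le> 432" if "a < m" for a
  proof -
    have "(\<integral>\<omega>. X a \<omega> \<partial>random_source) = (\<Sum>j<Jm. 4 ^ Suc j * measure random_source {\<omega> \<in> space random_source. R a j \<omega>})"
      unfolding X_def using Rs[OF that]
      by (subst Bochner_Integration.integral_sum) (auto intro!: bm_integrable bm_cmult bm_of_bool simp: integral_of_bool)
    also have "\<dots> \<le> (\<Sum>j<Jm. 4 ^ Suc j * (3 / 2 ^ j) ^ 4)"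
      using Rm[OF that] by (intro sum_mono mult_left_mono) auto
    also have "\<dots> \<le> 432" by (rule geometric_quarter_sum)
    finally show ?thesis .
  qed
  let ?s = "\<Sum>a<m. \<rho> a"
  let ?Z = "\<lambda>\<omega>. \<Sum>a<m. \<rho> a * X a \<omega>"
  have bZ: "bm ?Z" using bX by (intro bm_sum bm_cmult) auto
  note [measurable] = bm_measurable[OF bZ]
  have X0: "0 \<le> X a \<omega>" for a \<omega> unfolding X_def by (intro sum_nonneg) auto
  have s0: "0 \<le> ?s" using \<rho> by (intro sum_nonneg) auto
  define B1 where "B1 = {\<omega> \<in> space random_source. 432000 * ?s < ?Z \<omega>}"
  define B2 where "B2 = (\<Union>a\<in>{..<m}. {\<omega> \<in> space random_source. R a Jm \<omega>})"
  have B1s: "B1 \<in> sets random_source" unfolding B1_def by measurable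
  have B2s: "B2 \<in> sets random_source" unfolding B2_def using Rs by (intro sets.finite_UN) auto
  have "measure random_source B1 \<le> 1 / 1000"
  proof (cases "?s = 0")
    case True
    then have "\<rho> a = 0" if "a < m" for a using \<rho> that by (subst (asm) sum_nonneg_eq_0_iff) auto
    then have "B1 = {}" unfolding B1_def using True by auto
    then show ?thesis by simp
  next
    case False
    then have sp: "0 < ?s" using s0 by linarith
    have "measure random_source B1 \<le> measure random_source {\<omega> \<in> space random_source. 432000 * ?s \<le> ?Z \<omega>}"
      unfolding B1_def by (intro S.finite_measure_mono) auto
    also have "\<dots> \<le> (\<integral>\<omega>. ?Z \<omega> \<partial>random_source) / (432000 * ?s)"
      by (rule integral_Markov_inequality_measure[where A = "space random_source"])
        (use bZ sp \<rho> X0 in \<open>auto intro!: AE_I2 sum_nonneg bm_integrable mult_nonneg_nonneg\<close>)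
    also have "(\<integral>\<omega>. ?Z \<omega> \<partial>random_source) = (\<Sum>a<m. \<rho> a * (\<integral>\<omega>. X a \<omega> \<partial>random_source))"
      using bX by (subst Bochner_Integration.integral_sum) (auto intro!: bm_integrable bm_cmult)
    also have "\<dots> \<le> (\<Sum>a<m. \<rho> a * 432)" using EX \<rho> by (intro sum_mono mult_left_mono) auto
    also have "(\<Sum>a<m. \<rho> a * 432) / (432000 * ?s) = 1 / 1000"
      using sp by (simp add: sum_distrib_right[symmetric])
    finally show ?thesis using sp by (simp add: divide_right_mono)
  qed
  moreover have "measure random_source B2 \<le> 1 / 1000"
  proof -
    have "measure random_source B2 \<le> (\<Sum>a<m. (3 / 2 ^ Jm) ^ 4)"
      unfolding B2_def using Rs Rm by (intro prob_union_le) auto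
    also have "\<dots> = 81 * real m / (2 ^ Jm) ^ 4" by (simp add: power_divide)
    also have "\<dots> \<le> 81 * real m / 2 ^ Jm"
    proof (intro divide_left_mono)
      show "(2::real) ^ Jm \<le> (2 ^ Jm) ^ 4" by (rule self_le_power) auto
    qed auto
    also have "\<dots> \<le> 1 / 1000" using Jm by (simp add: field_simps)
    finally show ?thesis .
  qed
  moreover have "measure random_source (space random_source - (B1 \<union> B2)) = 1 - measure random_source (B1 \<union> B2)"
    using B1s B2s by (intro S.prob_compl) auto
  ultimately have "measure random_source (space random_source - (B1 \<union> B2)) \<ge> 1 - 2 / 1000"
    using measure_Un_le[OF B1s B2s] by linarith
  moreover have "(\<Sum>a<m. D a) \<le> 432001 * ?s"
    if w: "\<omega> \<in> space random_source - (B1 \<union> B2)" "G \<omega>" and D: "\<forall>a<m. \<forall>r<4. \<forall>x. Q a r \<omega> x \<longrightarrow> D a \<le> x" for \<omega> D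
  proof -
    have Da: "D a \<le> \<rho> a + \<rho> a * X a \<omega>" if a: "a < m" for a
    proof -
      have "\<not> R a Jm \<omega>" using w(1) a by (auto simp: B2_def)
      \<comment> \<open>At the least level with a good copy the loss is \<open>4 ^ j\<close>. For
        \<open>j > 0\<close> all copies failed at level \<open>j - 1\<close>, and the corresponding
        summand of \<open>X\<close> pays exactly \<open>4 ^ j\<close>; the case \<open>j = 0\<close>
        is paid by the 1 in \<open>1 + X\<close>.\<close>
      define j where "j = (LEAST j. \<not> R a j \<omega>)"
      have nj: "\<not> R a j \<omega>" unfolding j_def using \<open>\<not> R a Jm \<omega>\<close> by (rule LeastI)
      have jle: "j \<le> Jm" unfolding j_def using \<open>\<not> R a Jm \<omega>\<close> by (rule Least_le)
      obtain r where r: "r < 4" "\<not> P a r j \<omega>" using nj by (auto simp: R_def)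
      have "D a \<le> 4 ^ j * \<rho> a" using D a r PQ[OF a r(1) _ r(2) w(2)] w(1) by blast
      also have "4 ^ j * \<rho> a \<le> (1 + X a \<omega>) * \<rho> a"
      proof (intro mult_right_mono \<rho> a)
        show "4 ^ j \<le> 1 + X a \<omega>"
        proof (cases j)
          case (Suc i)
          have Ri: "R a i \<omega>" using not_less_Least[of i "\<lambda>j. \<not> R a j \<omega>"] Suc unfolding j_def by auto
          have "4 ^ Suc i * of_bool (R a i \<omega>) \<le> X a \<omega>"
            unfolding X_def using Suc jle by (intro member_le_sum) auto
          then show ?thesis using Ri Suc by simp
        qed (use X0 in simp)
      qed
      finally show ?thesis by (simp add: algebra_simps)
    qed
    have "(\<Sum>a<m. D a) \<le> (\<Sum>a<m. \<rho> a + \<rho> a * X a \<omega>)" using Da by (intro sum_mono) auto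
    also have "\<dots> = ?s + ?Z \<omega>" by (rule sum.distrib)
    also have "?Z \<omega> \<le> 432000 * ?s" using w(1) by (auto simp: B1_def)
    finally show ?thesis by linarith
  qed
  ultimately show ?thesis using B1s B2s
    by (intro bexI[of _ "space random_source - (B1 \<union> B2)"] conjI ballI allI impI) auto
qed

section \<open>Crude distances from four copies\<close>

context gap_system
begin

definition base :: "nat \<Rightarrow> nat \<Rightarrow> nat" where
  "base \<beta> r = \<beta> + r * (k * Suc N)"

lemma disjoint_blocks: "disjoint_family_on (\<lambda>r. block (base \<beta> r)) A"
proof -
  have "block (base \<beta> r) \<inter> block (base \<beta> r') = {}" if "r < r'" for r r'
  proof -
    have "Suc r * (k * Suc N) \<le> r' * (k * Suc N)" using that by (intro mult_le_mono1) simp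
    then have "base \<beta> r + k * Suc N \<le> base \<beta> r'" by (simp add: base_def)
    then show ?thesis unfolding block_def by (auto simp del: mult_Suc_right)
  qed
  then show ?thesis unfolding disjoint_family_on_def by (metis Int_commute linorder_neqE_nat)
qed

lemma prob_all_copies:
  assumes "\<And>r. r < 4 \<Longrightarrow> {\<omega> \<in> space random_source. H r \<omega>} \<in> sets random_source"
    and "\<And>r. r < 4 \<Longrightarrow> measure random_source {\<omega> \<in> space random_source. \<not> H r \<omega>} \<le> c"
  shows "measure random_source {\<omega> \<in> space random_source. \<forall>r\<in>{..<4::nat}. H r \<omega>} \<ge> 1 - 4 * c"
    "{\<omega> \<in> space random_source. \<forall>r\<in>{..<4::nat}. H r \<omega>} \<in> sets random_source"
proof -
  let ?B = "\<Union>r\<in>{..<4::nat}. {\<omega> \<in> space random_source. \<not> H r \<omega>}"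
  have ns: "{\<omega> \<in> space random_source. \<not> H r \<omega>} \<in> sets random_source" if "r < 4" for r
    using assms(1)[OF that] by (intro sets.sets_Collect_neg)
  show s: "{\<omega> \<in> space random_source. \<forall>r\<in>{..<4::nat}. H r \<omega>} \<in> sets random_source"
    using assms(1) by (intro sets.sets_Collect_finite_All) auto
  have eq: "{\<omega> \<in> space random_source. \<forall>r\<in>{..<4::nat}. H r \<omega>} = space random_source - ?B" by blast
  have "measure random_source ?B \<le> (\<Sum>r\<in>{..<4::nat}. c)"
    using ns assms(2) by (intro prob_union_le) auto
  moreover have "measure random_source (space random_source - ?B) = 1 - measure random_source ?B"
    using ns by (intro S.prob_compl sets.finite_UN) auto
  ultimately show "measure random_source {\<omega> \<in> space random_source. \<forall>r\<in>{..<4::nat}. H r \<omega>} \<ge> 1 - 4 * c"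
    unfolding eq by simp
qed

lemma clear_prob_bound:
  assumes "real N \<le> 2 ^ q"
  shows "measure random_source {\<omega> \<in> space random_source. \<not> clear (1 / 2 ^ (9 * q)) \<beta> \<omega>} \<le> 1 / 8000"
proof -
  have "measure random_source {\<omega> \<in> space random_source. \<not> clear (1 / 2 ^ (9 * q)) \<beta> \<omega>} \<le> real N ^ 2 * (2 * (1 / 2 ^ (9 * q)))"
    by (rule prob_not_clear) simp
  also have "\<dots> \<le> (2 ^ q) ^ 2 * (2 * (1 / 2 ^ (9 * q)))"
    using assms by (intro mult_right_mono power_mono) auto
  also have "\<dots> = 2 / 2 ^ (7 * q)"
  proof -
    have "9 * q = q * 2 + 7 * q" by simp
    then have "(2::real) ^ (9 * q) = (2 ^ q) ^ 2 * 2 ^ (7 * q)" by (simp only: power_add power_mult)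
    then show ?thesis by simp
  qed
  also have "\<dots> \<le> 2 / 2 ^ 14" using q2 by (intro divide_left_mono power_increasing) auto
  finally show ?thesis by simp
qed

text \<open>The rate \<open>8 * q\<close> leaves \<open>1 / 2 ^ (6 * q) \<le> 1 / 4096\<close> after
  the union bound over at most \<open>2 ^ (2 * q)\<close> pairs.\<close>

lemma ticking_prob_bound:
  assumes "real N \<le> 2 ^ q"
  shows "measure random_source {\<omega> \<in> space random_source. \<not> ticking (8 * real q) \<beta> \<omega>} \<le> 1 / 4000"
proof -
  have "measure random_source {\<omega> \<in> space random_source. \<not> ticking (8 * real q) \<beta> \<omega>} \<le> real N ^ 2 * exp (- (8 * real q))"
    using q2 by (intro prob_not_ticking) simp
  also have "\<dots> \<le> (2 ^ q) ^ 2 * exp (- (8 * real q))"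
    using assms by (intro mult_right_mono power_mono) auto
  also have "exp (- (8 * real q)) \<le> 1 / 2 ^ (8 * q)"
  proof -
    have "(2::real) ^ (8 * q) \<le> exp 1 ^ (8 * q)"
      using exp_ge_add_one_self[of 1] by (intro power_mono) auto
    also have "\<dots> = exp (8 * real q)" by (simp add: exp_of_nat_mult[symmetric])
    finally have "exp (8 * real q) \<ge> 2 ^ (8 * q)" .
    then show ?thesis by (simp add: exp_minus field_simps)
  qed
  also have "(2 ^ q) ^ 2 * (1 / 2 ^ (8 * q)) = 1 / (2::real) ^ (6 * q)"
  proof -
    have "8 * q = q * 2 + 6 * q" by simp
    then have "(2::real) ^ (8 * q) = (2 ^ q) ^ 2 * 2 ^ (6 * q)" by (simp only: power_add power_mult)
    then show ?thesis by simp
  qed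
  also have "\<dots> \<le> 1 / 2 ^ 12" using q2 by (intro divide_left_mono power_increasing) auto
  finally show ?thesis by simp
qed

text \<open>\<open>b'\<close> will be the true nearest neighbour. The analysis asks of the point
  \<open>b\<close> found by the program only that it be no farther from \<open>a\<close> on the
  line.\<close>

definition nearby :: "nat \<Rightarrow> (nat \<Rightarrow> real) \<Rightarrow> nat \<Rightarrow> nat \<Rightarrow> nat \<Rightarrow> bool" where
  "nearby \<beta> \<omega> a b' b \<longleftrightarrow> b < N \<and> \<bar>pv \<beta> \<omega> a - pv \<beta> \<omega> b\<bar> \<le> \<bar>pv \<beta> \<omega> a - pv \<beta> \<omega> b'\<bar>"

text \<open>\<open>clear\<close> and \<open>ticking\<close> concern all pairs and rarely fail, so
  they form one event \<open>G\<close> for all \<open>a\<close>. Only tails of order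
  \<open>1 / z\<close> depend on the individual \<open>a\<close>; these are averaged by
  \<open>best_of_four\<close>, with \<open>z = 2 ^ j\<close> and hence
  \<open>z\<^sup>2 = 4 ^ j\<close>.\<close>

lemma crude_l1:
  assumes N: "real N \<le> 2 ^ q" and m: "m \<le> N" and b': "\<And>a. a < m \<Longrightarrow> b' a < N"
  shows "\<exists>A\<in>sets random_source. measure random_source A \<ge> 1 - 4 / 1000 \<and>
    (\<forall>\<omega>\<in>A. \<forall>D. (\<forall>a<m. \<forall>r<4. \<exists>b. nearby (base \<beta> r) \<omega> a (b' a) b \<and> D a \<le> l1n k (X a) (X b)) \<longrightarrow>
      (\<Sum>a<m. D a) \<le> 432001 * (\<Sum>a<m. 8 * real q * 2 ^ 9 * l1n k (X a) (X (b' a))))"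
proof -
  define G where "G \<omega> \<longleftrightarrow> (\<forall>r\<in>{..<4::nat}. clear (1 / 2 ^ (9 * q)) (base \<beta> r) \<omega> \<and> ticking (8 * real q) (base \<beta> r) \<omega>)" for \<omega>
  define Q where "Q a r \<omega> x \<longleftrightarrow> (\<forall>b. nearby (base \<beta> r) \<omega> a (b' a) b \<longrightarrow> l1n k (X a) (X b) \<le> x)" for a r \<omega> x
  let ?G = "{\<omega> \<in> space random_source. G \<omega>}"
  have Gs: "?G \<in> sets random_source" and Gm: "measure random_source ?G \<ge> 1 - 4 * (1 / 8000 + 1 / 4000)"
  proof -
    have 1: "{\<omega> \<in> space random_source. clear (1 / 2 ^ (9 * q)) (base \<beta> r) \<omega> \<and> ticking (8 * real q) (base \<beta> r) \<omega>} \<in> sets random_source" for r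
      by (intro sets.sets_Collect_conj clear_sets ticking_sets)
    have 2: "measure random_source {\<omega> \<in> space random_source. \<not> (clear (1 / 2 ^ (9 * q)) (base \<beta> r) \<omega> \<and> ticking (8 * real q) (base \<beta> r) \<omega>)}
      \<le> 1 / 8000 + 1 / 4000" for r
    proof -
      let ?C = "{\<omega> \<in> space random_source. \<not> clear (1 / 2 ^ (9 * q)) (base \<beta> r) \<omega>}"
      let ?T = "{\<omega> \<in> space random_source. \<not> ticking (8 * real q) (base \<beta> r) \<omega>}"
      have "{\<omega> \<in> space random_source. \<not> (clear (1 / 2 ^ (9 * q)) (base \<beta> r) \<omega> \<and> ticking (8 * real q) (base \<beta> r) \<omega>)} = ?C \<union> ?T"
        by blast
      moreover have "measure random_source (?C \<union> ?T) \<le> measure random_source ?C + measure random_source ?T"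
        by (intro measure_Un_le sets.sets_Collect_neg clear_sets ticking_sets)
      ultimately show ?thesis
        using clear_prob_bound[OF N, of "base \<beta> r"] ticking_prob_bound[OF N, of "base \<beta> r"] by simp
    qed
    show "?G \<in> sets random_source" "measure random_source ?G \<ge> 1 - 4 * (1 / 8000 + 1 / 4000)"
      unfolding G_def by (rule prob_all_copies[OF 1 2])+
  qed
  have "\<exists>A\<in>sets random_source. measure random_source A \<ge> 1 - 2 / 1000 \<and>
    (\<forall>\<omega>\<in>A. G \<omega> \<longrightarrow> (\<forall>D. (\<forall>a<m. \<forall>r<4. \<forall>x. Q a r \<omega> x \<longrightarrow> D a \<le> x) \<longrightarrow>
      (\<Sum>a<m. D a) \<le> 432001 * (\<Sum>a<m. 8 * real q * 2 ^ 9 * l1n k (X a) (X (b' a)))))"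
  proof (rule best_of_four[where J = "\<lambda>r. block (base \<beta> r)"])
    fix a r j assume a: "a < m" and r: "r < (4::nat)"
    have 1: "a < N" "1 \<le> (2::real) ^ j" "0 < 8 * real q" using a m q2 by auto
    have "((2::real) ^ j)\<^sup>2 = (2\<^sup>2) ^ j" by (simp only: power_mult[symmetric] mult.commute)
    then have z2: "((2::real) ^ j)\<^sup>2 = 4 ^ j" by simp
    obtain P where P: "{\<omega> \<in> space random_source. P \<omega>} \<in> sets random_source" "dep (block (base \<beta> r)) P"
      "measure random_source {\<omega> \<in> space random_source. P \<omega>} \<le> 3 / 2 ^ j"
      and main: "\<forall>\<omega>\<in>space random_source. \<not> P \<omega> \<longrightarrow> clear (1 / 2 ^ (9 * q)) (base \<beta> r) \<omega> \<longrightarrow> ticking (8 * real q) (base \<beta> r) \<omega> \<longrightarrow>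
      (\<forall>b<N. \<bar>pv (base \<beta> r) \<omega> a - pv (base \<beta> r) \<omega> b\<bar> \<le> \<bar>pv (base \<beta> r) \<omega> a - pv (base \<beta> r) \<omega> (b' a)\<bar> \<longrightarrow>
        l1n k (X a) (X b) \<le> (2 ^ j)\<^sup>2 * (8 * real q * 2 ^ 9 * l1n k (X a) (X (b' a))))"
      using copy_l1[OF 1(1) b'[OF a] 1(2,3), of "base \<beta> r"] by blast
    have "Q a r \<omega> (4 ^ j * (8 * real q * 2 ^ 9 * l1n k (X a) (X (b' a))))"
      if w: "\<omega> \<in> space random_source" "\<not> P \<omega>" "G \<omega>" for \<omega>
      unfolding Q_def nearby_def z2[symmetric] using main[rule_format, OF w(1,2)] w(3) r unfolding G_def by blast
    then show "\<exists>P. {\<omega> \<in> space random_source. P \<omega>} \<in> sets random_source \<and> dep (block (base \<beta> r)) P \<and>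
      measure random_source {\<omega> \<in> space random_source. P \<omega>} \<le> 3 / 2 ^ j \<and>
      (\<forall>\<omega>\<in>space random_source. \<not> P \<omega> \<longrightarrow> G \<omega> \<longrightarrow> Q a r \<omega> (4 ^ j * (8 * real q * 2 ^ 9 * l1n k (X a) (X (b' a)))))"
      by (intro exI[of _ P] conjI P) blast
  qed (auto intro!: disjoint_blocks mult_nonneg_nonneg l1n_nonneg)
  then obtain A where A: "A \<in> sets random_source" "measure random_source A \<ge> 1 - 2 / 1000"
    "\<And>\<omega> D. \<omega> \<in> A \<Longrightarrow> G \<omega> \<Longrightarrow> (\<forall>a<m. \<forall>r<4. \<forall>x. Q a r \<omega> x \<longrightarrow> D a \<le> x) \<Longrightarrow>
      (\<Sum>a<m. D a) \<le> 432001 * (\<Sum>a<m. 8 * real q * 2 ^ 9 * l1n k (X a) (X (b' a)))" by blast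
  have "measure random_source (A \<inter> ?G) \<ge> measure random_source A + measure random_source ?G - 1"
    using S.finite_measure_Union'[OF A(1) Gs] S.prob_le_1[of "A \<union> ?G"] S.finite_measure_Diff'[OF Gs A(1)] by (simp add: Int_commute)
  then have "measure random_source (A \<inter> ?G) \<ge> 1 - 4 / 1000" using A(2) Gm by simp
  moreover have "(\<Sum>a<m. D a) \<le> 432001 * (\<Sum>a<m. 8 * real q * 2 ^ 9 * l1n k (X a) (X (b' a)))"
    if "\<omega> \<in> A \<inter> ?G" "\<forall>a<m. \<forall>r<4. \<exists>b. nearby (base \<beta> r) \<omega> a (b' a) b \<and> D a \<le> l1n k (X a) (X b)" for \<omega> D
  proof (rule A(3))
    show "\<forall>a<m. \<forall>r<4. \<forall>x. Q a r \<omega> x \<longrightarrow> D a \<le> x"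
      using that(2) unfolding Q_def by (meson order_trans)
  qed (use that in auto)
  ultimately show ?thesis using A(1) Gs by (intro bexI[of _ "A \<inter> ?G"] conjI ballI allI impI) auto
qed

text \<open>The box moments of \<open>copy_l2\<close> play the role of \<open>ticking\<close>; being
  tails of order \<open>1 / z\<close>, they move from \<open>G\<close> to the events handled by
  \<open>best_of_four\<close>.\<close>

lemma crude_l2:
  assumes N: "real N \<le> 2 ^ q" and m: "m \<le> N" and b': "\<And>a. a < m \<Longrightarrow> b' a < N"
  shows "\<exists>A\<in>sets random_source. measure random_source A \<ge> 1 - 4 / 1000 \<and>
    (\<forall>\<omega>\<in>A. \<forall>D. (\<forall>a<m. \<forall>r<4. \<exists>b. nearby (base \<beta> r) \<omega> a (b' a) b \<and> D a \<le> L2_set (\<lambda>i. X a i - X b i) {..<k}) \<longrightarrow>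
      (\<Sum>a<m. D a) \<le> 432001 * (\<Sum>a<m. 2 ^ 11 * sqrt (real k) * l1n k (X a) (X (b' a))))"
proof -
  define G where "G \<omega> \<longleftrightarrow> (\<forall>r\<in>{..<4::nat}. clear (1 / 2 ^ (9 * q)) (base \<beta> r) \<omega>)" for \<omega>
  define Q where "Q a r \<omega> x \<longleftrightarrow> (\<forall>b. nearby (base \<beta> r) \<omega> a (b' a) b \<longrightarrow> L2_set (\<lambda>i. X a i - X b i) {..<k} \<le> x)" for a r \<omega> x
  let ?G = "{\<omega> \<in> space random_source. G \<omega>}"
  have Gs: "?G \<in> sets random_source" and Gm: "measure random_source ?G \<ge> 1 - 4 * (1 / 8000)"
    unfolding G_def by (rule prob_all_copies[OF clear_sets clear_prob_bound[OF N]])+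
  have "\<exists>A\<in>sets random_source. measure random_source A \<ge> 1 - 2 / 1000 \<and>
    (\<forall>\<omega>\<in>A. G \<omega> \<longrightarrow> (\<forall>D. (\<forall>a<m. \<forall>r<4. \<forall>x. Q a r \<omega> x \<longrightarrow> D a \<le> x) \<longrightarrow>
      (\<Sum>a<m. D a) \<le> 432001 * (\<Sum>a<m. 2 ^ 11 * sqrt (real k) * l1n k (X a) (X (b' a)))))"
  proof (rule best_of_four[where J = "\<lambda>r. block (base \<beta> r)"])
    fix a r j assume a: "a < m" and r: "r < (4::nat)"
    have 1: "a < N" "1 \<le> (2::real) ^ j" using a m by auto
    have "((2::real) ^ j)\<^sup>2 = (2\<^sup>2) ^ j" by (simp only: power_mult[symmetric] mult.commute)
    then have z2: "((2::real) ^ j)\<^sup>2 = 4 ^ j" by simp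
    obtain P where P: "{\<omega> \<in> space random_source. P \<omega>} \<in> sets random_source" "dep (block (base \<beta> r)) P"
      "measure random_source {\<omega> \<in> space random_source. P \<omega>} \<le> 3 / 2 ^ j"
      and main: "\<forall>\<omega>\<in>space random_source. \<not> P \<omega> \<longrightarrow> clear (1 / 2 ^ (9 * q)) (base \<beta> r) \<omega> \<longrightarrow>
      (\<forall>b<N. \<bar>pv (base \<beta> r) \<omega> a - pv (base \<beta> r) \<omega> b\<bar> \<le> \<bar>pv (base \<beta> r) \<omega> a - pv (base \<beta> r) \<omega> (b' a)\<bar> \<longrightarrow>
        L2_set (\<lambda>i. X a i - X b i) {..<k} \<le> (2 ^ j)\<^sup>2 * (2 ^ 11 * sqrt (real k) * l1n k (X a) (X (b' a))))"
      using copy_l2[OF 1(1) b'[OF a] 1(2), of "base \<beta> r"] by blast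
    have "Q a r \<omega> (4 ^ j * (2 ^ 11 * sqrt (real k) * l1n k (X a) (X (b' a))))"
      if w: "\<omega> \<in> space random_source" "\<not> P \<omega>" "G \<omega>" for \<omega>
      unfolding Q_def nearby_def z2[symmetric] using main[rule_format, OF w(1,2)] w(3) r unfolding G_def by blast
    then show "\<exists>P. {\<omega> \<in> space random_source. P \<omega>} \<in> sets random_source \<and> dep (block (base \<beta> r)) P \<and>
      measure random_source {\<omega> \<in> space random_source. P \<omega>} \<le> 3 / 2 ^ j \<and>
      (\<forall>\<omega>\<in>space random_source. \<not> P \<omega> \<longrightarrow> G \<omega> \<longrightarrow> Q a r \<omega> (4 ^ j * (2 ^ 11 * sqrt (real k) * l1n k (X a) (X (b' a)))))"
      by (intro exI[of _ P] conjI P) blast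
  qed (auto intro!: disjoint_blocks mult_nonneg_nonneg l1n_nonneg)
  then obtain A where A: "A \<in> sets random_source" "measure random_source A \<ge> 1 - 2 / 1000"
    "\<And>\<omega> D. \<omega> \<in> A \<Longrightarrow> G \<omega> \<Longrightarrow> (\<forall>a<m. \<forall>r<4. \<forall>x. Q a r \<omega> x \<longrightarrow> D a \<le> x) \<Longrightarrow>
      (\<Sum>a<m. D a) \<le> 432001 * (\<Sum>a<m. 2 ^ 11 * sqrt (real k) * l1n k (X a) (X (b' a)))" by blast
  have "measure random_source (A \<inter> ?G) \<ge> measure random_source A + measure random_source ?G - 1"
    using S.finite_measure_Union'[OF A(1) Gs] S.prob_le_1[of "A \<union> ?G"] S.finite_measure_Diff'[OF Gs A(1)] by (simp add: Int_commute)
  then have "measure random_source (A \<inter> ?G) \<ge> 1 - 4 / 1000" using A(2) Gm by simp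
  moreover have "(\<Sum>a<m. D a) \<le> 432001 * (\<Sum>a<m. 2 ^ 11 * sqrt (real k) * l1n k (X a) (X (b' a)))"
    if "\<omega> \<in> A \<inter> ?G" "\<forall>a<m. \<forall>r<4. \<exists>b. nearby (base \<beta> r) \<omega> a (b' a) b \<and> D a \<le> L2_set (\<lambda>i. X a i - X b i) {..<k}" for \<omega> D
  proof (rule A(3))
    show "\<forall>a<m. \<forall>r<4. \<forall>x. Q a r \<omega> x \<longrightarrow> D a \<le> x"
      using that(2) unfolding Q_def by (meson order_trans)
  qed (use that in auto)
  ultimately show ?thesis using A(1) Gs by (intro bexI[of _ "A \<inter> ?G"] conjI ballI allI impI) auto
qed

end

subsection \<open>Random projections\<close>

text \<open>\<open>2 * \<omega> j - 1\<close> is uniform on \<open>[-1, 1]\<close>. It stands in for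
  a Gaussian entry, since the machine draws uniform values, and four moments are all that the
  projection estimates use.\<close>

lemma sign_moments:
  "(\<integral>\<omega>. 2 * \<omega> j - 1 \<partial>random_source) = 0"
  "(\<integral>\<omega>. (2 * \<omega> j - 1)\<^sup>2 \<partial>random_source) = 1 / 3"
  "(\<integral>\<omega>. (2 * \<omega> j - 1) ^ 3 \<partial>random_source) = 0"
  "(\<integral>\<omega>. (2 * \<omega> j - 1) ^ 4 \<partial>random_source) = 1 / 5"
proof -
  have *: "(\<integral>\<omega>. (2 * \<omega> j - 1) ^ n \<partial>random_source) = 1 / (2 * real (Suc n)) - (-1) ^ Suc n / (2 * real (Suc n))" for n
  proof -
    have "(\<integral>\<omega>. (2 * \<omega> j - 1) ^ n \<partial>random_source) = (2 * 1 - 1) ^ Suc n / (2 * real (Suc n)) - (2 * 0 - 1) ^ Suc n / (2 * real (Suc n))"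
    proof (rule integral_coord_has_integral)
      fix x :: real
      have "((\<lambda>x. (2 * x - 1) ^ Suc n) has_real_derivative real (Suc n) * (2 * x - 1) ^ n * 2) (at x)"
        by (auto intro!: derivative_eq_intros simp del: power_Suc)
      then have "((\<lambda>x. (2 * x - 1) ^ Suc n / (2 * real (Suc n))) has_real_derivative real (Suc n) * (2 * x - 1) ^ n * 2 / (2 * real (Suc n))) (at x)"
        by (rule DERIV_cdivide)
      then show "((\<lambda>x. (2 * x - 1) ^ Suc n / (2 * real (Suc n))) has_real_derivative (2 * x - 1) ^ n) (at x)"
        by (simp del: power_Suc of_nat_Suc)
    qed (auto intro!: continuous_intros)
    then show ?thesis by simp
  qed
  show "(\<integral>\<omega>. 2 * \<omega> j - 1 \<partial>random_source) = 0"
    "(\<integral>\<omega>. (2 * \<omega> j - 1)\<^sup>2 \<partial>random_source) = 1 / 3"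
    "(\<integral>\<omega>. (2 * \<omega> j - 1) ^ 3 \<partial>random_source) = 0"
    "(\<integral>\<omega>. (2 * \<omega> j - 1) ^ 4 \<partial>random_source) = 1 / 5"
    using *[of 1] *[of 2] *[of 3] *[of 4] by simp_all
qed

definition rproj :: "(nat \<Rightarrow> nat) \<Rightarrow> nat \<Rightarrow> (nat \<Rightarrow> real) \<Rightarrow> (nat \<Rightarrow> real) \<Rightarrow> real" where
  "rproj p d v \<omega> = (\<Sum>l<d. (2 * \<omega> (p l) - 1) * v l)"

lemma bm_sign: "bm (\<lambda>\<omega>. 2 * \<omega> j - 1)"
  by (intro bm_diff bm_cmult bm_coord bm_const)

lemma bm_rproj: "bm (rproj p d v)"
proof -
  have "bm (\<lambda>\<omega>. (2 * \<omega> (p l) - 1) * v l)" for l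
    by (intro bm_mult bm_sign bm_const)
  then show ?thesis unfolding rproj_def[abs_def] by (intro bm_sum)
qed

lemma rproj_dep: "dep (p ` {..<d}) (rproj p d v)"
  unfolding dep_def rproj_def by (auto intro!: sum.cong)

text \<open>With \<open>n\<close> the sum of the squares, the fourth moment bound
  \<open>n^2 / 3\<close> is three times the squared variance, the value for a Gaussian. In the
  induction the mixed term \<open>2 * v^2 * n / 3\<close> of the new square is matched exactly, and
  \<open>v^4 / 5\<close> stays below \<open>v^4 / 3\<close>.\<close>

lemma rproj_moments:
  assumes "inj_on p {..<d}"
  shows "(\<integral>\<omega>. rproj p d v \<omega> \<partial>random_source) = 0"
    and "(\<integral>\<omega>. (rproj p d v \<omega>)\<^sup>2 \<partial>random_source) = (\<Sum>l<d. (v l)\<^sup>2) / 3"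
    and "(\<integral>\<omega>. (rproj p d v \<omega>) ^ 4 \<partial>random_source) \<le> (\<Sum>l<d. (v l)\<^sup>2)\<^sup>2 / 3"
proof -
  have "(\<integral>\<omega>. rproj p d v \<omega> \<partial>random_source) = 0 \<and>
    (\<integral>\<omega>. (rproj p d v \<omega>)\<^sup>2 \<partial>random_source) = (\<Sum>l<d. (v l)\<^sup>2) / 3 \<and>
    (\<integral>\<omega>. (rproj p d v \<omega>) ^ 4 \<partial>random_source) \<le> (\<Sum>l<d. (v l)\<^sup>2)\<^sup>2 / 3"
    using assms
  proof (induction d)
    case (Suc d)
    have inj: "inj_on p {..<d}" using Suc.prems by (rule inj_on_subset) auto
    let ?S = "rproj p d v" and ?r = "\<lambda>\<omega>. 2 * \<omega> (p d) - 1"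
    let ?n = "\<Sum>l<d. (v l)\<^sup>2"
    have IH: "(\<integral>\<omega>. ?S \<omega> \<partial>random_source) = 0" "(\<integral>\<omega>. (?S \<omega>)\<^sup>2 \<partial>random_source) = ?n / 3"
      using Suc.IH[OF inj] by blast+
    have S: "rproj p (Suc d) v = (\<lambda>\<omega>. ?S \<omega> + ?r \<omega> * v d)" by (simp add: rproj_def fun_eq_iff)
    have "p l \<noteq> p d" if "l < d" for l using inj_onD[OF Suc.prems, of l d] that by auto
    then have "p ` {..<d} \<subseteq> - {p d}" by force
    then have dS: "dep (- {p d}) ?S" by (rule dep_mono[OF rproj_dep])
    have mix: "(\<integral>\<omega>. ?S \<omega> ^ m * ?r \<omega> ^ n \<partial>random_source) = (\<integral>\<omega>. ?S \<omega> ^ m \<partial>random_source) * (\<integral>\<omega>. ?r \<omega> ^ n \<partial>random_source)" for m n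
    proof (rule integral_indep[where J = "{p d}"])
      show "dep (- {p d}) (\<lambda>\<omega>. ?S \<omega> ^ m)" using dS unfolding dep_def by metis
    qed (auto intro!: bm_power bm_rproj bm_sign simp: dep_def)
    have bmix: "bm (\<lambda>\<omega>. c * (?S \<omega> ^ m * ?r \<omega> ^ n))" for m n c
      by (intro bm_cmult bm_mult bm_power bm_rproj bm_sign)
    note i = bm_integrable[OF bmix]
    have 1: "(\<integral>\<omega>. rproj p (Suc d) v \<omega> \<partial>random_source) = 0"
      unfolding S using i[of 1 1 0] i[of "v d" 0 1] IH sign_moments(1)[of "p d"]
      by (simp add: mult.commute[of _ "v d"] bm_integrable bm_rproj bm_sign bm_cmult)
    have "(\<integral>\<omega>. (?S \<omega> + ?r \<omega> * v d)\<^sup>2 \<partial>random_source)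
      = (\<integral>\<omega>. 1 * (?S \<omega> ^ 2 * ?r \<omega> ^ 0) + (2 * v d) * (?S \<omega> ^ 1 * ?r \<omega> ^ 1) + (v d)\<^sup>2 * (?S \<omega> ^ 0 * ?r \<omega> ^ 2) \<partial>random_source)"
      by (intro Bochner_Integration.integral_cong refl) (simp add: power2_eq_square algebra_simps)
    also have "\<dots> = 1 * (\<integral>\<omega>. ?S \<omega> ^ 2 * ?r \<omega> ^ 0 \<partial>random_source) + (2 * v d) * (\<integral>\<omega>. ?S \<omega> ^ 1 * ?r \<omega> ^ 1 \<partial>random_source)
       + (v d)\<^sup>2 * (\<integral>\<omega>. ?S \<omega> ^ 0 * ?r \<omega> ^ 2 \<partial>random_source)"
      by (simp only: Bochner_Integration.integral_add[OF Bochner_Integration.integrable_add[OF i i] i]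
        Bochner_Integration.integral_add[OF i i] integral_mult_right_zero)
    also have "\<dots> = (\<Sum>l<Suc d. (v l)\<^sup>2) / 3"
      unfolding mix by (simp add: IH sign_moments S.prob_space add_divide_distrib)
    finally have 2: "(\<integral>\<omega>. (rproj p (Suc d) v \<omega>)\<^sup>2 \<partial>random_source) = (\<Sum>l<Suc d. (v l)\<^sup>2) / 3" unfolding S .
    have "(\<integral>\<omega>. (?S \<omega> + ?r \<omega> * v d) ^ 4 \<partial>random_source)
      = (\<integral>\<omega>. 1 * (?S \<omega> ^ 4 * ?r \<omega> ^ 0) + (4 * v d) * (?S \<omega> ^ 3 * ?r \<omega> ^ 1) + (6 * (v d)\<^sup>2) * (?S \<omega> ^ 2 * ?r \<omega> ^ 2)
        + (4 * v d ^ 3) * (?S \<omega> ^ 1 * ?r \<omega> ^ 3) + (v d) ^ 4 * (?S \<omega> ^ 0 * ?r \<omega> ^ 4) \<partial>random_source)"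
      by (intro Bochner_Integration.integral_cong refl) (simp add: power2_eq_square power3_eq_cube power4_eq_xxxx algebra_simps)
    also have "\<dots> = 1 * (\<integral>\<omega>. ?S \<omega> ^ 4 * ?r \<omega> ^ 0 \<partial>random_source) + (4 * v d) * (\<integral>\<omega>. ?S \<omega> ^ 3 * ?r \<omega> ^ 1 \<partial>random_source)
       + (6 * (v d)\<^sup>2) * (\<integral>\<omega>. ?S \<omega> ^ 2 * ?r \<omega> ^ 2 \<partial>random_source) + (4 * v d ^ 3) * (\<integral>\<omega>. ?S \<omega> ^ 1 * ?r \<omega> ^ 3 \<partial>random_source)
       + (v d) ^ 4 * (\<integral>\<omega>. ?S \<omega> ^ 0 * ?r \<omega> ^ 4 \<partial>random_source)"
      by (simp only: Bochner_Integration.integral_add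
        Bochner_Integration.integrable_add i integral_mult_right_zero)
    also have "\<dots> = (\<integral>\<omega>. ?S \<omega> ^ 4 \<partial>random_source) + 2 * (v d)\<^sup>2 * ?n / 3 + (v d) ^ 4 / 5"
      unfolding mix by (simp add: IH sign_moments S.prob_space add_divide_distrib)
    also have "\<dots> \<le> ?n\<^sup>2 / 3 + 2 * (v d)\<^sup>2 * ?n / 3 + (v d) ^ 4 / 3"
    proof -
      have "(v d) ^ 4 / 5 \<le> (v d) ^ 4 / 3" by simp
      moreover have "(\<integral>\<omega>. ?S \<omega> ^ 4 \<partial>random_source) \<le> ?n\<^sup>2 / 3" using Suc.IH[OF inj] by blast
      ultimately show ?thesis by linarith
    qed
    also have "\<dots> = (\<Sum>l<Suc d. (v l)\<^sup>2)\<^sup>2 / 3"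
      by (simp add: power2_eq_square power4_eq_xxxx field_simps)
    finally have "(\<integral>\<omega>. (rproj p (Suc d) v \<omega>) ^ 4 \<partial>random_source) \<le> (\<Sum>l<Suc d. (v l)\<^sup>2)\<^sup>2 / 3" unfolding S .
    with 1 2 show ?case by blast
  next
    case 0
    have "rproj p 0 v = (\<lambda>_. 0)" by (simp add: rproj_def fun_eq_iff)
    then show ?case by simp
  qed
  then show "(\<integral>\<omega>. rproj p d v \<omega> \<partial>random_source) = 0"
    "(\<integral>\<omega>. (rproj p d v \<omega>)\<^sup>2 \<partial>random_source) = (\<Sum>l<d. (v l)\<^sup>2) / 3"
    "(\<integral>\<omega>. (rproj p d v \<omega>) ^ 4 \<partial>random_source) \<le> (\<Sum>l<d. (v l)\<^sup>2)\<^sup>2 / 3" by auto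
qed

text \<open>The product of \<open>1 - y + y^2 / 2\<close> and \<open>1 + y + y^2 / 2\<close> is
  \<open>1 + y^4 / 4\<close>, and the second factor is at most \<open>exp y\<close>.\<close>

lemma exp_minus_le_quadratic:
  fixes y :: real assumes "0 \<le> y"
  shows "exp (- y) \<le> 1 - y + y\<^sup>2 / 2"
proof -
  have pos: "0 < 1 - y + y\<^sup>2 / 2"
  proof -
    have "1 - y + y\<^sup>2 / 2 = ((y - 1)\<^sup>2 + 1) / 2" by (simp add: power2_eq_square field_simps)
    moreover have "0 < ((y - 1)\<^sup>2 + 1) / 2" by (simp add: add_nonneg_pos)
    ultimately show ?thesis by simp
  qed
  have "1 \<le> (1 - y + y\<^sup>2 / 2) * (1 + y + y\<^sup>2 / 2)"
    using assms by (simp add: power2_eq_square field_simps)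
  also have "\<dots> \<le> (1 - y + y\<^sup>2 / 2) * exp y"
    using pos exp_lower_Taylor_quadratic[OF assms] by (intro mult_left_mono) auto
  finally show ?thesis by (simp add: exp_minus field_simps)
qed

text \<open>This is a Chernoff bound from four moments: for the square \<open>y\<close> of one
  projection divided by \<open>n\<close>, the mean of \<open>exp (- y)\<close> is at most
  \<open>1 - 1/3 + 1/6 = 5/6 \<le> exp (- 1/6)\<close>. The threshold \<open>K / 12\<close> uses up
  half of the exponent \<open>K / 6\<close>.\<close>

lemma projection_lower_tail:
  assumes inj: "inj_on (\<lambda>(i, l). p i l) (UNIV \<times> {..<d})" and n: "n = (\<Sum>l<d. (v l)\<^sup>2)" "0 < n"
  shows "measure random_source {\<omega> \<in> space random_source. (\<Sum>i<K. (rproj (p i) d v \<omega>)\<^sup>2) < real K / 12 * n} \<le> exp (- (real K / 12))"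
proof -
  have inji: "inj_on (p i) {..<d}" for i
    by (rule inj_onI) (use inj_onD[OF inj, of "(i, _)" "(i, _)"] in simp)
  let ?e = "\<lambda>i \<omega>. exp (- ((rproj (p i) d v \<omega>)\<^sup>2 / n))"
  have bmZ: "bm (\<lambda>\<omega>. (rproj (p i) d v \<omega>)\<^sup>2 / n)" for i
    using bm_cmult[OF bm_power[OF bm_rproj], of "1 / n" "p i" d v 2] by simp
  have be: "bm (?e i)" for i
    unfolding bm_def using bm_measurable[OF bmZ[of i]] n by (auto intro!: exI[of _ 1])
  have Ee: "(\<integral>\<omega>. ?e i \<omega> \<partial>random_source) \<le> exp (- (1 / 6))" for i
  proof -
    have b4: "bm (\<lambda>\<omega>. ((rproj (p i) d v \<omega>)\<^sup>2 / n)\<^sup>2 / 2)"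
      using bm_cmult[OF bm_power[OF bmZ[of i], of 2], of "1/2"] by simp
    have "(\<integral>\<omega>. ?e i \<omega> \<partial>random_source) \<le> (\<integral>\<omega>. 1 - (rproj (p i) d v \<omega>)\<^sup>2 / n + ((rproj (p i) d v \<omega>)\<^sup>2 / n)\<^sup>2 / 2 \<partial>random_source)"
      using n by (intro integral_mono bm_integrable be bm_add bm_diff bm_const bmZ b4 exp_minus_le_quadratic) auto
    also have "\<dots> = 1 - (\<integral>\<omega>. (rproj (p i) d v \<omega>)\<^sup>2 \<partial>random_source) / n + (\<integral>\<omega>. (rproj (p i) d v \<omega>) ^ 4 \<partial>random_source) / (2 * n\<^sup>2)"
    proof -
      have "(\<integral>\<omega>. ((rproj (p i) d v \<omega>)\<^sup>2 / n)\<^sup>2 / 2 \<partial>random_source) = (\<integral>\<omega>. (rproj (p i) d v \<omega>) ^ 4 / (2 * n\<^sup>2) \<partial>random_source)"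
        by (intro Bochner_Integration.integral_cong refl) (simp add: power_divide power_mult[symmetric] field_simps)
      then show ?thesis
        using bm_integrable[OF bmZ[of i]] bm_integrable[OF b4] by (simp add: S.prob_space)
    qed
    also have "\<dots> \<le> 1 - n / 3 / n + (n\<^sup>2 / 3) / (2 * n\<^sup>2)"
      using rproj_moments[OF inji, of i v] n by (intro add_mono divide_right_mono) auto
    also have "\<dots> = 1 - 1 / 6" using n by (simp add: field_simps)
    also have "\<dots> \<le> exp (- (1 / 6))" using exp_ge_add_one_self[of "- (1/6)"] by simp
    finally show ?thesis .
  qed
  let ?W = "\<lambda>\<omega>. exp (real K / 12) * (\<Prod>i<K. ?e i \<omega>)"
  have bW: "bm ?W" by (intro bm_cmult bm_prod be)
  have prod_e: "(\<Prod>i<K. ?e i \<omega>) = exp (- ((\<Sum>i<K. (rproj (p i) d v \<omega>)\<^sup>2) / n))" for \<omega>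
    by (simp add: exp_sum[symmetric] sum_negf sum_divide_distrib)
  have "{\<omega> \<in> space random_source. (\<Sum>i<K. (rproj (p i) d v \<omega>)\<^sup>2) < real K / 12 * n} \<subseteq> {\<omega> \<in> space random_source. 1 \<le> ?W \<omega>}"
  proof (intro subsetI CollectI conjI; elim CollectE conjE)
    fix \<omega> assume "(\<Sum>i<K. (rproj (p i) d v \<omega>)\<^sup>2) < real K / 12 * n"
    then have "(\<Sum>i<K. (rproj (p i) d v \<omega>)\<^sup>2) / n \<le> real K / 12" using n(2) by (simp add: field_simps)
    then have "0 \<le> real K / 12 + - ((\<Sum>i<K. (rproj (p i) d v \<omega>)\<^sup>2) / n)" by linarith
    then have "1 \<le> exp (real K / 12 + - ((\<Sum>i<K. (rproj (p i) d v \<omega>)\<^sup>2) / n))" by (simp only: one_le_exp_iff)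
    then show "1 \<le> ?W \<omega>" unfolding prod_e by (simp only: exp_add)
  qed
  then have "measure random_source {\<omega> \<in> space random_source. (\<Sum>i<K. (rproj (p i) d v \<omega>)\<^sup>2) < real K / 12 * n}
    \<le> measure random_source {\<omega> \<in> space random_source. 1 \<le> ?W \<omega>}"
    using bm_measurable[OF bW] by (intro S.finite_measure_mono) auto
  also have "\<dots> \<le> (\<integral>\<omega>. ?W \<omega> \<partial>random_source) / 1"
    by (rule integral_Markov_inequality_measure[where A = "space random_source"])
      (use bm_integrable[OF bW] in \<open>auto intro!: AE_I2 mult_nonneg_nonneg prod_nonneg simp del: integrable_mult_right_iff\<close>)
  also have "(\<integral>\<omega>. ?W \<omega> \<partial>random_source) = exp (real K / 12) * (\<Prod>i<K. \<integral>\<omega>. ?e i \<omega> \<partial>random_source)"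
  proof -
    have "(\<integral>\<omega>. (\<Prod>i<K. ?e i \<omega>) \<partial>random_source) = (\<Prod>i<K. \<integral>\<omega>. ?e i \<omega> \<partial>random_source)"
    proof (rule integral_prod_indep[where J = "\<lambda>i. p i ` {..<d}"])
      show "dep (p i ` {..<d}) (?e i)" for i
        using rproj_dep[of "p i" d v] unfolding dep_def by metis
      show "disjoint_family_on (\<lambda>i. p i ` {..<d}) {..<K}"
      proof (unfold disjoint_family_on_def, intro ballI impI equals0I)
        fix i i' x assume "i \<noteq> i'" "x \<in> p i ` {..<d} \<inter> p i' ` {..<d}"
        then obtain l l' where "p i l = p i' l'" "l < d" "l' < d" by auto
        then show False using inj_onD[OF inj, of "(i, l)" "(i', l')"] \<open>i \<noteq> i'\<close> by simp
      qed
    qed (auto intro: be)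
    then show ?thesis by simp
  qed
  also have "(\<Prod>i<K. \<integral>\<omega>. ?e i \<omega> \<partial>random_source) \<le> (\<Prod>i<K. exp (- (1 / 6)))"
    using Ee by (intro prod_mono) (auto intro!: integral_nonneg_AE)
  also have "exp (real K / 12) * (\<Prod>i<K. exp (- (1 / 6))) = exp (- (real K / 12))"
    by (simp add: exp_of_nat_mult[symmetric] exp_add[symmetric] field_simps)
  finally show ?thesis by simp
qed

text \<open>With \<open>n\<close> the Euclidean norm,
  \<open>\<bar>x\<bar> \<le> (n + x^2 / n) / 2\<close> holds pointwise, and the right side has mean
  \<open>n / 2 + n / 6\<close>.\<close>

lemma projection_mean_abs:
  assumes "inj_on p {..<d}"
  shows "(\<integral>\<omega>. \<bar>rproj p d v \<omega>\<bar> \<partial>random_source) \<le> L2_set v {..<d}" "bm (\<lambda>\<omega>. \<bar>rproj p d v \<omega>\<bar>)"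
proof -
  show b: "bm (\<lambda>\<omega>. \<bar>rproj p d v \<omega>\<bar>)"
    using bm_rproj[of p d v] unfolding bm_def by auto
  let ?n = "L2_set v {..<d}"
  have n0: "0 \<le> ?n" by (rule L2_set_nonneg)
  have n2: "?n\<^sup>2 = (\<Sum>l<d. (v l)\<^sup>2)" by (simp add: L2_set_def sum_nonneg)
  show "(\<integral>\<omega>. \<bar>rproj p d v \<omega>\<bar> \<partial>random_source) \<le> ?n"
  proof (cases "?n = 0")
    case True
    then have "v l = 0" if "l < d" for l using that by (simp add: L2_set_eq_0_iff)
    then have "rproj p d v = (\<lambda>_. 0)" by (simp add: rproj_def fun_eq_iff)
    then show ?thesis using True by simp
  next
    case False
    then have np: "0 < ?n" using n0 by linarith
    let ?h = "\<lambda>\<omega>. 1 / 2 * ?n + (1 / (2 * ?n)) * (rproj p d v \<omega>)\<^sup>2"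
    have bh: "bm ?h" by (intro bm_add bm_const bm_cmult bm_power bm_rproj)
    have "(\<integral>\<omega>. \<bar>rproj p d v \<omega>\<bar> \<partial>random_source) \<le> (\<integral>\<omega>. ?h \<omega> \<partial>random_source)"
    proof (intro integral_mono bm_integrable b bh)
      fix \<omega>
      have "0 \<le> (?n - \<bar>rproj p d v \<omega>\<bar>)\<^sup>2" by simp
      then have "2 * ?n * \<bar>rproj p d v \<omega>\<bar> \<le> ?n\<^sup>2 + (rproj p d v \<omega>)\<^sup>2" by (simp add: power2_diff)
      then have "\<bar>rproj p d v \<omega>\<bar> \<le> (?n\<^sup>2 + (rproj p d v \<omega>)\<^sup>2) / (2 * ?n)"
        using np by (simp add: pos_le_divide_eq mult.commute)
      also have "\<dots> = ?h \<omega>" using np by (simp add: power2_eq_square field_simps)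
      finally show "\<bar>rproj p d v \<omega>\<bar> \<le> ?h \<omega>" .
    qed
    also have "\<dots> = 1 / 2 * ?n + (1 / (2 * ?n)) * (?n\<^sup>2 / 3)"
      using bm_integrable[OF bm_power[OF bm_rproj[of p d v], of 2]]
      by (simp add: rproj_moments(2)[OF assms] n2 S.prob_space)
    also have "\<dots> \<le> ?n" using np by (simp add: power2_eq_square)
    finally show ?thesis .
  qed
qed

lemma pairs_exp_small:
  assumes "real N \<le> 2 ^ q" "2 \<le> q"
  shows "real N ^ 2 * exp (- (8 * real q)) \<le> 1 / 1000"
proof -
  have "real N ^ 2 * exp (- (8 * real q)) \<le> (2 ^ q) ^ 2 * exp (- (8 * real q))"
    using assms by (intro mult_right_mono power_mono) auto
  also have "exp (- (8 * real q)) \<le> 1 / 2 ^ (8 * q)"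
  proof -
    have "(2::real) ^ (8 * q) \<le> exp 1 ^ (8 * q)"
      using exp_ge_add_one_self[of 1] by (intro power_mono) auto
    also have "\<dots> = exp (8 * real q)" by (simp add: exp_of_nat_mult[symmetric])
    finally have "exp (8 * real q) \<ge> 2 ^ (8 * q)" .
    then show ?thesis by (simp add: exp_minus field_simps)
  qed
  also have "(2 ^ q) ^ 2 * (1 / 2 ^ (8 * q)) = 1 / (2::real) ^ (6 * q)"
  proof -
    have "8 * q = q * 2 + 6 * q" by simp
    then have "(2::real) ^ (8 * q) = (2 ^ q) ^ 2 * 2 ^ (6 * q)" by (simp only: power_add power_mult)
    then show ?thesis by simp
  qed
  also have "\<dots> \<le> 1 / 2 ^ 12" using assms(2) by (intro divide_left_mono power_increasing) auto
  finally show ?thesis by simp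
qed

text \<open>The two directions are asymmetric. Contraction has to be excluded for every pair, as the
  program may find any point near \<open>a\<close>; \<open>K = 96 * q\<close> makes each failure
  probability \<open>exp (- 8 * q)\<close>. Expansion matters only for the pairs
  \<open>(a, b' a)\<close> and only in total, so Markov's inequality suffices.\<close>

lemma random_projection:
  fixes x :: "nat \<Rightarrow> nat \<Rightarrow> real" and d :: nat
  assumes inj: "inj_on (\<lambda>(i, l). p i l) (UNIV \<times> {..<d})" and N: "real N \<le> 2 ^ q" and q: "2 \<le> q" and K: "K = 96 * q"
    and m: "m \<le> N" and b': "\<And>a. a < m \<Longrightarrow> b' a < N"
  defines "f \<equiv> \<lambda>\<omega> a i. rproj (p i) d (x a) \<omega>"
  shows "\<exists>A\<in>sets random_source. measure random_source A \<ge> 1 - 2 / 1000 \<and> (\<forall>\<omega>\<in>A.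
    (\<forall>a<N. \<forall>b<N. L2_set (\<lambda>l. x a l - x b l) {..<d} \<le> sqrt (12 / real K) * L2_set (\<lambda>i. f \<omega> a i - f \<omega> b i) {..<K}) \<and>
    (\<Sum>a<m. l1n K (f \<omega> a) (f \<omega> (b' a))) \<le> 1000 * real K * (\<Sum>a<m. L2_set (\<lambda>l. x a l - x (b' a) l) {..<d}))"
proof -
  have inji: "inj_on (p i) {..<d}" for i
    by (rule inj_onI) (use inj_onD[OF inj, of "(i, _)" "(i, _)"] in simp)
  have fd: "f \<omega> a i - f \<omega> b i = rproj (p i) d (\<lambda>l. x a l - x b l) \<omega>" for \<omega> a b i
    by (simp add: f_def rproj_def sum_subtractf right_diff_distrib)
  have Kp: "0 < K" using K q by simp
  let ?n = "\<lambda>a b. \<Sum>l<d. (x a l - x b l)\<^sup>2"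
  let ?F = "\<lambda>a b \<omega>. \<Sum>i<K. (f \<omega> a i - f \<omega> b i)\<^sup>2"
  have bF: "bm (?F a b)" for a b unfolding fd by (intro bm_sum bm_power bm_rproj)
  note [measurable] = bm_measurable[OF bF]
  define B1 where "B1 = (\<Union>a\<in>{..<N}. \<Union>b\<in>{..<N}. {\<omega> \<in> space random_source. ?F a b \<omega> < real K / 12 * ?n a b})"
  have B1s: "B1 \<in> sets random_source" unfolding B1_def by measurable
  have "measure random_source {\<omega> \<in> space random_source. ?F a b \<omega> < real K / 12 * ?n a b} \<le> exp (- (8 * real q))" for a b
  proof (cases "?n a b = 0")
    case True
    have empty: "{\<omega> \<in> space random_source. ?F a b \<omega> < real K / 12 * ?n a b} = {}"
      unfolding True by (auto simp: not_less intro!: sum_nonneg)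
    show ?thesis unfolding empty by simp
  next
    case False
    moreover have "0 \<le> ?n a b" by (intro sum_nonneg) auto
    ultimately have "0 < ?n a b" by linarith
    from projection_lower_tail[OF inj refl this, of K]
    show ?thesis by (simp add: fd K)
  qed
  then have "measure random_source (\<Union>b\<in>{..<N}. {\<omega> \<in> space random_source. ?F a b \<omega> < real K / 12 * ?n a b}) \<le> (\<Sum>b<N. exp (- (8 * real q)))" for a
    by (intro prob_union_le) auto
  then have "measure random_source B1 \<le> (\<Sum>a<N. (\<Sum>b<N. exp (- (8 * real q))))"
    unfolding B1_def by (rule prob_union_le[rotated 2]) auto
  also have "\<dots> = real N ^ 2 * exp (- (8 * real q))" by (simp add: power2_eq_square)
  also have "\<dots> \<le> 1 / 1000" by (rule pairs_exp_small[OF N q])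
  finally have B1m: "measure random_source B1 \<le> 1 / 1000" .
  let ?Z = "\<lambda>\<omega>. \<Sum>a<m. l1n K (f \<omega> a) (f \<omega> (b' a))"
  let ?s = "\<Sum>a<m. L2_set (\<lambda>l. x a l - x (b' a) l) {..<d}"
  have bl: "bm (\<lambda>\<omega>. l1n K (f \<omega> a) (f \<omega> b))" for a b
    unfolding l1n_def fd by (intro bm_sum projection_mean_abs inji)
  have bZ: "bm ?Z" by (intro bm_sum bl)
  note [measurable] = bm_measurable[OF bZ]
  have EZ: "(\<integral>\<omega>. ?Z \<omega> \<partial>random_source) \<le> real K * ?s"
  proof -
    have "(\<integral>\<omega>. l1n K (f \<omega> a) (f \<omega> b) \<partial>random_source) \<le> real K * L2_set (\<lambda>l. x a l - x b l) {..<d}" for a b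
    proof -
      have "(\<integral>\<omega>. l1n K (f \<omega> a) (f \<omega> b) \<partial>random_source) = (\<Sum>i<K. \<integral>\<omega>. \<bar>rproj (p i) d (\<lambda>l. x a l - x b l) \<omega>\<bar> \<partial>random_source)"
        unfolding l1n_def fd by (intro Bochner_Integration.integral_sum bm_integrable projection_mean_abs inji)
      also have "\<dots> \<le> (\<Sum>i<K. L2_set (\<lambda>l. x a l - x b l) {..<d})"
        by (intro sum_mono projection_mean_abs inji)
      finally show ?thesis by simp
    qed
    moreover have "(\<integral>\<omega>. ?Z \<omega> \<partial>random_source) = (\<Sum>a<m. \<integral>\<omega>. l1n K (f \<omega> a) (f \<omega> (b' a)) \<partial>random_source)"
      by (intro Bochner_Integration.integral_sum bm_integrable bl)
    ultimately show ?thesis by (simp add: sum_distrib_left sum_mono)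
  qed
  define B2 where "B2 = {\<omega> \<in> space random_source. 1000 * real K * ?s < ?Z \<omega>}"
  have B2s: "B2 \<in> sets random_source" unfolding B2_def by measurable
  have Z0: "0 \<le> ?Z \<omega>" for \<omega> by (intro sum_nonneg l1n_nonneg)
  have s0: "0 \<le> ?s" by (intro sum_nonneg L2_set_nonneg)
  have B2m: "measure random_source B2 \<le> 1 / 1000"
  proof (cases "?s = 0")
    case True
    then have z: "L2_set (\<lambda>l. x a l - x (b' a) l) {..<d} = 0" if "a < m" for a
      using that by (subst (asm) sum_nonneg_eq_0_iff) (auto simp: L2_set_nonneg)
    have "rproj (p i) d (\<lambda>l. x a l - x (b' a) l) \<omega> = 0" if "a < m" for a i \<omega>
      using z[OF that] by (simp add: L2_set_eq_0_iff rproj_def)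
    then have "?Z \<omega> = 0" for \<omega> unfolding l1n_def fd by (intro sum.neutral) auto
    then have "B2 = {}" unfolding B2_def True by simp
    then show ?thesis by simp
  next
    case False
    then have c: "0 < 1000 * real K * ?s" using s0 Kp by simp
    have "measure random_source B2 \<le> measure random_source {\<omega> \<in> space random_source. 1000 * real K * ?s \<le> ?Z \<omega>}"
      unfolding B2_def by (intro S.finite_measure_mono) auto
    also have "\<dots> \<le> (\<integral>\<omega>. ?Z \<omega> \<partial>random_source) / (1000 * real K * ?s)"
      by (rule integral_Markov_inequality_measure[where A = "space random_source"])
        (use bZ c Z0 in \<open>auto intro!: AE_I2 bm_integrable\<close>)
    also have "\<dots> \<le> real K * ?s / (1000 * real K * ?s)" using EZ c by (intro divide_right_mono) auto
    also have "\<dots> = 1 / 1000" using False Kp by simp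
    finally show ?thesis .
  qed
  have "measure random_source (space random_source - (B1 \<union> B2)) = 1 - measure random_source (B1 \<union> B2)"
    using B1s B2s by (intro S.prob_compl) auto
  then have Am: "measure random_source (space random_source - (B1 \<union> B2)) \<ge> 1 - 2 / 1000"
    using measure_Un_le[OF B1s B2s] B1m B2m by linarith
  have L2: "L2_set (\<lambda>l. x a l - x b l) {..<d} \<le> sqrt (12 / real K) * L2_set (\<lambda>i. f \<omega> a i - f \<omega> b i) {..<K}"
    if "\<omega> \<in> space random_source - (B1 \<union> B2)" "a < N" "b < N" for \<omega> a b
  proof -
    have "real K / 12 * ?n a b \<le> ?F a b \<omega>" using that by (auto simp: B1_def not_less)
    then have "?n a b \<le> 12 / real K * ?F a b \<omega>" using Kp by (simp add: field_simps)
    then have "sqrt (?n a b) \<le> sqrt (12 / real K * ?F a b \<omega>)" by (rule real_sqrt_le_mono)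
    then show ?thesis unfolding L2_set_def by (simp only: real_sqrt_mult)
  qed
  show ?thesis
  proof (intro bexI[of _ "space random_source - (B1 \<union> B2)"] conjI ballI allI impI)
    show "(\<Sum>a<m. l1n K (f \<omega> a) (f \<omega> (b' a))) \<le> 1000 * real K * ?s" if "\<omega> \<in> space random_source - (B1 \<union> B2)" for \<omega>
      using that by (auto simp: B2_def not_less)
  qed (use B1s B2s Am L2 in auto)
qed

subsection \<open>Importance sampling\<close>

text \<open>This inverts the cumulative distribution of the weights: it is the last index whose
  preceding partial sum does not exceed \<open>x\<close>, as found by a linear scan that overwrites
  its result. If no index qualifies, 0 is the default.\<close>

primrec sel :: "(nat \<Rightarrow> real) \<Rightarrow> nat \<Rightarrow> real \<Rightarrow> nat" where
  "sel D 0 x = 0"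
| "sel D (Suc m) x = (if (\<Sum>a<m. D a) \<le> x then m else sel D m x)"

lemma sel_as_sum:
  assumes D: "\<And>a. 0 \<le> D a" and x: "0 \<le> x" "x < (\<Sum>a<m. D a)"
  shows "g (sel D m x) = (\<Sum>a<m. g a * indicator {(\<Sum>i<a. D i)..<(\<Sum>i<Suc a. D i)} x :: real)"
  using x(2)
proof (induction m)
  case (Suc m)
  show ?case
  proof (cases "(\<Sum>a<m. D a) \<le> x")
    case True
    have "(\<Sum>i<Suc a. D i) \<le> x" if "a < m" for a
    proof -
      have "(\<Sum>i<Suc a. D i) \<le> (\<Sum>i<m. D i)" using that D by (intro sum_mono2) auto
      then show ?thesis using True by linarith
    qed
    then have "(\<Sum>a<m. g a * indicator {(\<Sum>i<a. D i)..<(\<Sum>i<Suc a. D i)} x) = 0"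
      by (intro sum.neutral ballI) (simp add: indicator_def not_less del: sum.lessThan_Suc)
    then show ?thesis using True Suc.prems by simp
  qed (use Suc in auto)
qed (use x in auto)

lemma sel_less: "0 < m \<Longrightarrow> 0 \<le> x \<Longrightarrow> sel D m x < m"
proof (induction m)
  case (Suc m)
  then show ?case by (cases m) auto
qed simp

lemma measurable_sel [measurable]: "(\<lambda>x. g (sel D m x) :: real) \<in> borel_measurable borel"
proof (induction m)
  case (Suc m)
  note [measurable] = this
  have "(\<lambda>x. if (\<Sum>a<m. D a) \<le> x then g m else g (sel D m x)) \<in> borel_measurable borel" by measurable
  then show ?case by (simp add: if_distrib cong: if_cong)
qed simp

lemma sel_mean:
  assumes D: "\<And>a. 0 \<le> D a" and T: "T = (\<Sum>a<m. D a)" "0 < T"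
  shows "(\<integral>\<omega>. g (sel D m (\<omega> j * T)) \<partial>random_source) = (\<Sum>a<m. g a * D a) / T"
proof -
  let ?I = "\<lambda>a. {(\<Sum>i<a. D i) / T..<(\<Sum>i<Suc a. D i) / T}"
  have le: "(\<Sum>i<a. D i) \<le> (\<Sum>i<b. D i)" if "a \<le> b" for a b
    using that D by (intro sum_mono2) auto
  have meas: "measure random_source {\<omega> \<in> space random_source. \<omega> j \<in> ?I a} = D a / T" if "a < m" for a
  proof -
    have "(\<Sum>i<Suc a. D i) / T \<le> 1" using le[of "Suc a" m] that T by simp
    moreover have "0 \<le> (\<Sum>i<a. D i) / T" using D T by (intro divide_nonneg_pos sum_nonneg) auto
    ultimately have "?I a \<inter> {0..1} = ?I a" by auto
    then have "measure random_source {\<omega> \<in> space random_source. \<omega> j \<in> ?I a} = measure lborel (?I a)"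
      by (subst prob_coord) auto
    also have "\<dots> = (\<Sum>i<Suc a. D i) / T - (\<Sum>i<a. D i) / T"
      using D[of a] T by (intro measure_lborel_Ico divide_right_mono) auto
    also have "\<dots> = D a / T" by (simp add: add_divide_distrib)
    finally show ?thesis .
  qed
  have bi: "bm (\<lambda>\<omega>. indicator (?I a) (\<omega> j))" for a
    unfolding bm_def by (auto intro!: exI[of _ 1] simp: indicator_def)
  \<comment> \<open>At \<open>\<omega> j = 1\<close> no half-open interval of the partition contains
    the value; this null event is set aside.\<close>
  have "measure random_source {\<omega> \<in> space random_source. \<omega> j = 1} = 0"
  proof -
    have "{1::real} \<inter> {0..1} = {1}" by auto
    then show ?thesis using prob_coord[of "{1}" j] by simp
  qed
  then have ae: "AE \<omega> in random_source. \<omega> j \<noteq> 1"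
    by (intro AE_I[of _ _ "{\<omega> \<in> space random_source. \<omega> j = 1}"]) (auto simp: S.emeasure_eq_measure)
  have "(\<integral>\<omega>. g (sel D m (\<omega> j * T)) \<partial>random_source) = (\<integral>\<omega>. (\<Sum>a<m. g a * indicator (?I a) (\<omega> j)) \<partial>random_source)"
  proof (rule integral_cong_AE)
    show "AE \<omega> in random_source. g (sel D m (\<omega> j * T)) = (\<Sum>a<m. g a * indicator (?I a) (\<omega> j))"
      using ae AE_space
    proof eventually_elim
      case (elim \<omega>)
      have "0 \<le> \<omega> j" "\<omega> j < 1" using elim mem_space_source[of \<omega> j] by auto
      then have x: "0 \<le> \<omega> j * T" "\<omega> j * T < (\<Sum>a<m. D a)" using T by auto
      have "indicator {(\<Sum>i<a. D i)..<(\<Sum>i<Suc a. D i)} (\<omega> j * T) = (indicator (?I a) (\<omega> j) :: real)" for a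
        using T(2) by (simp add: indicator_def pos_divide_le_eq pos_less_divide_eq del: sum.lessThan_Suc)
      then show ?case using sel_as_sum[OF D x, of g] by (simp only:)
    qed
  qed measurable
  also have "\<dots> = (\<Sum>a<m. g a * (\<integral>\<omega>. indicator (?I a) (\<omega> j) \<partial>random_source))"
    by (subst Bochner_Integration.integral_sum) (auto intro!: bm_integrable bm_cmult bi simp del: sum.lessThan_Suc)
  also have "\<dots> = (\<Sum>a<m. g a * (D a / T))"
  proof (intro sum.cong refl)
    fix a assume "a \<in> {..<m}"
    have "(\<integral>\<omega>. indicator (?I a) (\<omega> j) \<partial>random_source) = (\<integral>\<omega>. indicat_real {\<omega> \<in> space random_source. \<omega> j \<in> ?I a} \<omega> \<partial>random_source)"
      by (intro Bochner_Integration.integral_cong) (auto simp: indicator_def)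
    also have "\<dots> = D a / T" using meas[of a] \<open>a \<in> {..<m}\<close> by simp
    finally show "g a * (\<integral>\<omega>. indicator (?I a) (\<omega> j) \<partial>random_source) = g a * (D a / T)" by simp
  qed
  finally show ?thesis by (simp add: sum_divide_distrib)
qed

text \<open>Each sample \<open>t / D\<close> lies in \<open>[0, 1]\<close> and has mean
  \<open>\<mu> = C / T\<close>, so its variance is at most \<open>\<mu>\<close>. Chebyshev's
  inequality at relative error \<open>\<epsilon>\<close> gives a failure probability of
  \<open>1 / (\<epsilon>\<^sup>2 * M * \<mu>)\<close>, and \<open>1 / \<mu> \<le> R\<close>: an
  overestimate by \<open>R\<close> costs a factor \<open>R\<close> in the number of samples.\<close>

lemma sampling_concentration:
  fixes D t :: "nat \<Rightarrow> real"
  assumes t: "\<And>a. 0 \<le> t a" "\<And>a. t a \<le> D a" and T: "T = (\<Sum>a<m. D a)" and C: "C = (\<Sum>a<m. t a)" "0 < C"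
    and R: "T \<le> R * C" and e: "0 < \<epsilon>" and M: "1000 * R / \<epsilon>\<^sup>2 \<le> real M"
  shows "measure random_source {\<omega> \<in> space random_source.
    \<bar>(\<Sum>j<M. t (sel D m (\<omega> (p + j) * T)) / D (sel D m (\<omega> (p + j) * T))) * T / real M - C\<bar> \<le> \<epsilon> * C} \<ge> 1 - 1 / 1000"
proof -
  have D0: "0 \<le> D a" for a using t[of a] by linarith
  have CT: "C \<le> T" unfolding T C using t by (intro sum_mono) auto
  then have Tp: "0 < T" using C by linarith
  then have Rp: "0 < R" using R C by (smt (verit) mult_nonpos_nonneg)
  then have Mp: "0 < real M" using M e by (smt (verit) divide_pos_pos mult_pos_pos zero_less_power)
  define h where "h a = t a / D a" for a
  have h: "0 \<le> h a" "h a \<le> 1" for a using t[of a] D0[of a] by (auto simp: h_def divide_le_eq_1)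
  \<comment> \<open>If \<open>D a = 0\<close> then \<open>t a = 0\<close> as well, and division by
    zero gives the right value.\<close>
  have hD: "h a * D a = t a" for a using t[of a] by (auto simp: h_def)
  let ?Y = "\<lambda>j \<omega>. h (sel D m (\<omega> (p + j) * T))"
  define \<mu> where "\<mu> = C / T"
  have mu: "0 < \<mu>" using C Tp by (simp add: \<mu>_def)
  have bY: "bm (?Y j)" for j
  proof -
    have "(\<lambda>x. h (sel D m x)) \<in> borel_measurable borel" by (rule measurable_sel)
    then have "?Y j \<in> borel_measurable random_source" by measurable
    moreover have "\<bar>?Y j \<omega>\<bar> \<le> 1" for \<omega> using h[of "sel D m (\<omega> (p + j) * T)"] by simp
    ultimately show ?thesis unfolding bm_def by blast
  qed
  have EY: "(\<integral>\<omega>. ?Y j \<omega> \<partial>random_source) = \<mu>" for j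
    using sel_mean[OF D0 T Tp, of h "p + j"] by (simp add: hD \<mu>_def C)
  let ?V = "\<lambda>j \<omega>. ?Y j \<omega> - \<mu>"
  have bV: "bm (?V j)" for j by (intro bm_diff bY bm_const)
  have EV: "(\<integral>\<omega>. ?V j \<omega> \<partial>random_source) = 0" for j
    using EY[of j] bm_integrable[OF bY[of j]] by (simp add: S.prob_space)
  have EV2: "(\<integral>\<omega>. ?V j \<omega> * ?V j \<omega> \<partial>random_source) \<le> \<mu>" for j
  proof -
    have "(\<integral>\<omega>. ?V j \<omega> * ?V j \<omega> \<partial>random_source) \<le> (\<integral>\<omega>. (1 - 2 * \<mu>) * ?Y j \<omega> + \<mu>\<^sup>2 \<partial>random_source)"
    proof (intro integral_mono bm_integrable bm_mult bV bm_add bm_cmult bY bm_const)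
      fix \<omega>
      have "?Y j \<omega> * ?Y j \<omega> \<le> ?Y j \<omega>" using h[of "sel D m (\<omega> (p + j) * T)"] by (simp add: mult_left_le)
      then show "?V j \<omega> * ?V j \<omega> \<le> (1 - 2 * \<mu>) * ?Y j \<omega> + \<mu>\<^sup>2" by (simp add: power2_eq_square algebra_simps)
    qed
    also have "\<dots> = (1 - 2 * \<mu>) * \<mu> + \<mu>\<^sup>2" using EY[of j] bm_integrable[OF bY[of j]] by (simp add: S.prob_space)
    also have "\<dots> \<le> \<mu>" by (simp add: power2_eq_square algebra_simps)
    finally show ?thesis .
  qed
  have cross: "(\<integral>\<omega>. ?V i \<omega> * ?V j \<omega> \<partial>random_source) = 0" if "i \<noteq> j" for i j
  proof -
    have "(\<integral>\<omega>. ?V i \<omega> * ?V j \<omega> \<partial>random_source) = (\<integral>\<omega>. ?V i \<omega> \<partial>random_source) * (\<integral>\<omega>. ?V j \<omega> \<partial>random_source)"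
      using that by (intro integral_indep[where J = "{p + j}"] bV) (auto simp: dep_def)
    then show ?thesis by (simp add: EV)
  qed
  let ?S = "\<lambda>\<omega>. \<Sum>j<M. ?V j \<omega>"
  have b2: "bm (\<lambda>\<omega>. (?S \<omega>)\<^sup>2)" by (intro bm_power bm_sum bV)
  have "(\<integral>\<omega>. (?S \<omega>)\<^sup>2 \<partial>random_source) = (\<integral>\<omega>. (\<Sum>i<M. \<Sum>j<M. ?V i \<omega> * ?V j \<omega>) \<partial>random_source)"
    by (simp add: power2_eq_square sum_product)
  also have "\<dots> = (\<Sum>i<M. \<Sum>j<M. \<integral>\<omega>. ?V i \<omega> * ?V j \<omega> \<partial>random_source)"
    by (subst Bochner_Integration.integral_sum Bochner_Integration.integral_sum; intro sum.cong refl bm_integrable bm_sum bm_mult bV Bochner_Integration.integral_sum)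
  also have "\<dots> \<le> (\<Sum>i<M. \<mu>)"
  proof (rule sum_mono)
    fix i assume i: "i \<in> {..<M}"
    have "(\<Sum>j<M. \<integral>\<omega>. ?V i \<omega> * ?V j \<omega> \<partial>random_source) = (\<integral>\<omega>. ?V i \<omega> * ?V i \<omega> \<partial>random_source) + (\<Sum>j\<in>{..<M} - {i}. \<integral>\<omega>. ?V i \<omega> * ?V j \<omega> \<partial>random_source)"
      using i by (intro sum.remove) auto
    also have "(\<Sum>j\<in>{..<M} - {i}. \<integral>\<omega>. ?V i \<omega> * ?V j \<omega> \<partial>random_source) = 0"
      by (intro sum.neutral ballI cross) auto
    finally show "(\<Sum>j<M. \<integral>\<omega>. ?V i \<omega> * ?V j \<omega> \<partial>random_source) \<le> \<mu>" using EV2[of i] by simp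
  qed
  finally have ES: "(\<integral>\<omega>. (?S \<omega>)\<^sup>2 \<partial>random_source) \<le> real M * \<mu>" by simp
  define c where "c = \<epsilon> * (real M * \<mu>)"
  have c: "0 < c" using e Mp mu by (simp add: c_def)
  note [measurable] = bm_measurable[OF b2]
  let ?B = "{\<omega> \<in> space random_source. c\<^sup>2 \<le> (?S \<omega>)\<^sup>2}"
  have "measure random_source ?B \<le> (\<integral>\<omega>. (?S \<omega>)\<^sup>2 \<partial>random_source) / c\<^sup>2"
    by (rule integral_Markov_inequality_measure[where A = "space random_source"])
      (use c in \<open>auto intro!: AE_I2 bm_integrable[OF b2]\<close>)
  also have "\<dots> \<le> real M * \<mu> / c\<^sup>2" using ES by (intro divide_right_mono) auto
  also have "\<dots> = 1 / (\<epsilon>\<^sup>2 * (real M * \<mu>))" using Mp mu e by (simp add: c_def power2_eq_square)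
  also have "\<dots> \<le> 1 / 1000"
  proof -
    have "1000 * R \<le> \<epsilon>\<^sup>2 * real M" using M e by (simp add: field_simps)
    then have "1000 * R * \<mu> \<le> \<epsilon>\<^sup>2 * real M * \<mu>" using mu by (intro mult_right_mono) auto
    moreover have "1 \<le> R * \<mu>" using R Tp by (simp add: \<mu>_def field_simps)
    ultimately have "1000 \<le> \<epsilon>\<^sup>2 * (real M * \<mu>)" by (simp add: mult.assoc)
    then show ?thesis by (intro divide_left_mono) auto
  qed
  finally have B: "measure random_source ?B \<le> 1 / 1000" .
  have "space random_source - ?B \<subseteq> {\<omega> \<in> space random_source. \<bar>(\<Sum>j<M. ?Y j \<omega>) * T / real M - C\<bar> \<le> \<epsilon> * C}" (is "_ \<subseteq> ?G")
  proof
    fix \<omega> assume w: "\<omega> \<in> space random_source - ?B"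
    then have "\<bar>?S \<omega>\<bar> < c" using c by (auto simp: not_le intro!: power2_less_imp_less[of "\<bar>?S \<omega>\<bar>" c])
    moreover have "(\<Sum>j<M. ?Y j \<omega>) * T / real M - C = ?S \<omega> * (T / real M)"
    proof -
      have "?S \<omega> = (\<Sum>j<M. ?Y j \<omega>) - real M * \<mu>" by (simp add: sum_subtractf)
      moreover have "real M * \<mu> * (T / real M) = C" using Mp Tp by (simp add: \<mu>_def)
      ultimately show ?thesis by (simp only: left_diff_distrib) simp
    qed
    moreover have "c * (T / real M) = \<epsilon> * C" using Mp Tp by (simp add: c_def \<mu>_def)
    ultimately have "\<bar>(\<Sum>j<M. ?Y j \<omega>) * T / real M - C\<bar> \<le> \<epsilon> * C"
      using Mp Tp mult_right_mono[of "\<bar>?S \<omega>\<bar>" c "T / real M"] by (simp add: abs_mult)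
    then show "\<omega> \<in> ?G" using w by simp
  qed
  then have "measure random_source (space random_source - ?B) \<le> measure random_source ?G"
    using bm_measurable[OF bY] by (intro S.finite_measure_mono) measurable
  moreover have "measure random_source (space random_source - ?B) = 1 - measure random_source ?B"
    by (intro S.prob_compl) measurable
  ultimately show ?thesis using B by (simp add: h_def)
qed

subsection \<open>Measurability of runs\<close>

text \<open>A fuelled interpreter turns the inductive run relation into a function of
  \<open>\<omega>\<close>, so that measurability follows by induction on the fuel; termination is a
  countable union over it.\<close>

fun ev :: "nat \<Rightarrow> com \<Rightarrow> (nat \<Rightarrow> real) \<Rightarrow> state \<Rightarrow> state option" where
  "ev 0 c \<omega> s = None"
| "ev (Suc n) Skip \<omega> s = Some s"
| "ev (Suc n) (NStore a e) \<omega> s = Some (s\<lparr>nmem := (nmem s)(nval a s := nval e s)\<rparr>)"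
| "ev (Suc n) (RStore a e) \<omega> s = Some (s\<lparr>rmem := (rmem s)(nval a s := rval e s)\<rparr>)"
| "ev (Suc n) (Sample a) \<omega> s = Some (s\<lparr>rmem := (rmem s)(nval a s := \<omega> (pos s)), pos := Suc (pos s)\<rparr>)"
| "ev (Suc n) (Seq c c') \<omega> s = (case ev n c \<omega> s of None \<Rightarrow> None | Some s' \<Rightarrow> ev n c' \<omega> s')"
| "ev (Suc n) (Cond b c c') \<omega> s = (if bval b s then ev n c \<omega> s else ev n c' \<omega> s)"
| "ev (Suc n) (While b c) \<omega> s = (if bval b s then (case ev n c \<omega> s of None \<Rightarrow> None | Some s' \<Rightarrow> ev n (While b c) \<omega> s') else Some s)"

lemma ev_sound: "ev n c \<omega> s = Some s' \<Longrightarrow> \<exists>k. exec \<omega> c s k s'"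
proof (induction n c \<omega> s arbitrary: s' rule: ev.induct)
  case (6 n c c' \<omega> s)
  then show ?case by (auto split: option.splits intro: exec.Seq) (meson exec.Seq)
next
  case (7 n b c c' \<omega> s)
  then show ?case by (auto split: if_splits) (meson exec.CondTrue exec.CondFalse)+
next
  case (8 n b c \<omega> s)
  show ?case
  proof (cases "bval b s")
    case True
    then obtain s1 where "ev n c \<omega> s = Some s1" "ev n (While b c) \<omega> s1 = Some s'" using 8(3) by (auto split: option.splits)
    then show ?thesis using 8(1)[OF True] 8(2)[OF True] exec.WhileTrue[OF True] by meson
  next
    case False
    then show ?thesis using 8(3) exec.WhileFalse[OF False] by auto
  qed
qed (auto intro: exec.intros)

lemma exec_time_pos: "exec \<omega> c s k s' \<Longrightarrow> 0 < k"
  by (induction rule: exec.induct) auto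

lemma ev_complete: "exec \<omega> c s k s' \<Longrightarrow> k \<le> n \<Longrightarrow> ev n c \<omega> s = Some s'"
proof (induction arbitrary: n rule: exec.induct)
  case (Seq c s k s' c' k' s'')
  then obtain m where "n = Suc m" "k \<le> m" "k' \<le> m"
    using exec_time_pos[OF Seq.hyps(1)] exec_time_pos[OF Seq.hyps(2)] by (cases n) auto
  then show ?case using Seq.IH by simp
next
  case (WhileTrue b s c k s' k' s'')
  then obtain m where "n = Suc m" "k \<le> m" "k' \<le> m" by (cases n) auto
  then show ?case using WhileTrue by simp
next
  case (CondTrue b s c k s' c')
  then show ?case by (cases n) auto
next
  case (CondFalse b s c' k s' c)
  then show ?case by (cases n) auto
qed (auto simp: Suc_le_eq gr0_conv_Suc)

text \<open>Measurability cell by cell suffices although addresses may depend on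
  \<open>\<omega>\<close>: an access at a random address is a countable case distinction.\<close>

definition msr :: "((nat \<Rightarrow> real) \<Rightarrow> state) \<Rightarrow> bool" where
  "msr \<sigma> \<longleftrightarrow> (\<forall>i. (\<lambda>\<omega>. nmem (\<sigma> \<omega>) i) \<in> measurable random_source (count_space UNIV)) \<and>
    (\<forall>i. (\<lambda>\<omega>. rmem (\<sigma> \<omega>) i) \<in> borel_measurable random_source) \<and>
    (\<lambda>\<omega>. pos (\<sigma> \<omega>)) \<in> measurable random_source (count_space UNIV)"

lemma msr_nval:
  assumes "msr \<sigma>" shows "(\<lambda>\<omega>. nval e (\<sigma> \<omega>)) \<in> measurable random_source (count_space UNIV)"
proof (induction e)
  case (NLoad a)
  have "(\<lambda>\<omega>. (\<lambda>i \<omega>. nmem (\<sigma> \<omega>) i) (nval a (\<sigma> \<omega>)) \<omega>) \<in> measurable random_source (count_space UNIV)"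
    by (rule measurable_compose_countable[OF _ NLoad]) (use assms in \<open>simp add: msr_def\<close>)
  then show ?case by simp
qed auto

lemma msr_rval:
  assumes "msr \<sigma>" shows "(\<lambda>\<omega>. rval e (\<sigma> \<omega>)) \<in> borel_measurable random_source"
proof (induction e)
  case (ROfNat e)
  note [measurable] = msr_nval[OF assms, of e]
  show ?case by simp
next
  case (RLoad a)
  have "(\<lambda>\<omega>. (\<lambda>i \<omega>. rmem (\<sigma> \<omega>) i) (nval a (\<sigma> \<omega>)) \<omega>) \<in> borel_measurable random_source"
    by (rule measurable_compose_countable[OF _ msr_nval[OF assms]]) (use assms in \<open>simp add: msr_def\<close>)
  then show ?case by simp
qed auto

lemma msr_bval:
  assumes "msr \<sigma>" shows "Measurable.pred random_source (\<lambda>\<omega>. bval b (\<sigma> \<omega>))"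
proof (induction b)
  case (NLess e f)
  note [measurable] = msr_nval[OF assms, of e] msr_nval[OF assms, of f]
  have "Measurable.pred random_source (\<lambda>\<omega>. real (nval e (\<sigma> \<omega>)) < real (nval f (\<sigma> \<omega>)))" by measurable
  then show ?case by simp
next
  case (RLess e f)
  note [measurable] = msr_rval[OF assms, of e] msr_rval[OF assms, of f]
  show ?case by simp
qed auto

lemma msr_if:
  assumes "msr \<sigma>" "msr \<tau>" and [measurable]: "Measurable.pred random_source P"
  shows "msr (\<lambda>\<omega>. if P \<omega> then \<sigma> \<omega> else \<tau> \<omega>)"
proof -
  have [measurable]: "(\<lambda>\<omega>. nmem (\<sigma> \<omega>) i) \<in> measurable random_source (count_space UNIV)"
    "(\<lambda>\<omega>. rmem (\<sigma> \<omega>) i) \<in> borel_measurable random_source"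
    "(\<lambda>\<omega>. nmem (\<tau> \<omega>) i) \<in> measurable random_source (count_space UNIV)"
    "(\<lambda>\<omega>. rmem (\<tau> \<omega>) i) \<in> borel_measurable random_source"
    "(\<lambda>\<omega>. pos (\<sigma> \<omega>)) \<in> measurable random_source (count_space UNIV)"
    "(\<lambda>\<omega>. pos (\<tau> \<omega>)) \<in> measurable random_source (count_space UNIV)" for i
    using assms(1,2) by (auto simp: msr_def)
  show ?thesis unfolding msr_def by (simp add: if_distrib[of nmem] if_distrib[of rmem] if_distrib[of pos] if_distribR)
qed

lemma msr_nstore:
  assumes "msr \<sigma>"
  shows "msr (\<lambda>\<omega>. (\<sigma> \<omega>)\<lparr>nmem := (nmem (\<sigma> \<omega>))(nval a (\<sigma> \<omega>) := nval e (\<sigma> \<omega>))\<rparr>)"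
proof -
  note [measurable] = msr_nval[OF assms, of a] msr_nval[OF assms, of e]
  have [measurable]: "(\<lambda>\<omega>. nmem (\<sigma> \<omega>) i) \<in> measurable random_source (count_space UNIV)" for i
    using assms by (simp add: msr_def)
  have "(\<lambda>\<omega>. if i = nval a (\<sigma> \<omega>) then nval e (\<sigma> \<omega>) else nmem (\<sigma> \<omega>) i) \<in> measurable random_source (count_space UNIV)" for i
    by measurable
  then show ?thesis using assms by (simp add: msr_def fun_upd_def)
qed

lemma msr_rstore:
  assumes "msr \<sigma>" and [measurable]: "f \<in> borel_measurable random_source"
  shows "msr (\<lambda>\<omega>. (\<sigma> \<omega>)\<lparr>rmem := (rmem (\<sigma> \<omega>))(nval a (\<sigma> \<omega>) := f \<omega>)\<rparr>)"
proof -
  note [measurable] = msr_nval[OF assms(1), of a]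
  have [measurable]: "(\<lambda>\<omega>. rmem (\<sigma> \<omega>) i) \<in> borel_measurable random_source" for i
    using assms by (simp add: msr_def)
  have "(\<lambda>\<omega>. if i = nval a (\<sigma> \<omega>) then f \<omega> else rmem (\<sigma> \<omega>) i) \<in> borel_measurable random_source" for i
    by measurable
  then show ?thesis using assms by (simp add: msr_def fun_upd_def)
qed

lemma msr_sample:
  assumes "msr \<sigma>"
  shows "msr (\<lambda>\<omega>. (\<sigma> \<omega>)\<lparr>rmem := (rmem (\<sigma> \<omega>))(nval a (\<sigma> \<omega>) := \<omega> (pos (\<sigma> \<omega>))), pos := Suc (pos (\<sigma> \<omega>))\<rparr>)"
proof -
  have p: "(\<lambda>\<omega>. pos (\<sigma> \<omega>)) \<in> measurable random_source (count_space UNIV)" using assms by (simp add: msr_def)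
  have "(\<lambda>\<omega>. (\<lambda>i \<omega>. \<omega> i) (pos (\<sigma> \<omega>)) \<omega>) \<in> borel_measurable random_source"
    by (rule measurable_compose_countable[OF _ p]) (rule coord_measurable)
  then have "(\<lambda>\<omega>. \<omega> (pos (\<sigma> \<omega>))) \<in> borel_measurable random_source" by simp
  from msr_rstore[OF assms this, of a] show ?thesis
    using measurable_compose[OF p, of Suc "count_space UNIV"] by (simp add: msr_def)
qed

text \<open>When the fuel is exhausted the state falls back to \<open>\<sigma> \<omega>\<close>. The
  outcome is then a total random state, which a sequential composition can pass on to the next
  command.\<close>

lemma msr_ev:
  assumes "msr \<sigma>"
  shows "Measurable.pred random_source (\<lambda>\<omega>. ev n c \<omega> (\<sigma> \<omega>) \<noteq> None) \<and>
    msr (\<lambda>\<omega>. case ev n c \<omega> (\<sigma> \<omega>) of None \<Rightarrow> \<sigma> \<omega> | Some s \<Rightarrow> s)"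
  using assms
proof (induction n arbitrary: c \<sigma>)
  case 0
  then show ?case by simp
next
  case (Suc n)
  note s = Suc.prems
  have seq: "Measurable.pred random_source (\<lambda>\<omega>. (case ev n c1 \<omega> (\<sigma> \<omega>) of None \<Rightarrow> None | Some s' \<Rightarrow> ev n c2 \<omega> s') \<noteq> None) \<and>
    msr (\<lambda>\<omega>. case (case ev n c1 \<omega> (\<sigma> \<omega>) of None \<Rightarrow> None | Some s' \<Rightarrow> ev n c2 \<omega> s') of None \<Rightarrow> \<sigma> \<omega> | Some s \<Rightarrow> s)" for c1 c2
  proof -
    let ?\<tau> = "\<lambda>\<omega>. case ev n c1 \<omega> (\<sigma> \<omega>) of None \<Rightarrow> \<sigma> \<omega> | Some s \<Rightarrow> s"
    have 1: "Measurable.pred random_source (\<lambda>\<omega>. ev n c1 \<omega> (\<sigma> \<omega>) \<noteq> None)" "msr ?\<tau>" using Suc.IH[OF s, of c1] by auto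
    have 2: "Measurable.pred random_source (\<lambda>\<omega>. ev n c2 \<omega> (?\<tau> \<omega>) \<noteq> None)"
      "msr (\<lambda>\<omega>. case ev n c2 \<omega> (?\<tau> \<omega>) of None \<Rightarrow> ?\<tau> \<omega> | Some s \<Rightarrow> s)" using Suc.IH[OF 1(2), of c2] by auto
    note [measurable] = 1(1) 2(1)
    have 3: "Measurable.pred random_source (\<lambda>\<omega>. ev n c1 \<omega> (\<sigma> \<omega>) \<noteq> None \<and> ev n c2 \<omega> (?\<tau> \<omega>) \<noteq> None)" by measurable
    have "(\<lambda>\<omega>. ev n c1 \<omega> (\<sigma> \<omega>) \<noteq> None \<and> ev n c2 \<omega> (?\<tau> \<omega>) \<noteq> None) =
      (\<lambda>\<omega>. (case ev n c1 \<omega> (\<sigma> \<omega>) of None \<Rightarrow> None | Some s' \<Rightarrow> ev n c2 \<omega> s') \<noteq> None)"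
      by (auto simp: fun_eq_iff split: option.splits)
    moreover have "(\<lambda>\<omega>. if ev n c1 \<omega> (\<sigma> \<omega>) \<noteq> None \<and> ev n c2 \<omega> (?\<tau> \<omega>) \<noteq> None
        then (case ev n c2 \<omega> (?\<tau> \<omega>) of None \<Rightarrow> ?\<tau> \<omega> | Some s \<Rightarrow> s) else \<sigma> \<omega>)
      = (\<lambda>\<omega>. case (case ev n c1 \<omega> (\<sigma> \<omega>) of None \<Rightarrow> None | Some s' \<Rightarrow> ev n c2 \<omega> s') of None \<Rightarrow> \<sigma> \<omega> | Some s \<Rightarrow> s)"
      by (auto simp: fun_eq_iff split: option.splits)
    ultimately show ?thesis using 3 msr_if[OF 2(2) s 3] by simp
  qed
  have cond: "Measurable.pred random_source (\<lambda>\<omega>. (if bval b (\<sigma> \<omega>) then f \<omega> else g \<omega>) \<noteq> None) \<and>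
    msr (\<lambda>\<omega>. case (if bval b (\<sigma> \<omega>) then f \<omega> else g \<omega>) of None \<Rightarrow> \<sigma> \<omega> | Some s \<Rightarrow> s)"
    if f: "Measurable.pred random_source (\<lambda>\<omega>. f \<omega> \<noteq> None) \<and> msr (\<lambda>\<omega>. case f \<omega> of None \<Rightarrow> \<sigma> \<omega> | Some s \<Rightarrow> s)"
      and g: "Measurable.pred random_source (\<lambda>\<omega>. g \<omega> \<noteq> None) \<and> msr (\<lambda>\<omega>. case g \<omega> of None \<Rightarrow> \<sigma> \<omega> | Some s \<Rightarrow> s)" for f g b
  proof -
    note b = msr_bval[OF s, of b]
    note [measurable] = b conjunct1[OF f] conjunct1[OF g]
    have "Measurable.pred random_source (\<lambda>\<omega>. if bval b (\<sigma> \<omega>) then f \<omega> \<noteq> None else g \<omega> \<noteq> None)" by measurable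
    moreover have "(\<lambda>\<omega>. if bval b (\<sigma> \<omega>) then f \<omega> \<noteq> None else g \<omega> \<noteq> None) = (\<lambda>\<omega>. (if bval b (\<sigma> \<omega>) then f \<omega> else g \<omega>) \<noteq> None)"
      by auto
    moreover have "(\<lambda>\<omega>. case (if bval b (\<sigma> \<omega>) then f \<omega> else g \<omega>) of None \<Rightarrow> \<sigma> \<omega> | Some s \<Rightarrow> s)
      = (\<lambda>\<omega>. if bval b (\<sigma> \<omega>) then (case f \<omega> of None \<Rightarrow> \<sigma> \<omega> | Some s \<Rightarrow> s) else (case g \<omega> of None \<Rightarrow> \<sigma> \<omega> | Some s \<Rightarrow> s))"
      by auto
    ultimately show ?thesis using msr_if[OF conjunct2[OF f] conjunct2[OF g] b] by simp
  qed
  show ?case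
  proof (cases c)
    case (Cond b c1 c2)
    then show ?thesis using cond[of "\<lambda>\<omega>. ev n c1 \<omega> (\<sigma> \<omega>)" "\<lambda>\<omega>. ev n c2 \<omega> (\<sigma> \<omega>)" b, OF Suc.IH[OF s] Suc.IH[OF s]] by simp
  next
    case (While b c1)
    have "Measurable.pred random_source (\<lambda>\<omega>. Some (\<sigma> \<omega>) \<noteq> None) \<and> msr (\<lambda>\<omega>. case Some (\<sigma> \<omega>) of None \<Rightarrow> \<sigma> \<omega> | Some s \<Rightarrow> s)"
      using s by simp
    from cond[where b = b and f = "\<lambda>\<omega>. case ev n c1 \<omega> (\<sigma> \<omega>) of None \<Rightarrow> None | Some s' \<Rightarrow> ev n (While b c1) \<omega> s'"
        and g = "\<lambda>\<omega>. Some (\<sigma> \<omega>)", OF seq[where ?c1.0 = c1 and ?c2.0 = "While b c1"] this]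
    show ?thesis unfolding While ev.simps(8) .
  qed (use s seq in \<open>simp_all add: msr_nstore msr_rstore msr_rval msr_sample\<close>)
qed

lemma outputs_sets:
  assumes P: "{x. P x} \<in> sets borel"
  shows "{\<omega> \<in> space random_source. \<exists>\<eta>. outputs c \<omega> s \<eta> \<and> P \<eta>} \<in> sets random_source"
proof -
  have ms: "msr (\<lambda>_. s)" by (simp add: msr_def)
  let ?r = "\<lambda>n \<omega>. case ev n c \<omega> s of None \<Rightarrow> s | Some s' \<Rightarrow> s'"
  have "{\<omega> \<in> space random_source. \<exists>\<eta>. outputs c \<omega> s \<eta> \<and> P \<eta>} =
    (\<Union>n. {\<omega> \<in> space random_source. ev n c \<omega> s \<noteq> None} \<inter> ((\<lambda>\<omega>. rmem (?r n \<omega>) 0) -` {x. P x} \<inter> space random_source))"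
    (is "?L = ?R")
  proof (intro set_eqI iffI)
    fix \<omega> assume "\<omega> \<in> ?L"
    then obtain k s' where "\<omega> \<in> space random_source" "exec \<omega> c s k s'" "P (rmem s' 0)" by (auto simp: outputs_def)
    then show "\<omega> \<in> ?R" using ev_complete[of \<omega> c s k s' k] by (intro UN_I[of k]) auto
  next
    fix \<omega> assume "\<omega> \<in> ?R"
    then obtain n s' where "\<omega> \<in> space random_source" "ev n c \<omega> s = Some s'" "P (rmem s' 0)" by auto
    then show "\<omega> \<in> ?L" using ev_sound[of n c \<omega> s s'] by (auto simp: outputs_def)
  qed
  also have "\<dots> \<in> sets random_source"
  proof (intro sets.countable_UN image_subsetI)
    fix n
    from msr_ev[OF ms, of n c] have "Measurable.pred random_source (\<lambda>\<omega>. ev n c \<omega> s \<noteq> None)"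
      and "(\<lambda>\<omega>. rmem (?r n \<omega>) 0) \<in> borel_measurable random_source" by (auto simp: msr_def)
    from measurable_sets[OF this(2) P] this(1)
    show "{\<omega> \<in> space random_source. ev n c \<omega> s \<noteq> None} \<inter> ((\<lambda>\<omega>. rmem (?r n \<omega>) 0) -` {x. P x} \<inter> space random_source) \<in> sets random_source"
      by (simp only: pred_def sets.Int)
  qed
  finally show ?thesis .
qed

subsection \<open>Randomness consumption\<close>

lemma exec_pos_mono: "exec \<omega> c s k s' \<Longrightarrow> pos s \<le> pos s'"
  by (induction rule: exec.induct) auto

text \<open>A run is determined by the values it consumes, so the state reached by the first phase
  stays fixed when all later positions are resampled.\<close>

lemma exec_cong_source:
  "exec \<omega> c s k s' \<Longrightarrow> (\<And>j. j < pos s' \<Longrightarrow> \<omega> j = \<omega>' j) \<Longrightarrow> exec \<omega>' c s k s'"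
proof (induction rule: exec.induct)
  case (Sample a s)
  then have "\<omega> (pos s) = \<omega>' (pos s)" by simp
  then show ?case using exec.Sample[of \<omega>' a s] by simp
next
  case (Seq c s k s' c' k' s'')
  then show ?case using exec_pos_mono[OF Seq.hyps(2)] by (meson exec.Seq less_le_trans)
next
  case (WhileTrue b s c k s' k' s'')
  then show ?case using exec_pos_mono[OF WhileTrue.hyps(3)] by (meson exec.WhileTrue less_le_trans)
qed (auto intro: exec.intros simp del: One_nat_def)

subsection \<open>Memory layout and program constructs\<close>

text \<open>Cell \<open>i\<close> of array \<open>t < 64\<close> is stored at address \<open>64 * i + t\<close>, so that arrays never overlap and
  no multiplication is needed to address them. Scalars are arrays used at index 0 only. Real arrays
  are shifted behind the input by the offset stored in scalar 4.\<close>

definition ad :: "nat \<Rightarrow> nat \<Rightarrow> nat" where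
  "ad t i = 64 * i + t"

lemma ad_eq [simp]: "t < 64 \<Longrightarrow> u < 64 \<Longrightarrow> ad t i = ad u j \<longleftrightarrow> t = u \<and> i = j"
proof
  assume tu: "t < 64" "u < 64" and "ad t i = ad u j"
  then have e: "t + i * 64 = u + j * 64" by (simp add: ad_def)
  have "(t + i * 64) mod 64 = (u + j * 64) mod 64" "(t + i * 64) div 64 = (u + j * 64) div 64"
    using e by (simp_all only:)
  then show "t = u \<and> i = j" using tu by (simp only: mod_mult_self1 div_mult_self1 mod_less div_less) simp
qed simp

definition dbl :: "nexp \<Rightarrow> nexp" where "dbl e = NAdd e e"
text \<open>Six doublings produce the factor 64. The expression contains 64 copies of
  \<open>e\<close>, but its size is part of the program text and hence a constant.\<close>

definition ix :: "nat \<Rightarrow> nexp \<Rightarrow> nexp" where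
  "ix t e = NAdd (dbl (dbl (dbl (dbl (dbl (dbl e)))))) (NConst t)"
definition v :: "nat \<Rightarrow> nexp" where "v t = NLoad (NConst t)"
definition na :: "nat \<Rightarrow> nexp \<Rightarrow> nexp" where "na t e = NLoad (ix t e)"
definition rx :: "nat \<Rightarrow> nexp \<Rightarrow> nexp" where "rx t e = NAdd (v 4) (ix t e)"
definition ra :: "nat \<Rightarrow> nexp \<Rightarrow> rexp" where "ra t e = RLoad (rx t e)"
definition rv :: "nat \<Rightarrow> rexp" where "rv t = ra t (NConst 0)"
definition vset :: "nat \<Rightarrow> nexp \<Rightarrow> com" where "vset t e = NStore (NConst t) e"
definition naset :: "nat \<Rightarrow> nexp \<Rightarrow> nexp \<Rightarrow> com" where "naset t e f = NStore (ix t e) f"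
definition raset :: "nat \<Rightarrow> nexp \<Rightarrow> rexp \<Rightarrow> com" where "raset t e f = RStore (rx t e) f"
definition rset :: "nat \<Rightarrow> rexp \<Rightarrow> com" where "rset t f = raset t (NConst 0) f"
definition rsample :: "nat \<Rightarrow> nexp \<Rightarrow> com" where "rsample t e = Sample (rx t e)"
definition For :: "nat \<Rightarrow> nexp \<Rightarrow> com \<Rightarrow> com" where
  "For t e c = Seq (vset t (NConst 0)) (While (NLess (v t) e) (Seq c (vset t (NAdd (v t) (NConst 1)))))"

lemma ad_0: "ad t 0 = t" by (simp add: ad_def)

lemma nval_dbl [simp]: "nval (dbl e) s = 2 * nval e s"
  by (simp add: dbl_def)

lemma nval_ix [simp]: "nval (ix t e) s = ad t (nval e s)"
  by (simp add: ix_def ad_def)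

lemma nval_exps [simp]:
  "nval (v t) s = nmem s (ad t 0)" "nval (na t e) s = nmem s (ad t (nval e s))"
  "nval (rx t e) s = nmem s (ad 4 0) + ad t (nval e s)"
  "rval (ra t e) s = rmem s (nmem s (ad 4 0) + ad t (nval e s))"
  "rval (rv t) s = rmem s (nmem s (ad 4 0) + ad t 0)"
  by (simp_all add: v_def na_def rx_def ra_def rv_def ad_0)

section \<open>A calculus for total correctness with time bounds\<close>

definition setn :: "state \<Rightarrow> nat \<Rightarrow> nat \<Rightarrow> state" where
  "setn s a x = s\<lparr>nmem := (nmem s)(a := x)\<rparr>"
definition setr :: "state \<Rightarrow> nat \<Rightarrow> real \<Rightarrow> state" where
  "setr s a x = s\<lparr>rmem := (rmem s)(a := x)\<rparr>"
definition tick :: "state \<Rightarrow> state" where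
  "tick s = s\<lparr>pos := Suc (pos s)\<rparr>"

lemma set_simps [simp]:
  "nmem (setn s a x) b = (if b = a then x else nmem s b)" "rmem (setn s a x) = rmem s" "pos (setn s a x) = pos s"
  "rmem (setr s a y) b = (if b = a then y else rmem s b)" "nmem (setr s a y) = nmem s" "pos (setr s a y) = pos s"
  "nmem (tick s) = nmem s" "rmem (tick s) = rmem s" "pos (tick s) = Suc (pos s)"
  by (simp_all add: setn_def setr_def tick_def)

text \<open>The postcondition may itself be an \<open>hx\<close> statement about the rest of the
  program, so sequences are verified by nesting, and their costs add up.\<close>

definition hx :: "(nat \<Rightarrow> real) \<Rightarrow> com \<Rightarrow> nat \<Rightarrow> state \<Rightarrow> (state \<Rightarrow> bool) \<Rightarrow> bool" where
  "hx \<omega> c K s Q \<longleftrightarrow> (\<exists>k s'. exec \<omega> c s k s' \<and> k \<le> K \<and> Q s')"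

lemma hx_mono: "hx \<omega> c K s Q \<Longrightarrow> K \<le> K' \<Longrightarrow> (\<And>s'. Q s' \<Longrightarrow> Q' s') \<Longrightarrow> hx \<omega> c K' s Q'"
  unfolding hx_def by (meson le_trans)

lemma hx_skip: "Q s \<Longrightarrow> hx \<omega> Skip 1 s Q"
  unfolding hx_def using exec.Skip by blast

lemma hx_seq: "hx \<omega> c K s (\<lambda>s1. hx \<omega> c' K' s1 Q) \<Longrightarrow> hx \<omega> (Seq c c') (K + K') s Q"
  unfolding hx_def by (meson add_mono exec.Seq)

lemma hx_nstore: "Q (setn s (nval a s) (nval e s)) \<Longrightarrow> hx \<omega> (NStore a e) 1 s Q"
  unfolding hx_def setn_def using exec.NStore by blast

lemma hx_rstore: "Q (setr s (nval a s) (rval e s)) \<Longrightarrow> hx \<omega> (RStore a e) 1 s Q"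
  unfolding hx_def setr_def using exec.RStore by blast

lemma hx_vset: "Q (setn s (ad t 0) (nval e s)) \<Longrightarrow> hx \<omega> (vset t e) 1 s Q"
  unfolding vset_def by (rule hx_nstore) (simp add: ad_def)

lemma hx_naset: "Q (setn s (ad t (nval e s)) (nval f s)) \<Longrightarrow> hx \<omega> (naset t e f) 1 s Q"
  unfolding naset_def by (rule hx_nstore) simp

lemma hx_raset: "Q (setr s (nmem s (ad 4 0) + ad t (nval e s)) (rval f s)) \<Longrightarrow> hx \<omega> (raset t e f) 1 s Q"
  unfolding raset_def by (rule hx_rstore) simp

lemma hx_rset: "Q (setr s (nmem s (ad 4 0) + ad t 0) (rval f s)) \<Longrightarrow> hx \<omega> (rset t f) 1 s Q"
  unfolding rset_def by (rule hx_raset) simp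

lemma hx_rsample: "Q (tick (setr s (nmem s (ad 4 0) + ad t (nval e s)) (\<omega> (pos s)))) \<Longrightarrow> hx \<omega> (rsample t e) 1 s Q"
  unfolding hx_def rsample_def
  by (intro exI conjI, rule exec.Sample) (simp_all add: setr_def tick_def)

lemma hx_cond: "(bval b s \<Longrightarrow> hx \<omega> c K s Q) \<Longrightarrow> (\<not> bval b s \<Longrightarrow> hx \<omega> c' K s Q) \<Longrightarrow> hx \<omega> (Cond b c c') (Suc K) s Q"
  unfolding hx_def by (cases "bval b s") (meson exec.CondTrue exec.CondFalse Suc_le_mono)+

text \<open>\<open>j\<close> bounds the number of remaining rounds. A round costs the body and one
  test; the final 1 is the failing test.\<close>

lemma hx_while:
  assumes "\<And>j s. I j s \<Longrightarrow> bval b s \<Longrightarrow> \<exists>j'. j = Suc j' \<and> hx \<omega> c K s (I j')"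
    and "\<And>j s. I j s \<Longrightarrow> \<not> bval b s \<Longrightarrow> Q s"
  shows "I j s \<Longrightarrow> hx \<omega> (While b c) (j * (K + 1) + 1) s Q"
proof (induction j arbitrary: s)
  case 0
  then have nb: "\<not> bval b s" using assms(1)[of 0 s] by auto
  then show ?case unfolding hx_def using exec.WhileFalse[OF nb] assms(2)[OF 0 nb] by (intro exI conjI) auto
next
  case (Suc j)
  show ?case
  proof (cases "bval b s")
    case True
    then obtain k s1 where 1: "exec \<omega> c s k s1" "k \<le> K" "I j s1"
      using assms(1)[OF Suc.prems] unfolding hx_def by auto
    obtain k' s2 where 2: "exec \<omega> (While b c) s1 k' s2" "k' \<le> j * (K + 1) + 1" "Q s2"
      using Suc.IH[OF 1(3)] unfolding hx_def by auto
    show ?thesis unfolding hx_def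
      using exec.WhileTrue[OF True 1(1) 2(1)] 1(2) 2(2,3) by (intro exI conjI) auto
  next
    case False
    then show ?thesis unfolding hx_def using exec.WhileFalse[OF False] assms(2)[OF Suc.prems] by (intro exI conjI) auto
  qed
qed

text \<open>\<open>K + 2\<close> pays for body, test and increment, and the last 2 for the
  initialisation and the failing test. The bound \<open>e\<close> is evaluated anew in every round,
  so the invariant has to keep its value at \<open>n\<close>.\<close>

lemma hx_for:
  assumes init: "I 0 (setn s (ad t 0) 0)"
    and bound: "\<And>j s. I j s \<Longrightarrow> nval e s = n \<and> nmem s (ad t 0) = j"
    and step: "\<And>j s. j < n \<Longrightarrow> I j s \<Longrightarrow> hx \<omega> c K s (\<lambda>s'. nmem s' (ad t 0) = j \<and> I (Suc j) (setn s' (ad t 0) (Suc j)))"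
    and fin: "\<And>s. I n s \<Longrightarrow> Q s"
  shows "hx \<omega> (For t e c) (n * (K + 2) + 2) s Q"
proof -
  let ?I = "\<lambda>j s. \<exists>i. i + j = n \<and> I i s"
  have "hx \<omega> (While (NLess (v t) e) (Seq c (vset t (NAdd (v t) (NConst 1))))) (n * (K + 1 + 1) + 1) (setn s (ad t 0) 0) Q"
  proof (rule hx_while[where I = ?I])
    fix j s assume I: "?I j s" and b: "bval (NLess (v t) e) s"
    from I obtain i where i: "i + j = n" "I i s" by blast
    have "i < n" using b bound[OF i(2)] by simp
    then obtain j' where j: "j = Suc j'" using i by (cases j) auto
    have "hx \<omega> (Seq c (vset t (NAdd (v t) (NConst 1)))) (K + 1) s (?I j')"
    proof (rule hx_seq, rule hx_mono[OF step[OF \<open>i < n\<close> i(2)] order_refl])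
      fix s' assume s': "nmem s' (ad t 0) = i \<and> I (Suc i) (setn s' (ad t 0) (Suc i))"
      show "hx \<omega> (vset t (NAdd (v t) (NConst 1))) 1 s' (?I j')"
        by (rule hx_vset) (use s' i j in \<open>auto intro!: exI[of _ "Suc i"]\<close>)
    qed
    then show "\<exists>j'. j = Suc j' \<and> hx \<omega> (Seq c (vset t (NAdd (v t) (NConst 1)))) (K + 1) s (?I j')" using j by blast
  next
    fix j s assume I: "?I j s" and b: "\<not> bval (NLess (v t) e) s"
    from I obtain i where i: "i + j = n" "I i s" by blast
    then have "i = n" using b bound[OF i(2)] by simp
    then show "Q s" using i fin by blast
  qed (use init in auto)
  then have "hx \<omega> (For t e c) (1 + (n * (K + 1 + 1) + 1)) s Q"
    unfolding For_def by (intro hx_seq hx_vset) simp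
  then show ?thesis by (rule hx_mono) auto
qed

definition same :: "nat \<Rightarrow> nat set \<Rightarrow> nat set \<Rightarrow> state \<Rightarrow> state \<Rightarrow> bool" where
  "same rb TN TR s s' \<longleftrightarrow> (\<forall>t i. t < 64 \<longrightarrow> t \<notin> TN \<longrightarrow> nmem s' (ad t i) = nmem s (ad t i)) \<and>
    (\<forall>t i. t < 64 \<longrightarrow> t \<notin> TR \<longrightarrow> rmem s' (rb + ad t i) = rmem s (rb + ad t i))"

lemma same_refl [simp]: "same rb TN TR s s"
  by (simp add: same_def)

lemma same_setn: "same rb TN TR s0 s \<Longrightarrow> t \<in> TN \<Longrightarrow> t < 64 \<Longrightarrow> same rb TN TR s0 (setn s (ad t i) x)"
  by (auto simp: same_def)

lemma same_setr: "same rb TN TR s0 s \<Longrightarrow> t \<in> TR \<Longrightarrow> t < 64 \<Longrightarrow> same rb TN TR s0 (setr s (rb + ad t i) x)"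
  by (auto simp: same_def)

lemma same_tick: "same rb TN TR s0 s \<Longrightarrow> same rb TN TR s0 (tick s)"
  by (auto simp: same_def)

lemmas same_intros = same_setn same_setr same_tick

lemma same_nD: "same rb TN TR s s' \<Longrightarrow> t < 64 \<Longrightarrow> t \<notin> TN \<Longrightarrow> nmem s' (ad t i) = nmem s (ad t i)"
  by (simp add: same_def)

lemma same_rD: "same rb TN TR s s' \<Longrightarrow> t < 64 \<Longrightarrow> t \<notin> TR \<Longrightarrow> rmem s' (rb + ad t i) = rmem s (rb + ad t i)"
  by (simp add: same_def)

lemma same_trans: "same rb TN TR s s' \<Longrightarrow> same rb TN' TR' s' s'' \<Longrightarrow> TN' \<subseteq> TN \<Longrightarrow> TR' \<subseteq> TR \<Longrightarrow> same rb TN TR s s''"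
  unfolding same_def by (metis subsetD)

text \<open>\<open>P\<close> is the number of leaves of the tournament tree, whose nodes are
  numbered from 1 to \<open>2 * P - 1\<close> as in a heap; \<open>2 * P \<le> 2 ^ q\<close> bounds
  the number of halvings from a leaf to the root by \<open>q\<close>. \<open>inp\<close> is the
  initial real memory, whose first \<open>rb\<close> cells are the input.\<close>

locale machine =
  fixes mA mB d N rb P q k :: nat and inp :: "nat \<Rightarrow> real"
  assumes N: "N = mA + mB" and rb: "rb = N * d + 1" and P: "N \<le> P" "2 * P \<le> 2 ^ q" and mB: "0 < mB" and q2: "2 \<le> q"
begin

text \<open>Scalars: 0 to 2 input, 3 \<open>N\<close>, 4 \<open>rb\<close>, 5 \<open>P\<close>, 6 \<open>q\<close>, 7 \<open>k\<close>. Integer arrays: 20 offsets of the input points, 21 halves,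
  22 tournament tree, 23 order computed by the last sort. Real arrays: 1 sorting keys, 2 images on the line, 3 crude distances,
  4 projection matrix, 5 embedded points; \<open>N\<close> is also the index of a sentinel key. All other tags are temporary.\<close>

definition ctx :: "state \<Rightarrow> bool" where
  "ctx s \<longleftrightarrow> nmem s (ad 0 0) = mA \<and> nmem s (ad 1 0) = mB \<and> nmem s (ad 2 0) = d \<and> nmem s (ad 3 0) = N \<and>
    nmem s (ad 4 0) = rb \<and> nmem s (ad 5 0) = P \<and> nmem s (ad 6 0) = q \<and> nmem s (ad 7 0) = k \<and>
    (\<forall>j<N. nmem s (ad 20 j) = 1 + j * d) \<and> (\<forall>x<2 * P. 2 \<le> x \<longrightarrow> nmem s (ad 21 x) = x div 2) \<and>
    (\<forall>j<rb. rmem s j = inp j)"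

lemma ctxD:
  assumes "ctx s"
  shows "nmem s (ad 0 0) = mA" "nmem s (ad 1 0) = mB" "nmem s (ad 2 0) = d" "nmem s (ad 3 0) = N"
    "nmem s (ad 4 0) = rb" "nmem s (ad 5 0) = P" "nmem s (ad 6 0) = q" "nmem s (ad 7 0) = k"
    "j < N \<Longrightarrow> nmem s (ad 20 j) = 1 + j * d" "x < 2 * P \<Longrightarrow> 2 \<le> x \<Longrightarrow> nmem s (ad 21 x) = x div 2"
    "y < rb \<Longrightarrow> rmem s y = inp y"
  using assms by (auto simp: ctx_def)

lemma ctx_setn: "t < 64 \<Longrightarrow> 8 \<le> t \<Longrightarrow> t \<noteq> 20 \<Longrightarrow> t \<noteq> 21 \<Longrightarrow> ctx (setn s (ad t i) x) = ctx s"
  by (auto simp: ctx_def)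

lemma ctx_setr: "ctx (setr s (rb + y) x) = ctx s"
  by (auto simp: ctx_def)

lemma ctx_tick: "ctx (tick s) = ctx s"
  by (auto simp: ctx_def)

lemmas ctx_upd = ctx_setn ctx_setr ctx_tick

lemma N_pos: "0 < N" using N mB by simp

subsection \<open>Tournament sort\<close>

definition fixc :: com where
  "fixc = Cond (RLess (ra 1 (na 22 (NAdd (dbl (v 16)) (NConst 1)))) (ra 1 (na 22 (dbl (v 16)))))
    (naset 22 (v 16) (na 22 (NAdd (dbl (v 16)) (NConst 1)))) (naset 22 (v 16) (na 22 (dbl (v 16))))"

text \<open>The sentinel key is one more than the maximum, so that empty leaves lose against every
  point.\<close>

definition sort_max :: com where
  "sort_max = Seq (rset 6 (ra 1 (NConst 0))) (Seq (For 15 (v 3) (Cond (RLess (rv 6) (ra 1 (v 15))) (rset 6 (ra 1 (v 15))) Skip))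
    (raset 1 (v 3) (RAdd (rv 6) (ROfNat (NConst 1)))))"

definition sort_leaves :: com where
  "sort_leaves = For 15 (v 5) (Cond (NLess (v 15) (v 3)) (naset 22 (NAdd (v 5) (v 15)) (v 15)) (naset 22 (NAdd (v 5) (v 15)) (v 3)))"

definition sort_build :: com where
  "sort_build = Seq (vset 16 (v 5)) (While (NLess (NConst 1) (v 16)) (Seq (vset 16 (NSub (v 16) (NConst 1))) fixc))"

definition sort_extract :: com where
  "sort_extract = For 15 (v 3) (Seq (naset 23 (v 15) (na 22 (NConst 1))) (Seq (vset 16 (NAdd (v 5) (na 22 (NConst 1))))
    (Seq (naset 22 (v 16) (v 3)) (While (NLess (NConst 1) (v 16)) (Seq (vset 16 (na 21 (v 16))) fixc)))))"

text \<open>A tournament sorts in \<open>O(N q)\<close> steps with loops alone. On the way to the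
  root, parents are read from the array of halves, since integers cannot be divided.\<close>

definition sortc :: com where
  "sortc = Seq sort_max (Seq sort_leaves (Seq sort_build sort_extract))"

definition good :: "(nat \<Rightarrow> real) \<Rightarrow> (nat \<Rightarrow> nat) \<Rightarrow> nat \<Rightarrow> bool" where
  "good key T x \<longleftrightarrow> (T x = T (2 * x) \<or> T x = T (2 * x + 1)) \<and> key (T x) \<le> key (T (2 * x)) \<and> key (T x) \<le> key (T (2 * x + 1))"

definition leaves :: "nat set \<Rightarrow> (nat \<Rightarrow> nat) \<Rightarrow> bool" where
  "leaves L T \<longleftrightarrow> (\<forall>j<P. T (P + j) = (if j \<in> L then j else N))"

lemma good_upd: "good key T x \<Longrightarrow> y \<noteq> x \<Longrightarrow> y \<noteq> 2 * x \<Longrightarrow> y \<noteq> 2 * x + 1 \<Longrightarrow> good key (T(y := z)) x"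
  by (simp add: good_def)

text \<open>The parameter \<open>x0\<close> covers a tree under construction, in which only the
  nodes from \<open>x0\<close> on are correct; the induction starts at the leaves.\<close>

lemma tournament_mem:
  assumes l: "leaves L T" and g: "\<And>x. x0 \<le> x \<Longrightarrow> x < P \<Longrightarrow> good key T x" and x: "x0 \<le> x" "1 \<le> x" "x < 2 * P"
  shows "T x \<in> insert N L"
  using x
proof (induction "2 * P - x" arbitrary: x rule: less_induct)
  case less
  show ?case
  proof (cases "x < P")
    case True
    have "T (2 * x) \<in> insert N L" "T (2 * x + 1) \<in> insert N L"
      by (rule less.hyps; use less.prems True in linarith)+
    then show ?thesis using g[OF less.prems(1) True] by (auto simp: good_def)
  next
    case False
    then have "x = P + (x - P)" "x - P < P" using less.prems by auto
    then show ?thesis using l unfolding leaves_def by (metis insert_iff)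
  qed
qed

lemma tournament_min:
  assumes g: "\<And>x. 1 \<le> x \<Longrightarrow> x < P \<Longrightarrow> good key T x" and x: "1 \<le> x" "x < 2 * P"
  shows "key (T 1) \<le> key (T x)"
  using x
proof (induction x rule: less_induct)
  case (less x)
  show ?case
  proof (cases "x = 1")
    case False
    let ?y = "x div 2"
    have y: "1 \<le> ?y" "?y < P" "?y < x" using less.prems False by auto
    have "key (T 1) \<le> key (T ?y)" using less.IH[OF y(3) y(1)] y less.prems by auto
    also have "\<dots> \<le> key (T x)"
    proof -
      have "x = 2 * ?y \<or> x = 2 * ?y + 1" by auto
      then show ?thesis using g[OF y(1,2)] unfolding good_def by metis
    qed
    finally show ?thesis .
  qed simp
qed

lemma tournament_winner:
  assumes l: "leaves L T" and g: "\<And>x. 1 \<le> x \<Longrightarrow> x < P \<Longrightarrow> good key T x"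
    and L: "L \<subseteq> {..<N}" "L \<noteq> {}" and key: "\<And>j. j < N \<Longrightarrow> key j < key N"
  shows "T 1 \<in> L" "\<And>j. j \<in> L \<Longrightarrow> key (T 1) \<le> key j"
proof -
  show m: "key (T 1) \<le> key j" if "j \<in> L" for j
  proof -
    have j: "j < P" using that L P by auto
    then have "T (P + j) = j" using l that by (simp add: leaves_def)
    moreover have "key (T 1) \<le> key (T (P + j))" using j by (intro tournament_min g) auto
    ultimately show ?thesis by simp
  qed
  have "T 1 \<in> insert N L" using tournament_mem[OF l g, of 1 1] P N_pos by auto
  moreover have "T 1 \<noteq> N"
  proof
    assume "T 1 = N"
    obtain j where "j \<in> L" using L by blast
    then show False using m[of j] key[of j] \<open>T 1 = N\<close> L by auto
  qed
  ultimately show "T 1 \<in> L" by simp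
qed

abbreviation sN :: "nat set" where "sN \<equiv> {15, 16, 22, 23}"
abbreviation sR :: "nat set" where "sR \<equiv> {1, 6}"

definition keyed :: "(nat \<Rightarrow> real) \<Rightarrow> state \<Rightarrow> state \<Rightarrow> bool" where
  "keyed key s0 s \<longleftrightarrow> ctx s \<and> same rb sN sR s0 s \<and> pos s = pos s0 \<and> (\<forall>j\<le>N. rmem s (rb + ad 1 j) = key j)"

abbreviation tree :: "state \<Rightarrow> nat \<Rightarrow> nat" where
  "tree s \<equiv> \<lambda>x. nmem s (ad 22 x)"

lemma keyed_setn: "keyed key s0 s \<Longrightarrow> t \<in> sN \<Longrightarrow> keyed key s0 (setn s (ad t i) x)"
  by (auto simp: keyed_def ctx_upd same_intros)

lemma hx_fix:
  assumes k: "keyed key s0 s" and c: "tree s (2 * x) \<le> N" "tree s (2 * x + 1) \<le> N" and x: "nmem s (ad 16 0) = x" "1 \<le> x"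
    and Q: "\<And>y. good key ((tree s)(x := y)) x \<Longrightarrow> y \<le> N \<Longrightarrow> Q (setn s (ad 22 x) y)"
  shows "hx \<omega> fixc 2 s Q"
proof -
  let ?a = "tree s (2 * x)" and ?b = "tree s (2 * x + 1)"
  have key: "rmem s (rb + ad 1 j) = key j" if "j \<le> N" for j using k that by (simp add: keyed_def)
  have rb4: "nmem s (ad 4 0) = rb" using k by (simp add: keyed_def ctxD)
  have "hx \<omega> fixc (Suc 1) s Q"
    unfolding fixc_def
  proof (rule hx_cond)
    assume b: "bval (RLess (ra 1 (na 22 (NAdd (dbl (v 16)) (NConst 1)))) (ra 1 (na 22 (dbl (v 16))))) s"
    have "key ?b < key ?a" using b key[OF c(1)] key[OF c(2)] by (simp add: rb4 x)
    then have "Q (setn s (ad 22 x) ?b)" using c by (intro Q) (auto simp: good_def)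
    then show "hx \<omega> (naset 22 (v 16) (na 22 (NAdd (dbl (v 16)) (NConst 1)))) 1 s Q"
      by (intro hx_naset) (simp add: x)
  next
    assume b: "\<not> bval (RLess (ra 1 (na 22 (NAdd (dbl (v 16)) (NConst 1)))) (ra 1 (na 22 (dbl (v 16))))) s"
    have "key ?a \<le> key ?b" using b key[OF c(1)] key[OF c(2)] by (simp add: rb4 x)
    then have "Q (setn s (ad 22 x) ?a)" using c x by (intro Q) (auto simp: good_def)
    then show "hx \<omega> (naset 22 (v 16) (na 22 (dbl (v 16)))) 1 s Q"
      by (intro hx_naset) (simp add: x)
  qed
  then show ?thesis by (simp add: numeral_2_eq_2)
qed

lemma hx_sort_max:
  assumes c: "ctx s"
  shows "hx \<omega> sort_max (N * 4 + 5) s (\<lambda>s'. \<exists>key. keyed key s s' \<and> (\<forall>j<N. key j = rmem s (rb + ad 1 j) \<and> key j < key N))"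
proof -
  let ?I = "\<lambda>j s'. ctx s' \<and> same rb sN sR s s' \<and> pos s' = pos s \<and> nmem s' (ad 15 0) = j \<and>
    (\<forall>i. rmem s' (rb + ad 1 i) = rmem s (rb + ad 1 i)) \<and> (\<forall>i<j. rmem s (rb + ad 1 i) \<le> rmem s' (rb + ad 6 0))"
  have "hx \<omega> sort_max (1 + ((N * (2 + 2) + 2) + 1)) s (\<lambda>s'. \<exists>key. keyed key s s' \<and> (\<forall>j<N. key j = rmem s (rb + ad 1 j) \<and> key j < key N))"
    unfolding sort_max_def
  proof (intro hx_seq hx_rset hx_raset, rule hx_for[where I = ?I])
    fix j s' assume j: "j < N" and I: "?I j s'"
    have "hx \<omega> (Cond (RLess (rv 6) (ra 1 (v 15))) (rset 6 (ra 1 (v 15))) Skip) (Suc 1) s'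
      (\<lambda>s''. nmem s'' (ad 15 0) = j \<and> ?I (Suc j) (setn s'' (ad 15 0) (Suc j)))"
      using I by (intro hx_cond hx_rset hx_skip) (auto simp: ctxD ctx_upd same_intros less_Suc_eq not_less dest: order_trans less_imp_le)
    then show "hx \<omega> (Cond (RLess (rv 6) (ra 1 (v 15))) (rset 6 (ra 1 (v 15))) Skip) 2 s'
      (\<lambda>s''. nmem s'' (ad 15 0) = j \<and> ?I (Suc j) (setn s'' (ad 15 0) (Suc j)))" by (simp add: numeral_2_eq_2)
  next
    fix s' assume I: "?I N s'"
    show "hx \<omega> (raset 1 (v 3) (RAdd (rv 6) (ROfNat (NConst 1)))) 1 s'
      (\<lambda>s'. \<exists>key. keyed key s s' \<and> (\<forall>j<N. key j = rmem s (rb + ad 1 j) \<and> key j < key N))"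
    proof (intro hx_raset)
      let ?M = "rmem s' (rb + ad 6 0)" and ?s = "setr s' (rb + ad 1 N) (rmem s' (rb + ad 6 0) + 1)"
      let ?key = "\<lambda>j. if j = N then ?M + 1 else rmem s (rb + ad 1 j)"
      have "ctx s'" using I by blast
      have "keyed ?key s ?s" using I by (auto simp: keyed_def ctx_upd same_intros)
      moreover have "?key j < ?key N" if "j < N" for j
        using I that by (auto intro: le_less_trans)
      ultimately have "\<exists>key. keyed key s ?s \<and> (\<forall>j<N. key j = rmem s (rb + ad 1 j) \<and> key j < key N)"
        by (intro exI[of _ ?key]) auto
      then show "\<exists>key. keyed key s (setr s' (nmem s' (ad 4 0) + ad 1 (nval (v 3) s')) (rval (RAdd (rv 6) (ROfNat (NConst 1))) s'))
          \<and> (\<forall>j<N. key j = rmem s (rb + ad 1 j) \<and> key j < key N)"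
        by (simp add: ctxD[OF \<open>ctx s'\<close>])
    qed
  qed (use c in \<open>auto simp: ctxD ctx_upd same_intros\<close>)
  then show ?thesis by (rule hx_mono) auto
qed

lemma hx_sort_leaves:
  assumes k: "keyed key s0 s"
  shows "hx \<omega> sort_leaves (P * 4 + 2) s (\<lambda>s'. keyed key s0 s' \<and> leaves {..<N} (tree s'))"
proof -
  let ?I = "\<lambda>j s'. keyed key s0 s' \<and> nmem s' (ad 15 0) = j \<and> (\<forall>i<j. tree s' (P + i) = (if i < N then i else N))"
  have "hx \<omega> sort_leaves (P * (2 + 2) + 2) s (\<lambda>s'. keyed key s0 s' \<and> leaves {..<N} (tree s'))"
    unfolding sort_leaves_def
  proof (rule hx_for[where I = ?I])
    fix j s' assume j: "j < P" and I: "?I j s'"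
    then have c: "ctx s'" by (simp add: keyed_def)
    have "hx \<omega> (Cond (NLess (v 15) (v 3)) (naset 22 (NAdd (v 5) (v 15)) (v 15)) (naset 22 (NAdd (v 5) (v 15)) (v 3))) (Suc 1) s'
      (\<lambda>s''. nmem s'' (ad 15 0) = j \<and> ?I (Suc j) (setn s'' (ad 15 0) (Suc j)))"
      using I by (intro hx_cond hx_naset) (auto simp: ctxD[OF c] keyed_setn less_Suc_eq)
    then show "hx \<omega> (Cond (NLess (v 15) (v 3)) (naset 22 (NAdd (v 5) (v 15)) (v 15)) (naset 22 (NAdd (v 5) (v 15)) (v 3))) 2 s'
      (\<lambda>s''. nmem s'' (ad 15 0) = j \<and> ?I (Suc j) (setn s'' (ad 15 0) (Suc j)))" by (simp add: numeral_2_eq_2)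
  next
    show "?I 0 (setn s (ad 15 0) 0)" using k by (simp add: keyed_setn)
  next
    fix j s' assume I: "?I j s'"
    then have "ctx s'" by (simp add: keyed_def)
    then show "nval (v 5) s' = P \<and> nmem s' (ad 15 0) = j" using I by (simp add: ctxD)
  qed (auto simp: leaves_def)
  then show ?thesis by (rule hx_mono) auto
qed

definition tour :: "(nat \<Rightarrow> real) \<Rightarrow> nat set \<Rightarrow> nat \<Rightarrow> (nat \<Rightarrow> nat) \<Rightarrow> bool" where
  "tour key L x0 T \<longleftrightarrow> leaves L T \<and> (\<forall>x. x0 \<le> x \<longrightarrow> x < P \<longrightarrow> 1 \<le> x \<longrightarrow> good key T x)"

lemma hx_sort_build:
  assumes k: "keyed key s0 s" and l: "leaves {..<N} (tree s)"
  shows "hx \<omega> sort_build (P * 4 + 2) s (\<lambda>s'. keyed key s0 s' \<and> tour key {..<N} 1 (tree s'))"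
proof -
  let ?I = "\<lambda>j s'. keyed key s0 s' \<and> nmem s' (ad 16 0) = Suc j \<and> Suc j \<le> P \<and> tour key {..<N} (Suc j) (tree s')"
  have Pp: "0 < P" using P N_pos by simp
  have "hx \<omega> (While (NLess (NConst 1) (v 16)) (Seq (vset 16 (NSub (v 16) (NConst 1))) fixc)) ((P - 1) * ((1 + 2) + 1) + 1) (setn s (ad 16 0) P)
    (\<lambda>s'. keyed key s0 s' \<and> tour key {..<N} 1 (tree s'))"
  proof (rule hx_while[where I = ?I])
    fix j s' assume I: "?I j s'" and b: "bval (NLess (NConst 1) (v 16)) s'"
    then obtain j' where j: "j = Suc j'" by (cases j) auto
    have l': "leaves {..<N} (tree s')" using I by (simp add: tour_def)
    have g: "good key (tree s') x" if "Suc j \<le> x" "x < P" for x using I that by (simp add: tour_def)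
    have mem: "tree s' x \<le> N" if "Suc j \<le> x" "x < 2 * P" for x
      using tournament_mem[OF l' g that(1) _ that(2)] that(1) by auto
    let ?s = "setn s' (ad 16 0) (Suc j')"
    have "hx \<omega> (Seq (vset 16 (NSub (v 16) (NConst 1))) fixc) (1 + 2) s' (?I j')"
    proof (intro hx_seq hx_vset)
      have "hx \<omega> fixc 2 ?s (?I j')"
      proof (rule hx_fix[where key = key and ?s0.0 = s0 and x = "Suc j'"])
        show "keyed key s0 ?s" using I by (simp add: keyed_setn)
        show "tree ?s (2 * Suc j') \<le> N" "tree ?s (2 * Suc j' + 1) \<le> N" using mem[of "2 * Suc j'"] mem[of "2 * Suc j' + 1"] j I by auto
        fix y assume y: "good key ((tree ?s)(Suc j' := y)) (Suc j')" "y \<le> N"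
        have T: "tree (setn ?s (ad 22 (Suc j')) y) = (tree s')(Suc j' := y)" by (auto simp: fun_eq_iff)
        have "good key ((tree s')(Suc j' := y)) x" if "Suc j' \<le> x" "x < P" for x
        proof (cases "x = Suc j'")
          case True
          moreover have "tree ?s = tree s'" by (simp add: fun_eq_iff)
          ultimately show ?thesis using y(1) by simp
        next
          case False
          then show ?thesis using that g[of x] j by (intro good_upd) auto
        qed
        moreover have "leaves {..<N} ((tree s')(Suc j' := y))"
          using l' I j by (auto simp: leaves_def)
        ultimately have "tour key {..<N} (Suc j') (tree (setn ?s (ad 22 (Suc j')) y))"
          unfolding T tour_def by blast
        then show "?I j' (setn ?s (ad 22 (Suc j')) y)" using I j by (auto simp: keyed_setn)
      qed auto
      then show "hx \<omega> fixc 2 (setn s' (ad 16 0) (nval (NSub (v 16) (NConst 1)) s')) (?I j')" using I j by simp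
    qed
    then show "\<exists>j'. j = Suc j' \<and> hx \<omega> (Seq (vset 16 (NSub (v 16) (NConst 1))) fixc) (1 + 2) s' (?I j')" using j by blast
  next
    fix j s' assume I: "?I j s'" and "\<not> bval (NLess (NConst 1) (v 16)) s'"
    then have "j = 0" by simp
    then show "keyed key s0 s' \<and> tour key {..<N} 1 (tree s')" using I by simp
  next
    show "?I (P - 1) (setn s (ad 16 0) P)" using k l Pp by (auto simp: keyed_setn tour_def)
  qed
  then have "hx \<omega> sort_build (1 + ((P - 1) * ((1 + 2) + 1) + 1)) s (\<lambda>s'. keyed key s0 s' \<and> tour key {..<N} 1 (tree s'))"
    unfolding sort_build_def using k by (intro hx_seq hx_vset) (auto simp: keyed_def ctxD)
  then show ?thesis using Pp by (rule_tac hx_mono) auto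
qed

text \<open>After a leaf is emptied, only its proper ancestors can violate \<open>good\<close>.
  Recomputing the parent of the current node shrinks this set by one level, and the invariant
  \<open>c < 2 ^ j\<close> limits the number of levels to \<open>q\<close>.\<close>

lemma hx_repair:
  assumes k: "keyed key s0 s" and cur: "nmem s (ad 16 0) = cur" "1 \<le> cur" "cur < 2 * P" "P \<le> cur" and l: "leaves L (tree s)" and L: "L \<subseteq> {..<N}"
    and g: "\<And>x. 1 \<le> x \<Longrightarrow> x < P \<Longrightarrow> good key (tree s) x \<or> (\<exists>i\<ge>1. x = cur div 2 ^ i)" and b: "\<And>x. 1 \<le> x \<Longrightarrow> x < 2 * P \<Longrightarrow> tree s x \<le> N"
  shows "hx \<omega> (While (NLess (NConst 1) (v 16)) (Seq (vset 16 (na 21 (v 16))) fixc)) (q * 4 + 1) s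
    (\<lambda>s'. keyed key s0 s' \<and> tour key L 1 (tree s') \<and> (\<forall>t i. t \<in> {15, 23} \<longrightarrow> nmem s' (ad t i) = nmem s (ad t i)))"
proof -
  let ?I = "\<lambda>j s'. keyed key s0 s' \<and> leaves L (tree s') \<and> (\<exists>c. nmem s' (ad 16 0) = c \<and> 1 \<le> c \<and> c < 2 * P \<and> c < 2 ^ j \<and>
    (\<forall>x. 1 \<le> x \<longrightarrow> x < P \<longrightarrow> good key (tree s') x \<or> (\<exists>i\<ge>1. x = c div 2 ^ i))) \<and> (\<forall>x. 1 \<le> x \<longrightarrow> x < 2 * P \<longrightarrow> tree s' x \<le> N) \<and>
    (\<forall>t i. t \<in> {15, 23} \<longrightarrow> nmem s' (ad t i) = nmem s (ad t i))"
  have "hx \<omega> (While (NLess (NConst 1) (v 16)) (Seq (vset 16 (na 21 (v 16))) fixc)) (q * ((1 + 2) + 1) + 1) s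
    (\<lambda>s'. keyed key s0 s' \<and> tour key L 1 (tree s') \<and> (\<forall>t i. t \<in> {15, 23} \<longrightarrow> nmem s' (ad t i) = nmem s (ad t i)))"
  proof (rule hx_while[where I = ?I])
    fix j s' assume I: "?I j s'" and bv: "bval (NLess (NConst 1) (v 16)) s'"
    then obtain c where c: "nmem s' (ad 16 0) = c" "2 \<le> c" "c < 2 * P" "c < 2 ^ j"
      and gc: "\<And>x. 1 \<le> x \<Longrightarrow> x < P \<Longrightarrow> good key (tree s') x \<or> (\<exists>i\<ge>1. x = c div 2 ^ i)" by auto
    have "j \<noteq> 0" using c by (cases j) auto
    then obtain j' where j: "j = Suc j'" by (cases j) auto
    let ?h = "c div 2"
    have h: "1 \<le> ?h" "?h < P" "?h < 2 ^ j'" using c j by auto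
    have cx: "ctx s'" using I by (simp add: keyed_def)
    let ?s = "setn s' (ad 16 0) ?h"
    have "hx \<omega> (Seq (vset 16 (na 21 (v 16))) fixc) (1 + 2) s' (?I j')"
    proof (intro hx_seq hx_vset)
      have "hx \<omega> fixc 2 ?s (?I j')"
      proof (rule hx_fix[where key = key and ?s0.0 = s0 and x = ?h])
        show "keyed key s0 ?s" using I by (simp add: keyed_setn)
        show "tree ?s (2 * ?h) \<le> N" "tree ?s (2 * ?h + 1) \<le> N" using I h by auto
        fix y assume y: "good key ((tree ?s)(?h := y)) ?h" "y \<le> N"
        have T: "tree (setn ?s (ad 22 ?h) y) = (tree s')(?h := y)" by (auto simp: fun_eq_iff)
        have gy: "good key ((tree s')(?h := y)) x \<or> (\<exists>i\<ge>1. x = ?h div 2 ^ i)" if "1 \<le> x" "x < P" for x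
        proof (cases "x = ?h")
          case True
          moreover have "tree ?s = tree s'" by (simp add: fun_eq_iff)
          ultimately show ?thesis using y(1) by simp
        next
          case False
          show ?thesis
          proof (cases "\<exists>i\<ge>1. x = ?h div 2 ^ i")
            case no: False
            have "\<not> (\<exists>i\<ge>1. x = c div 2 ^ i)"
            proof
              assume "\<exists>i\<ge>1. x = c div 2 ^ i"
              then obtain i where i: "1 \<le> i" "x = c div 2 ^ i" by blast
              then obtain i' where i': "i = Suc i'" by (cases i) auto
              then have "x = ?h div 2 ^ i'" using i by (simp add: div_mult2_eq)
              then show False using no False by (cases i') auto
            qed
            then have "good key (tree s') x" using gc that by blast
            moreover have "?h \<noteq> 2 * x" "?h \<noteq> 2 * x + 1"
              using no by (auto simp: not_ex dest: spec[of _ 1])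
            ultimately show ?thesis using False by (intro disjI1 good_upd) auto
          qed simp
        qed
        moreover have "leaves L ((tree s')(?h := y))" using I h by (auto simp: leaves_def)
        moreover have "((tree s')(?h := y)) x \<le> N" if "1 \<le> x" "x < 2 * P" for x using I y(2) that by auto
        moreover have "keyed key s0 (setn ?s (ad 22 ?h) y)" using I by (simp add: keyed_setn)
        ultimately show "?I j' (setn ?s (ad 22 ?h) y)" unfolding T using I h y(2) by simp
      qed (use h in auto)
      then show "hx \<omega> fixc 2 (setn s' (ad 16 0) (nval (na 21 (v 16)) s')) (?I j')" using ctxD(10)[OF cx c(3,2)] c(1) by simp
    qed
    then show "\<exists>j'. j = Suc j' \<and> hx \<omega> (Seq (vset 16 (na 21 (v 16))) fixc) (1 + 2) s' (?I j')" using j by blast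
  next
    fix j s' assume I: "?I j s'" and nb: "\<not> bval (NLess (NConst 1) (v 16)) s'"
    then have "good key (tree s') x" if "1 \<le> x" "x < P" for x
    proof -
      have "nmem s' (ad 16 0) = 1" using I nb by auto
      then have "good key (tree s') x \<or> (\<exists>i\<ge>1. x = 1 div 2 ^ i)" using I that by auto
      moreover have "x \<noteq> 1 div 2 ^ i" if "1 \<le> i" for i :: nat
      proof -
        have "(1::nat) < 2 ^ i" using that by (intro one_less_power) auto
        then have "(1::nat) div 2 ^ i = 0" by simp
        then show ?thesis using \<open>1 \<le> x\<close> by simp
      qed
      ultimately show ?thesis by blast
    qed
    then show "keyed key s0 s' \<and> tour key L 1 (tree s') \<and> (\<forall>t i. t \<in> {15, 23} \<longrightarrow> nmem s' (ad t i) = nmem s (ad t i))"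
      using I by (simp add: tour_def)
  next
    have "cur < 2 ^ q" using cur P by linarith
    then show "?I q s" using k cur l g b by auto
  qed
  then show ?thesis by (rule hx_mono) auto
qed

definition sorted_by :: "(nat \<Rightarrow> real) \<Rightarrow> (nat \<Rightarrow> nat) \<Rightarrow> nat \<Rightarrow> bool" where
  "sorted_by key od n \<longleftrightarrow> (\<forall>e<n. od e < N) \<and> inj_on od {..<n} \<and> (\<forall>e e'. e \<le> e' \<longrightarrow> e' < n \<longrightarrow> key (od e) \<le> key (od e'))"

text \<open>The candidates are the indices not yet output. The output must not only be sorted but
  also stay below all candidates, for then the next winner extends it.\<close>

lemma hx_sort_extract:
  assumes k: "keyed key s0 s" and t: "tour key {..<N} 1 (tree s)" and key: "\<And>j. j < N \<Longrightarrow> key j < key N"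
  shows "hx \<omega> sort_extract (N * (q * 4 + 6) + 2) s (\<lambda>s'. keyed key s0 s' \<and> sorted_by key (\<lambda>e. nmem s' (ad 23 e)) N)"
proof -
  let ?od = "\<lambda>s e. nmem s (ad 23 e)"
  let ?L = "\<lambda>j s. {..<N} - ?od s ` {..<j}"
  let ?I = "\<lambda>j s'. keyed key s0 s' \<and> nmem s' (ad 15 0) = j \<and> j \<le> N \<and> tour key (?L j s') 1 (tree s') \<and>
    sorted_by key (?od s') j \<and> (\<forall>e<j. \<forall>i\<in>?L j s'. key (?od s' e) \<le> key i)"
  let ?body = "Seq (naset 23 (v 15) (na 22 (NConst 1))) (Seq (vset 16 (NAdd (v 5) (na 22 (NConst 1))))
    (Seq (naset 22 (v 16) (v 3)) (While (NLess (NConst 1) (v 16)) (Seq (vset 16 (na 21 (v 16))) fixc))))"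
  have "hx \<omega> sort_extract (N * ((1 + (1 + (1 + (q * 4 + 1)))) + 2) + 2) s (\<lambda>s'. keyed key s0 s' \<and> sorted_by key (\<lambda>e. nmem s' (ad 23 e)) N)"
    unfolding sort_extract_def
  proof (rule hx_for[where I = ?I])
    fix j s' assume j: "j < N" and I: "?I j s'"
    let ?w = "tree s' 1"
    have c: "ctx s'" using I by (simp add: keyed_def)
    have l: "leaves (?L j s') (tree s')" and g: "\<And>x. 1 \<le> x \<Longrightarrow> x < P \<Longrightarrow> good key (tree s') x"
      using I by (auto simp: tour_def)
    have "card (?od s' ` {..<j}) \<le> j" using card_image_le[of "{..<j}" "?od s'"] by simp
    then have "?L j s' \<noteq> {}" using j card_mono[of "?od s' ` {..<j}" "{..<N}"] by auto
    note win = tournament_winner[OF l g _ this key]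
    have w: "?w \<in> ?L j s'" "\<And>i. i \<in> ?L j s' \<Longrightarrow> key ?w \<le> key i" using win by auto
    then have wN: "?w < N" "?w < P" using P by auto
    let ?s3 = "setn (setn (setn s' (ad 23 j) ?w) (ad 16 0) (P + ?w)) (ad 22 (P + ?w)) N"
    let ?L' = "?L j s' - {?w}"
    have tr: "tree ?s3 = (tree s')(P + ?w := N)" by (auto simp: fun_eq_iff)
    have od: "?od ?s3 = (?od s')(j := ?w)" by (auto simp: fun_eq_iff)
    have rep: "hx \<omega> (While (NLess (NConst 1) (v 16)) (Seq (vset 16 (na 21 (v 16))) fixc)) (q * 4 + 1) ?s3
      (\<lambda>s''. keyed key s0 s'' \<and> tour key ?L' 1 (tree s'') \<and> (\<forall>t i. t \<in> {15, 23} \<longrightarrow> nmem s'' (ad t i) = nmem ?s3 (ad t i)))"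
    proof (rule hx_repair[where cur = "P + ?w"])
      show "keyed key s0 ?s3" using I by (simp add: keyed_setn)
      show "leaves ?L' (tree ?s3)" unfolding tr using l by (auto simp: leaves_def)
      fix x :: nat assume x: "1 \<le> x"
      show "good key (tree ?s3) x \<or> (\<exists>i\<ge>1. x = (P + ?w) div 2 ^ i)" if "x < P"
      proof (cases "P + ?w = 2 * x \<or> P + ?w = 2 * x + 1")
        case True
        then have "x = (P + ?w) div 2 ^ 1" by auto
        then show ?thesis by blast
      next
        case False
        then show ?thesis unfolding tr using g[OF x that] that by (intro disjI1 good_upd) auto
      qed
      show "tree ?s3 x \<le> N" if "x < 2 * P"
        using tournament_mem[OF l g _ x that, of 1] x unfolding tr by auto
    qed (use wN N_pos P in auto)
    have fin: "nmem s'' (ad 15 0) = j \<and> ?I (Suc j) (setn s'' (ad 15 0) (Suc j))"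
      if s'': "keyed key s0 s'' \<and> tour key ?L' 1 (tree s'') \<and> (\<forall>t i. t \<in> {15, 23} \<longrightarrow> nmem s'' (ad t i) = nmem ?s3 (ad t i))" for s''
    proof -
      have od2: "?od (setn s'' (ad 15 0) (Suc j)) = (?od s')(j := ?w)" using s'' od by (auto simp: fun_eq_iff)
      have L2: "?L (Suc j) (setn s'' (ad 15 0) (Suc j)) = ?L'"
        unfolding od2 by (auto simp: less_Suc_eq)
      have tr2: "tree (setn s'' (ad 15 0) (Suc j)) = tree s''" by auto
      have so: "sorted_by key (?od s') j" and lt: "\<forall>e<j. \<forall>i\<in>?L j s'. key (?od s' e) \<le> key i" using I by auto
      have nw: "?od s' e \<noteq> ?w" if "e < j" for e using w(1) that by (metis DiffD2 imageI lessThan_iff)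
      have "inj_on ((?od s')(j := ?w)) {..<Suc j}"
        using so nw not_sym[OF nw] unfolding sorted_by_def lessThan_Suc by (auto simp: inj_on_def)
      moreover have "key (((?od s')(j := ?w)) e) \<le> key (((?od s')(j := ?w)) e')" if "e \<le> e'" "e' < Suc j" for e e'
        using so that lt w(1) unfolding sorted_by_def by (auto simp: less_Suc_eq)
      ultimately have so': "sorted_by key ((?od s')(j := ?w)) (Suc j)"
        using so wN unfolding sorted_by_def by (auto simp: less_Suc_eq)
      have lt': "\<forall>e<Suc j. \<forall>i\<in>?L'. key (((?od s')(j := ?w)) e) \<le> key i"
        using lt w(2) by (auto simp: less_Suc_eq)
      let ?s4 = "setn s'' (ad 15 0) (Suc j)"
      have ode: "nmem ?s4 (ad 23 e) = ((?od s')(j := ?w)) e" for e using fun_cong[OF od2, of e] .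
      have "tour key (?L (Suc j) ?s4) 1 (tree ?s4)" unfolding L2 tr2 using s'' by blast
      moreover have "sorted_by key (?od ?s4) (Suc j)" unfolding od2 by (rule so')
      moreover have "\<forall>e<Suc j. \<forall>i\<in>?L (Suc j) ?s4. key (?od ?s4 e) \<le> key i"
        unfolding L2 using lt' unfolding ode .
      moreover have "keyed key s0 ?s4" using s'' by (simp add: keyed_setn)
      moreover have "nmem s'' (ad 15 0) = j" using s'' I by auto
      moreover have "nmem ?s4 (ad 15 0) = Suc j" "Suc j \<le> N" using j by auto
      ultimately show ?thesis by blast
    qed
    show "hx \<omega> ?body (1 + (1 + (1 + (q * 4 + 1)))) s' (\<lambda>s''. nmem s'' (ad 15 0) = j \<and> ?I (Suc j) (setn s'' (ad 15 0) (Suc j)))"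
    proof (intro hx_seq hx_naset hx_vset)
      let ?a = "setn s' (ad 23 (nval (v 15) s')) (nval (na 22 (NConst 1)) s')"
      let ?b = "setn ?a (ad 16 0) (nval (NAdd (v 5) (na 22 (NConst 1))) ?a)"
      have "setn ?b (ad 22 (nval (v 16) ?b)) (nval (v 3) ?b) = ?s3"
        using I by (simp add: ctxD[OF c])
      then show "hx \<omega> (While (NLess (NConst 1) (v 16)) (Seq (vset 16 (na 21 (v 16))) fixc)) (q * 4 + 1)
        (setn ?b (ad 22 (nval (v 16) ?b)) (nval (v 3) ?b)) (\<lambda>s''. nmem s'' (ad 15 0) = j \<and> ?I (Suc j) (setn s'' (ad 15 0) (Suc j)))"
        using hx_mono[OF rep order_refl fin] by simp
    qed
  next
    show "?I 0 (setn s (ad 15 0) 0)" using k t by (simp add: keyed_setn sorted_by_def)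
  qed (use key in \<open>auto simp: keyed_def ctxD\<close>)
  then show ?thesis by (rule hx_mono) (auto simp: algebra_simps)
qed

definition sort_cost :: nat where
  "sort_cost = 6 + N * 4 + 2 * (P * 4 + 2) + N * (q * 4 + 6) + 2"

lemma hx_sort:
  assumes c: "ctx s"
  shows "hx \<omega> sortc sort_cost s (\<lambda>s'. ctx s' \<and> same rb sN sR s s' \<and> pos s' = pos s \<and>
    (\<forall>j<N. rmem s' (rb + ad 1 j) = rmem s (rb + ad 1 j)) \<and>
    sorted_by (\<lambda>j. rmem s (rb + ad 1 j)) (\<lambda>e. nmem s' (ad 23 e)) N)"
proof -
  let ?Q = "\<lambda>s'. ctx s' \<and> same rb sN sR s s' \<and> pos s' = pos s \<and> (\<forall>j<N. rmem s' (rb + ad 1 j) = rmem s (rb + ad 1 j)) \<and>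
    sorted_by (\<lambda>j. rmem s (rb + ad 1 j)) (\<lambda>e. nmem s' (ad 23 e)) N"
  have "hx \<omega> sortc ((N * 4 + 5) + ((P * 4 + 2) + ((P * 4 + 2) + (N * (q * 4 + 6) + 2)))) s ?Q"
    unfolding sortc_def
  proof (rule hx_seq, rule hx_mono[OF hx_sort_max[OF c] order_refl])
    fix s1 assume "\<exists>key. keyed key s s1 \<and> (\<forall>j<N. key j = rmem s (rb + ad 1 j) \<and> key j < key N)"
    then obtain key where key: "keyed key s s1" "\<And>j. j < N \<Longrightarrow> key j = rmem s (rb + ad 1 j)" "\<And>j. j < N \<Longrightarrow> key j < key N" by blast
    show "hx \<omega> (Seq sort_leaves (Seq sort_build sort_extract)) ((P * 4 + 2) + ((P * 4 + 2) + (N * (q * 4 + 6) + 2))) s1 ?Q"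
    proof (rule hx_seq, rule hx_mono[OF hx_sort_leaves[OF key(1)] order_refl], elim conjE)
      fix s2 assume s2: "keyed key s s2" "leaves {..<N} (tree s2)"
      show "hx \<omega> (Seq sort_build sort_extract) ((P * 4 + 2) + (N * (q * 4 + 6) + 2)) s2 ?Q"
      proof (rule hx_seq, rule hx_mono[OF hx_sort_build[OF s2] order_refl], elim conjE)
        fix s3 assume s3: "keyed key s s3" "tour key {..<N} 1 (tree s3)"
        show "hx \<omega> sort_extract (N * (q * 4 + 6) + 2) s3 ?Q"
        proof (rule hx_mono[OF hx_sort_extract[OF s3 key(3)] order_refl], assumption, elim conjE)
          fix s4 assume s4: "keyed key s s4" "sorted_by key (\<lambda>e. nmem s4 (ad 23 e)) N"
          have "sorted_by (\<lambda>j. rmem s (rb + ad 1 j)) (\<lambda>e. nmem s4 (ad 23 e)) N"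
            using s4(2) key(2) unfolding sorted_by_def by auto
          then show "?Q s4" using s4(1) key(2) by (auto simp: keyed_def)
        qed
      qed
    qed
  qed
  then show ?thesis by (rule hx_mono) (auto simp: sort_cost_def)
qed

end

subsection \<open>Distances and the embedding of the points\<close>

text \<open>Both distances arise by applying \<open>dfin\<close> to a coordinatewise sum of
  \<open>dterm\<close>, so one program scheme serves them both.\<close>

definition dterm :: "bool \<Rightarrow> real \<Rightarrow> real" where
  "dterm l2 x = (if l2 then x\<^sup>2 else \<bar>x\<bar>)"

definition dfin :: "bool \<Rightarrow> real \<Rightarrow> real" where
  "dfin l2 x = (if l2 then sqrt x else x)"

context machine
begin

definition pt :: "nat \<Rightarrow> nat \<Rightarrow> real" where
  "pt x i = inp (1 + x * d + i)"

definition dst :: "bool \<Rightarrow> nat \<Rightarrow> nat \<Rightarrow> real" where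
  "dst l2 x y = dfin l2 (\<Sum>i<d. dterm l2 (pt x i - pt y i))"

text \<open>The absolute value is written as the root of the square, since expressions offer square
  roots but no absolute value.\<close>

definition distc :: "bool \<Rightarrow> com" where
  "distc l2 = Seq (vset 26 (na 20 (v 24))) (Seq (vset 27 (na 20 (v 25))) (Seq (rset 12 (ROfNat (NConst 0)))
    (Seq (For 28 (v 2) (Seq (rset 12 (RAdd (rv 12) (if l2 then RMult (RSub (RLoad (v 26)) (RLoad (v 27))) (RSub (RLoad (v 26)) (RLoad (v 27)))
        else RSqrt (RMult (RSub (RLoad (v 26)) (RLoad (v 27))) (RSub (RLoad (v 26)) (RLoad (v 27)))))))
      (Seq (vset 26 (NAdd (v 26) (NConst 1))) (vset 27 (NAdd (v 27) (NConst 1))))))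
    (rset 12 (if l2 then RSqrt (rv 12) else rv 12)))))"

lemma index_less: "x < N \<Longrightarrow> i < d \<Longrightarrow> 1 + x * d + i < rb"
proof -
  assume "x < N" "i < d"
  then have "Suc x * d \<le> N * d" by (intro mult_le_mono1) simp
  then show ?thesis using \<open>i < d\<close> rb by simp
qed

lemma hx_dist:
  assumes c: "ctx s" and x: "nmem s (ad 24 0) = x" "x < N" and y: "nmem s (ad 25 0) = y" "y < N"
  shows "hx \<omega> (distc l2) (d * 5 + 6) s (\<lambda>s'. ctx s' \<and> same rb {26, 27, 28} {12} s s' \<and> pos s' = pos s \<and> rmem s' (rb + ad 12 0) = dst l2 x y)"
proof -
  let ?I = "\<lambda>j s'. ctx s' \<and> same rb {26, 27, 28} {12} s s' \<and> pos s' = pos s \<and> nmem s' (ad 28 0) = j \<and>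
    nmem s' (ad 26 0) = 1 + x * d + j \<and> nmem s' (ad 27 0) = 1 + y * d + j \<and>
    rmem s' (rb + ad 12 0) = (\<Sum>i<j. dterm l2 (pt x i - pt y i))"
  have "hx \<omega> (distc l2) (1 + (1 + (1 + ((d * ((1 + (1 + 1)) + 2) + 2) + 1)))) s
    (\<lambda>s'. ctx s' \<and> same rb {26, 27, 28} {12} s s' \<and> pos s' = pos s \<and> rmem s' (rb + ad 12 0) = dst l2 x y)"
    unfolding distc_def
  proof (intro hx_seq hx_vset hx_rset, rule hx_for[where I = ?I])
    fix j s' assume j: "j < d" and I: "?I j s'"
    have c': "ctx s'" using I by blast
    have 1: "rmem s' (1 + x * d + j) = pt x j" "rmem s' (1 + y * d + j) = pt y j"
      using ctxD(11)[OF c'] index_less[OF x(2) j] index_less[OF y(2) j] by (simp_all add: pt_def)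
    let ?e = "if l2 then RMult (RSub (RLoad (v 26)) (RLoad (v 27))) (RSub (RLoad (v 26)) (RLoad (v 27)))
        else RSqrt (RMult (RSub (RLoad (v 26)) (RLoad (v 27))) (RSub (RLoad (v 26)) (RLoad (v 27))))"
    have 2: "rval ?e s' = dterm l2 (pt x j - pt y j)"
      using I 1 by (simp add: dterm_def power2_eq_square)
    show "hx \<omega> (Seq (rset 12 (RAdd (rv 12) ?e)) (Seq (vset 26 (NAdd (v 26) (NConst 1))) (vset 27 (NAdd (v 27) (NConst 1)))))
      (1 + (1 + 1)) s' (\<lambda>s''. nmem s'' (ad 28 0) = j \<and> ?I (Suc j) (setn s'' (ad 28 0) (Suc j)))"
      by (intro hx_seq hx_vset hx_rset, insert I) (simp add: ctxD[OF c'] ctx_upd same_intros 2 del: nval.simps(2) rval.simps(2))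
  next
    fix s' assume I: "?I d s'"
    have c': "ctx s'" using I by blast
    show "hx \<omega> (rset 12 (if l2 then RSqrt (rv 12) else rv 12)) 1 s'
      (\<lambda>s'. ctx s' \<and> same rb {26, 27, 28} {12} s s' \<and> pos s' = pos s \<and> rmem s' (rb + ad 12 0) = dst l2 x y)"
      using I by (intro hx_rset) (simp add: ctxD[OF c'] ctx_upd same_intros dst_def dfin_def)
  next
    show "nval (v 2) s' = d \<and> nmem s' (ad 28 0) = j" if "?I j s'" for j s'
      using that by (simp add: ctxD)
  qed (use c x y in \<open>simp add: ctxD[OF c] ctx_upd same_intros\<close>)
  then show ?thesis by (rule hx_mono) auto
qed

definition has_F :: "(nat \<Rightarrow> nat \<Rightarrow> real) \<Rightarrow> state \<Rightarrow> bool" where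
  "has_F X s \<longleftrightarrow> (\<forall>j<N. \<forall>i<k. rmem s (rb + ad 5 (j * k + i)) = X j i)"

lemma has_F_same: "has_F X s \<Longrightarrow> same rb TN TR s s' \<Longrightarrow> 5 \<notin> TR \<Longrightarrow> has_F X s'"
  by (simp add: has_F_def same_rD)

lemma flat_less: "x < (n::nat) \<Longrightarrow> i < m \<Longrightarrow> x * m + i < n * m"
proof -
  assume "x < n" "i < m"
  then have "Suc x * m \<le> n * m" by (intro mult_le_mono1) simp
  then show ?thesis using \<open>i < m\<close> by simp
qed

definition copyin :: com where
  "copyin = For 10 (NSub (v 4) (NConst 1)) (raset 5 (v 10) (RLoad (NAdd (v 10) (NConst 1))))"

lemma hx_copyin:
  assumes c: "ctx s" and k: "k = d"
  shows "hx \<omega> copyin (N * d * 3 + 2) s (\<lambda>s'. ctx s' \<and> pos s' = pos s \<and> has_F pt s')"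
proof -
  let ?I = "\<lambda>j s'. ctx s' \<and> pos s' = pos s \<and> nmem s' (ad 10 0) = j \<and> (\<forall>x<j. rmem s' (rb + ad 5 x) = inp (x + 1))"
  have "hx \<omega> copyin (N * d * (1 + 2) + 2) s (\<lambda>s'. ctx s' \<and> pos s' = pos s \<and> has_F pt s')"
    unfolding copyin_def
  proof (rule hx_for[where I = ?I])
    fix j s' assume j: "j < N * d" and I: "?I j s'"
    then have c': "ctx s'" by blast
    have "rmem s' (Suc j) = inp (Suc j)" using ctxD(11)[OF c', of "Suc j"] j rb by simp
    then show "hx \<omega> (raset 5 (v 10) (RLoad (NAdd (v 10) (NConst 1)))) 1 s' (\<lambda>s''. nmem s'' (ad 10 0) = j \<and> ?I (Suc j) (setn s'' (ad 10 0) (Suc j)))"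
      using I by (intro hx_raset) (simp add: ctxD[OF c'] ctx_upd less_Suc_eq)
  next
    fix s' assume I: "?I (N * d) s'"
    have *: "rmem s' (rb + ad 5 (j * d + i)) = inp (1 + j * d + i)" if "j < N" "i < d" for j i
      using I flat_less[OF that] by simp
    have "has_F pt s'" unfolding has_F_def pt_def using * by (simp add: k)
    then show "ctx s' \<and> pos s' = pos s \<and> has_F pt s'" using I by blast
  next
    show "nval (NSub (v 4) (NConst 1)) s' = N * d \<and> nmem s' (ad 10 0) = j" if "?I j s'" for j s'
      using that rb by (simp add: ctxD)
  qed (use c in \<open>simp add: ctx_upd\<close>)
  then show ?thesis by (rule hx_mono) auto
qed

definition drawc :: com where
  "drawc = Seq (vset 11 (NConst 0)) (For 10 (v 7) (For 12 (v 2) (Seq (rsample 4 (v 11)) (vset 11 (NAdd (v 11) (NConst 1))))))"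

lemma hx_draw:
  assumes c: "ctx s" and p: "pos s = 0"
  shows "hx \<omega> drawc (k * (d * 4 + 4) + 3) s (\<lambda>s'. ctx s' \<and> pos s' = k * d \<and> (\<forall>x<k * d. rmem s' (rb + ad 4 x) = \<omega> x))"
proof -
  let ?R = "\<lambda>x s'. ctx s' \<and> pos s' = x \<and> nmem s' (ad 11 0) = x \<and> (\<forall>y<x. rmem s' (rb + ad 4 y) = \<omega> y)"
  let ?I = "\<lambda>j s'. nmem s' (ad 10 0) = j \<and> ?R (j * d) s'"
  have "hx \<omega> drawc (1 + (k * ((d * ((1 + 1) + 2) + 2) + 2) + 2)) s (\<lambda>s'. ctx s' \<and> pos s' = k * d \<and> (\<forall>x<k * d. rmem s' (rb + ad 4 x) = \<omega> x))"
    unfolding drawc_def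
  proof (intro hx_seq hx_vset, rule hx_for[where I = ?I])
    fix j s' assume j: "j < k" and I: "?I j s'"
    let ?J = "\<lambda>l s''. nmem s'' (ad 12 0) = l \<and> nmem s'' (ad 10 0) = j \<and> ?R (j * d + l) s''"
    show "hx \<omega> (For 12 (v 2) (Seq (rsample 4 (v 11)) (vset 11 (NAdd (v 11) (NConst 1))))) (d * ((1 + 1) + 2) + 2) s'
      (\<lambda>s''. nmem s'' (ad 10 0) = j \<and> ?I (Suc j) (setn s'' (ad 10 0) (Suc j)))"
    proof (rule hx_for[where I = ?J])
      fix l s'' assume l: "l < d" and J: "?J l s''"
      then have c': "ctx s''" by blast
      show "hx \<omega> (Seq (rsample 4 (v 11)) (vset 11 (NAdd (v 11) (NConst 1)))) (1 + 1) s''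
        (\<lambda>s'. nmem s' (ad 12 0) = l \<and> ?J (Suc l) (setn s' (ad 12 0) (Suc l)))"
        using J by (intro hx_seq hx_rsample hx_vset) (simp add: ctxD[OF c'] ctx_upd less_Suc_eq)
    qed (use I in \<open>auto simp: ctxD ctx_upd add.commute\<close>)
  qed (use c p in \<open>auto simp: ctxD ctx_upd\<close>)
  then show ?thesis by (rule hx_mono) (auto simp: algebra_simps)
qed

definition projc :: com where
  "projc = Seq (vset 13 (NConst 0)) (For 10 (v 3) (Seq (vset 11 (NConst 0)) (For 12 (v 7)
    (Seq (rset 0 (ROfNat (NConst 0))) (Seq (vset 26 (na 20 (v 10)))
    (Seq (For 14 (v 2) (Seq (rset 0 (RAdd (rv 0) (RMult (RSub (RMult (ROfNat (NConst 2)) (ra 4 (v 11))) (ROfNat (NConst 1))) (RLoad (v 26)))))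
      (Seq (vset 11 (NAdd (v 11) (NConst 1))) (vset 26 (NAdd (v 26) (NConst 1))))))
    (Seq (raset 5 (v 13) (rv 0)) (vset 13 (NAdd (v 13) (NConst 1))))))))))"

definition prj :: "(nat \<Rightarrow> real) \<Rightarrow> nat \<Rightarrow> nat \<Rightarrow> real" where
  "prj \<omega> j i = (\<Sum>l<d. (2 * \<omega> (i * d + l) - 1) * pt j l)"

lemma hx_proj:
  assumes c: "ctx s" and G: "\<forall>x<k * d. rmem s (rb + ad 4 x) = \<omega> x"
  shows "hx \<omega> projc (N * (k * (d * 5 + 8) + 5) + 3) s (\<lambda>s'. ctx s' \<and> pos s' = pos s \<and> has_F (prj \<omega>) s')"
proof -
  let ?R = "\<lambda>x s'. ctx s' \<and> pos s' = pos s \<and> (\<forall>x<k * d. rmem s' (rb + ad 4 x) = \<omega> x) \<and> nmem s' (ad 13 0) = x \<and>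
    (\<forall>j i. i < k \<longrightarrow> j * k + i < x \<longrightarrow> rmem s' (rb + ad 5 (j * k + i)) = prj \<omega> j i)"
  let ?I = "\<lambda>j s'. nmem s' (ad 10 0) = j \<and> ?R (j * k) s'"
  have "hx \<omega> projc (1 + (N * ((1 + (k * ((1 + (1 + ((d * ((1 + (1 + 1)) + 2) + 2) + (1 + 1)))) + 2) + 2)) + 2) + 2)) s
    (\<lambda>s'. ctx s' \<and> pos s' = pos s \<and> has_F (prj \<omega>) s')"
    unfolding projc_def
  proof (intro hx_seq hx_vset, rule hx_for[where I = ?I])
    fix j s' assume j: "j < N" and I: "?I j s'"
    let ?J = "\<lambda>i s''. nmem s'' (ad 12 0) = i \<and> nmem s'' (ad 10 0) = j \<and> nmem s'' (ad 11 0) = i * d \<and> ?R (j * k + i) s''"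
    let ?l = "Seq (rset 0 (RAdd (rv 0) (RMult (RSub (RMult (ROfNat (NConst 2)) (ra 4 (v 11))) (ROfNat (NConst 1))) (RLoad (v 26)))))
      (Seq (vset 11 (NAdd (v 11) (NConst 1))) (vset 26 (NAdd (v 26) (NConst 1))))"
    let ?b = "Seq (rset 0 (ROfNat (NConst 0))) (Seq (vset 26 (na 20 (v 10))) (Seq (For 14 (v 2) ?l) (Seq (raset 5 (v 13) (rv 0)) (vset 13 (NAdd (v 13) (NConst 1))))))"
    show "hx \<omega> (Seq (vset 11 (NConst 0)) (For 12 (v 7) ?b)) (1 + (k * ((1 + (1 + ((d * ((1 + (1 + 1)) + 2) + 2) + (1 + 1)))) + 2) + 2)) s'
      (\<lambda>s''. nmem s'' (ad 10 0) = j \<and> ?I (Suc j) (setn s'' (ad 10 0) (Suc j)))"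
    proof (intro hx_seq hx_vset, rule hx_for[where I = ?J])
      fix i s'' assume i: "i < k" and J: "?J i s''"
      then have c': "ctx s''" by blast
      let ?L = "\<lambda>l s3. ctx s3 \<and> pos s3 = pos s \<and> (\<forall>x<k * d. rmem s3 (rb + ad 4 x) = \<omega> x) \<and> nmem s3 (ad 13 0) = j * k + i \<and>
        (\<forall>j' i'. i' < k \<longrightarrow> j' * k + i' < j * k + i \<longrightarrow> rmem s3 (rb + ad 5 (j' * k + i')) = prj \<omega> j' i') \<and>
        nmem s3 (ad 12 0) = i \<and> nmem s3 (ad 10 0) = j \<and> nmem s3 (ad 11 0) = i * d + l \<and> nmem s3 (ad 26 0) = 1 + j * d + l \<and>
        nmem s3 (ad 14 0) = l \<and> rmem s3 (rb + ad 0 0) = (\<Sum>l'<l. (2 * \<omega> (i * d + l') - 1) * pt j l')"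
      show "hx \<omega> ?b (1 + (1 + ((d * ((1 + (1 + 1)) + 2) + 2) + (1 + 1)))) s''
        (\<lambda>s'. nmem s' (ad 12 0) = i \<and> ?J (Suc i) (setn s' (ad 12 0) (Suc i)))"
      proof (intro hx_seq hx_rset hx_vset, rule hx_for[where I = ?L])
        fix l s3 assume l: "l < d" and L: "?L l s3"
        then have c3: "ctx s3" by blast
        have 1: "rmem s3 (1 + j * d + l) = pt j l"
          using ctxD(11)[OF c3] index_less[OF j l] by (simp add: pt_def)
        have 2: "rmem s3 (rb + ad 4 (i * d + l)) = \<omega> (i * d + l)" using L flat_less[OF i l] by blast
        show "hx \<omega> ?l (1 + (1 + 1)) s3 (\<lambda>s'. nmem s' (ad 14 0) = l \<and> ?L (Suc l) (setn s' (ad 14 0) (Suc l)))"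
          using L 1 2 by (intro hx_seq hx_rset hx_vset) (simp add: ctxD[OF c3] ctx_upd)
      next
        fix s3 assume L: "?L d s3"
        then have c3: "ctx s3" by blast
        have uniq: "j' * k + i' = j * k + i \<longleftrightarrow> j' = j \<and> i' = i" if "i' < k" for j' i'
        proof
          assume "j' * k + i' = j * k + i"
          then have "(i' + j' * k) div k = (i + j * k) div k" "(i' + j' * k) mod k = (i + j * k) mod k" by (simp_all add: add.commute)
          then show "j' = j \<and> i' = i" using that i by (simp only: div_mult_self1 mod_mult_self1 div_less mod_less) simp
        qed simp
        show "hx \<omega> (Seq (raset 5 (v 13) (rv 0)) (vset 13 (NAdd (v 13) (NConst 1)))) (1 + 1) s3
          (\<lambda>s'. nmem s' (ad 12 0) = i \<and> ?J (Suc i) (setn s' (ad 12 0) (Suc i)))"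
          using L by (intro hx_seq hx_raset hx_vset) (simp add: ctxD[OF c3] ctx_upd less_Suc_eq uniq prj_def)
      next
        show "nval (v 2) s3 = d \<and> nmem s3 (ad 14 0) = l" if "?L l s3" for l s3
          using that by (simp add: ctxD)
      qed (use J j in \<open>simp add: ctxD[OF c'] ctx_upd\<close>)
    next
      fix s'' assume J: "?J k s''"
      then show "nmem s'' (ad 10 0) = j \<and> ?I (Suc j) (setn s'' (ad 10 0) (Suc j))" by (simp add: ctx_upd add.commute)
    next
      show "nval (v 7) s'' = k \<and> nmem s'' (ad 12 0) = i" if "?J i s''" for i s''
        using that by (simp add: ctxD)
    qed (use I in \<open>simp add: ctxD ctx_upd\<close>)
  next
    fix s' assume I: "?I N s'"
    then have "has_F (prj \<omega>) s'" unfolding has_F_def using flat_less[of _ N _ k] by blast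
    then show "ctx s' \<and> pos s' = pos s \<and> has_F (prj \<omega>) s'" using I by blast
  next
    show "nval (v 3) s' = N \<and> nmem s' (ad 10 0) = j" if "?I j s'" for j s'
      using that by (simp add: ctxD)
  qed (use c G in \<open>simp add: ctxD[OF c] ctx_upd\<close>)
  then show ?thesis by (rule hx_mono) (auto simp: algebra_simps)
qed

end

subsection \<open>Computing the crude distances\<close>

context gap_system
begin

text \<open>The program may break ties in any way: the sorted list of values is determined by their
  multiset, whichever permutation produced it.\<close>

lemma zs_nth_perm:
  assumes od: "\<And>e. e < N \<Longrightarrow> od e < N" "inj_on od {..<N}"
    and mono: "\<And>e e'. e \<le> e' \<Longrightarrow> e' < N \<Longrightarrow> X (od e) i \<le> X (od e') i" and e: "e < N"
  shows "zs i ! e = X (od e) i"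
proof -
  let ?ys = "map (\<lambda>e. X (od e) i) [0..<N]"
  have "od ` {..<N} = {..<N}" using od by (intro endo_inj_surj) auto
  then have "set (map od [0..<N]) = set [0..<N]" by (simp add: atLeast0LessThan)
  moreover have "distinct (map od [0..<N])" using od(2) by (simp add: distinct_map atLeast0LessThan)
  ultimately have "mset (map od [0..<N]) = mset [0..<N]" by (subst set_eq_iff_mset_eq_distinct[symmetric]) auto
  then have "mset (map (\<lambda>j. X j i) (map od [0..<N])) = mset (map (\<lambda>j. X j i) [0..<N])" by (metis mset_map)
  moreover have "map (\<lambda>j. X j i) (map od [0..<N]) = ?ys" by (simp only: map_map comp_def)
  moreover have "sorted ?ys" using mono by (simp add: sorted_iff_nth_mono)
  ultimately have "mset ?ys = mset (map (\<lambda>j. X j i) [0..<N])" "sorted ?ys" by metis+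
  then have "zs i = ?ys" unfolding zs_def by (rule properties_for_sort)
  then show ?thesis using e by simp
qed

text \<open>With ties, \<open>phi\<close> also counts positions after \<open>e\<close> that hold the
  same value. Their gaps are 0, so the running sum at any of the tied positions already has the
  final value.\<close>

lemma prefix_phi:
  assumes e: "e < N"
  shows "(\<Sum>e'<Suc e. Y \<beta> \<omega> i e' ^ q) = phi \<beta> \<omega> i (zs i ! e)"
  unfolding phi_def
proof (rule sum.mono_neutral_left)
  show "{..<Suc e} \<subseteq> {e'. e' < N \<and> zs i ! e' \<le> zs i ! e}"
    using e sorted_nth_mono[OF sorted_zs, of _ e i] length_zs by auto
  show "\<forall>e'\<in>{e'. e' < N \<and> zs i ! e' \<le> zs i ! e} - {..<Suc e}. Y \<beta> \<omega> i e' ^ q = 0"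
  proof
    fix e' assume e': "e' \<in> {e'. e' < N \<and> zs i ! e' \<le> zs i ! e} - {..<Suc e}"
    then have "zs i ! e \<le> zs i ! (e' - 1)" using sorted_nth_mono[OF sorted_zs, of e "e' - 1" i] length_zs by auto
    then have "gap i e' \<le> 0" using e' by (simp add: gap_def)
    then have "gap i e' = 0" using gap_nonneg[of e' i] e' by auto
    then show "Y \<beta> \<omega> i e' ^ q = 0" using q2 by (simp add: Y_def)
  qed
qed simp

end

context machine
begin

lemma hx_vset_c: "nval e s = x \<Longrightarrow> Q (setn s (ad t 0) x) \<Longrightarrow> hx \<omega> (vset t e) 1 s Q"
  by (rule hx_vset) simp

lemma hx_rset_c: "ctx s \<Longrightarrow> rval f s = x \<Longrightarrow> Q (setr s (rb + ad t 0) x) \<Longrightarrow> hx \<omega> (rset t f) 1 s Q"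
  by (rule hx_rset) (simp add: ctxD)

lemma hx_raset_c: "ctx s \<Longrightarrow> nval e s = y \<Longrightarrow> rval f s = x \<Longrightarrow> Q (setr s (rb + ad t y) x) \<Longrightarrow> hx \<omega> (raset t e f) 1 s Q"
  by (rule hx_raset) (simp add: ctxD)

lemma hx_rsample_c: "ctx s \<Longrightarrow> nval e s = y \<Longrightarrow> Q (tick (setr s (rb + ad t y) (\<omega> (pos s)))) \<Longrightarrow> hx \<omega> (rsample t e) 1 s Q"
  by (rule hx_rsample) (simp add: ctxD)

definition powc :: com where
  "powc = Seq (rset 11 (ROfNat (NConst 1))) (For 12 (v 6) (rset 11 (RMult (rv 11) (rv 10))))"

lemma hx_pow:
  assumes c: "ctx s"
  shows "hx \<omega> powc (q * 3 + 3) s (\<lambda>s'. ctx s' \<and> same rb {12} {11} s s' \<and> pos s' = pos s \<and> rmem s' (rb + ad 11 0) = rmem s (rb + ad 10 0) ^ q)"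
proof -
  let ?I = "\<lambda>j s'. ctx s' \<and> same rb {12} {11} s s' \<and> pos s' = pos s \<and> nmem s' (ad 12 0) = j \<and> rmem s' (rb + ad 11 0) = rmem s (rb + ad 10 0) ^ j"
  have "hx \<omega> powc (1 + (q * (1 + 2) + 2)) s (\<lambda>s'. ctx s' \<and> same rb {12} {11} s s' \<and> pos s' = pos s \<and> rmem s' (rb + ad 11 0) = rmem s (rb + ad 10 0) ^ q)"
    unfolding powc_def
  proof (intro hx_seq hx_rset, rule hx_for[where I = ?I])
    fix j s' assume I: "?I j s'"
    then have c': "ctx s'" and sm: "same rb {12} {11} s s'" by blast+
    show "hx \<omega> (rset 11 (RMult (rv 11) (rv 10))) 1 s' (\<lambda>s''. nmem s'' (ad 12 0) = j \<and> ?I (Suc j) (setn s'' (ad 12 0) (Suc j)))"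
      using I by (intro hx_rset) (simp add: ctxD[OF c'] ctx_upd same_intros same_rD[OF sm])
    show "nval (v 6) s' = q \<and> nmem s' (ad 12 0) = j" using I by (simp add: ctxD[OF c'])
  qed (use c in \<open>simp_all add: ctxD[OF c] ctx_upd same_intros\<close>)
  then show ?thesis by (rule hx_mono) auto
qed

text \<open>Real scalar 8 holds the preceding key. \<open>coordc\<close> initialises it with the
  first key, so that the gap at position 0 is 0 as in \<open>gap\<close>.\<close>

definition accbody :: com where
  "accbody = Seq (rsample 9 (NConst 0)) (Seq (rset 10 (RDiv (RSub (ra 1 (na 23 (v 10))) (rv 8)) (rv 9)))
    (Seq (rset 8 (ra 1 (na 23 (v 10)))) (Seq powc
    (Seq (rset 0 (RAdd (rv 0) (rv 11))) (raset 2 (na 23 (v 10)) (RAdd (ra 2 (na 23 (v 10))) (RMult (rv 7) (rv 0))))))))"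

definition coordc :: com where
  "coordc = Seq (vset 9 (v 18)) (Seq (For 10 (v 3) (Seq (raset 1 (v 10) (ra 5 (v 9))) (vset 9 (NAdd (v 9) (v 7)))))
   (Seq sortc (Seq (rsample 7 (NConst 0)) (Seq (rset 0 (ROfNat (NConst 0))) (Seq (rset 8 (ra 1 (na 23 (NConst 0))))
   (For 10 (v 3) accbody))))))"

lemma hx_acc:
  fixes X :: "nat \<Rightarrow> nat \<Rightarrow> real"
  assumes c: "ctx s" and od: "sorted_by (\<lambda>j. X j i) (\<lambda>e. nmem s (ad 23 e)) N"
    and key: "\<forall>j<N. rmem s (rb + ad 1 j) = X j i" and p: "pos s = Suc (gap_system.cpos N \<beta> i)"
    and r: "rmem s (rb + ad 0 0) = 0" "rmem s (rb + ad 7 0) = \<omega> (gap_system.cpos N \<beta> i)" "rmem s (rb + ad 8 0) = X (nmem s (ad 23 0)) i"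
  shows "hx \<omega> (For 10 (v 3) accbody) (N * (q * 3 + 10) + 2) s (\<lambda>s'. ctx s' \<and> same rb {10, 12} {0, 2, 8, 9, 10, 11} s s' \<and>
    pos s' = gap_system.cpos N \<beta> (Suc i) \<and>
    (\<forall>j<N. rmem s' (rb + ad 2 j) = rmem s (rb + ad 2 j) + \<omega> (gap_system.cpos N \<beta> i) * gap_system.phi N q X \<beta> \<omega> i (X j i)))"
proof -
  interpret G: gap_system k N q X by unfold_locales (rule q2)
  let ?od = "\<lambda>e. nmem s (ad 23 e)"
  have odN: "?od e < N" if "e < N" for e using od that by (simp add: sorted_by_def)
  have odi: "?od e = ?od e' \<longleftrightarrow> e = e'" if "e < N" "e' < N" for e e'
    using od that by (auto simp: sorted_by_def inj_on_def)
  have zs: "G.zs i ! e = X (?od e) i" if "e < N" for e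
    using od that by (intro G.zs_nth_perm) (auto simp: sorted_by_def)
  let ?c = "\<omega> (G.cpos \<beta> i)"
  \<comment> \<open>At \<open>e = 0\<close> the truncated subtraction turns
    \<open>?od (e - 1)\<close> into the first point, whose key is the initial content of real scalar
    8.\<close>
  let ?I = "\<lambda>e s'. ctx s' \<and> same rb {10, 12} {0, 2, 8, 9, 10, 11} s s' \<and> nmem s' (ad 10 0) = e \<and>
    pos s' = Suc (G.cpos \<beta> i) + e \<and> rmem s' (rb + ad 8 0) = X (?od (e - 1)) i \<and> rmem s' (rb + ad 0 0) = (\<Sum>e'<e. G.Y \<beta> \<omega> i e' ^ q) \<and>
    (\<forall>e'<N. rmem s' (rb + ad 2 (?od e')) = rmem s (rb + ad 2 (?od e')) + (if e' < e then ?c * G.phi \<beta> \<omega> i (X (?od e') i) else 0))"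
  have "hx \<omega> (For 10 (v 3) accbody) (N * ((1 + (1 + (1 + ((q * 3 + 3) + (1 + 1))))) + 2) + 2) s (\<lambda>s'. ctx s' \<and> same rb {10, 12} {0, 2, 8, 9, 10, 11} s s' \<and>
    pos s' = G.cpos \<beta> (Suc i) \<and>
    (\<forall>j<N. rmem s' (rb + ad 2 j) = rmem s (rb + ad 2 j) + ?c * G.phi \<beta> \<omega> i (X j i)))"
  proof (rule hx_for[where I = ?I])
    fix e s1 assume e: "e < N" and I: "?I e s1"
    then have c1: "ctx s1" and sm1: "same rb {10, 12} {0, 2, 8, 9, 10, 11} s s1" by blast+
    have pe: "pos s1 = G.upos \<beta> i e" using I by (simp add: G.upos_def G.cpos_def)
    have od1: "nmem s1 (ad 23 x) = ?od x" for x by (simp add: same_nD[OF sm1])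
    have key1: "rmem s1 (rb + ad 1 (?od e)) = X (?od e) i" using key odN[OF e] by (simp add: same_rD[OF sm1])
    have Ye: "(X (?od e) i - X (?od (e - 1)) i) / \<omega> (pos s1) = G.Y \<beta> \<omega> i e"
      using zs[OF e] zs[of "e - 1"] e by (simp add: G.Y_def G.gap_def pe)
    show "hx \<omega> accbody (1 + (1 + (1 + ((q * 3 + 3) + (1 + 1))))) s1 (\<lambda>s'. nmem s' (ad 10 0) = e \<and> ?I (Suc e) (setn s' (ad 10 0) (Suc e)))"
      unfolding accbody_def
    proof (rule hx_seq)
      let ?a = "tick (setr s1 (rb + ad 9 0) (\<omega> (pos s1)))"
      let ?b = "setr ?a (rb + ad 10 0) (G.Y \<beta> \<omega> i e)"
      let ?s2 = "setr ?b (rb + ad 8 0) (X (?od e) i)"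
      let ?Q = "\<lambda>s'. nmem s' (ad 10 0) = e \<and> ?I (Suc e) (setn s' (ad 10 0) (Suc e))"
      let ?R0 = "raset 2 (na 23 (v 10)) (RAdd (ra 2 (na 23 (v 10))) (RMult (rv 7) (rv 0)))"
      let ?R1 = "Seq (rset 0 (RAdd (rv 0) (rv 11))) ?R0"
      have ca: "ctx ?a" "ctx ?b" and c2: "ctx ?s2" using c1 by (simp_all add: ctx_upd)
      have 1: "rval (RDiv (RSub (ra 1 (na 23 (v 10))) (rv 8)) (rv 9)) ?a = G.Y \<beta> \<omega> i e"
        using I Ye by (simp add: ctxD[OF c1] od1 key1 del: One_nat_def)
      have 2: "rval (ra 1 (na 23 (v 10))) ?b = X (?od e) i"
        using I by (simp add: ctxD[OF c1] od1 key1 del: One_nat_def)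
      have "hx \<omega> powc (q * 3 + 3) ?s2 (\<lambda>s1. hx \<omega> ?R1 (1 + 1) s1 ?Q)"
      proof (rule hx_mono[OF hx_pow[OF c2] order_refl], elim conjE)
        fix s3 assume c3: "ctx s3" and sm3: "same rb {12} {11} ?s2 s3" and p3: "pos s3 = pos ?s2"
          and w: "rmem s3 (rb + ad 11 0) = rmem ?s2 (rb + ad 10 0) ^ q"
        have "same rb {10, 12} {0, 2, 8, 9, 10, 11} s ?s2" using sm1 by (simp add: same_intros)
        then have sm: "same rb {10, 12} {0, 2, 8, 9, 10, 11} s s3" using sm3 by (rule same_trans) auto
        have 10: "nmem s3 (ad 10 0) = e" and 23: "nmem s3 (ad 23 x) = ?od x" for x
          using I by (simp_all add: same_nD[OF sm3] od1)
        have acc: "rmem s3 (rb + ad 0 0) = (\<Sum>e'<e. G.Y \<beta> \<omega> i e' ^ q)" using I by (simp add: same_rD[OF sm3])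
        have r7: "rmem s3 (rb + ad 7 0) = ?c" using r by (simp add: same_rD[OF sm])
        have pp: "rmem s3 (rb + ad 2 (?od e')) = rmem s (rb + ad 2 (?od e')) + (if e' < e then ?c * G.phi \<beta> \<omega> i (X (?od e') i) else 0)" if "e' < N" for e'
          using I that by (simp add: same_rD[OF sm3])
        have r8: "rmem s3 (rb + ad 8 0) = X (?od e) i" by (simp add: same_rD[OF sm3])
        have phi: "(\<Sum>e'<e. G.Y \<beta> \<omega> i e' ^ q) + G.Y \<beta> \<omega> i e ^ q = G.phi \<beta> \<omega> i (X (?od e) i)"
          using G.prefix_phi[OF e, of \<beta> \<omega> i] zs[OF e] by simp
        show "hx \<omega> ?R1 (1 + 1) s3 ?Q"
        proof (rule hx_seq, rule hx_rset_c[OF c3])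
          show "rval (RAdd (rv 0) (rv 11)) s3 = G.phi \<beta> \<omega> i (X (?od e) i)"
            by (simp add: ctxD[OF c3] acc w phi)
          let ?s4 = "setr s3 (rb + ad 0 0) (G.phi \<beta> \<omega> i (X (?od e) i))"
          have c4: "ctx ?s4" using c3 by (simp add: ctx_upd)
          show "hx \<omega> (raset 2 (na 23 (v 10)) (RAdd (ra 2 (na 23 (v 10))) (RMult (rv 7) (rv 0)))) 1 ?s4
            (\<lambda>s'. nmem s' (ad 10 0) = e \<and> ?I (Suc e) (setn s' (ad 10 0) (Suc e)))"
          proof (rule hx_raset_c[OF c4])
            show "nval (na 23 (v 10)) ?s4 = ?od e" by (simp add: 10 23)
            show "rval (RAdd (ra 2 (na 23 (v 10))) (RMult (rv 7) (rv 0))) ?s4 = rmem s (rb + ad 2 (?od e)) + ?c * G.phi \<beta> \<omega> i (X (?od e) i)"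
              using pp[OF e] by (simp add: ctxD[OF c3] 10 23 r7)
            show "nmem (setr ?s4 (rb + ad 2 (?od e)) (rmem s (rb + ad 2 (?od e)) + ?c * G.phi \<beta> \<omega> i (X (?od e) i))) (ad 10 0) = e \<and>
              ?I (Suc e) (setn (setr ?s4 (rb + ad 2 (?od e)) (rmem s (rb + ad 2 (?od e)) + ?c * G.phi \<beta> \<omega> i (X (?od e) i))) (ad 10 0) (Suc e))"
            proof -
              let ?s6 = "setn (setr ?s4 (rb + ad 2 (?od e)) (rmem s (rb + ad 2 (?od e)) + ?c * G.phi \<beta> \<omega> i (X (?od e) i))) (ad 10 0) (Suc e)"
              have "ctx ?s6" using c3 by (simp add: ctx_upd)
              moreover have "same rb {10, 12} {0, 2, 8, 9, 10, 11} s ?s6" using sm by (simp add: same_intros)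
              moreover have "pos ?s6 = Suc (G.cpos \<beta> i) + Suc e" using p3 I by simp
              moreover have "rmem ?s6 (rb + ad 8 0) = X (?od (Suc e - 1)) i" using r8 by simp
              moreover have "rmem ?s6 (rb + ad 0 0) = (\<Sum>e'<Suc e. G.Y \<beta> \<omega> i e' ^ q)" using phi by simp
              moreover have "rmem ?s6 (rb + ad 2 (?od e')) = rmem s (rb + ad 2 (?od e')) + (if e' < Suc e then ?c * G.phi \<beta> \<omega> i (X (?od e') i) else 0)"
                if e': "e' < N" for e'
              proof (cases "e' = e")
                case False
                then show ?thesis using pp[OF e'] odi[OF e' e] by (simp add: less_Suc_eq)
              qed simp
              ultimately show ?thesis using 10 by simp
            qed
          qed
        qed
      qed
      then have "hx \<omega> (Seq powc ?R1) ((q * 3 + 3) + (1 + 1)) ?s2 ?Q" by (rule hx_seq)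
      then have "hx \<omega> (Seq (rset 8 (ra 1 (na 23 (v 10)))) (Seq powc ?R1)) (1 + ((q * 3 + 3) + (1 + 1))) ?b ?Q"
        by (rule hx_seq[OF hx_rset_c[OF ca(2) 2]])
      then have "hx \<omega> (Seq (rset 10 (RDiv (RSub (ra 1 (na 23 (v 10))) (rv 8)) (rv 9))) (Seq (rset 8 (ra 1 (na 23 (v 10)))) (Seq powc ?R1)))
          (1 + (1 + ((q * 3 + 3) + (1 + 1)))) ?a ?Q"
        by (rule hx_seq[OF hx_rset_c[OF ca(1) 1]])
      then show "hx \<omega> (rsample 9 (NConst 0)) 1 s1 (\<lambda>s1. hx \<omega> (Seq (rset 10 (RDiv (RSub (ra 1 (na 23 (v 10))) (rv 8)) (rv 9))) (Seq (rset 8 (ra 1 (na 23 (v 10)))) (Seq powc ?R1)))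
          (1 + (1 + ((q * 3 + 3) + (1 + 1)))) s1 ?Q)"
        by (rule hx_rsample_c[OF c1 nval.simps(1)])
    qed
  next
    fix s' assume I: "?I N s'"
    have onto: "\<exists>e<N. j = ?od e" if "j < N" for j
    proof -
      have "?od ` {..<N} = {..<N}" by (rule endo_inj_surj) (auto simp: inj_on_def odN odi)
      then have "j \<in> ?od ` {..<N}" using that by simp
      then show ?thesis by blast
    qed
    have "rmem s' (rb + ad 2 j) = rmem s (rb + ad 2 j) + ?c * G.phi \<beta> \<omega> i (X j i)" if j: "j < N" for j
    proof -
      obtain e where "e < N" "j = ?od e" using onto[OF j] by blast
      then show ?thesis using I by simp
    qed
    moreover have "pos s' = G.cpos \<beta> (Suc i)" using I by (simp add: G.cpos_def)
    ultimately show "ctx s' \<and> same rb {10, 12} {0, 2, 8, 9, 10, 11} s s' \<and> pos s' = G.cpos \<beta> (Suc i) \<and>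
      (\<forall>j<N. rmem s' (rb + ad 2 j) = rmem s (rb + ad 2 j) + ?c * G.phi \<beta> \<omega> i (X j i))" using I by blast
  next
    show "nval (v 3) s' = N \<and> nmem s' (ad 10 0) = e" if "?I e s'" for e s'
      using that by (simp add: ctxD)
  qed (use c p r in \<open>simp add: ctx_upd same_intros\<close>)
  then show ?thesis by (rule hx_mono) (auto simp: algebra_simps)
qed

lemma mA_less: "mA < N" using N mB by simp

definition fillc :: com where
  "fillc = For 10 (v 3) (Seq (raset 1 (v 10) (ra 5 (v 9))) (vset 9 (NAdd (v 9) (v 7))))"

lemma coordc_fill: "coordc = Seq (vset 9 (v 18)) (Seq fillc
   (Seq sortc (Seq (rsample 7 (NConst 0)) (Seq (rset 0 (ROfNat (NConst 0))) (Seq (rset 8 (ra 1 (na 23 (NConst 0))))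
   (For 10 (v 3) accbody))))))"
  by (simp add: coordc_def fillc_def)

lemma hx_fill:
  assumes c: "ctx s" and F: "has_F X s" and i: "nmem s (ad 9 0) = i" "i < k"
  shows "hx \<omega> fillc (N * 4 + 2) s (\<lambda>s'. ctx s' \<and> same rb {9, 10} {1} s s' \<and> pos s' = pos s \<and> (\<forall>j<N. rmem s' (rb + ad 1 j) = X j i))"
proof -
  let ?I = "\<lambda>j s'. ctx s' \<and> same rb {9, 10} {1} s s' \<and> pos s' = pos s \<and> nmem s' (ad 10 0) = j \<and> nmem s' (ad 9 0) = j * k + i \<and>
    (\<forall>x<j. rmem s' (rb + ad 1 x) = X x i)"
  have "hx \<omega> fillc (N * ((1 + 1) + 2) + 2) s (\<lambda>s'. ctx s' \<and> same rb {9, 10} {1} s s' \<and> pos s' = pos s \<and> (\<forall>j<N. rmem s' (rb + ad 1 j) = X j i))"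
    unfolding fillc_def
  proof (rule hx_for[where I = ?I])
    fix j s1 assume j: "j < N" and I: "?I j s1"
    then have c1: "ctx s1" and sm: "same rb {9, 10} {1} s s1" by blast+
    have x: "rmem s1 (rb + ad 5 (j * k + i)) = X j i"
      using has_F_same[OF F sm] j i(2) by (simp add: has_F_def)
    show "hx \<omega> (Seq (raset 1 (v 10) (ra 5 (v 9))) (vset 9 (NAdd (v 9) (v 7)))) (1 + 1) s1
      (\<lambda>s'. nmem s' (ad 10 0) = j \<and> ?I (Suc j) (setn s' (ad 10 0) (Suc j)))"
      using I x by (intro hx_seq hx_raset hx_vset) (simp add: ctxD[OF c1] ctx_upd same_intros less_Suc_eq del: One_nat_def)
  next
    show "nval (v 3) s' = N \<and> nmem s' (ad 10 0) = e" if "?I e s'" for e s'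
      using that by (simp add: ctxD)
  qed (use c i in \<open>simp_all add: ctx_upd same_intros\<close>)
  then show ?thesis by (rule hx_mono) auto
qed

abbreviation cN :: "nat set" where "cN \<equiv> {9, 10, 12, 15, 16, 22, 23}"
abbreviation cR :: "nat set" where "cR \<equiv> {0, 1, 2, 6, 7, 8, 9, 10, 11}"

definition coord_cost :: nat where
  "coord_cost = 1 + ((N * 4 + 2) + (sort_cost + (1 + (1 + (1 + (N * (q * 3 + 10) + 2))))))"

lemma hx_coord:
  assumes c: "ctx s" and F: "has_F X s" and i: "nmem s (ad 18 0) = i" "i < k" and p: "pos s = gap_system.cpos N \<beta> i"
  shows "hx \<omega> coordc coord_cost s (\<lambda>s'. ctx s' \<and> same rb cN cR s s' \<and> pos s' = gap_system.cpos N \<beta> (Suc i) \<and>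
    (\<forall>j<N. rmem s' (rb + ad 2 j) = rmem s (rb + ad 2 j) + \<omega> (gap_system.cpos N \<beta> i) * gap_system.phi N q X \<beta> \<omega> i (X j i)))"
proof -
  let ?c = "\<omega> (gap_system.cpos N \<beta> i)"
  let ?Q = "\<lambda>s'. ctx s' \<and> same rb cN cR s s' \<and> pos s' = gap_system.cpos N \<beta> (Suc i) \<and>
    (\<forall>j<N. rmem s' (rb + ad 2 j) = rmem s (rb + ad 2 j) + ?c * gap_system.phi N q X \<beta> \<omega> i (X j i))"
  let ?t = "Seq (rsample 7 (NConst 0)) (Seq (rset 0 (ROfNat (NConst 0))) (Seq (rset 8 (ra 1 (na 23 (NConst 0)))) (For 10 (v 3) accbody)))"
  let ?tc = "1 + (1 + (1 + (N * (q * 3 + 10) + 2)))"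
  show ?thesis unfolding coordc_fill coord_cost_def
  proof (intro hx_seq hx_vset)
    let ?s1 = "setn s (ad 9 0) (nval (v 18) s)"
    have c1: "ctx ?s1" and F1: "has_F X ?s1" and i1: "nmem ?s1 (ad 9 0) = i" using c F i by (simp_all add: ctx_upd has_F_def)
    show "hx \<omega> fillc (N * 4 + 2) ?s1 (\<lambda>s1. hx \<omega> (Seq sortc ?t) (sort_cost + ?tc) s1 ?Q)"
    proof (rule hx_mono[OF hx_fill[OF c1 F1 i1 i(2)] order_refl], elim conjE)
      fix s2 assume c2: "ctx s2" and sm2: "same rb {9, 10} {1} ?s1 s2" and p2: "pos s2 = pos ?s1" and k2: "\<forall>j<N. rmem s2 (rb + ad 1 j) = X j i"
      have "same rb cN cR s ?s1" by (simp add: same_intros)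
      then have sm2': "same rb cN cR s s2" using sm2 by (rule same_trans) auto
      show "hx \<omega> (Seq sortc ?t) (sort_cost + ?tc) s2 ?Q"
      proof (rule hx_seq, rule hx_mono[OF hx_sort[OF c2] order_refl], elim conjE)
        fix s3 assume c3: "ctx s3" and sm3: "same rb sN sR s2 s3" and p3: "pos s3 = pos s2"
          and k3: "\<forall>j<N. rmem s3 (rb + ad 1 j) = rmem s2 (rb + ad 1 j)"
          and so: "sorted_by (\<lambda>j. rmem s2 (rb + ad 1 j)) (\<lambda>e. nmem s3 (ad 23 e)) N"
        have so': "sorted_by (\<lambda>j. X j i) (\<lambda>e. nmem s3 (ad 23 e)) N" using so k2 unfolding sorted_by_def by auto
        have sm3': "same rb cN cR s s3" using sm2' sm3 by (rule same_trans) auto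
        have pp: "rmem s3 (rb + ad 2 j) = rmem s (rb + ad 2 j)" for j
          by (simp add: same_rD[OF sm3] same_rD[OF sm2])
        have od0: "nmem s3 (ad 23 0) < N" using so' N_pos by (simp add: sorted_by_def)
        let ?s4 = "tick (setr s3 (rb + ad 7 0) ?c)"
        let ?s5 = "setr ?s4 (rb + ad 0 0) 0"
        let ?s6 = "setr ?s5 (rb + ad 8 0) (X (nmem s3 (ad 23 0)) i)"
        have cc: "ctx ?s4" "ctx ?s5" "ctx ?s6" using c3 by (simp_all add: ctx_upd)
        have key: "\<forall>j<N. rmem ?s6 (rb + ad 1 j) = X j i" using k3 k2 by simp
        have so6: "sorted_by (\<lambda>j. X j i) (\<lambda>e. nmem ?s6 (ad 23 e)) N" using so' by simp
        have pc: "pos s3 = gap_system.cpos N \<beta> i" using p p3 p2 by simp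
        have sm6: "same rb cN cR s ?s6" using sm3' by (simp add: same_intros)
        have v5: "rval (ra 1 (na 23 (NConst 0))) ?s5 = X (nmem s3 (ad 23 0)) i"
          using key od0 by (simp add: ctxD[OF c3] del: One_nat_def)
        have "hx \<omega> (For 10 (v 3) accbody) (N * (q * 3 + 10) + 2) ?s6 ?Q"
        proof (rule hx_mono[OF hx_acc[where X = X and i = i and \<beta> = \<beta> and \<omega> = \<omega>, OF cc(3) so6 key] order_refl])
          show "pos ?s6 = Suc (gap_system.cpos N \<beta> i)" using pc by simp
          fix s' assume s': "ctx s' \<and> same rb {10, 12} {0, 2, 8, 9, 10, 11} ?s6 s' \<and> pos s' = gap_system.cpos N \<beta> (Suc i) \<and>
            (\<forall>j<N. rmem s' (rb + ad 2 j) = rmem ?s6 (rb + ad 2 j) + ?c * gap_system.phi N q X \<beta> \<omega> i (X j i))"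
          then have "same rb {10, 12} {0, 2, 8, 9, 10, 11} ?s6 s'" by blast
          with sm6 have "same rb cN cR s s'" by (rule same_trans) auto
          then show "?Q s'" using s' by (simp add: pp)
        qed simp_all
        then have "hx \<omega> (Seq (rset 8 (ra 1 (na 23 (NConst 0)))) (For 10 (v 3) accbody)) (1 + (N * (q * 3 + 10) + 2)) ?s5 ?Q"
          by (rule hx_seq[OF hx_rset_c[OF cc(2) v5]])
        then have "hx \<omega> (Seq (rset 0 (ROfNat (NConst 0))) (Seq (rset 8 (ra 1 (na 23 (NConst 0)))) (For 10 (v 3) accbody))) (1 + (1 + (N * (q * 3 + 10) + 2))) ?s4 ?Q"
          by (intro hx_seq[OF hx_rset_c[OF cc(1)]]) simp_all
        then show "hx \<omega> ?t ?tc s3 ?Q"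
          by (intro hx_seq[OF hx_rsample_c[OF c3 nval.simps(1)]]) (simp add: pc)
      qed
    qed
  qed
qed

text \<open>A scan visits the points in the order of \<open>od\<close> and remembers the last point of \<open>B\<close> seen; before the first one it
  uses the point with index \<open>mA\<close>, so that every \<open>D a\<close> remains the distance to some point of \<open>B\<close>.\<close>

definition scan_body :: "bool \<Rightarrow> nexp \<Rightarrow> com" where
  "scan_body l2 idx = Seq (vset 24 idx) (Cond (NLess (v 24) (v 0)) (Seq (vset 25 (v 19)) (Seq (distc l2)
    (Cond (RLess (rv 12) (ra 3 (v 24))) (raset 3 (v 24) (rv 12)) Skip))) (vset 19 (v 24)))"

definition scanc :: "bool \<Rightarrow> nexp \<Rightarrow> com" where
  "scanc l2 idx = Seq (vset 19 (v 0)) (For 10 (v 3) (scan_body l2 idx))"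

text \<open>A crude distance that is a true distance cannot fall below the nearest one, so the
  ratios sampled later lie in \<open>[0, 1]\<close>.\<close>

definition attained :: "bool \<Rightarrow> state \<Rightarrow> bool" where
  "attained l2 s \<longleftrightarrow> (\<forall>a<mA. \<exists>b. mA \<le> b \<and> b < N \<and> rmem s (rb + ad 3 a) = dst l2 a b)"

abbreviation pN :: "nat set" where "pN \<equiv> {10, 19, 24, 25, 26, 27, 28}"
abbreviation pR :: "nat set" where "pR \<equiv> {3, 12}"

text \<open>When \<open>a\<close> is visited, the remembered point comes no earlier than any
  \<open>b'\<close> already passed, hence lies between \<open>b'\<close> and \<open>a\<close> on the
  line. \<open>g\<close> is abstract because the backward scan is the same statement for the negated
  images.\<close>

lemma hx_scan:
  assumes c: "ctx s" and at: "attained l2 s"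
    and idx: "\<And>s'. ctx s' \<Longrightarrow> same rb pN pR s s' \<Longrightarrow> nmem s' (ad 10 0) < N \<Longrightarrow> nval idx s' = od (nmem s' (ad 10 0))"
    and od: "\<And>e. e < N \<Longrightarrow> od e < N" and inj: "\<And>e e'. e < N \<Longrightarrow> e' < N \<Longrightarrow> od e = od e' \<Longrightarrow> e = e'"
    and g: "\<And>e e'. e \<le> e' \<Longrightarrow> e' < N \<Longrightarrow> g (od e) \<le> (g (od e') :: real)"
  shows "hx \<omega> (scanc l2 idx) (N * (d * 5 + 13) + 3) s (\<lambda>s'. ctx s' \<and> same rb pN pR s s' \<and> pos s' = pos s \<and> attained l2 s' \<and>
    (\<forall>a<mA. rmem s' (rb + ad 3 a) \<le> rmem s (rb + ad 3 a)) \<and>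
    (\<forall>e<N. \<forall>e'<e. od e < mA \<longrightarrow> mA \<le> od e' \<longrightarrow>
      (\<exists>b. mA \<le> b \<and> b < N \<and> rmem s' (rb + ad 3 (od e)) \<le> dst l2 (od e) b \<and> g (od e') \<le> g b \<and> g b \<le> g (od e))))"
    (is "hx _ _ _ _ ?Q")
proof -
  let ?D = "\<lambda>s a. rmem s (rb + ad 3 a)"
  let ?W = "\<lambda>x D e e'. od e < mA \<longrightarrow> mA \<le> od e' \<longrightarrow>
      (\<exists>b. mA \<le> b \<and> b < N \<and> D (od e) \<le> dst l2 (od e) b \<and> g (od e') \<le> g b \<and> g b \<le> g (od e))"
  \<comment> \<open>The initial index \<open>mA\<close> need not have been visited yet; the order
    relation is therefore claimed only relative to points of the second set already passed.\<close>
  let ?L = "\<lambda>e l. mA \<le> l \<and> l < N \<and> (\<forall>e'<e. mA \<le> od e' \<longrightarrow> (\<exists>e1<e. l = od e1) \<and> g (od e') \<le> g l)"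
  let ?I = "\<lambda>e s'. ctx s' \<and> same rb pN pR s s' \<and> pos s' = pos s \<and> nmem s' (ad 10 0) = e \<and> ?L e (nmem s' (ad 19 0)) \<and>
    attained l2 s' \<and> (\<forall>a<mA. ?D s' a \<le> ?D s a) \<and> (\<forall>e1<e. \<forall>e'<e1. ?W s' (?D s') e1 e')"
  have "hx \<omega> (scanc l2 idx) (1 + (N * ((1 + Suc (1 + ((d * 5 + 6) + Suc 1))) + 2) + 2)) s ?Q"
    unfolding scanc_def
  proof (intro hx_seq hx_vset, rule hx_for[where I = ?I])
    show "?I 0 (setn (setn s (ad 19 0) (nval (v 0) s)) (ad 10 0) 0)"
      using c at mA_less by (simp add: ctxD ctx_upd same_intros attained_def)
  next
    show "nval (v 3) s' = N \<and> nmem s' (ad 10 0) = e" if "?I e s'" for e s' using that by (simp add: ctxD)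
  next
    fix s' assume I: "?I N s'"
    then show "?Q s'" by blast
  next
    fix e s1 assume e: "e < N" and I: "?I e s1"
    let ?R = "\<lambda>s'. nmem s' (ad 10 0) = e \<and> ?I (Suc e) (setn s' (ad 10 0) (Suc e))"
    let ?a = "od e" and ?l = "nmem s1 (ad 19 0)"
    let ?s2 = "setn s1 (ad 24 0) ?a"
    have c1: "ctx s1" and sm1: "same rb pN pR s s1" and 10: "nmem s1 (ad 10 0) = e" and p1: "pos s1 = pos s" and L: "?L e ?l"
      and at1: "attained l2 s1" and le1: "\<forall>a<mA. ?D s1 a \<le> ?D s a" and W1: "\<forall>e1<e. \<forall>e'<e1. ?W s1 (?D s1) e1 e'"
      using I by blast+
    have ix: "nval idx s1 = ?a" using idx[OF c1 sm1] 10 e by simp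
    have c2: "ctx ?s2" using c1 by (simp add: ctx_upd)
    have sm2: "same rb pN pR s ?s2" using sm1 by (simp add: same_intros)
    let ?c = "Cond (RLess (rv 12) (ra 3 (v 24))) (raset 3 (v 24) (rv 12)) Skip"
    show "hx \<omega> (scan_body l2 idx) (1 + Suc (1 + ((d * 5 + 6) + Suc 1))) s1 ?R"
      unfolding scan_body_def
    proof (rule hx_seq, rule hx_vset_c[OF ix], rule hx_cond)
      assume "bval (NLess (v 24) (v 0)) ?s2"
      then have a: "?a < mA" using c1 by (simp add: ctxD)
      let ?s3 = "setn ?s2 (ad 25 0) ?l"
      have c3: "ctx ?s3" using c2 by (simp add: ctx_upd)
      have sm3: "same rb pN pR s ?s3" using sm2 by (simp add: same_intros)
      have "hx \<omega> (distc l2) (d * 5 + 6) ?s3 (\<lambda>s4. hx \<omega> ?c (Suc 1) s4 ?R)"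
      proof (rule hx_mono[OF hx_dist[where x = ?a and y = ?l, OF c3] order_refl])
        show "nmem ?s3 (ad 24 0) = ?a" "?a < N" "nmem ?s3 (ad 25 0) = ?l" "?l < N" using od[OF e] L by simp_all
        fix s4 assume "ctx s4 \<and> same rb {26, 27, 28} {12} ?s3 s4 \<and> pos s4 = pos ?s3 \<and> rmem s4 (rb + ad 12 0) = dst l2 ?a ?l"
        then have c4: "ctx s4" and sm4: "same rb {26, 27, 28} {12} ?s3 s4" and p4: "pos s4 = pos s" and d4: "rmem s4 (rb + ad 12 0) = dst l2 ?a ?l"
          using p1 by simp_all
        have sm: "same rb pN pR s s4" using sm3 sm4 by (rule same_trans) auto
        have n4: "nmem s4 (ad 10 0) = e" "nmem s4 (ad 19 0) = ?l" "nmem s4 (ad 24 0) = ?a" using 10 by (simp_all add: same_nD[OF sm4])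
        have D4: "?D s4 a = ?D s1 a" for a by (simp add: same_rD[OF sm4])
        let ?D5 = "\<lambda>a. if a = ?a then min (?D s1 ?a) (dst l2 ?a ?l) else ?D s1 a"
        have fin: "?R s5" if s5: "ctx s5" "same rb pN pR s s5" "pos s5 = pos s" "nmem s5 (ad 10 0) = e" "nmem s5 (ad 19 0) = ?l"
          and D5: "\<And>a. ?D s5 a = ?D5 a" for s5
        proof -
          let ?s6 = "setn s5 (ad 10 0) (Suc e)"
          have D6: "?D ?s6 a = ?D5 a" for a using D5 by simp
          have "?L (Suc e) ?l"
          proof (intro conjI allI impI)
            fix e' assume "e' < Suc e" "mA \<le> od e'"
            then have "e' < e" using a by (auto simp: less_Suc_eq)
            then show "\<exists>e1<Suc e. ?l = od e1" "g (od e') \<le> g ?l" using L \<open>mA \<le> od e'\<close> by (auto intro: less_SucI)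
          qed (use L in blast)+
          moreover have "attained l2 ?s6"
            unfolding attained_def D6
          proof (intro allI impI)
            fix x assume x: "x < mA"
            have "min (?D s1 ?a) (dst l2 ?a ?l) = ?D s1 ?a \<or> min (?D s1 ?a) (dst l2 ?a ?l) = dst l2 ?a ?l" by linarith
            then show "\<exists>b\<ge>mA. b < N \<and> ?D5 x = dst l2 x b" using at1 L x unfolding attained_def by (cases "x = ?a") auto
          qed
          moreover have "\<forall>x<mA. ?D ?s6 x \<le> ?D s x"
          proof (intro allI impI)
            fix x assume "x < mA"
            then have "?D s1 x \<le> ?D s x" using le1 by blast
            then show "?D ?s6 x \<le> ?D s x" unfolding D6 by auto
          qed
          moreover have "?W ?s6 (?D ?s6) e1 e'" if e1: "e1 < Suc e" "e' < e1" for e1 e'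
          proof (cases "e1 = e")
            case True
            show ?thesis
            proof (intro impI)
              assume "mA \<le> od e'"
              then obtain e2 where e2: "e2 < e" "?l = od e2" "g (od e') \<le> g ?l" using L e1(2) True by blast
              have "g ?l \<le> g ?a" using g[of e2 e] e2 e by simp
              then show "\<exists>b\<ge>mA. b < N \<and> ?D ?s6 (od e1) \<le> dst l2 (od e1) b \<and> g (od e') \<le> g b \<and> g b \<le> g (od e1)"
                unfolding D6 True using e2 L by (intro exI[of _ ?l]) simp
            qed
          next
            case False
            then have "e1 < e" using e1 by simp
            then have "od e1 \<noteq> ?a" using inj[of e1 e] e by auto
            then have "?D ?s6 (od e1) = ?D s1 (od e1)" unfolding D6 by simp
            then show ?thesis using W1 \<open>e1 < e\<close> e1(2) by simp
          qed
          moreover have "ctx ?s6" "same rb pN pR s ?s6" using s5 by (simp_all add: ctx_upd same_intros)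
          ultimately show "?R s5" using s5 by simp
        qed
        show "hx \<omega> ?c (Suc 1) s4 ?R"
        proof (rule hx_cond)
          assume "bval (RLess (rv 12) (ra 3 (v 24))) s4"
          then have lt: "dst l2 ?a ?l < ?D s1 ?a" using d4 n4 D4 by (simp add: ctxD[OF c4])
          have "?R (setr s4 (rb + ad 3 ?a) (dst l2 ?a ?l))"
            by (rule fin) (use c4 sm p4 n4 D4 lt in \<open>auto simp: ctx_upd same_intros\<close>)
          then show "hx \<omega> (raset 3 (v 24) (rv 12)) 1 s4 ?R"
            by (intro hx_raset_c[OF c4]) (use n4 d4 in \<open>auto simp: ctxD[OF c4]\<close>)
        next
          assume "\<not> bval (RLess (rv 12) (ra 3 (v 24))) s4"
          then have lt: "?D s1 ?a \<le> dst l2 ?a ?l" using d4 n4 D4 by (simp add: ctxD[OF c4])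
          have "?R s4" by (rule fin) (use c4 sm p4 n4 D4 lt in \<open>auto simp: min_absorb1\<close>)
          then show "hx \<omega> Skip 1 s4 ?R" by (rule hx_skip)
        qed
      qed
      moreover have vl: "nval (v 19) ?s2 = ?l" by simp
      ultimately have "hx \<omega> (Seq (distc l2) ?c) ((d * 5 + 6) + Suc 1) ?s3 ?R" by (intro hx_seq)
      then show "hx \<omega> (Seq (vset 25 (v 19)) (Seq (distc l2) ?c)) (1 + ((d * 5 + 6) + Suc 1)) ?s2 ?R"
        by (rule hx_seq[OF hx_vset_c[OF vl]])
    next
      assume "\<not> bval (NLess (v 24) (v 0)) ?s2"
      then have a: "mA \<le> ?a" using c1 by (simp add: ctxD)
      let ?s3 = "setn ?s2 (ad 19 0) ?a"
      let ?s6 = "setn ?s3 (ad 10 0) (Suc e)"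
      have "?L (Suc e) ?a"
      proof (intro conjI allI impI)
        fix e' assume e': "e' < Suc e" "mA \<le> od e'"
        show "\<exists>e1<Suc e. ?a = od e1" by blast
        show "g (od e') \<le> g ?a" using g[of e' e] e' e by simp
      qed (use a od[OF e] in simp_all)
      moreover have "?W ?s6 (?D ?s6) e1 e'" if e1: "e1 < Suc e" "e' < e1" for e1 e'
      proof (cases "e1 = e")
        case False
        then have "e1 < e" using e1 by simp
        then show ?thesis using W1 e1(2) by simp
      qed (use a in simp)
      moreover have "attained l2 ?s6" using at1 by (simp add: attained_def)
      moreover have "ctx ?s6" "same rb pN pR s ?s6" using c2 sm2 by (simp_all add: ctx_upd same_intros)
      ultimately have "?R ?s3" using p1 le1 10 by simp
      then have "hx \<omega> (vset 19 (v 24)) 1 ?s2 ?R" by (intro hx_vset_c[where x = ?a]) simp_all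
      then show "hx \<omega> (vset 19 (v 24)) (1 + ((d * 5 + 6) + Suc 1)) ?s2 ?R" by (rule hx_mono) simp_all
    qed
  qed
  then show ?thesis by (rule hx_mono) (simp_all add: algebra_simps)
qed

lemma hx_fill_array:
  assumes c: "ctx s" and t: "t < 64"
    and e: "\<And>s'. ctx s' \<Longrightarrow> nval e s' = n"
    and f: "\<And>s'. ctx s' \<Longrightarrow> same rb {10} {t} s s' \<Longrightarrow> nmem s' (ad 10 0) < n \<Longrightarrow> rval f s' = F (nmem s' (ad 10 0))"
  shows "hx \<omega> (For 10 e (raset t (v 10) f)) (n * 3 + 2) s (\<lambda>s'. ctx s' \<and> same rb {10} {t} s s' \<and> pos s' = pos s \<and>
    (\<forall>j<n. rmem s' (rb + ad t j) = F j))"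
proof -
  let ?I = "\<lambda>j s'. ctx s' \<and> same rb {10} {t} s s' \<and> pos s' = pos s \<and> nmem s' (ad 10 0) = j \<and> (\<forall>x<j. rmem s' (rb + ad t x) = F x)"
  have "hx \<omega> (For 10 e (raset t (v 10) f)) (n * (1 + 2) + 2) s (\<lambda>s'. ctx s' \<and> same rb {10} {t} s s' \<and> pos s' = pos s \<and>
    (\<forall>j<n. rmem s' (rb + ad t j) = F j))"
  proof (rule hx_for[where I = ?I])
    fix j s1 assume j: "j < n" and I: "?I j s1"
    then have c1: "ctx s1" and sm: "same rb {10} {t} s s1" and 10: "nmem s1 (ad 10 0) = j" by blast+
    have v: "rval f s1 = F j" using f[OF c1 sm] 10 j by simp
    show "hx \<omega> (raset t (v 10) f) 1 s1 (\<lambda>s'. nmem s' (ad 10 0) = j \<and> ?I (Suc j) (setn s' (ad 10 0) (Suc j)))"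
      using I t v 10 by (intro hx_raset) (simp add: ctxD[OF c1] ctx_upd same_intros less_Suc_eq)
  next
    show "nval e s' = n \<and> nmem s' (ad 10 0) = j" if "?I j s'" for j s' using that e by blast
  qed (use c in \<open>auto simp: ctx_upd same_intros\<close>)
  then show ?thesis by (rule hx_mono) auto
qed

section \<open>One copy: images on the line, their order and the two scans\<close>

definition pvalc :: com where
  "pvalc = Seq (For 10 (v 3) (raset 2 (v 10) (ROfNat (NConst 0)))) (Seq (For 18 (v 7) coordc)
    (For 10 (v 3) (raset 1 (v 10) (ra 2 (v 10)))))"

lemma hx_pvals:
  assumes c: "ctx s" and F: "has_F X s" and p: "pos s = \<beta>"
  shows "hx \<omega> pvalc ((N * 3 + 2) + ((k * (coord_cost + 2) + 2) + (N * 3 + 2))) s (\<lambda>s'. ctx s' \<and> same rb (insert 18 cN) cR s s' \<and>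
    pos s' = \<beta> + k * Suc N \<and> (\<forall>j<N. rmem s' (rb + ad 1 j) = gap_system.pv k N q X \<beta> \<omega> j))"
    (is "hx _ _ _ _ ?Q")
proof -
  interpret G: gap_system k N q X by unfold_locales (rule q2)
  let ?t = "For 10 (v 3) (raset 1 (v 10) (ra 2 (v 10)))"
  let ?S = "same rb (insert 18 cN) cR s"
  have 0: "rval (ROfNat (NConst 0)) s' = (\<lambda>_. 0) (nmem s' (ad 10 0))" for s' by simp
  show ?thesis unfolding pvalc_def
  proof (rule hx_seq, rule hx_mono[OF hx_fill_array[OF c, where n = N and F = "\<lambda>_. 0"] order_refl])
    fix s1 assume "ctx s1 \<and> same rb {10} {2} s s1 \<and> pos s1 = pos s \<and> (\<forall>j<N. rmem s1 (rb + ad 2 j) = 0)"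
    then have c1: "ctx s1" and sm1: "same rb {10} {2} s s1" and p1: "pos s1 = \<beta>" and z: "\<forall>j<N. rmem s1 (rb + ad 2 j) = 0"
      using p by auto
    have "?S s" by simp
    then have S1: "?S s1" using sm1 by (rule same_trans) auto
    let ?I = "\<lambda>i s'. ctx s' \<and> ?S s' \<and> nmem s' (ad 18 0) = i \<and> pos s' = G.cpos \<beta> i \<and>
      (\<forall>j<N. rmem s' (rb + ad 2 j) = (\<Sum>i'<i. \<omega> (G.cpos \<beta> i') * G.phi \<beta> \<omega> i' (X j i')))"
    show "hx \<omega> (Seq (For 18 (v 7) coordc) ?t) ((k * (coord_cost + 2) + 2) + (N * 3 + 2)) s1 ?Q"
    proof (rule hx_seq, rule hx_for[where I = ?I])
      show "?I 0 (setn s1 (ad 18 0) 0)" using c1 S1 p1 z by (simp add: ctx_upd same_intros G.cpos_def)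
      show "nval (v 7) s' = k \<and> nmem s' (ad 18 0) = i" if "?I i s'" for i s' using that by (simp add: ctxD)
    next
      fix i s2 assume i: "i < k" and I: "?I i s2"
      then have c2: "ctx s2" and S2: "?S s2" and i2: "nmem s2 (ad 18 0) = i" and p2: "pos s2 = G.cpos \<beta> i" by blast+
      have F2: "has_F X s2" by (rule has_F_same[OF F S2]) simp
      show "hx \<omega> coordc coord_cost s2 (\<lambda>s'. nmem s' (ad 18 0) = i \<and> ?I (Suc i) (setn s' (ad 18 0) (Suc i)))"
      proof (rule hx_mono[OF hx_coord[OF c2 F2 i2 i p2] order_refl], elim conjE)
        fix s3 assume c3: "ctx s3" and sm3: "same rb cN cR s2 s3" and p3: "pos s3 = G.cpos \<beta> (Suc i)"
          and v3: "\<forall>j<N. rmem s3 (rb + ad 2 j) = rmem s2 (rb + ad 2 j) + \<omega> (G.cpos \<beta> i) * G.phi \<beta> \<omega> i (X j i)"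
        have "?S s3" using S2 sm3 by (rule same_trans) auto
        then show "nmem s3 (ad 18 0) = i \<and> ?I (Suc i) (setn s3 (ad 18 0) (Suc i))"
          using c3 p3 v3 I same_nD[OF sm3, of 18 0] by (simp add: ctx_upd same_intros)
      qed
    next
      fix s2 assume I: "?I k s2"
      then have c2: "ctx s2" and S2: "?S s2" and p2: "pos s2 = \<beta> + k * Suc N" by (simp_all add: G.cpos_def)
      have v2: "rmem s2 (rb + ad 2 j) = G.pv \<beta> \<omega> j" if "j < N" for j using I that by (simp add: G.pv_def)
      show "hx \<omega> ?t (N * 3 + 2) s2 ?Q"
      proof (rule hx_mono[OF hx_fill_array[OF c2, where n = N and F = "G.pv \<beta> \<omega>"] order_refl])
        fix s' assume c': "ctx s'" and sm': "same rb {10} {1} s2 s'" and l: "nmem s' (ad 10 0) < N"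
        show "rval (ra 2 (v 10)) s' = G.pv \<beta> \<omega> (nmem s' (ad 10 0))"
          using v2[OF l] by (simp add: ctxD[OF c'] same_rD[OF sm'])
      next
        fix s' assume "ctx s' \<and> same rb {10} {1} s2 s' \<and> pos s' = pos s2 \<and> (\<forall>j<N. rmem s' (rb + ad 1 j) = G.pv \<beta> \<omega> j)"
        then have c': "ctx s'" and sm': "same rb {10} {1} s2 s'" and p': "pos s' = pos s2" and v': "\<forall>j<N. rmem s' (rb + ad 1 j) = G.pv \<beta> \<omega> j" by blast+
        have "?S s'" using S2 sm' by (rule same_trans) auto
        then show "?Q s'" using c' p' v' p2 by simp
      qed (simp_all add: ctxD)
    qed
  qed (simp_all add: ctxD)
qed

definition copyc :: "bool \<Rightarrow> com" where
  "copyc l2 = Seq pvalc (Seq sortc (Seq (scanc l2 (na 23 (v 10))) (scanc l2 (na 23 (NSub (NSub (v 3) (NConst 1)) (v 10))))))"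

definition copy_cost :: nat where
  "copy_cost = ((N * 3 + 2) + ((k * (coord_cost + 2) + 2) + (N * 3 + 2))) + (sort_cost + ((N * (d * 5 + 13) + 3) + (N * (d * 5 + 13) + 3)))"

abbreviation wN :: "nat set" where "wN \<equiv> {9, 10, 12, 15, 16, 18, 19, 22, 23, 24, 25, 26, 27, 28}"
abbreviation wR :: "nat set" where "wR \<equiv> {0, 1, 2, 3, 6, 7, 8, 9, 10, 11, 12}"

text \<open>If \<open>b'\<close> precedes \<open>a\<close> in the sorted order, the forward scan
  applies, otherwise the backward scan. A point between \<open>a\<close> and \<open>b'\<close> on
  the line is no farther from \<open>a\<close> than \<open>b'\<close> is.\<close>

lemma hx_copy:
  assumes c: "ctx s" and F: "has_F X s" and at: "attained l2 s" and p: "pos s = \<beta>"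
  shows "hx \<omega> (copyc l2) copy_cost s (\<lambda>s'. ctx s' \<and> same rb wN wR s s' \<and> pos s' = \<beta> + k * Suc N \<and> attained l2 s' \<and>
    (\<forall>a<mA. rmem s' (rb + ad 3 a) \<le> rmem s (rb + ad 3 a)) \<and>
    (\<forall>a<mA. \<forall>b'. mA \<le> b' \<longrightarrow> b' < N \<longrightarrow> (\<exists>b. gap_system.nearby k N q X \<beta> \<omega> a b' b \<and> rmem s' (rb + ad 3 a) \<le> dst l2 a b)))"
    (is "hx _ _ _ _ ?Q")
proof -
  interpret G: gap_system k N q X by unfold_locales (rule q2)
  let ?p = "G.pv \<beta> \<omega>"
  let ?S = "same rb wN wR s"
  let ?D = "\<lambda>s a. rmem s (rb + ad 3 a)"
  let ?i1 = "na 23 (v 10)" and ?i2 = "na 23 (NSub (NSub (v 3) (NConst 1)) (v 10))"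
  let ?sc = "N * (d * 5 + 13) + 3"
  show ?thesis unfolding copyc_def copy_cost_def
  proof (rule hx_seq, rule hx_mono[OF hx_pvals[OF c F p] order_refl], elim conjE)
    fix s1 assume c1: "ctx s1" and sm1: "same rb (insert 18 cN) cR s s1" and p1: "pos s1 = \<beta> + k * Suc N"
      and key: "\<forall>j<N. rmem s1 (rb + ad 1 j) = ?p j"
    have "?S s" by simp
    then have S1: "?S s1" using sm1 by (rule same_trans) auto
    show "hx \<omega> (Seq sortc (Seq (scanc l2 ?i1) (scanc l2 ?i2))) (sort_cost + (?sc + ?sc)) s1 ?Q"
    proof (rule hx_seq, rule hx_mono[OF hx_sort[OF c1] order_refl], elim conjE)
      fix s2 assume c2: "ctx s2" and sm2: "same rb sN sR s1 s2" and p2: "pos s2 = pos s1"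
        and so: "sorted_by (\<lambda>j. rmem s1 (rb + ad 1 j)) (\<lambda>e. nmem s2 (ad 23 e)) N"
      let ?od = "\<lambda>e. nmem s2 (ad 23 e)"
      have od: "?od e < N" if "e < N" for e using so that by (simp add: sorted_by_def)
      have inj: "?od e = ?od e' \<Longrightarrow> e = e'" if "e < N" "e' < N" for e e' using so that by (auto simp: sorted_by_def inj_on_def)
      have mono: "?p (?od e) \<le> ?p (?od e')" if "e \<le> e'" "e' < N" for e e'
      proof -
        have "rmem s1 (rb + ad 1 (?od e)) \<le> rmem s1 (rb + ad 1 (?od e'))" using so that by (simp add: sorted_by_def)
        then show ?thesis using key od[of e] od[of e'] that by simp
      qed
      have onto: "\<exists>e<N. j = ?od e" if "j < N" for j
      proof -
        have "?od ` {..<N} = {..<N}" by (rule endo_inj_surj) (auto simp: inj_on_def od inj)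
        then have "j \<in> ?od ` {..<N}" using that by simp
        then show ?thesis by blast
      qed
      have S2: "?S s2" using S1 sm2 by (rule same_trans) auto
      have D2: "?D s2 a = ?D s a" for a by (simp add: same_rD[OF sm2] same_rD[OF sm1])
      have at2: "attained l2 s2" using at by (simp add: attained_def D2)
      show "hx \<omega> (Seq (scanc l2 ?i1) (scanc l2 ?i2)) (?sc + ?sc) s2 ?Q"
      proof (rule hx_seq, rule hx_mono[OF hx_scan[OF c2 at2, where od = ?od and g = ?p] order_refl])
        fix s3
        assume "ctx s3 \<and> same rb pN pR s2 s3 \<and> pos s3 = pos s2 \<and> attained l2 s3 \<and> (\<forall>a<mA. ?D s3 a \<le> ?D s2 a) \<and>
          (\<forall>e<N. \<forall>e'<e. ?od e < mA \<longrightarrow> mA \<le> ?od e' \<longrightarrow>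
            (\<exists>b. mA \<le> b \<and> b < N \<and> ?D s3 (?od e) \<le> dst l2 (?od e) b \<and> ?p (?od e') \<le> ?p b \<and> ?p b \<le> ?p (?od e)))"
        then have c3: "ctx s3" and sm3: "same rb pN pR s2 s3" and p3: "pos s3 = pos s2" and at3: "attained l2 s3"
          and le3: "\<And>a. a < mA \<Longrightarrow> ?D s3 a \<le> ?D s2 a"
          and W3: "\<And>e e'. e < N \<Longrightarrow> e' < e \<Longrightarrow> ?od e < mA \<Longrightarrow> mA \<le> ?od e' \<Longrightarrow>
            (\<exists>b. mA \<le> b \<and> b < N \<and> ?D s3 (?od e) \<le> dst l2 (?od e) b \<and> ?p (?od e') \<le> ?p b \<and> ?p b \<le> ?p (?od e))"
          by simp_all
        have S3: "?S s3" using S2 sm3 by (rule same_trans) auto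
        let ?od' = "\<lambda>e. ?od (N - 1 - e)"
        show "hx \<omega> (scanc l2 ?i2) ?sc s3 ?Q"
        proof (rule hx_mono[OF hx_scan[OF c3 at3, where od = ?od' and g = "\<lambda>j. - ?p j"] order_refl])
          fix s' assume "ctx s'" "same rb pN pR s3 s'"
          then show "nval ?i2 s' = ?od' (nmem s' (ad 10 0))" by (simp add: same_nD same_nD[OF sm3] ctxD[OF c2])
        next
          show "?od' e < N" if "e < N" for e using that by (intro od) simp
          show "e = e'" if "e < N" "e' < N" "?od' e = ?od' e'" for e e'
          proof -
            have "N - 1 - e = N - 1 - e'" by (rule inj[OF _ _ that(3)]) (use that in auto)
            then show ?thesis using that by simp
          qed
          show "- ?p (?od' e) \<le> - ?p (?od' e')" if "e \<le> e'" "e' < N" for e e'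
            using mono[of "N - 1 - e'" "N - 1 - e"] that by simp
        next
          fix s4
          assume "ctx s4 \<and> same rb pN pR s3 s4 \<and> pos s4 = pos s3 \<and> attained l2 s4 \<and> (\<forall>a<mA. ?D s4 a \<le> ?D s3 a) \<and>
            (\<forall>e<N. \<forall>e'<e. ?od' e < mA \<longrightarrow> mA \<le> ?od' e' \<longrightarrow>
              (\<exists>b. mA \<le> b \<and> b < N \<and> ?D s4 (?od' e) \<le> dst l2 (?od' e) b \<and> - ?p (?od' e') \<le> - ?p b \<and> - ?p b \<le> - ?p (?od' e)))"
          then have c4: "ctx s4" and sm4: "same rb pN pR s3 s4" and p4: "pos s4 = pos s3" and at4: "attained l2 s4"
            and le4: "\<And>a. a < mA \<Longrightarrow> ?D s4 a \<le> ?D s3 a"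
            and W4: "\<And>e e'. e < N \<Longrightarrow> e' < e \<Longrightarrow> ?od' e < mA \<Longrightarrow> mA \<le> ?od' e' \<Longrightarrow>
              (\<exists>b. mA \<le> b \<and> b < N \<and> ?D s4 (?od' e) \<le> dst l2 (?od' e) b \<and> ?p b \<le> ?p (?od' e') \<and> ?p (?od' e) \<le> ?p b)"
            by simp_all
          have S4: "?S s4" using S3 sm4 by (rule same_trans) auto
          have "\<exists>b. G.nearby \<beta> \<omega> a b' b \<and> ?D s4 a \<le> dst l2 a b" if a: "a < mA" and b': "mA \<le> b'" "b' < N" for a b'
          proof -
            have aN: "a < N" using a mA_less by simp
            obtain e where e: "e < N" "a = ?od e" using onto[OF aN] by blast
            obtain e' where e': "e' < N" "b' = ?od e'" using onto[OF b'(2)] by blast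
            show ?thesis
            proof (cases "e' < e")
              case True
              then obtain b where b: "b < N" "?D s3 a \<le> dst l2 a b" "?p b' \<le> ?p b" "?p b \<le> ?p a"
                using W3[of e e'] e e' a b' by blast
              then have "G.nearby \<beta> \<omega> a b' b" by (simp add: G.nearby_def)
              then show ?thesis using b(2) le4[OF a] by (intro exI[of _ b]) simp
            next
              case False
              have "e \<noteq> e'" using e e' a b' by auto
              then have lt: "N - 1 - e' < N - 1 - e" "N - 1 - e < N" using False e' by auto
              have r: "?od' (N - 1 - e) = a" "?od' (N - 1 - e') = b'" using e e' by simp_all
              obtain b where b: "b < N" "?D s4 a \<le> dst l2 a b" "?p b \<le> ?p b'" "?p a \<le> ?p b"
                using W4[OF lt(2,1)] a b' unfolding r by blast
              then have "G.nearby \<beta> \<omega> a b' b" by (simp add: G.nearby_def)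
              then show ?thesis using b(2) by (intro exI[of _ b]) simp
            qed
          qed
          moreover have "?D s4 a \<le> ?D s a" if "a < mA" for a using le4[OF that] le3[OF that] D2[of a] by simp
          ultimately show "?Q s4" using c4 S4 at4 p4 p3 p2 p1 by simp
        qed
      next
        fix s' assume "same rb pN pR s2 s'"
        then show "nval ?i1 s' = ?od (nmem s' (ad 10 0))" by (simp add: same_nD)
      qed (use od inj mono in blast)+
    qed
  qed
qed

definition initDc :: "bool \<Rightarrow> com" where
  "initDc l2 = Seq (vset 25 (v 0)) (For 10 (v 0) (Seq (vset 24 (v 10)) (Seq (distc l2) (raset 3 (v 10) (rv 12)))))"

lemma hx_initD:
  assumes c: "ctx s" and F: "has_F X s"
  shows "hx \<omega> (initDc l2) (mA * (d * 5 + 10) + 3) s (\<lambda>s'. ctx s' \<and> has_F X s' \<and> pos s' = pos s \<and> attained l2 s')"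
proof -
  let ?I = "\<lambda>j s'. ctx s' \<and> has_F X s' \<and> pos s' = pos s \<and> nmem s' (ad 10 0) = j \<and> nmem s' (ad 25 0) = mA \<and>
    (\<forall>a<j. rmem s' (rb + ad 3 a) = dst l2 a mA)"
  have "hx \<omega> (initDc l2) (1 + (mA * ((1 + ((d * 5 + 6) + 1)) + 2) + 2)) s (\<lambda>s'. ctx s' \<and> has_F X s' \<and> pos s' = pos s \<and> attained l2 s')"
    unfolding initDc_def
  proof (intro hx_seq hx_vset, rule hx_for[where I = ?I])
    show "?I 0 (setn (setn s (ad 25 0) (nval (v 0) s)) (ad 10 0) 0)" using c F by (simp add: ctxD ctx_upd has_F_def)
    show "nval (v 0) s' = mA \<and> nmem s' (ad 10 0) = j" if "?I j s'" for j s' using that by (simp add: ctxD)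
    show "ctx s' \<and> has_F X s' \<and> pos s' = pos s \<and> attained l2 s'" if "?I mA s'" for s'
      using that mA_less unfolding attained_def by blast
  next
    fix j s1 assume j: "j < mA" and I: "?I j s1"
    then have c1: "ctx s1" by blast
    let ?R = "\<lambda>s'. nmem s' (ad 10 0) = j \<and> ?I (Suc j) (setn s' (ad 10 0) (Suc j))"
    let ?s2 = "setn s1 (ad 24 0) j"
    have v10: "nval (v 10) s1 = j" using I by simp
    have c2: "ctx ?s2" using c1 by (simp add: ctx_upd)
    have "hx \<omega> (distc l2) (d * 5 + 6) ?s2 (\<lambda>s3. hx \<omega> (raset 3 (v 10) (rv 12)) 1 s3 ?R)"
    proof (rule hx_mono[OF hx_dist[where x = j and y = mA, OF c2] order_refl], goal_cases)
      case (5 s3)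
      then have c3: "ctx s3" and sm: "same rb {26, 27, 28} {12} ?s2 s3" and p3: "pos s3 = pos ?s2" and d3: "rmem s3 (rb + ad 12 0) = dst l2 j mA" by blast+
      have F2: "has_F X ?s2" using I by (simp add: has_F_def)
      have F3: "has_F X s3" by (rule has_F_same[OF F2 sm]) simp
      have n3: "nmem s3 (ad 10 0) = j" "nmem s3 (ad 25 0) = mA" "\<forall>a<j. rmem s3 (rb + ad 3 a) = dst l2 a mA"
        using I by (simp_all add: same_nD[OF sm] same_rD[OF sm])
      show ?case
        by (rule hx_raset_c[OF c3 _ refl, where y = j])
          (use c3 F3 n3 p3 d3 I in \<open>simp_all add: ctxD[OF c3] ctx_upd has_F_def less_Suc_eq\<close>)
    qed (use I j mA_less in simp_all)
    then have "hx \<omega> (Seq (distc l2) (raset 3 (v 10) (rv 12))) ((d * 5 + 6) + 1) ?s2 ?R" by (rule hx_seq)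
    then show "hx \<omega> (Seq (vset 24 (v 10)) (Seq (distc l2) (raset 3 (v 10) (rv 12)))) (1 + ((d * 5 + 6) + 1)) s1 ?R"
      by (rule hx_seq[OF hx_vset_c[OF v10]])
  qed
  then show ?thesis by (rule hx_mono) (simp_all add: algebra_simps)
qed

definition crudec :: "bool \<Rightarrow> com" where
  "crudec l2 = Seq (initDc l2) (For 17 (NConst 4) (copyc l2))"

text \<open>Crude distances are only ever lowered, so the bounds from earlier copies survive and the
  final value obeys the bounds of all four.\<close>

lemma hx_crude:
  assumes c: "ctx s" and F: "has_F X s" and p: "pos s = \<beta>"
  shows "hx \<omega> (crudec l2) (mA * (d * 5 + 10) + copy_cost * 4 + 13) s (\<lambda>s'. ctx s' \<and> pos s' = \<beta> + 4 * (k * Suc N) \<and> attained l2 s' \<and>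
    (\<forall>r<4. \<forall>a<mA. \<forall>b'. mA \<le> b' \<longrightarrow> b' < N \<longrightarrow>
      (\<exists>b. gap_system.nearby k N q X (gap_system.base k N \<beta> r) \<omega> a b' b \<and> rmem s' (rb + ad 3 a) \<le> dst l2 a b)))"
    (is "hx _ _ _ _ ?Q")
proof -
  interpret G: gap_system k N q X by unfold_locales (rule q2)
  let ?W = "\<lambda>r s'. \<forall>a<mA. \<forall>b'. mA \<le> b' \<longrightarrow> b' < N \<longrightarrow>
      (\<exists>b. G.nearby (G.base \<beta> r) \<omega> a b' b \<and> rmem s' (rb + ad 3 a) \<le> dst l2 a b)"
  let ?I = "\<lambda>j s'. ctx s' \<and> has_F X s' \<and> nmem s' (ad 17 0) = j \<and> pos s' = G.base \<beta> j \<and> attained l2 s' \<and> (\<forall>r<j. ?W r s')"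
  have "hx \<omega> (crudec l2) ((mA * (d * 5 + 10) + 3) + (4 * (copy_cost + 2) + 2)) s ?Q"
    unfolding crudec_def
  proof (rule hx_seq, rule hx_mono[OF hx_initD[OF c F] order_refl], rule hx_for[where I = ?I])
    fix s1 assume s1: "ctx s1 \<and> has_F X s1 \<and> pos s1 = pos s \<and> attained l2 s1"
    then show "?I 0 (setn s1 (ad 17 0) 0)" using p by (simp add: ctx_upd has_F_def attained_def G.base_def)
    show "nval (NConst 4) s' = 4 \<and> nmem s' (ad 17 0) = j" if "?I j s'" for j s' using that by simp
    show "?Q s'" if "?I 4 s'" for s' using that by (simp add: G.base_def)
  next
    fix s0 j s1 assume I: "?I j s1"
    then have c1: "ctx s1" and F1: "has_F X s1" and at1: "attained l2 s1" and p1: "pos s1 = G.base \<beta> j"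
      and j1: "nmem s1 (ad 17 0) = j" and W1: "\<And>r. r < j \<Longrightarrow> ?W r s1" by blast+
    show "hx \<omega> (copyc l2) copy_cost s1 (\<lambda>s'. nmem s' (ad 17 0) = j \<and> ?I (Suc j) (setn s' (ad 17 0) (Suc j)))"
    proof (rule hx_mono[OF hx_copy[OF c1 F1 at1 p1] order_refl], elim conjE)
      fix s2 assume c2: "ctx s2" and sm: "same rb wN wR s1 s2" and p2: "pos s2 = G.base \<beta> j + k * Suc N" and at2: "attained l2 s2"
        and le: "\<forall>a<mA. rmem s2 (rb + ad 3 a) \<le> rmem s1 (rb + ad 3 a)" and W2: "?W j s2"
      let ?s3 = "setn s2 (ad 17 0) (Suc j)"
      have "?W r ?s3" if "r < Suc j" for r
      proof (cases "r = j")
        case True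
        then show ?thesis using W2 by simp
      next
        case False
        show ?thesis
        proof (intro allI impI)
          fix a b' assume a: "a < mA" and b': "mA \<le> b'" "b' < N"
          have "r < j" using False that by simp
          then obtain b where "G.nearby (G.base \<beta> r) \<omega> a b' b" "rmem s1 (rb + ad 3 a) \<le> dst l2 a b" using W1[of r] a b' by blast
          moreover have "rmem s2 (rb + ad 3 a) \<le> rmem s1 (rb + ad 3 a)" using le a by blast
          ultimately show "\<exists>b. G.nearby (G.base \<beta> r) \<omega> a b' b \<and> rmem ?s3 (rb + ad 3 a) \<le> dst l2 a b"
            by (intro exI[of _ b]) simp
        qed
      qed
      moreover have "has_F X s2" by (rule has_F_same[OF F1 sm]) simp
      then have "has_F X ?s3" by (simp add: has_F_def)
      moreover have "nmem s2 (ad 17 0) = j" using j1 by (simp add: same_nD[OF sm])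
      moreover have "pos s2 = G.base \<beta> (Suc j)" using p2 by (simp add: G.base_def algebra_simps)
      ultimately show "nmem s2 (ad 17 0) = j \<and> ?I (Suc j) ?s3" using c2 at2 by (simp add: ctx_upd attained_def)
    qed
  qed
  then show ?thesis by (rule hx_mono) (simp_all add: algebra_simps)
qed

subsection \<open>The sampling phase\<close>

definition nn :: "bool \<Rightarrow> nat \<Rightarrow> real" where
  "nn l2 a = Min (dst l2 a ` {mA..<N})"

definition selectc :: com where
  "selectc = Seq (rset 16 (ROfNat (NConst 0))) (Seq (vset 24 (NConst 0)) (For 10 (v 0)
    (Seq (Cond (RLess (rv 15) (rv 16)) Skip (vset 24 (v 10))) (rset 16 (RAdd (rv 16) (ra 3 (v 10)))))))"

lemma hx_select:
  assumes c: "ctx s" and x: "rmem s (rb + ad 15 0) = x"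
  shows "hx \<omega> selectc (mA * 5 + 4) s (\<lambda>s'. ctx s' \<and> same rb {10, 24} {16} s s' \<and> pos s' = pos s \<and>
    nmem s' (ad 24 0) = sel (\<lambda>a. rmem s (rb + ad 3 a)) mA x)"
    (is "hx _ _ _ _ ?Q")
proof -
  let ?D = "\<lambda>a. rmem s (rb + ad 3 a)"
  let ?I = "\<lambda>j s'. ctx s' \<and> same rb {10, 24} {16} s s' \<and> pos s' = pos s \<and> nmem s' (ad 10 0) = j \<and>
    nmem s' (ad 24 0) = sel ?D j x \<and> rmem s' (rb + ad 16 0) = (\<Sum>a<j. ?D a)"
  let ?c = "Cond (RLess (rv 15) (rv 16)) Skip (vset 24 (v 10))"
  have "hx \<omega> selectc (1 + (1 + (mA * ((Suc 1 + 1) + 2) + 2))) s ?Q"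
    unfolding selectc_def
  proof (intro hx_seq hx_rset hx_vset, rule hx_for[where I = ?I])
    fix j s1 assume j: "j < mA" and I: "?I j s1"
    then have c1: "ctx s1" and sm: "same rb {10, 24} {16} s s1" and j1: "nmem s1 (ad 10 0) = j" by blast+
    have x1: "rmem s1 (rb + ad 15 0) = x" and D1: "rmem s1 (rb + ad 3 j) = ?D j" using x by (simp_all add: same_rD[OF sm])
    let ?R = "\<lambda>s'. nmem s' (ad 10 0) = j \<and> ?I (Suc j) (setn s' (ad 10 0) (Suc j))"
    show "hx \<omega> (Seq ?c (rset 16 (RAdd (rv 16) (ra 3 (v 10))))) (Suc 1 + 1) s1 ?R"
    proof (rule hx_seq, rule hx_cond)
      assume "bval (RLess (rv 15) (rv 16)) s1"
      then have "x < (\<Sum>a<j. ?D a)" using I x1 by (simp add: ctxD[OF c1])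
      then show "hx \<omega> Skip 1 s1 (\<lambda>s1. hx \<omega> (rset 16 (RAdd (rv 16) (ra 3 (v 10)))) 1 s1 ?R)"
        by (intro hx_skip hx_rset, insert I D1) (simp add: ctxD[OF c1] ctx_upd same_intros)
    next
      assume "\<not> bval (RLess (rv 15) (rv 16)) s1"
      then have "(\<Sum>a<j. ?D a) \<le> x" using I x1 by (simp add: ctxD[OF c1])
      then show "hx \<omega> (vset 24 (v 10)) 1 s1 (\<lambda>s1. hx \<omega> (rset 16 (RAdd (rv 16) (ra 3 (v 10)))) 1 s1 ?R)"
        by (intro hx_vset hx_rset, insert I D1) (simp add: ctxD[OF c1] ctx_upd same_intros)
    qed
  next
    show "nval (v 0) s' = mA \<and> nmem s' (ad 10 0) = j" if "?I j s'" for j s' using that by (simp add: ctxD)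
  qed (use c in \<open>simp_all add: ctxD[OF c] ctx_upd same_intros\<close>)
  then show ?thesis by (rule hx_mono) simp_all
qed

definition nearestc :: "bool \<Rightarrow> com" where
  "nearestc l2 = Seq (vset 25 (v 0)) (Seq (distc l2) (Seq (rset 17 (rv 12)) (For 10 (v 1) (Seq (vset 25 (NAdd (v 0) (v 10)))
    (Seq (distc l2) (Cond (RLess (rv 12) (rv 17)) (rset 17 (rv 12)) Skip))))))"

lemma hx_nearest:
  assumes c: "ctx s" and a: "nmem s (ad 24 0) = a" "a < N"
  shows "hx \<omega> (nearestc l2) ((mB + 1) * (d * 5 + 11)) s (\<lambda>s'. ctx s' \<and> same rb {10, 25, 26, 27, 28} {12, 17} s s' \<and> pos s' = pos s \<and>
    rmem s' (rb + ad 17 0) = nn l2 a)"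
    (is "hx _ _ _ _ ?Q")
proof -
  let ?S = "same rb {10, 25, 26, 27, 28} {12, 17} s"
  let ?I = "\<lambda>j s'. ctx s' \<and> ?S s' \<and> pos s' = pos s \<and> nmem s' (ad 10 0) = j \<and>
    (\<exists>b. mA \<le> b \<and> b < N \<and> rmem s' (rb + ad 17 0) = dst l2 a b) \<and> (\<forall>b. mA \<le> b \<longrightarrow> b < mA + j \<longrightarrow> rmem s' (rb + ad 17 0) \<le> dst l2 a b)"
  let ?c = "Cond (RLess (rv 12) (rv 17)) (rset 17 (rv 12)) Skip"
  let ?f = "For 10 (v 1) (Seq (vset 25 (NAdd (v 0) (v 10))) (Seq (distc l2) ?c))"
  let ?fc = "mB * ((1 + ((d * 5 + 6) + Suc 1)) + 2) + 2"
  let ?s1 = "setn s (ad 25 0) mA"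
  have loop: "hx \<omega> ?f ?fc s2 ?Q" if "?I 0 (setn s2 (ad 10 0) 0)" for s2
  proof (rule hx_for[where I = ?I])
    show "nval (v 1) s' = mB \<and> nmem s' (ad 10 0) = j" if "?I j s'" for j s' using that by (simp add: ctxD del: One_nat_def)
    fix s' assume I: "?I mB s'"
    have "nn l2 a = rmem s' (rb + ad 17 0)" unfolding nn_def
    proof (rule Min_eqI)
      show "y \<ge> rmem s' (rb + ad 17 0)" if y: "y \<in> dst l2 a ` {mA..<N}" for y
      proof -
        obtain b where "y = dst l2 a b" "mA \<le> b" "b < mA + mB" using y N by auto
        then show ?thesis using I by blast
      qed
      show "rmem s' (rb + ad 17 0) \<in> dst l2 a ` {mA..<N}"
      proof -
        obtain b where "mA \<le> b" "b < N" "rmem s' (rb + ad 17 0) = dst l2 a b" using I by blast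
        then show ?thesis by simp
      qed
    qed simp
    then show "?Q s'" using I by simp
  next
    fix j s1 assume j: "j < mB" and I: "?I j s1"
    then have c1: "ctx s1" and S1: "?S s1" and j1: "nmem s1 (ad 10 0) = j" and p1: "pos s1 = pos s"
      and w: "\<exists>b. mA \<le> b \<and> b < N \<and> rmem s1 (rb + ad 17 0) = dst l2 a b"
      and l: "\<And>b. mA \<le> b \<Longrightarrow> b < mA + j \<Longrightarrow> rmem s1 (rb + ad 17 0) \<le> dst l2 a b" by blast+
    have jN: "mA + j < N" using j N by linarith
    let ?R = "\<lambda>s'. nmem s' (ad 10 0) = j \<and> ?I (Suc j) (setn s' (ad 10 0) (Suc j))"
    let ?s2 = "setn s1 (ad 25 0) (mA + j)"
    have vb: "nval (NAdd (v 0) (v 10)) s1 = mA + j" using j1 by (simp add: ctxD[OF c1])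
    have c2: "ctx ?s2" using c1 by (simp add: ctx_upd)
    have S2: "?S ?s2" using S1 by (simp add: same_intros)
    have "hx \<omega> (distc l2) (d * 5 + 6) ?s2 (\<lambda>s3. hx \<omega> ?c (Suc 1) s3 ?R)"
    proof (rule hx_mono[OF hx_dist[where x = a and y = "mA + j", OF c2] order_refl], goal_cases)
      case (5 s3)
      then have c3: "ctx s3" and sm: "same rb {26, 27, 28} {12} ?s2 s3" and p3: "pos s3 = pos s" and d3: "rmem s3 (rb + ad 12 0) = dst l2 a (mA + j)"
        using p1 by simp_all
      have S3: "?S s3" using S2 sm by (rule same_trans) auto
      have n3: "nmem s3 (ad 10 0) = j" and r3: "rmem s3 (rb + ad 17 0) = rmem s1 (rb + ad 17 0)"
        using j1 by (simp_all add: same_nD[OF sm] same_rD[OF sm])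
      have fin: "?R s4" if s4: "ctx s4" "?S s4" "pos s4 = pos s" "nmem s4 (ad 10 0) = j"
        "rmem s4 (rb + ad 17 0) = min (rmem s1 (rb + ad 17 0)) (dst l2 a (mA + j))" for s4
      proof -
        have "\<exists>b. mA \<le> b \<and> b < N \<and> rmem s4 (rb + ad 17 0) = dst l2 a b"
          using w jN s4(5) unfolding min_def by (auto intro: exI[of _ "mA + j"])
        moreover have "rmem s4 (rb + ad 17 0) \<le> dst l2 a b" if b: "mA \<le> b" "b < mA + Suc j" for b
        proof (cases "b = mA + j")
          case False
          then show ?thesis using l[of b] b s4(5) by simp
        qed (use s4(5) in simp)
        ultimately show ?thesis using s4 by (simp add: ctx_upd same_intros)
      qed
      show ?case
      proof (rule hx_cond)
        assume "bval (RLess (rv 12) (rv 17)) s3"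
        then have "dst l2 a (mA + j) < rmem s1 (rb + ad 17 0)" using d3 r3 by (simp add: ctxD[OF c3])
        then have "?R (setr s3 (rb + ad 17 0) (dst l2 a (mA + j)))"
          by (intro fin) (use c3 S3 p3 n3 in \<open>simp_all add: ctx_upd same_intros min_def\<close>)
        then show "hx \<omega> (rset 17 (rv 12)) 1 s3 ?R"
          by (intro hx_rset_c[OF c3, where x = "dst l2 a (mA + j)"]) (simp_all add: d3 ctxD[OF c3])
      next
        assume "\<not> bval (RLess (rv 12) (rv 17)) s3"
        then have "rmem s1 (rb + ad 17 0) \<le> dst l2 a (mA + j)" using d3 r3 by (simp add: ctxD[OF c3])
        then have "?R s3" by (intro fin) (use c3 S3 p3 n3 r3 in \<open>simp_all add: min_def\<close>)
        then show "hx \<omega> Skip 1 s3 ?R" by (rule hx_skip)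
      qed
    qed (use a jN same_nD[OF S1, of 24 0] in simp_all)
    then have "hx \<omega> (Seq (distc l2) ?c) ((d * 5 + 6) + Suc 1) ?s2 ?R" by (rule hx_seq)
    then show "hx \<omega> (Seq (vset 25 (NAdd (v 0) (v 10))) (Seq (distc l2) ?c)) (1 + ((d * 5 + 6) + Suc 1)) s1 ?R"
      by (rule hx_seq[OF hx_vset_c[OF vb]])
  qed (use that in blast)
  have c1: "ctx ?s1" using c by (simp add: ctx_upd)
  have S1: "?S ?s1" by (simp add: same_intros)
  have "hx \<omega> (distc l2) (d * 5 + 6) ?s1 (\<lambda>s3. hx \<omega> (Seq (rset 17 (rv 12)) ?f) (1 + ?fc) s3 ?Q)"
  proof (rule hx_mono[OF hx_dist[where x = a and y = mA, OF c1] order_refl], goal_cases)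
    case (5 s3)
    then have c3: "ctx s3" and sm: "same rb {26, 27, 28} {12} ?s1 s3" and p3: "pos s3 = pos s" and d3: "rmem s3 (rb + ad 12 0) = dst l2 a mA" by simp_all
    have S3: "?S s3" using S1 sm by (rule same_trans) auto
    have "hx \<omega> ?f ?fc (setr s3 (rb + ad 17 0) (dst l2 a mA)) ?Q"
      by (rule loop) (use c3 S3 p3 mA_less in \<open>auto simp: ctx_upd same_intros\<close>)
    moreover have "rval (rv 12) s3 = dst l2 a mA" using d3 by (simp add: ctxD[OF c3])
    ultimately show ?case by (intro hx_seq hx_rset_c[OF c3])
  qed (use a mA_less in simp_all)
  then have "hx \<omega> (Seq (distc l2) (Seq (rset 17 (rv 12)) ?f)) ((d * 5 + 6) + (1 + ?fc)) ?s1 ?Q" by (rule hx_seq)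
  moreover have "nval (v 0) s = mA" by (simp add: ctxD[OF c])
  ultimately have "hx \<omega> (nearestc l2) (1 + ((d * 5 + 6) + (1 + ?fc))) s ?Q" unfolding nearestc_def by (intro hx_seq[OF hx_vset_c])
  then show ?thesis by (rule hx_mono) (simp_all add: algebra_simps)
qed

text \<open>Reals cannot be rounded to integers, so the number of samples is never computed
  beforehand: the counter is compared with the real bound, and its final value, the ceiling of that
  bound, serves as divisor.\<close>

definition sampc :: "nat \<Rightarrow> bool \<Rightarrow> com" where
  "sampc cs l2 = Seq (rset 13 (ROfNat (NConst 0))) (Seq (For 10 (v 0) (rset 13 (RAdd (rv 13) (ra 3 (v 10))))) (Seq (vset 29 (NConst 0)) (Seq (rset 14 (ROfNat (NConst 0)))
    (Seq (While (RLess (ROfNat (v 29)) (RDiv (RMult (ROfNat (NConst cs)) (ROfNat (v 6))) (RMult (RLoad (NConst 0)) (RLoad (NConst 0)))))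
      (Seq (rsample 15 (NConst 0)) (Seq (rset 15 (RMult (rv 15) (rv 13))) (Seq selectc (Seq (nearestc l2)
        (Seq (rset 14 (RAdd (rv 14) (RDiv (rv 17) (ra 3 (v 24))))) (vset 29 (NAdd (v 29) (NConst 1)))))))))
    (RStore (NConst 0) (RDiv (RMult (rv 14) (rv 13)) (ROfNat (v 29))))))))"

definition samples :: "nat \<Rightarrow> real \<Rightarrow> nat" where
  "samples cs \<epsilon> = nat \<lceil>real cs * real q / \<epsilon>\<^sup>2\<rceil>"

definition iter_cost :: nat where
  "iter_cost = 1 + (1 + ((mA * 5 + 4) + ((mB + 1) * (d * 5 + 11) + (1 + 1))))"

definition estimate :: "bool \<Rightarrow> (nat \<Rightarrow> real) \<Rightarrow> nat \<Rightarrow> nat \<Rightarrow> (nat \<Rightarrow> real) \<Rightarrow> real" where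
  "estimate l2 D M p \<omega> = (\<Sum>j<M. nn l2 (sel D mA (\<omega> (p + j) * (\<Sum>a<mA. D a))) / D (sel D mA (\<omega> (p + j) * (\<Sum>a<mA. D a)))) * (\<Sum>a<mA. D a) / real M"

lemma hx_samp:
  assumes c: "ctx s" and w: "\<And>i. 0 \<le> \<omega> i" and D0: "\<And>a. a < mA \<Longrightarrow> 0 \<le> rmem s (rb + ad 3 a)" and rb0: "0 < rb"
  shows "hx \<omega> (sampc cs l2) (samples cs (inp 0) * (iter_cost + 1) + mA * 3 + 7) s
    (\<lambda>s'. rmem s' 0 = estimate l2 (\<lambda>a. rmem s (rb + ad 3 a)) (samples cs (inp 0)) (pos s) \<omega>)"
    (is "hx _ _ _ _ ?Q")
proof -
  let ?D = "\<lambda>a. rmem s (rb + ad 3 a)"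
  let ?T = "\<Sum>a<mA. ?D a"
  let ?M = "samples cs (inp 0)"
  let ?x = "real cs * real q / (inp 0)\<^sup>2"
  let ?TN = "{10, 24, 25, 26, 27, 28, 29}" and ?TR = "{12, 13, 14, 15, 16, 17}"
  let ?S = "same rb ?TN ?TR s"
  let ?f = "\<lambda>j. nn l2 (sel ?D mA (\<omega> (pos s + j) * ?T)) / ?D (sel ?D mA (\<omega> (pos s + j) * ?T))"
  let ?b = "RLess (ROfNat (v 29)) (RDiv (RMult (ROfNat (NConst cs)) (ROfNat (v 6))) (RMult (RLoad (NConst 0)) (RLoad (NConst 0))))"
  let ?add = "Seq (rset 14 (RAdd (rv 14) (RDiv (rv 17) (ra 3 (v 24))))) (vset 29 (NAdd (v 29) (NConst 1)))"
  let ?body = "Seq (rsample 15 (NConst 0)) (Seq (rset 15 (RMult (rv 15) (rv 13))) (Seq selectc (Seq (nearestc l2) ?add)))"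
  let ?out = "RStore (NConst 0) (RDiv (RMult (rv 14) (rv 13)) (ROfNat (v 29)))"
  have T0: "0 \<le> ?T" using D0 by (intro sum_nonneg) simp
  let ?I = "\<lambda>i s'. ctx s' \<and> ?S s' \<and> rmem s' (rb + ad 13 0) = ?T \<and> nmem s' (ad 29 0) = i \<and> pos s' = pos s + i \<and> rmem s' (rb + ad 14 0) = (\<Sum>j<i. ?f j)"
  have b: "bval ?b s' \<longleftrightarrow> i < ?M" if "?I i s'" for i s'
  proof -
    have "rmem s' 0 = inp 0" using ctxD(11)[of s' 0] that rb0 by blast
    then have "bval ?b s' \<longleftrightarrow> real i < ?x" using that by (simp add: ctxD power2_eq_square)
    also have "\<dots> \<longleftrightarrow> i < ?M" unfolding samples_def by linarith
    finally show ?thesis .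
  qed
  have step: "hx \<omega> ?body iter_cost s1 (?I (Suc i))" if I: "?I i s1" for i s1
  proof -
    have c1: "ctx s1" and S1: "?S s1" and p1: "pos s1 = pos s + i" and T1: "rmem s1 (rb + ad 13 0) = ?T" using I by blast+
    let ?s2 = "tick (setr s1 (rb + ad 15 0) (\<omega> (pos s + i)))"
    let ?x = "\<omega> (pos s + i) * ?T"
    let ?s3 = "setr ?s2 (rb + ad 15 0) ?x"
    have c2: "ctx ?s2" and c3: "ctx ?s3" using c1 by (simp_all add: ctx_upd)
    have S3: "?S ?s3" using S1 by (simp add: same_intros)
    have v2: "rval (RMult (rv 15) (rv 13)) ?s2 = ?x" using T1 by (simp add: ctxD[OF c1])
    have x3: "rmem ?s3 (rb + ad 15 0) = ?x" by simp
    have D3: "(\<lambda>a. rmem ?s3 (rb + ad 3 a)) = ?D" by (simp add: fun_eq_iff same_rD[OF S1])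
    let ?a = "sel ?D mA ?x"
    \<comment> \<open>If the first set is empty, \<open>sel\<close> returns its default 0. This is
      still the index of a point, and the sampled ratio is later multiplied by a total weight of
      0.\<close>
    have aN: "?a < N"
    proof (cases "mA = 0")
      case False
      then show ?thesis using sel_less[of mA ?x ?D] T0 w mA_less by (simp add: order_less_trans)
    qed (use N_pos in simp)
    have "hx \<omega> selectc (mA * 5 + 4) ?s3 (\<lambda>s4. hx \<omega> (Seq (nearestc l2) ?add) ((mB + 1) * (d * 5 + 11) + (1 + 1)) s4 (?I (Suc i)))"
    proof (rule hx_mono[OF hx_select[OF c3 x3] order_refl], elim conjE)
      fix s4 assume c4: "ctx s4" and sm4: "same rb {10, 24} {16} ?s3 s4" and p4: "pos s4 = pos ?s3"
        and a4: "nmem s4 (ad 24 0) = sel (\<lambda>a. rmem ?s3 (rb + ad 3 a)) mA ?x"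
      have S4: "?S s4" using S3 sm4 by (rule same_trans) auto
      have a4': "nmem s4 (ad 24 0) = ?a" using a4 unfolding D3 .
      show "hx \<omega> (Seq (nearestc l2) ?add) ((mB + 1) * (d * 5 + 11) + (1 + 1)) s4 (?I (Suc i))"
      proof (rule hx_seq, rule hx_mono[OF hx_nearest[OF c4 a4' aN] order_refl], elim conjE)
        fix s5 assume c5: "ctx s5" and sm5: "same rb {10, 25, 26, 27, 28} {12, 17} s4 s5" and p5: "pos s5 = pos s4"
          and n5: "rmem s5 (rb + ad 17 0) = nn l2 ?a"
        have S5: "?S s5" using S4 sm5 by (rule same_trans) auto
        have r5: "nmem s5 (ad 24 0) = ?a" "nmem s5 (ad 29 0) = i" "rmem s5 (rb + ad 13 0) = ?T" "rmem s5 (rb + ad 14 0) = (\<Sum>j<i. ?f j)"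
          using a4' I by (simp_all add: same_nD[OF sm5] same_nD[OF sm4] same_rD[OF sm5] same_rD[OF sm4])
        have "rmem s5 (rb + ad 3 ?a) = ?D ?a" by (simp add: same_rD[OF S5])
        then have "rval (RAdd (rv 14) (RDiv (rv 17) (ra 3 (v 24)))) s5 = (\<Sum>j<Suc i. ?f j)"
          using r5 n5 by (simp add: ctxD[OF c5])
        then show "hx \<omega> ?add (1 + 1) s5 (?I (Suc i))"
          by (intro hx_seq hx_rset_c[OF c5] hx_vset) (use c5 S5 r5 p5 p4 p1 in \<open>simp_all add: ctx_upd same_intros\<close>)
      qed
    qed
    then have "hx \<omega> (Seq selectc (Seq (nearestc l2) ?add)) ((mA * 5 + 4) + ((mB + 1) * (d * 5 + 11) + (1 + 1))) ?s3 (?I (Suc i))" by (rule hx_seq)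
    then have "hx \<omega> (Seq (rset 15 (RMult (rv 15) (rv 13))) (Seq selectc (Seq (nearestc l2) ?add))) (1 + ((mA * 5 + 4) + ((mB + 1) * (d * 5 + 11) + (1 + 1)))) ?s2 (?I (Suc i))"
      by (rule hx_seq[OF hx_rset_c[OF c2 v2]])
    then show ?thesis unfolding iter_cost_def p1[symmetric]
      by (rule hx_seq[OF hx_rsample_c[OF c1 nval.simps(1)]])
  qed
  have loop: "hx \<omega> (While ?b ?body) (?M * (iter_cost + 1) + 1) s1 (?I ?M)" if "?I 0 s1" for s1
  proof (rule hx_while[where I = "\<lambda>j s'. \<exists>i. i + j = ?M \<and> ?I i s'"])
    fix j s' assume "\<exists>i. i + j = ?M \<and> ?I i s'" and bs: "bval ?b s'"
    then obtain i where i: "i + j = ?M" "?I i s'" by blast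
    then have "i < ?M" using b[OF i(2)] bs by simp
    then obtain j' where j: "j = Suc j'" using i(1) by (cases j) auto
    have "hx \<omega> ?body iter_cost s' (\<lambda>s'. \<exists>i. i + j' = ?M \<and> ?I i s')"
      by (rule hx_mono[OF step[OF i(2)] order_refl]) (use i(1) j in \<open>intro exI[of _ "Suc i"] conjI, simp_all\<close>)
    then show "\<exists>j'. j = Suc j' \<and> hx \<omega> ?body iter_cost s' (\<lambda>s'. \<exists>i. i + j' = ?M \<and> ?I i s')" using j by blast
  next
    fix j s' assume "\<exists>i. i + j = ?M \<and> ?I i s'" and bs: "\<not> bval ?b s'"
    then obtain i where i: "i + j = ?M" "?I i s'" by blast
    then have "i = ?M" using b[OF i(2)] bs by simp
    then show "?I ?M s'" using i by blast
  qed (use that in \<open>intro exI[of _ 0], simp\<close>)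
  have out: "hx \<omega> (Seq (While ?b ?body) ?out) ((?M * (iter_cost + 1) + 1) + 1) s1 ?Q" if "?I 0 s1" for s1
  proof (rule hx_seq, rule hx_mono[OF loop[OF that] order_refl])
    fix s' assume I: "?I ?M s'"
    show "hx \<omega> ?out 1 s' ?Q"
      by (rule hx_rstore) (use I in \<open>simp add: ctxD estimate_def\<close>)
  qed
  let ?s1 = "setr s (rb + ad 13 0) 0"
  have c1: "ctx ?s1" using c by (simp add: ctx_upd)
  let ?J = "\<lambda>j s'. ctx s' \<and> ?S s' \<and> rmem s' (rb + ad 13 0) = (\<Sum>a<j. ?D a) \<and> nmem s' (ad 10 0) = j \<and> pos s' = pos s"
  have "hx \<omega> (For 10 (v 0) (rset 13 (RAdd (rv 13) (ra 3 (v 10))))) (mA * (1 + 2) + 2) ?s1 (?J mA)"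
  proof (rule hx_for[where I = ?J])
    show "?J 0 (setn ?s1 (ad 10 0) 0)" using c1 by (simp add: ctx_upd same_intros)
    show "nval (v 0) s' = mA \<and> nmem s' (ad 10 0) = j" if "?J j s'" for j s' using that by (simp add: ctxD)
    fix j s' assume J: "?J j s'"
    then have "?S s'" by blast
    then have "rmem s' (rb + ad 3 j) = ?D j" by (simp add: same_rD)
    with J show "hx \<omega> (rset 13 (RAdd (rv 13) (ra 3 (v 10)))) 1 s' (\<lambda>s'. nmem s' (ad 10 0) = j \<and> ?J (Suc j) (setn s' (ad 10 0) (Suc j)))"
      by (intro hx_rset) (simp add: ctxD ctx_upd same_intros same_rD)
  qed
  then have "hx \<omega> (For 10 (v 0) (rset 13 (RAdd (rv 13) (ra 3 (v 10))))) (mA * (1 + 2) + 2) ?s1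
    (\<lambda>s2. hx \<omega> (Seq (vset 29 (NConst 0)) (Seq (rset 14 (ROfNat (NConst 0))) (Seq (While ?b ?body) ?out))) (1 + (1 + ((?M * (iter_cost + 1) + 1) + 1))) s2 ?Q)"
  proof (rule hx_mono[OF _ order_refl])
    fix s2 assume J: "?J mA s2"
    then have c2: "ctx (setn s2 (ad 29 0) 0)" by (simp add: ctx_upd)
    have "?I 0 (setr (setn s2 (ad 29 0) 0) (rb + ad 14 0) 0)" using J by (simp add: ctx_upd same_intros)
    from out[OF this] have "hx \<omega> (Seq (rset 14 (ROfNat (NConst 0))) (Seq (While ?b ?body) ?out)) (1 + ((?M * (iter_cost + 1) + 1) + 1)) (setn s2 (ad 29 0) 0) ?Q"
      by (intro hx_seq[OF hx_rset_c[OF c2]]) simp_all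
    then show "hx \<omega> (Seq (vset 29 (NConst 0)) (Seq (rset 14 (ROfNat (NConst 0))) (Seq (While ?b ?body) ?out))) (1 + (1 + ((?M * (iter_cost + 1) + 1) + 1))) s2 ?Q"
      by (intro hx_seq[OF hx_vset_c]) simp_all
  qed
  then have "hx \<omega> (Seq (For 10 (v 0) (rset 13 (RAdd (rv 13) (ra 3 (v 10))))) (Seq (vset 29 (NConst 0)) (Seq (rset 14 (ROfNat (NConst 0))) (Seq (While ?b ?body) ?out))))
    ((mA * (1 + 2) + 2) + (1 + (1 + ((?M * (iter_cost + 1) + 1) + 1)))) ?s1 ?Q" by (rule hx_seq)
  moreover have "rval (ROfNat (NConst 0)) s = 0" by simp
  ultimately have "hx \<omega> (sampc cs l2) (1 + ((mA * (1 + 2) + 2) + (1 + (1 + ((?M * (iter_cost + 1) + 1) + 1))))) s ?Q"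
    unfolding sampc_def by (intro hx_seq[OF hx_rset_c[OF c]])
  then show ?thesis by (rule hx_mono) simp_all
qed

end

context gap_system
begin

text \<open>A copy reads random values only from its base on, so an analysis for a fresh source
  carries over to the spliced one.\<close>

lemma nearby_cong:
  assumes "\<And>x. \<beta> \<le> x \<Longrightarrow> \<omega> x = \<omega>' x"
  shows "nearby \<beta> \<omega> a b' b \<longleftrightarrow> nearby \<beta> \<omega>' a b' b"
proof -
  have "pv \<beta> \<omega> j = pv \<beta> \<omega>' j" for j
    unfolding pv_def phi_def Y_def by (simp add: assms cpos_def upos_def)
  then show ?thesis by (simp add: nearby_def)
qed

end

section \<open>The front phase: embedding followed by crude distances\<close>

context machine
begin

definition fphc :: com where
  "fphc = Cond (NLess (v 7) (v 2)) (Seq drawc projc) copyin"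

definition embed_cost :: nat where
  "embed_cost = Suc (if k < d then (k * (d * 4 + 4) + 3) + (N * (k * (d * 5 + 8) + 5) + 3) else N * d * 3 + 2)"

definition bpos :: nat where
  "bpos = (if k < d then k * d else 0)"

lemma hx_embed:
  assumes c: "ctx s" and p: "pos s = 0" and k: "k \<le> d"
    and X: "\<And>j i. j < N \<Longrightarrow> i < k \<Longrightarrow> X j i = (if k < d then prj \<omega> j i else pt j i)"
  shows "hx \<omega> fphc embed_cost s (\<lambda>s'. ctx s' \<and> has_F X s' \<and> pos s' = bpos)"
  unfolding fphc_def embed_cost_def
proof (rule hx_cond)
  assume "bval (NLess (v 7) (v 2)) s"
  then have kd: "k < d" by (simp add: ctxD[OF c])
  have "hx \<omega> (Seq drawc projc) ((k * (d * 4 + 4) + 3) + (N * (k * (d * 5 + 8) + 5) + 3)) s (\<lambda>s'. ctx s' \<and> has_F X s' \<and> pos s' = bpos)"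
  proof (rule hx_seq, rule hx_mono[OF hx_draw[OF c p] order_refl], elim conjE)
    fix s1 assume s1: "ctx s1" "pos s1 = k * d" "\<forall>x<k * d. rmem s1 (rb + ad 4 x) = \<omega> x"
    show "hx \<omega> projc (N * (k * (d * 5 + 8) + 5) + 3) s1 (\<lambda>s'. ctx s' \<and> has_F X s' \<and> pos s' = bpos)"
      by (rule hx_mono[OF hx_proj[OF s1(1,3)] order_refl]) (use s1 kd X in \<open>simp add: bpos_def has_F_def\<close>)
  qed
  then show "hx \<omega> (Seq drawc projc) (if k < d then (k * (d * 4 + 4) + 3) + (N * (k * (d * 5 + 8) + 5) + 3) else N * d * 3 + 2) s
    (\<lambda>s'. ctx s' \<and> has_F X s' \<and> pos s' = bpos)" using kd by simp
next
  assume "\<not> bval (NLess (v 7) (v 2)) s"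
  then have kd: "k = d" using k by (simp add: ctxD[OF c])
  have "hx \<omega> copyin (N * d * 3 + 2) s (\<lambda>s'. ctx s' \<and> has_F X s' \<and> pos s' = bpos)"
  proof (rule hx_mono[OF hx_copyin[OF c kd] order_refl], elim conjE)
    fix s1 assume s1: "ctx s1" "pos s1 = pos s" "has_F pt s1"
    have "bpos = 0" unfolding bpos_def using kd by simp
    moreover have "has_F X s1" using s1(3) X kd unfolding has_F_def by simp
    ultimately show "ctx s1 \<and> has_F X s1 \<and> pos s1 = bpos" using s1 p by simp
  qed
  then show "hx \<omega> copyin (if k < d then (k * (d * 4 + 4) + 3) + (N * (k * (d * 5 + 8) + 5) + 3) else N * d * 3 + 2) s
    (\<lambda>s'. ctx s' \<and> has_F X s' \<and> pos s' = bpos)" using kd by simp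
qed

definition crude_cost :: nat where
  "crude_cost = mA * (d * 5 + 10) + copy_cost * 4 + 13"

lemma hx_front:
  assumes c: "ctx s" and p: "pos s = 0" and k: "k \<le> d"
    and X: "\<And>j i. j < N \<Longrightarrow> i < k \<Longrightarrow> X j i = (if k < d then prj \<omega> j i else pt j i)"
  shows "hx \<omega> (Seq fphc (crudec l2)) (embed_cost + crude_cost) s (\<lambda>s'. ctx s' \<and> pos s' = bpos + 4 * (k * Suc N) \<and> attained l2 s' \<and>
    (\<forall>r<4. \<forall>a<mA. \<forall>b'. mA \<le> b' \<longrightarrow> b' < N \<longrightarrow>
      (\<exists>b. gap_system.nearby k N q X (gap_system.base k N bpos r) \<omega> a b' b \<and> rmem s' (rb + ad 3 a) \<le> dst l2 a b)))"
  unfolding crude_cost_def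
proof (rule hx_seq, rule hx_mono[OF hx_embed[where X = X, OF c p k] order_refl], rule X, assumption, assumption, elim conjE)
  fix s1 assume "ctx s1" "has_F X s1" "pos s1 = bpos"
  then show "hx \<omega> (crudec l2) (mA * (d * 5 + 10) + copy_cost * 4 + 13) s1 (\<lambda>s'. ctx s' \<and> pos s' = bpos + 4 * (k * Suc N) \<and> attained l2 s' \<and>
    (\<forall>r<4. \<forall>a<mA. \<forall>b'. mA \<le> b' \<longrightarrow> b' < N \<longrightarrow>
      (\<exists>b. gap_system.nearby k N q X (gap_system.base k N bpos r) \<omega> a b' b \<and> rmem s' (rb + ad 3 a) \<le> dst l2 a b)))"
    by (rule hx_crude)
qed

end

subsection \<open>Initialisation\<close>

definition lg :: "nat \<Rightarrow> nat" where
  "lg n = (LEAST j. n \<le> 2 ^ j)"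

lemma le_two_power_lg: "n \<le> 2 ^ lg n"
proof -
  have "n \<le> 2 ^ n" using less_exp[of n] by linarith
  then show ?thesis unfolding lg_def by (rule LeastI)
qed

lemma less_lg_iff: "i < lg n \<longleftrightarrow> 2 ^ i < n"
proof
  assume "i < lg n"
  then have "\<not> n \<le> 2 ^ i" unfolding lg_def by (rule not_less_Least)
  then show "2 ^ i < n" by simp
next
  assume "2 ^ i < n"
  then have "(2::nat) ^ i < 2 ^ lg n" using le_two_power_lg[of n] by linarith
  then show "i < lg n" by simp
qed

text \<open>Multiplication and division of integers are avoided throughout: offsets of points come
  from repeated addition, halves from writing \<open>j\<close> at \<open>2 * j\<close> and
  \<open>2 * j + 1\<close>, and the target dimension \<open>96 * q\<close> is
  \<open>64 * q + 32 * q\<close>.\<close>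

definition initc :: "bool \<Rightarrow> com" where
  "initc l2 = Seq (vset 3 (NAdd (v 0) (v 1))) (Seq (vset 4 (NConst 1)) (Seq (For 10 (v 3) (Seq (naset 20 (v 10) (v 4)) (vset 4 (NAdd (v 4) (v 2)))))
    (Seq (vset 5 (NConst 1)) (Seq (vset 6 (NConst 2)) (Seq (While (NLess (v 5) (v 3)) (Seq (vset 5 (dbl (v 5))) (vset 6 (NAdd (v 6) (NConst 1)))))
    (Seq (For 10 (v 5) (Seq (naset 21 (dbl (v 10)) (v 10)) (naset 21 (NAdd (dbl (v 10)) (NConst 1)) (v 10))))
    (if l2 then Seq (vset 8 (NAdd (dbl (dbl (dbl (dbl (dbl (dbl (v 6))))))) (dbl (dbl (dbl (dbl (dbl (v 6))))))))
        (Cond (NLess (v 8) (v 2)) (vset 7 (v 8)) (vset 7 (v 2)))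
      else vset 7 (v 2))))))))"

definition target_dim :: "bool \<Rightarrow> nat \<Rightarrow> nat \<Rightarrow> nat" where
  "target_dim l2 q d = (if l2 then min d (96 * q) else d)"

definition init_cost :: "nat \<Rightarrow> nat \<Rightarrow> nat" where
  "init_cost N j = N * 4 + j * 3 + 2 ^ j * 4 + 12"

lemma hx_init:
  fixes mA mB d :: nat
  defines "N \<equiv> mA + mB" 
  defines "q \<equiv> lg N + 2"
  assumes mB: "0 < mB" and s: "nmem s 0 = mA" "nmem s 1 = mB" "nmem s 2 = d"
  shows "hx \<omega> (initc l2) (init_cost N (lg N)) s (\<lambda>s'. machine.ctx mA mB d N (N * d + 1) (2 ^ lg N) q (target_dim l2 q d) (rmem s) s' \<and> pos s' = pos s)"
    (is "hx _ _ _ _ ?Q")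
proof -
  let ?P = "2 ^ lg N"
  let ?k = "target_dim l2 q d"
  interpret machine mA mB d N "N * d + 1" ?P q ?k "rmem s"
    by unfold_locales (use mB le_two_power_lg in \<open>auto simp: N_def q_def\<close>)
  let ?B = "\<lambda>s'::state. rmem s' = rmem s \<and> pos s' = pos s \<and> nmem s' (ad 0 0) = mA \<and> nmem s' (ad 1 0) = mB \<and> nmem s' (ad 2 0) = d"
  let ?R = "\<lambda>n (s'::state). \<forall>j<n. nmem s' (ad 20 j) = 1 + j * d"
  let ?C = "\<lambda>s'::state. ?B s' \<and> nmem s' (ad 3 0) = N \<and> ?R N s' \<and> nmem s' (ad 4 0) = 1 + N * d"
  let ?C2 = "\<lambda>s'::state. ?C s' \<and> nmem s' (ad 5 0) = ?P \<and> nmem s' (ad 6 0) = q"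
  let ?H = "\<lambda>n (s'::state). \<forall>x<2 * n. nmem s' (ad 21 x) = x div 2"
  let ?k1 = "if l2 then Seq (vset 8 (NAdd (dbl (dbl (dbl (dbl (dbl (dbl (v 6))))))) (dbl (dbl (dbl (dbl (dbl (v 6))))))))
        (Cond (NLess (v 8) (v 2)) (vset 7 (v 8)) (vset 7 (v 2))) else vset 7 (v 2)"
  let ?half = "For 10 (v 5) (Seq (naset 21 (dbl (v 10)) (v 10)) (naset 21 (NAdd (dbl (v 10)) (NConst 1)) (v 10)))"
  let ?log = "While (NLess (v 5) (v 3)) (Seq (vset 5 (dbl (v 5))) (vset 6 (NAdd (v 6) (NConst 1))))"
  have ctxI: "ctx s'" if "?C2 s'" "?H ?P s'" "nmem s' (ad 7 0) = ?k" for s'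
    unfolding ctx_def using that by simp
  have kc: "hx \<omega> ?k1 (1 + Suc 1) s1 ?Q" if "?C2 s1 \<and> ?H ?P s1" for s1
  proof (cases l2)
    case True
    have "hx \<omega> (Seq (vset 8 (NAdd (dbl (dbl (dbl (dbl (dbl (dbl (v 6))))))) (dbl (dbl (dbl (dbl (dbl (v 6))))))))
        (Cond (NLess (v 8) (v 2)) (vset 7 (v 8)) (vset 7 (v 2)))) (1 + Suc 1) s1 ?Q"
    proof (intro hx_seq hx_vset hx_cond, goal_cases)
      case 1
      then show ?case by (intro conjI ctxI) (use that True in \<open>simp_all add: target_dim_def del: One_nat_def\<close>)
    next
      case 2
      then show ?case by (intro conjI ctxI) (use that True in \<open>simp_all add: target_dim_def del: One_nat_def\<close>)
    qed
    then show ?thesis using True by simp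
  next
    case False
    have "hx \<omega> (vset 7 (v 2)) 1 s1 ?Q" by (intro hx_vset conjI ctxI) (use that False in \<open>simp_all add: target_dim_def del: One_nat_def\<close>)
    then have "hx \<omega> (vset 7 (v 2)) (1 + Suc 1) s1 ?Q" by (rule hx_mono) simp_all
    then show ?thesis using False by simp
  qed
  have half: "hx \<omega> (Seq ?half ?k1) ((?P * ((1 + 1) + 2) + 2) + (1 + Suc 1)) s1 ?Q" if "?C2 s1" for s1
  proof (rule hx_seq, rule hx_for[where I = "\<lambda>j s'. nmem s' (ad 10 0) = j \<and> ?C2 s' \<and> ?H j s'"])
    show "hx \<omega> ?k1 (1 + Suc 1) s' ?Q" if "nmem s' (ad 10 0) = ?P \<and> ?C2 s' \<and> ?H ?P s'" for s'
      by (rule kc) (use that in blast)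
  next
    fix j s' assume I: "nmem s' (ad 10 0) = j \<and> ?C2 s' \<and> ?H j s'"
    show "hx \<omega> (Seq (naset 21 (dbl (v 10)) (v 10)) (naset 21 (NAdd (dbl (v 10)) (NConst 1)) (v 10))) (1 + 1) s'
      (\<lambda>s'. nmem s' (ad 10 0) = j \<and> nmem (setn s' (ad 10 0) (Suc j)) (ad 10 0) = Suc j \<and> ?C2 (setn s' (ad 10 0) (Suc j)) \<and> ?H (Suc j) (setn s' (ad 10 0) (Suc j)))"
      by (intro hx_seq hx_naset) (use I in \<open>auto simp: less_Suc_eq simp del: One_nat_def\<close>)
  qed (use that in simp_all)
  have log: "hx \<omega> (Seq ?log (Seq ?half ?k1)) ((lg N * ((1 + 1) + 1) + 1) + ((?P * ((1 + 1) + 2) + 2) + (1 + Suc 1))) s1 ?Q"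
    if s1: "?C s1 \<and> nmem s1 (ad 5 0) = 1 \<and> nmem s1 (ad 6 0) = 2" for s1
  proof (rule hx_seq, rule hx_while[where I = "\<lambda>j s'. \<exists>i. i + j = lg N \<and> ?C s' \<and> nmem s' (ad 5 0) = 2 ^ i \<and> nmem s' (ad 6 0) = i + 2"])
    fix j s' assume "\<exists>i. i + j = lg N \<and> ?C s' \<and> nmem s' (ad 5 0) = 2 ^ i \<and> nmem s' (ad 6 0) = i + 2"
    then obtain i where i: "i + j = lg N" "?C s'" "nmem s' (ad 5 0) = 2 ^ i" "nmem s' (ad 6 0) = i + 2" by blast
    have b: "bval (NLess (v 5) (v 3)) s' \<longleftrightarrow> i < lg N" using i by (simp add: less_lg_iff)
    show "\<exists>j'. j = Suc j' \<and> hx \<omega> (Seq (vset 5 (dbl (v 5))) (vset 6 (NAdd (v 6) (NConst 1)))) (1 + 1) s'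
      (\<lambda>s'. \<exists>i. i + j' = lg N \<and> ?C s' \<and> nmem s' (ad 5 0) = 2 ^ i \<and> nmem s' (ad 6 0) = i + 2)"
      if bs: "bval (NLess (v 5) (v 3)) s'"
    proof -
      obtain j' where j: "j = Suc j'" using bs b i(1) by (cases j) auto
      have "hx \<omega> (Seq (vset 5 (dbl (v 5))) (vset 6 (NAdd (v 6) (NConst 1)))) (1 + 1) s'
        (\<lambda>s'. \<exists>i. i + j' = lg N \<and> ?C s' \<and> nmem s' (ad 5 0) = 2 ^ i \<and> nmem s' (ad 6 0) = i + 2)"
        by (intro hx_seq hx_vset exI[of _ "Suc i"]) (use i j in \<open>simp del: One_nat_def\<close>)
      then show ?thesis using j by blast
    qed
    show "hx \<omega> (Seq ?half ?k1) ((?P * ((1 + 1) + 2) + 2) + (1 + Suc 1)) s' ?Q" if "\<not> bval (NLess (v 5) (v 3)) s'"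
    proof (rule half)
      have "i = lg N" using that b i(1) by simp
      then show "?C2 s'" using i by (simp add: q_def)
    qed
  qed (use s1 in \<open>auto intro: exI[of _ 0]\<close>)
  have "hx \<omega> (initc l2) (1 + (1 + ((N * ((1 + 1) + 2) + 2) + (1 + (1 + ((lg N * ((1 + 1) + 1) + 1) + ((?P * ((1 + 1) + 2) + 2) + (1 + Suc 1)))))))) s ?Q"
    unfolding initc_def
  proof (intro hx_seq[of _ "vset 3 _"] hx_seq[of _ "vset 4 _"] hx_vset, rule hx_seq,
      rule hx_for[where I = "\<lambda>j s'. ?B s' \<and> nmem s' (ad 3 0) = N \<and> nmem s' (ad 10 0) = j \<and> ?R j s' \<and> nmem s' (ad 4 0) = 1 + j * d"], goal_cases)
    case 1
    then show ?case using s by (simp add: N_def ad_0 del: One_nat_def)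
  next
    case (2 j s')
    then show ?case by simp
  next
    case (3 j s')
    then show ?case by (intro hx_seq hx_vset hx_naset) (simp add: less_Suc_eq del: One_nat_def)
  next
    case (4 s')
    show ?case
    proof (intro hx_seq[of _ "vset 5 _"] hx_seq[of _ "vset 6 _"] hx_vset)
      let ?s1 = "setn s' (ad 5 0) (nval (NConst 1) s')"
      show "hx \<omega> (Seq ?log (Seq ?half ?k1)) ((lg N * ((1 + 1) + 1) + 1) + ((?P * ((1 + 1) + 2) + 2) + (1 + Suc 1)))
        (setn ?s1 (ad 6 0) (nval (NConst 2) ?s1)) ?Q"
        by (rule log) (use 4 in \<open>simp del: One_nat_def\<close>)
    qed
  qed
  then show ?thesis by (rule hx_mono) (simp_all add: init_cost_def)
qed

subsection \<open>Probability of success\<close>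

lemma l1n_le_L2: "l1n d x y \<le> sqrt (real d) * L2_set (\<lambda>i. x i - y i) {..<d}"
proof -
  have "l1n d x y = (\<Sum>i<d. \<bar>1\<bar> * \<bar>x i - y i\<bar>)" by (simp add: l1n_def)
  also have "\<dots> \<le> L2_set (\<lambda>_. 1) {..<d} * L2_set (\<lambda>i. x i - y i) {..<d}" by (rule L2_set_mult_ineq)
  also have "L2_set (\<lambda>_. 1 :: real) {..<d} = sqrt (real d)" by (simp add: L2_set_def)
  finally show ?thesis .
qed

lemma inj_on_flat: "inj_on (\<lambda>(i, l). i * d + l) (UNIV \<times> {..<d :: nat})"
proof (rule inj_onI, clarify)
  fix i l i' l' assume l: "l < d" "l' < d" and e: "i * d + l = i' * d + l'"
  have "(l + i * d) div d = (l' + i' * d) div d" "(l + i * d) mod d = (l' + i' * d) mod d" using e by (simp_all add: add.commute)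
  then show "i = i' \<and> l = l'" using l by (simp only: div_mult_self1 mod_mult_self1 div_less mod_less) simp
qed

lemma hxE:
  assumes "hx \<omega> c K s Q" obtains k s' where "exec \<omega> c s k s'" "k \<le> K" "Q s'"
  using assms unfolding hx_def by blast

locale estimator = machine +
  fixes s0 :: state and I0 :: com and ic :: nat and l2 :: bool
  assumes init: "\<And>\<omega>. hx \<omega> I0 ic s0 (\<lambda>s'. ctx s' \<and> pos s' = 0)" and k: "k = target_dim l2 q d" and Nq: "N \<le> 2 ^ q"
    and eps: "0 < inp 0" "inp 0 < 1"
begin

abbreviation front :: com where "front \<equiv> Seq I0 (Seq fphc (crudec l2))"

text \<open>\<open>10 ^ 18\<close> is the factor 1000 demanded by
  \<open>sampling_concentration\<close> times the \<open>10 ^ 15\<close> of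
  \<open>blow\<close>.\<close>

definition prog :: com where
  "prog = Seq front (sampc (10 ^ 18) l2)"

definition CH :: real where
  "CH = (\<Sum>a<mA. nn l2 a)"

definition near :: "nat \<Rightarrow> nat" where
  "near a = (SOME b. mA \<le> b \<and> b < N \<and> dst l2 a b = nn l2 a)"

definition mpos :: nat where
  "mpos = bpos + 4 * (k * Suc N)"

definition crude :: "(nat \<Rightarrow> nat \<Rightarrow> real) \<Rightarrow> (nat \<Rightarrow> real) \<Rightarrow> state \<Rightarrow> bool" where
  "crude X \<omega> s \<longleftrightarrow> ctx s \<and> pos s = mpos \<and> attained l2 s \<and>
    (\<forall>r<4. \<forall>a<mA. \<exists>b. gap_system.nearby k N q X (gap_system.base k N bpos r) \<omega> a (near a) b \<and> rmem s (rb + ad 3 a) \<le> dst l2 a b)"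

abbreviation success :: "(nat \<Rightarrow> real) set" where
  "success \<equiv> {\<omega> \<in> space random_source. \<exists>\<eta>. outputs prog \<omega> s0 \<eta> \<and> (1 - inp 0) * CH \<le> \<eta> \<and> \<eta> \<le> (1 + inp 0) * CH}"

text \<open>The projected Euclidean case decides the constant: 432001 from the four copies,
  \<open>2 ^ 11\<close> from the box moments, 1000 from Markov's inequality for the projection, 96
  from the dimension, and \<open>sqrt 12 \<le> 4\<close>.\<close>

abbreviation blow :: real where "blow \<equiv> 10 ^ 15 * real q"

lemma k_le: "k \<le> d"
  by (simp add: k target_dim_def)

lemma near: "mA \<le> near a" "near a < N" "dst l2 a (near a) = nn l2 a"
proof -
  have "nn l2 a \<in> dst l2 a ` {mA..<N}" unfolding nn_def by (rule Min_in) (use mA_less in auto)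
  then have "\<exists>b. mA \<le> b \<and> b < N \<and> dst l2 a b = nn l2 a" by auto
  then have "mA \<le> near a \<and> near a < N \<and> dst l2 a (near a) = nn l2 a" unfolding near_def by (rule someI_ex)
  then show "mA \<le> near a" "near a < N" "dst l2 a (near a) = nn l2 a" by auto
qed

lemma dst_nonneg: "0 \<le> dst l2 a b"
  by (simp add: dst_def dfin_def dterm_def sum_nonneg)

lemma nn_nonneg: "0 \<le> nn l2 a"
  using near(3)[of a] dst_nonneg[of a "near a"] by simp

lemma CH_nonneg: "0 \<le> CH"
  unfolding CH_def by (intro sum_nonneg nn_nonneg)

lemma attained_ge: "attained l2 s \<Longrightarrow> a < mA \<Longrightarrow> nn l2 a \<le> rmem s (rb + ad 3 a)"
proof -
  assume "attained l2 s" "a < mA"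
  then obtain b where "mA \<le> b" "b < N" "rmem s (rb + ad 3 a) = dst l2 a b" unfolding attained_def by blast
  then show ?thesis unfolding nn_def by (simp add: Min_le)
qed

lemma run_front:
  assumes X: "\<And>j i. j < N \<Longrightarrow> i < k \<Longrightarrow> X j i = (if k < d then prj \<omega> j i else pt j i)"
  shows "hx \<omega> front (ic + (embed_cost + crude_cost)) s0 (crude X \<omega>)"
proof (rule hx_seq, rule hx_mono[OF init order_refl], elim conjE)
  fix s assume s: "ctx s" "pos s = 0"
  show "hx \<omega> (Seq fphc (crudec l2)) (embed_cost + crude_cost) s (crude X \<omega>)"
  proof (rule hx_mono[OF hx_front[where X = X, OF s k_le] order_refl])
    show "X j i = (if k < d then prj \<omega> j i else pt j i)" if "j < N" "i < k" for j i by (rule X[OF that])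
    fix s' assume s': "ctx s' \<and> pos s' = bpos + 4 * (k * Suc N) \<and> attained l2 s' \<and>
      (\<forall>r<4. \<forall>a<mA. \<forall>b'. mA \<le> b' \<longrightarrow> b' < N \<longrightarrow>
        (\<exists>b. gap_system.nearby k N q X (gap_system.base k N bpos r) \<omega> a b' b \<and> rmem s' (rb + ad 3 a) \<le> dst l2 a b))"
    then show "crude X \<omega> s'" unfolding crude_def mpos_def using near(1,2) by blast
  qed
qed

definition total_cost :: nat where
  "total_cost = (ic + (embed_cost + crude_cost)) + (samples (10 ^ 18) (inp 0) * (iter_cost + 1) + mA * 3 + 7)"

lemma hx_tail:
  assumes w: "\<omega> \<in> space random_source" and s: "crude X \<omega>' s"
  shows "hx \<omega> (sampc (10 ^ 18) l2) (samples (10 ^ 18) (inp 0) * (iter_cost + 1) + mA * 3 + 7) s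
    (\<lambda>s'. rmem s' 0 = estimate l2 (\<lambda>a. rmem s (rb + ad 3 a)) (samples (10 ^ 18) (inp 0)) mpos \<omega>)"
proof -
  have c: "ctx s" and p: "pos s = mpos" and at: "attained l2 s" using s by (auto simp: crude_def)
  show ?thesis
  proof (rule hx_mono[OF hx_samp[OF c] order_refl])
    show "0 \<le> \<omega> i" for i using mem_space_source[OF w] by blast
    show "0 \<le> rmem s (rb + ad 3 a)" if "a < mA" for a using attained_ge[OF at that] nn_nonneg[of a] by linarith
    show "0 < rb" using rb by simp
  qed (use p in simp)
qed

lemma halts_prog:
  assumes w: "\<omega> \<in> space random_source"
  shows "halts_within prog \<omega> s0 (real total_cost)"
proof -
  have "hx \<omega> prog total_cost s0 (\<lambda>_. True)"
    unfolding prog_def total_cost_def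
  proof (rule hx_seq, rule hx_mono[OF run_front[where X = "\<lambda>j i. if k < d then prj \<omega> j i else pt j i", OF refl] order_refl])
    fix s assume "crude (\<lambda>j i. if k < d then prj \<omega> j i else pt j i) \<omega> s"
    from hx_tail[OF w this] show "hx \<omega> (sampc (10 ^ 18) l2) (samples (10 ^ 18) (inp 0) * (iter_cost + 1) + mA * 3 + 7) s (\<lambda>_. True)"
      by (rule hx_mono) auto
  qed
  then show ?thesis by (auto simp: hx_def halts_within_def)
qed

lemma success_sets: "success \<in> sets random_source"
  by (rule outputs_sets) simp

text \<open>The front phase consumes exactly the positions below \<open>mpos\<close>, so its final
  state \<open>s\<close> is the same for all spliced sources, and the sampling phase sees fresh
  values. If \<open>CH = 0\<close>, the hypothesis \<open>le\<close> forces the total weight to be 0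
  and the output is exactly 0; otherwise \<open>sampling_concentration\<close> applies.\<close>

lemma final_stage:
  assumes w: "\<omega> \<in> space random_source" and X: "\<And>j i. j < N \<Longrightarrow> i < k \<Longrightarrow> X j i = (if k < d then prj \<omega> j i else pt j i)"
    and le: "\<And>s. crude X \<omega> s \<Longrightarrow> (\<Sum>a<mA. rmem s (rb + ad 3 a)) \<le> blow * CH"
  shows "measure random_source {\<omega>' \<in> space random_source. mrg {mpos..} \<omega> \<omega>' \<in> success} \<ge> 1 - 1 / 1000"
proof -
  let ?M = "samples (10 ^ 18) (inp 0)"
  have "hx \<omega> front (ic + (embed_cost + crude_cost)) s0 (crude X \<omega>)" by (rule run_front) (rule X)
  then obtain k1 s where e: "exec \<omega> front s0 k1 s" and "k1 \<le> ic + (embed_cost + crude_cost)" and s: "crude X \<omega> s" by (rule hxE)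
  let ?D0 = "\<lambda>a. rmem s (rb + ad 3 a)"
  have at: "attained l2 s" and ps: "pos s = mpos" using s by (auto simp: crude_def)
  \<comment> \<open>\<open>sampling_concentration\<close> asks for its inequalities at every index,
    so both families are extended by 0 beyond \<open>mA\<close>.\<close>
  define D where "D a = (if a < mA then ?D0 a else 0)" for a
  define t where "t a = (if a < mA then nn l2 a else 0)" for a
  define T where "T = (\<Sum>a<mA. D a)"
  have T: "T = (\<Sum>a<mA. ?D0 a)" by (simp add: T_def D_def)
  have CHt: "CH = (\<Sum>a<mA. t a)" by (simp add: CH_def t_def)
  have t: "0 \<le> t a" "t a \<le> D a" for a using nn_nonneg attained_ge[OF at] by (auto simp: t_def D_def)
  have T0: "0 \<le> T" unfolding T_def by (intro sum_nonneg) (metis t order_trans)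
  have out: "outputs prog (mrg {mpos..} \<omega> \<omega>') s0 (estimate l2 ?D0 ?M mpos \<omega>')" if w': "\<omega>' \<in> space random_source" for \<omega>'
  proof -
    let ?m = "mrg {mpos..} \<omega> \<omega>'"
    have "exec ?m front s0 k1 s" by (rule exec_cong_source[OF e]) (simp add: mrg_def ps)
    moreover obtain k2 s2 where "exec ?m (sampc (10 ^ 18) l2) s k2 s2" "k2 \<le> ?M * (iter_cost + 1) + mA * 3 + 7" "rmem s2 0 = estimate l2 ?D0 ?M mpos ?m"
      using hx_tail[OF mrg_space[OF w w'] s] by (rule hxE)
    moreover have "estimate l2 ?D0 ?M mpos ?m = estimate l2 ?D0 ?M mpos \<omega>'" by (simp add: estimate_def mrg_def)
    ultimately show ?thesis unfolding outputs_def prog_def by (metis exec.Seq)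
  qed
  have sel_D: "sel ?D0 m x = sel D m x" if "m \<le> mA" for m x
    using that by (induction m) (simp_all add: D_def)
  have est: "estimate l2 ?D0 ?M mpos \<omega>' = (\<Sum>j<?M. t (sel D mA (\<omega>' (mpos + j) * T)) / D (sel D mA (\<omega>' (mpos + j) * T))) * T / real ?M"
    if w': "\<omega>' \<in> space random_source" for \<omega>'
  proof (cases "mA = 0")
    case True
    then have "T = 0" by (simp add: T_def)
    then show ?thesis unfolding estimate_def T[symmetric] by simp
  next
    case False
    have "sel D mA (\<omega>' j * T) < mA" for j
      by (rule sel_less) (use False T0 mem_space_source[OF w'] in auto)
    then show ?thesis unfolding estimate_def T[symmetric] sel_D[OF order_refl] by (simp add: t_def D_def)
  qed
  have sets: "{\<omega>' \<in> space random_source. mrg {mpos..} \<omega> \<omega>' \<in> success} \<in> sets random_source"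
    by (rule mrg_vimage_sets[OF w success_sets])
  have TR: "T \<le> blow * CH" unfolding T by (rule le[OF s])
  show ?thesis
  proof (cases "CH = 0")
    case True
    then have "T = 0" using TR T0 by simp
    then have "estimate l2 ?D0 ?M mpos \<omega>' = 0" if "\<omega>' \<in> space random_source" for \<omega>' using est[OF that] by simp
    then have "{\<omega>' \<in> space random_source. mrg {mpos..} \<omega> \<omega>' \<in> success} = space random_source"
      using out mrg_space[OF w] True by fastforce
    then show ?thesis by (simp add: S.prob_space)
  next
    case False
    then have CHp: "0 < CH" using CH_nonneg by simp
    have "1000 * blow / (inp 0)\<^sup>2 = real (10 ^ 18) * real q / (inp 0)\<^sup>2" by simp
    also have "\<dots> \<le> real ?M" unfolding samples_def by linarith
    finally have M: "1000 * blow / (inp 0)\<^sup>2 \<le> real ?M" .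
    let ?S = "{\<omega>' \<in> space random_source.
      \<bar>(\<Sum>j<?M. t (sel D mA (\<omega>' (mpos + j) * T)) / D (sel D mA (\<omega>' (mpos + j) * T))) * T / real ?M - CH\<bar> \<le> inp 0 * CH}"
    have "1 - 1 / 1000 \<le> measure random_source ?S"
      by (rule sampling_concentration[OF t T_def CHt CHp TR eps(1) M])
    also have "\<dots> \<le> measure random_source {\<omega>' \<in> space random_source. mrg {mpos..} \<omega> \<omega>' \<in> success}"
    proof (rule S.finite_measure_mono[OF _ sets], rule subsetI)
      fix \<omega>' assume a: "\<omega>' \<in> ?S"
      then have w': "\<omega>' \<in> space random_source" by simp
      have "\<bar>estimate l2 ?D0 ?M mpos \<omega>' - CH\<bar> \<le> inp 0 * CH" unfolding est[OF w'] using a by simp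
      then have "(1 - inp 0) * CH \<le> estimate l2 ?D0 ?M mpos \<omega>'" "estimate l2 ?D0 ?M mpos \<omega>' \<le> (1 + inp 0) * CH"
        by (simp_all add: abs_le_iff algebra_simps)
      then show "\<omega>' \<in> {\<omega>' \<in> space random_source. mrg {mpos..} \<omega> \<omega>' \<in> success}" using out[OF w'] mrg_space[OF w w'] w' by blast
    qed
    finally show ?thesis .
  qed
qed

text \<open>This covers the Manhattan distance and the Euclidean one in dimension at most
  \<open>96 * q\<close>. In the latter case the \<open>sqrt (real k)\<close> of the box moments and
  that of the Cauchy-Schwarz inequality combine to \<open>k\<close>.\<close>

lemma crude_identity:
  assumes kd: "k = d"
  shows "\<exists>A\<in>sets random_source. measure random_source A \<ge> 1 - 4 / 1000 \<and>
    (\<forall>\<omega>\<in>A. \<forall>s. crude pt \<omega> s \<longrightarrow> (\<Sum>a<mA. rmem s (rb + ad 3 a)) \<le> blow * CH)"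
proof -
  interpret G: gap_system k N q pt by unfold_locales (rule q2)
  have Nq': "real N \<le> 2 ^ q" using Nq by (metis of_nat_le_iff of_nat_numeral of_nat_power)
  have mN: "mA \<le> N" using mA_less by simp
  show ?thesis
  proof (cases l2)
    case False
    have ds: "dst l2 a b = l1n k (pt a) (pt b)" for a b using False kd by (simp add: dst_def dfin_def dterm_def l1n_def)
    obtain A where A: "A \<in> sets random_source" "measure random_source A \<ge> 1 - 4 / 1000"
      and D: "\<And>\<omega> D. \<omega> \<in> A \<Longrightarrow> (\<forall>a<mA. \<forall>r<4. \<exists>b. G.nearby (G.base bpos r) \<omega> a (near a) b \<and> D a \<le> l1n k (pt a) (pt b)) \<Longrightarrow>
        (\<Sum>a<mA. D a) \<le> 432001 * (\<Sum>a<mA. 8 * real q * 2 ^ 9 * l1n k (pt a) (pt (near a)))"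
      using G.crude_l1[where b' = near and m = mA and \<beta> = bpos, OF Nq' mN near(2)] by blast
    have "(\<Sum>a<mA. rmem s (rb + ad 3 a)) \<le> blow * CH" if w: "\<omega> \<in> A" and s: "crude pt \<omega> s" for \<omega> s
    proof -
      have "(\<Sum>a<mA. rmem s (rb + ad 3 a)) \<le> 432001 * (\<Sum>a<mA. 8 * real q * 2 ^ 9 * l1n k (pt a) (pt (near a)))"
        by (rule D[OF w]) (use s in \<open>simp add: crude_def ds\<close>)
      also have "\<dots> = 432001 * (8 * real q * 2 ^ 9 * CH)"
        by (simp add: CH_def near(3)[symmetric] ds sum_distrib_left)
      also have "\<dots> \<le> blow * CH" using mult_nonneg_nonneg[of "real q" CH] CH_nonneg by simp
      finally show ?thesis .
    qed
    then show ?thesis using A by blast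
  next
    case True
    have ds: "dst l2 a b = L2_set (\<lambda>i. pt a i - pt b i) {..<k}" for a b using True kd by (simp add: dst_def dfin_def dterm_def L2_set_def)
    obtain A where A: "A \<in> sets random_source" "measure random_source A \<ge> 1 - 4 / 1000"
      and D: "\<And>\<omega> D. \<omega> \<in> A \<Longrightarrow> (\<forall>a<mA. \<forall>r<4. \<exists>b. G.nearby (G.base bpos r) \<omega> a (near a) b \<and> D a \<le> L2_set (\<lambda>i. pt a i - pt b i) {..<k}) \<Longrightarrow>
        (\<Sum>a<mA. D a) \<le> 432001 * (\<Sum>a<mA. 2 ^ 11 * sqrt (real k) * l1n k (pt a) (pt (near a)))"
      using G.crude_l2[where b' = near and m = mA and \<beta> = bpos, OF Nq' mN near(2)] by blast
    have kq: "real k \<le> 96 * real q" using k True by (simp add: target_dim_def)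
    have "(\<Sum>a<mA. rmem s (rb + ad 3 a)) \<le> blow * CH" if w: "\<omega> \<in> A" and s: "crude pt \<omega> s" for \<omega> s
    proof -
      have "(\<Sum>a<mA. rmem s (rb + ad 3 a)) \<le> 432001 * (\<Sum>a<mA. 2 ^ 11 * sqrt (real k) * l1n k (pt a) (pt (near a)))"
        by (rule D[OF w]) (use s in \<open>simp add: crude_def ds\<close>)
      also have "\<dots> \<le> 432001 * (\<Sum>a<mA. 2 ^ 11 * real k * nn l2 a)"
      proof (intro mult_left_mono sum_mono)
        fix a
        have "2 ^ 11 * sqrt (real k) * l1n k (pt a) (pt (near a)) \<le> 2 ^ 11 * sqrt (real k) * (sqrt (real k) * nn l2 a)"
          unfolding near(3)[symmetric] ds by (intro mult_left_mono l1n_le_L2) simp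
        also have "\<dots> = 2 ^ 11 * (sqrt (real k) * sqrt (real k)) * nn l2 a" by (simp only: mult.assoc)
        finally show "2 ^ 11 * sqrt (real k) * l1n k (pt a) (pt (near a)) \<le> 2 ^ 11 * real k * nn l2 a" by simp
      qed simp
      also have "\<dots> = 432001 * (2 ^ 11 * real k * CH)" by (simp add: CH_def sum_distrib_left)
      also have "\<dots> = 432001 * 2 ^ 11 * (real k * CH)" by (simp only: mult.assoc)
      also have "\<dots> \<le> 10 ^ 15 * (real q * CH)"
      proof -
        have "real k * CH \<le> 96 * (real q * CH)" using mult_right_mono[OF kq CH_nonneg] by (simp only: mult.assoc)
        moreover have "0 \<le> real q * CH" using CH_nonneg by simp
        \<comment> \<open>\<open>488281250000 = 10 ^ 15 / 2 ^ 11\<close>.\<close>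
        ultimately have "432001 * (real k * CH) \<le> 488281250000 * (real q * CH)" by linarith
        then show ?thesis by simp
      qed
      also have "\<dots> = blow * CH" by (simp only: mult.assoc)
      finally show ?thesis .
    qed
    then show ?thesis using A by blast
  qed
qed

lemma sqrt12_le: "sqrt 12 * 432001 * 2 ^ 11 * 1000 * 96 \<le> (10 ^ 15 :: real)"
proof -
  have "sqrt 12 \<le> (4 :: real)" by (rule real_le_lsqrt) auto
  then show ?thesis by simp
qed

text \<open>The gap system, and with it the good set \<open>B\<close> of the copies, depends on the
  projection. Hence the nested form: \<open>A\<close> concerns the projection alone, and
  \<open>B\<close> is chosen after \<open>\<omega>\<close>.\<close>

lemma crude_projected:
  assumes kd: "k < d"
  shows "\<exists>A\<in>sets random_source. measure random_source A \<ge> 1 - 2 / 1000 \<and> (\<forall>\<omega>\<in>A.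
    \<exists>B\<in>sets random_source. measure random_source B \<ge> 1 - 4 / 1000 \<and>
      (\<forall>\<omega>'\<in>B. \<forall>s. crude (prj \<omega>) (mrg {bpos..} \<omega> \<omega>') s \<longrightarrow> (\<Sum>a<mA. rmem s (rb + ad 3 a)) \<le> blow * CH))"
proof -
  have l2: l2 and kq: "k = 96 * q" using k kd by (auto simp: target_dim_def split: if_splits)
  have Nq': "real N \<le> 2 ^ q" using Nq by (metis of_nat_le_iff of_nat_numeral of_nat_power)
  have mN: "mA \<le> N" using mA_less by simp
  have kp: "0 < real k" using kq q2 by simp
  have ds: "dst l2 a b = L2_set (\<lambda>i. pt a i - pt b i) {..<d}" for a b using l2 by (simp add: dst_def dfin_def dterm_def L2_set_def)
  have rp: "(\<lambda>i. rproj (\<lambda>l. i * d + l) d (pt a) \<omega>) = prj \<omega> a" for \<omega> a by (simp add: fun_eq_iff rproj_def prj_def)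
  have rp2: "rproj (\<lambda>l. i * d + l) d (pt a) \<omega> = prj \<omega> a i" for \<omega> a i by (simp add: rproj_def prj_def)
  obtain A where A: "A \<in> sets random_source" "measure random_source A \<ge> 1 - 2 / 1000"
    and low: "\<And>\<omega> a b. \<omega> \<in> A \<Longrightarrow> a < N \<Longrightarrow> b < N \<Longrightarrow> dst l2 a b \<le> sqrt (12 / real k) * L2_set (\<lambda>i. prj \<omega> a i - prj \<omega> b i) {..<k}"
    and up: "\<And>\<omega>. \<omega> \<in> A \<Longrightarrow> (\<Sum>a<mA. l1n k (prj \<omega> a) (prj \<omega> (near a))) \<le> 1000 * real k * (\<Sum>a<mA. dst l2 a (near a))"
    using random_projection[where p = "\<lambda>i l. i * d + l" and b' = near and x = pt, OF inj_on_flat[of d] Nq' q2 kq mN near(2)]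
    unfolding rp rp2 ds[symmetric] by blast
  have "\<exists>B\<in>sets random_source. measure random_source B \<ge> 1 - 4 / 1000 \<and>
      (\<forall>\<omega>'\<in>B. \<forall>s. crude (prj \<omega>) (mrg {bpos..} \<omega> \<omega>') s \<longrightarrow> (\<Sum>a<mA. rmem s (rb + ad 3 a)) \<le> blow * CH)" if w: "\<omega> \<in> A" for \<omega>
  proof -
    interpret G: gap_system k N q "prj \<omega>" by unfold_locales (rule q2)
    obtain B where B: "B \<in> sets random_source" "measure random_source B \<ge> 1 - 4 / 1000"
      and D: "\<And>\<omega>' D. \<omega>' \<in> B \<Longrightarrow> (\<forall>a<mA. \<forall>r<4. \<exists>b. G.nearby (G.base bpos r) \<omega>' a (near a) b \<and> D a \<le> L2_set (\<lambda>i. prj \<omega> a i - prj \<omega> b i) {..<k}) \<Longrightarrow>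
        (\<Sum>a<mA. D a) \<le> 432001 * (\<Sum>a<mA. 2 ^ 11 * sqrt (real k) * l1n k (prj \<omega> a) (prj \<omega> (near a)))"
      using G.crude_l2[where b' = near and m = mA and \<beta> = bpos, OF Nq' mN near(2)] by blast
    have "(\<Sum>a<mA. rmem s (rb + ad 3 a)) \<le> blow * CH" if w': "\<omega>' \<in> B" and s: "crude (prj \<omega>) (mrg {bpos..} \<omega> \<omega>') s" for \<omega>' s
    proof -
      let ?c = "sqrt (12 / real k)"
      have cp: "0 < ?c" using kp by simp
      have "(\<Sum>a<mA. rmem s (rb + ad 3 a) / ?c) \<le> 432001 * (\<Sum>a<mA. 2 ^ 11 * sqrt (real k) * l1n k (prj \<omega> a) (prj \<omega> (near a)))"
      proof (rule D[OF w'], intro allI impI)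
        fix a r :: nat assume a: "a < mA" and r: "r < 4"
        obtain b where b: "G.nearby (G.base bpos r) (mrg {bpos..} \<omega> \<omega>') a (near a) b" "rmem s (rb + ad 3 a) \<le> dst l2 a b"
          using s a r unfolding crude_def by blast
        have nb: "G.nearby (G.base bpos r) \<omega>' a (near a) b"
          using b(1) by (subst (asm) G.nearby_cong[where \<omega>' = \<omega>']) (auto simp: mrg_def G.base_def)
        then have "b < N" by (simp add: G.nearby_def)
        have "rmem s (rb + ad 3 a) \<le> ?c * L2_set (\<lambda>i. prj \<omega> a i - prj \<omega> b i) {..<k}"
          using b(2) low[OF w _ \<open>b < N\<close>, of a] a mA_less by simp
        then have "rmem s (rb + ad 3 a) / ?c \<le> L2_set (\<lambda>i. prj \<omega> a i - prj \<omega> b i) {..<k}"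
          using cp by (simp only: pos_divide_le_eq mult.commute)
        then show "\<exists>b. G.nearby (G.base bpos r) \<omega>' a (near a) b \<and> rmem s (rb + ad 3 a) / ?c \<le> L2_set (\<lambda>i. prj \<omega> a i - prj \<omega> b i) {..<k}"
          using nb by blast
      qed
      also have "\<dots> = 432001 * (2 ^ 11 * sqrt (real k) * (\<Sum>a<mA. l1n k (prj \<omega> a) (prj \<omega> (near a))))"
        by (simp only: sum_distrib_left)
      also have "\<dots> \<le> 432001 * (2 ^ 11 * sqrt (real k) * (1000 * real k * CH))"
        using up[OF w] by (intro mult_left_mono) (simp_all add: CH_def near(3))
      finally have "(\<Sum>a<mA. rmem s (rb + ad 3 a)) / ?c \<le> 432001 * (2 ^ 11 * sqrt (real k) * (1000 * real k * CH))"
        by (simp only: sum_divide_distrib)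
      then have "(\<Sum>a<mA. rmem s (rb + ad 3 a)) \<le> 432001 * (2 ^ 11 * sqrt (real k) * (1000 * real k * CH)) * ?c"
        using cp by (simp only: pos_divide_le_eq)
      also have "\<dots> = (sqrt (real k) * ?c) * (432001 * 2 ^ 11 * 1000 * real k * CH)" by (simp only: ac_simps)
      \<comment> \<open>The bound on contraction cancels the \<open>sqrt (real k)\<close> of the box
        moments; the remaining factor \<open>k\<close> comes from summing \<open>k\<close> projected
        coordinates in the l1 distance.\<close>
      also have "sqrt (real k) * ?c = sqrt 12" using kp by (simp add: real_sqrt_mult[symmetric])
      also have "sqrt 12 * (432001 * 2 ^ 11 * 1000 * real k * CH) = (sqrt 12 * 432001 * 2 ^ 11 * 1000 * 96) * (real q * CH)"
        by (simp add: kq)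
      also have "\<dots> \<le> 10 ^ 15 * (real q * CH)"
        by (intro mult_right_mono sqrt12_le mult_nonneg_nonneg CH_nonneg) simp
      finally show ?thesis by (simp only: mult.assoc)
    qed
    then show ?thesis using B by blast
  qed
  then show ?thesis using A by blast
qed

text \<open>The failures are at most \<open>2 / 1000\<close> for the projection,
  \<open>4 / 1000\<close> for the copies and \<open>1 / 1000\<close> for the sampling. Each stage is
  resampled with the preceding ones frozen; without a projection the first stage is absent.\<close>

lemma success_prob: "measure random_source success \<ge> 99 / 100"
proof (cases "k < d")
  case False
  then have kd: "k = d" using k_le by simp
  obtain A where A: "A \<in> sets random_source" "measure random_source A \<ge> 1 - 4 / 1000"
    and D: "\<And>\<omega> s. \<omega> \<in> A \<Longrightarrow> crude pt \<omega> s \<Longrightarrow> (\<Sum>a<mA. rmem s (rb + ad 3 a)) \<le> blow * CH"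
    using crude_identity[OF kd] by blast
  have "measure random_source success \<ge> 1 - 4 / 1000 - 1 / 1000"
  proof (rule prob_ge_mrg[OF success_sets A])
    fix \<omega> assume w: "\<omega> \<in> A"
    then have "\<omega> \<in> space random_source" using A(1) sets.sets_into_space by blast
    then show "1 - 1 / 1000 \<le> measure random_source {\<omega>' \<in> space random_source. mrg {mpos..} \<omega> \<omega>' \<in> success}"
      by (rule final_stage[where X = pt]) (use False D[OF w] in auto)
  qed simp_all
  then show ?thesis by simp
next
  case True
  obtain A where A: "A \<in> sets random_source" "measure random_source A \<ge> 1 - 2 / 1000"
    and A2: "\<And>\<omega>. \<omega> \<in> A \<Longrightarrow> \<exists>B\<in>sets random_source. measure random_source B \<ge> 1 - 4 / 1000 \<and>
      (\<forall>\<omega>'\<in>B. \<forall>s. crude (prj \<omega>) (mrg {bpos..} \<omega> \<omega>') s \<longrightarrow> (\<Sum>a<mA. rmem s (rb + ad 3 a)) \<le> blow * CH)"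
    using crude_projected[OF True] by blast
  have "measure random_source success \<ge> 1 - 2 / 1000 - 5 / 1000"
  proof (rule prob_ge_mrg[OF success_sets A])
    fix \<omega> assume w: "\<omega> \<in> A"
    then have ws: "\<omega> \<in> space random_source" using A(1) sets.sets_into_space by blast
    obtain B where B: "B \<in> sets random_source" "measure random_source B \<ge> 1 - 4 / 1000"
      and D: "\<And>\<omega>' s. \<omega>' \<in> B \<Longrightarrow> crude (prj \<omega>) (mrg {bpos..} \<omega> \<omega>') s \<Longrightarrow> (\<Sum>a<mA. rmem s (rb + ad 3 a)) \<le> blow * CH"
      using A2[OF w] by blast
    let ?E = "{\<omega>' \<in> space random_source. mrg {bpos..} \<omega> \<omega>' \<in> success}"
    have "measure random_source ?E \<ge> 1 - 4 / 1000 - 1 / 1000"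
    proof (rule prob_ge_mrg[OF mrg_vimage_sets[OF ws success_sets] B])
      fix \<omega>' assume w': "\<omega>' \<in> B"
      then have ws': "\<omega>' \<in> space random_source" using B(1) sets.sets_into_space by blast
      let ?m = "mrg {bpos..} \<omega> \<omega>'"
      have bm: "bpos \<le> mpos" by (simp add: mpos_def)
      \<comment> \<open>Since \<open>bpos \<le> mpos\<close>, the two splicings commute in this
        sense, which turns the nested event into one about a single frozen source
        \<open>?m\<close>.\<close>
      have "mrg {mpos..} ?m \<omega>'' = mrg {bpos..} \<omega> (mrg {mpos..} \<omega>' \<omega>'')" for \<omega>''
        using bm by (auto simp: mrg_def fun_eq_iff)
      then have eq: "{\<omega>'' \<in> space random_source. mrg {mpos..} \<omega>' \<omega>'' \<in> ?E} = {\<omega>'' \<in> space random_source. mrg {mpos..} ?m \<omega>'' \<in> success}"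
        using mrg_space[OF ws'] by auto
      \<comment> \<open>The projection reads only positions below \<open>k * d = bpos\<close> and so
        is not affected by resampling from \<open>bpos\<close> on.\<close>
      have pr: "prj ?m j i = prj \<omega> j i" if "i < k" for j i
      proof -
        have "i * d + l < bpos" if "l < d" for l using flat_less[OF \<open>i < k\<close> that] True by (simp add: bpos_def)
        then have "\<not> bpos \<le> i * d + l" if "l < d" for l using that by (simp add: not_le)
        then show ?thesis unfolding prj_def mrg_def by (intro sum.cong refl) simp
      qed
      show "1 - 1 / 1000 \<le> measure random_source {\<omega>'' \<in> space random_source. mrg {mpos..} \<omega>' \<omega>'' \<in> ?E}"
        unfolding eq by (rule final_stage[where X = "prj \<omega>", OF mrg_space[OF ws ws']]) (use True D[OF w'] pr in auto)
    qed simp_all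
    then show "1 - 5 / 1000 \<le> measure random_source ?E" by simp
  qed simp_all
  then show ?thesis by simp
qed

end

subsection \<open>Running time\<close>

context machine
begin

abbreviation W :: nat where "W \<equiv> N * d * q"

text \<open>Every cost is a linear combination of monomials bounded by \<open>W\<close>, after which
  linear arithmetic suffices.\<close>

lemma products_le:
  assumes d: "1 \<le> d"
  shows "1 \<le> W" "N \<le> W" "q \<le> W" "N * d \<le> W" "N * q \<le> W" "d \<le> W" "d * q \<le> W" "1 \<le> N * q" "N \<le> N * q"
proof -
  have N1: "1 \<le> N" and q1: "1 \<le> q" using N_pos q2 by simp_all
  have a: "x \<le> x * y" "x \<le> y * x" if "1 \<le> y" for x y :: nat using that by simp_all
  have *: "1 * 1 * 1 \<le> W" "N * 1 * 1 \<le> W" "1 * 1 * q \<le> W" "N * d * 1 \<le> W" "N * 1 * q \<le> W" "1 * d * 1 \<le> W" "1 * d * q \<le> W"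
    "1 * 1 \<le> N * q" "N * 1 \<le> N * q"
    by (intro mult_le_mono order_refl N1 q1 d)+
  show "1 \<le> W" "N \<le> W" "q \<le> W" "N * d \<le> W" "N * q \<le> W" "d \<le> W" "d * q \<le> W" "1 \<le> N * q" "N \<le> N * q" using * by (simp_all only: mult_1_left mult_1_right)
qed

lemma sort_cost_le: assumes "1 \<le> d" "P \<le> 2 * N" shows "sort_cost \<le> 42 * (N * q)"
proof -
  have "sort_cost = 12 + 10 * N + 8 * P + 4 * (N * q)" by (simp add: sort_cost_def algebra_simps)
  then show ?thesis using products_le(8,9)[OF assms(1)] assms(2) by linarith
qed

lemma coord_cost_le: assumes "1 \<le> d" "P \<le> 2 * N" shows "coord_cost \<le> 67 * (N * q)"
proof -
  have "coord_cost = 8 + 14 * N + 3 * (N * q) + sort_cost" by (simp add: coord_cost_def algebra_simps)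
  then show ?thesis using products_le(8,9)[OF assms(1)] sort_cost_le[OF assms] by linarith
qed

text \<open>A copy sorts once per embedded coordinate, at \<open>O(N q)\<close> each;
  \<open>k \<le> d\<close> keeps the total within \<open>O(W)\<close>.\<close>

lemma copy_cost_le: assumes "1 \<le> d" "P \<le> 2 * N" "k \<le> d" shows "copy_cost \<le> 165 * W"
proof -
  have "copy_cost = 12 + 32 * N + 10 * (N * d) + sort_cost + k * (coord_cost + 2)" by (simp add: copy_cost_def algebra_simps)
  moreover have "k * (coord_cost + 2) \<le> d * (69 * (N * q))"
    using products_le(8)[OF assms(1)] coord_cost_le[OF assms(1,2)] by (intro mult_le_mono assms) linarith
  moreover have "d * (69 * (N * q)) = 69 * W" by (simp add: ac_simps)
  ultimately show ?thesis using products_le[OF assms(1)] sort_cost_le[OF assms(1,2)] by linarith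
qed

lemma crude_cost_le: assumes "1 \<le> d" "P \<le> 2 * N" "k \<le> d" shows "crude_cost \<le> 688 * W"
proof -
  have "mA * (d * 5 + 10) \<le> N * (d * 5 + 10)" using mA_less by (intro mult_le_mono) simp_all
  also have "\<dots> = 5 * (N * d) + 10 * N" by (simp add: algebra_simps)
  finally show ?thesis unfolding crude_cost_def using products_le[OF assms(1)] copy_cost_le[OF assms] by linarith
qed

text \<open>Projecting takes time of order \<open>N * k * d\<close>, which is \<open>96 * W\<close>
  for \<open>k = 96 * q\<close>: the target dimension may be of order \<open>q\<close>, but no
  larger.\<close>

lemma embed_cost_le:
  assumes d: "1 \<le> d" and k: "k = d \<or> k = 96 * q \<and> k < d"
  shows "embed_cost \<le> 895 * W"
proof (cases "k < d")
  case True
  then have k: "k = 96 * q" using k by simp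
  have "embed_cost = 4 * (k * d) + 4 * k + 5 * (N * (k * d)) + 8 * (N * k) + 5 * N + 7"
    unfolding embed_cost_def if_P[OF True] by (simp only: algebra_simps)
  moreover have "k * d = 96 * (d * q)" "N * (k * d) = 96 * W" by (simp_all add: k ac_simps)
  moreover have "N * k \<le> N * d" using True by simp
  ultimately show ?thesis using products_le[OF d] True by linarith
next
  case False
  then have "embed_cost = 3 * (N * d) + 3" by (simp add: embed_cost_def)
  then show ?thesis using products_le[OF d] by linarith
qed

lemma iter_cost_le: assumes "1 \<le> d" shows "iter_cost + 1 \<le> 46 * (N * d)"
proof -
  have "(mB + 1) * (d * 5 + 11) \<le> (2 * N) * (16 * d)" using N mB assms by (intro mult_le_mono) linarith+
  also have "\<dots> = 32 * (N * d)" by simp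
  finally have 1: "(mB + 1) * (d * 5 + 11) \<le> 32 * (N * d)" .
  have "N * 1 \<le> N * d" by (intro mult_le_mono order_refl assms)
  then have "mA \<le> N * d" "1 \<le> N * d" using mA_less by linarith+
  then show ?thesis unfolding iter_cost_def using 1 by linarith
qed

end

context estimator
begin

text \<open>The sampling phase dominates, and
  \<open>1620 + 46 * (10 ^ 18 + 1) \<le> 10 ^ 20\<close>.\<close>

lemma total_cost_le:
  assumes d: "1 \<le> d" and P2: "P \<le> 2 * N" and ic: "ic \<le> 27 * W"
  shows "real total_cost \<le> 10 ^ 20 * (real W / (inp 0)\<^sup>2)"
proof -
  let ?M = "samples (10 ^ 18) (inp 0)" and ?e = "(inp 0)\<^sup>2"
  have e: "0 < ?e" "?e \<le> 1" using eps by (simp_all add: power_le_one)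
  have k2: "k = d \<or> k = 96 * q \<and> k < d" using k by (auto simp: target_dim_def)
  have "total_cost \<le> 27 * W + (895 * W + 688 * W) + (?M * (46 * (N * d)) + N * 3 + 7)"
    unfolding total_cost_def using ic embed_cost_le[OF d k2] crude_cost_le[OF d P2 k_le] mA_less
    by (intro add_mono mult_le_mono iter_cost_le[OF d] order_refl) simp_all
  also have "\<dots> \<le> 1620 * W + ?M * (46 * (N * d))" using products_le[OF d] by linarith
  finally have 1: "real total_cost \<le> 1620 * real W + real ?M * (46 * real (N * d))"
    by (metis (mono_tags, opaque_lifting) of_nat_add of_nat_le_iff of_nat_mult of_nat_numeral)
  have q1: "1 \<le> real q" using q2 by simp
  define w where "w = real W / ?e"
  have w: "real W \<le> w" "0 \<le> w" unfolding w_def using e by (simp_all add: pos_le_divide_eq mult_left_le)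
  have "real ?M \<le> (10 ^ 18 + 1) * (real q / ?e)"
  proof -
    \<comment> \<open>Rounding the number of samples up adds at most 1, which this absorbs into one
      further multiple of \<open>q / \<epsilon>\<^sup>2\<close>.\<close>
    have "1 \<le> real q / ?e" using e q1 by (simp add: pos_le_divide_eq)
    moreover have "0 \<le> real (10 ^ 18) * real q / ?e" using e by simp
    then have "real ?M \<le> real (10 ^ 18) * real q / ?e + 1" unfolding samples_def by linarith
    moreover have "real (10 ^ 18) * real q / ?e = 10 ^ 18 * (real q / ?e)" by simp
    moreover have "(10 ^ 18 + 1) * (real q / ?e) = 10 ^ 18 * (real q / ?e) + real q / ?e" by (simp only: distrib_right mult_1_left)
    ultimately show ?thesis by linarith
  qed
  then have "real ?M * (46 * real (N * d)) \<le> (10 ^ 18 + 1) * (real q / ?e) * (46 * real (N * d))"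
    by (intro mult_right_mono) simp_all
  moreover have "(10 ^ 18 + 1) * (real q / ?e) * (46 * real (N * d)) = (46 * (10 ^ 18 + 1)) * w"
    unfolding w_def by (simp add: ac_simps)
  ultimately have "real ?M * (46 * real (N * d)) \<le> (46 * (10 ^ 18 + 1)) * w" by (simp only:)
  then have "real total_cost \<le> 1620 * w + (46 * (10 ^ 18 + 1)) * w" using 1 w(1) by linarith
  also have "\<dots> = (1620 + 46 * (10 ^ 18 + 1)) * w" by (simp only: distrib_right)
  also have "\<dots> \<le> 10 ^ 20 * w" by (rule mult_right_mono[OF _ w(2)]) simp
  finally show ?thesis unfolding w_def .
qed

end

lemma two_power_lg_le: "1 \<le> n \<Longrightarrow> 2 ^ lg n \<le> 2 * n"
proof (cases "lg n")
  case (Suc j)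
  then show "2 ^ lg n \<le> 2 * n" using less_lg_iff[of j n] by simp
qed simp

lemma init_cost_le: "N \<le> w \<Longrightarrow> j + 2 \<le> w \<Longrightarrow> 1 \<le> w \<Longrightarrow> 2 ^ j \<le> 2 * N \<Longrightarrow> init_cost N j \<le> 27 * w"
  by (simp add: init_cost_def)

text \<open>If \<open>lg m = j + 1\<close>, then
  \<open>j * ln 2 < ln (2 * n) \<le> 2 * ln n\<close>, so \<open>ln 2 \<ge> 2 / 3\<close> gives
  \<open>j \<le> 3 * ln n\<close>. The additive 3 is at most \<open>4.5 * ln n\<close> because
  \<open>n \<ge> 2\<close>.\<close>

lemma lg_bound:
  assumes n: "2 \<le> n" and m: "m \<le> 2 * n"
  shows "real (lg m + 2) \<le> 8 * ln (real n)"
proof -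
  have l: "2 / 3 \<le> ln (2::real)" by (rule ln2_ge_two_thirds)
  have ln: "ln 2 \<le> ln (real n)" using n by simp
  show ?thesis
  proof (cases "lg m")
    case 0
    then show ?thesis using l ln by simp
  next
    case (Suc j)
    then have "2 ^ j < m" using less_lg_iff[of j m] by simp
    then have "2 ^ j < 2 * n" using m by simp
    then have "(2::real) ^ j < 2 * real n" by (metis of_nat_less_iff of_nat_mult of_nat_numeral of_nat_power)
    then have "ln ((2::real) ^ j) < ln (2 * real n)" using n by (subst ln_less_cancel_iff) simp_all
    then have "real j * ln 2 < ln 2 + ln (real n)" using n by (simp add: ln_realpow ln_mult)
    moreover have "real j * (2 / 3) \<le> real j * ln 2" by (intro mult_left_mono l) simp
    moreover have "real (lg m + 2) = real j + 3" using Suc by simp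
    moreover have "real j * ln 2 \<le> 2 * ln (real n)" using calculation(1) ln by linarith
    ultimately show ?thesis using l ln by linarith
  qed
qed

lemma concat_nth: "\<forall>z\<in>set zs. length z = d \<Longrightarrow> j < length zs \<Longrightarrow> i < d \<Longrightarrow> concat zs ! (j * d + i) = zs ! j ! i"
proof (induction zs arbitrary: j)
  case (Cons z zs)
  then show ?case by (cases j) (simp_all add: nth_append)
qed simp

lemma length_concat_const: "\<forall>z\<in>set zs. length z = d \<Longrightarrow> length (concat zs) = length zs * d"
  by (induction zs) simp_all

text \<open>\<open>estimator.prog\<close> depends only on the initialisation and on
  \<open>l2\<close>. Instantiating the locale for each input therefore always yields the same
  program. In the running time, \<open>N \<le> 2 * n\<close> and \<open>q \<le> 8 * ln n\<close>
  contribute the factor 16.\<close>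

lemma estimator_correct:
  fixes l2 :: bool and n d :: nat and \<epsilon> :: real
  defines "dX \<equiv> (if l2 then euclidean_dist else manhattan_dist)"
  assumes n: "2 \<le> n" and d: "1 \<le> d" and e: "0 < \<epsilon>" "\<epsilon> < 1"
    and A: "A \<subseteq> Rd d" "card A \<le> n" "enumerates xs A"
    and B: "B \<subseteq> Rd d" "card B \<le> n" "enumerates ys B" "B \<noteq> {}"
  shows "\<forall>\<omega>\<in>space random_source. halts_within (estimator.prog (initc l2) l2) \<omega> (input_state d xs ys \<epsilon>)
      (2 * 10 ^ 21 * (real n * real d * ln (real n) / \<epsilon>\<^sup>2))" (is ?halts)
    and "measure random_source {\<omega> \<in> space random_source.
      \<exists>\<eta>. outputs (estimator.prog (initc l2) l2) \<omega> (input_state d xs ys \<epsilon>) \<eta> \<and>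
        (1 - \<epsilon>) * chamfer dX A B \<le> \<eta> \<and> \<eta> \<le> (1 + \<epsilon>) * chamfer dX A B} \<ge> 99 / 100" (is ?prob)
proof -
  let ?s = "input_state d xs ys \<epsilon>"
  let ?mA = "length xs" and ?mB = "length ys" and ?zs = "xs @ ys"
  let ?N = "length xs + length ys"
  let ?q = "lg ?N + 2" and ?P = "2 ^ lg ?N"
  have xs: "distinct xs" "set xs = A" and ys: "distinct ys" "set ys = B" using A B by (auto simp: enumerates_def)
  have len: "\<forall>z\<in>set ?zs. length z = d" using A(1) B(1) xs ys by (auto simp: Rd_def)
  have mB: "0 < ?mB" using ys B(4) by auto
  have sz: "?mA \<le> n" "?mB \<le> n" using A(2) B(2) xs ys by (metis distinct_card)+
  have s: "nmem ?s 0 = ?mA" "nmem ?s 1 = ?mB" "nmem ?s 2 = d" "pos ?s = 0" "rmem ?s 0 = \<epsilon>"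
    by (simp_all add: input_state_def)
  interpret E: estimator ?mA ?mB d ?N "?N * d + 1" ?P ?q "target_dim l2 ?q d" "rmem ?s" ?s "initc l2" "init_cost ?N (lg ?N)" l2
  proof unfold_locales
    show "?N \<le> ?P" by (rule le_two_power_lg)
    show "?N \<le> 2 ^ ?q" using le_two_power_lg[of ?N] by (simp add: power_add)
    show "hx \<omega> (initc l2) (init_cost ?N (lg ?N)) ?s
      (\<lambda>s'. machine.ctx ?mA ?mB d ?N (?N * d + 1) ?P ?q (target_dim l2 ?q d) (rmem ?s) s' \<and> pos s' = 0)" for \<omega>
      using hx_init[OF mB s(1-3), of \<omega> l2] unfolding s(4) .
  qed (use mB e s in \<open>simp_all\<close>)
  have P2: "?P \<le> 2 * ?N" by (rule two_power_lg_le) (use mB in linarith)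
  have W1: "?N \<le> E.W" "?q \<le> E.W" "1 \<le> E.W" using E.products_le[OF d] by blast+
  have "init_cost ?N (lg ?N) \<le> 27 * E.W" by (rule init_cost_le[OF W1 P2])
  note cost = E.total_cost_le[OF d P2 this]
  have "real ?q \<le> 8 * ln (real n)" by (rule lg_bound[OF n]) (use sz in simp)
  then have "real ?N * real d * real ?q \<le> (2 * real n) * real d * (8 * ln (real n))"
    using sz n by (intro mult_mono) (auto intro!: mult_nonneg_nonneg)
  then have "real E.W \<le> (2 * real n) * real d * (8 * ln (real n))" by (simp only: of_nat_mult)
  then have "real E.W / \<epsilon>\<^sup>2 \<le> ((2 * real n) * real d * (8 * ln (real n))) / \<epsilon>\<^sup>2"
    by (rule divide_right_mono) simp
  also have "\<dots> = 16 * (real n * real d * ln (real n) / \<epsilon>\<^sup>2)" by simp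
  finally have W: "real E.W / \<epsilon>\<^sup>2 \<le> 16 * (real n * real d * ln (real n) / \<epsilon>\<^sup>2)" .
  have nn: "0 \<le> real n * real d * ln (real n) / \<epsilon>\<^sup>2" using n by simp
  have "real E.total_cost \<le> 10 ^ 20 * (real E.W / \<epsilon>\<^sup>2)" using cost unfolding s(5) .
  also have "\<dots> \<le> 10 ^ 20 * (16 * (real n * real d * ln (real n) / \<epsilon>\<^sup>2))" by (rule mult_left_mono[OF W]) simp
  also have "\<dots> = 10 ^ 20 * 16 * (real n * real d * ln (real n) / \<epsilon>\<^sup>2)" by (simp only: mult.assoc)
  also have "\<dots> \<le> 2 * 10 ^ 21 * (real n * real d * ln (real n) / \<epsilon>\<^sup>2)" by (rule mult_right_mono[OF _ nn]) simp
  finally have "real E.total_cost \<le> 2 * 10 ^ 21 * (real n * real d * ln (real n) / \<epsilon>\<^sup>2)" .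
  then show ?halts using E.halts_prog unfolding halts_within_def by (meson order_trans)
  have pt: "E.pt j i = ?zs ! j ! i" if "j < ?N" "i < d" for j i
  proof -
    have l: "length (concat ?zs) = ?N * d" using length_concat_const[OF len] by simp
    have "j * d + i < ?N * d" by (rule E.flat_less[OF that])
    then have "rmem ?s (1 + j * d + i) = concat ?zs ! (j * d + i)"
      unfolding input_state_def Let_def using l by simp
    then show ?thesis unfolding E.pt_def using concat_nth[OF len] that by simp
  qed
  have lz: "length (?zs ! j) = d" if "j < ?N" for j using len that by (metis length_append nth_mem)
  have ds: "E.dst l2 a b = dX (?zs ! a) (?zs ! b)" if "a < ?N" "b < ?N" for a b
    using that lz pt by (simp add: E.dst_def dfin_def dterm_def dX_def euclidean_dist_def manhattan_dist_def L2_set_def)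
  have nnx: "E.nn l2 a = (MIN b\<in>B. dX (xs ! a) b)" if a: "a < ?mA" for a
  proof -
    have "E.dst l2 a ` {?mA..<?N} = (\<lambda>b. dX (?zs ! a) (?zs ! b)) ` {?mA..<?N}"
      using a by (intro image_cong refl ds) auto
    also have "\<dots> = dX (xs ! a) ` ((\<lambda>b. ?zs ! b) ` {?mA..<?N})" using a by (simp add: image_image nth_append)
    also have "(\<lambda>b. ?zs ! b) ` {?mA..<?N} = B"
    proof -
      have "{?mA..<?N} = (\<lambda>j. ?mA + j) ` {..<?mB}" by (simp add: lessThan_atLeast0 add.commute)
      then show ?thesis unfolding ys(2)[symmetric] set_conv_nth by (auto simp: image_image)
    qed
    finally show ?thesis by (simp add: E.nn_def)
  qed
  have "chamfer dX A B = (\<Sum>a<?mA. MIN b\<in>B. dX (xs ! a) b)"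
    unfolding chamfer_def by (rule sum.reindex_bij_betw[OF bij_betw_nth, symmetric]) (use xs in auto)
  then have "chamfer dX A B = E.CH" unfolding E.CH_def by (simp add: nnx)
  then show ?prob using E.success_prob unfolding s(5) by simp
qed

theorem theorem1:
  fixes dX :: "real list \<Rightarrow> real list \<Rightarrow> real"
  assumes "dX = manhattan_dist \<or> dX = euclidean_dist"
  shows "\<exists>(chamfer_estimate :: com) (C :: real).
    \<forall>(n :: nat) (d :: nat) (\<epsilon> :: real) A B xs ys.
      2 \<le> n \<and> 1 \<le> d \<and> 0 < \<epsilon> \<and> \<epsilon> < 1 \<and>
      finite A \<and> A \<subseteq> Rd d \<and> card A \<le> n \<and> enumerates xs A \<and>
      finite B \<and> B \<subseteq> Rd d \<and> card B \<le> n \<and> enumerates ys B \<and> B \<noteq> {} \<longrightarrow>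
        (\<forall>\<omega>\<in>space random_source.
          halts_within chamfer_estimate \<omega> (input_state d xs ys \<epsilon>)
            (C * (real n * real d * ln (real n) / \<epsilon>\<^sup>2))) \<and>
        measure random_source {\<omega> \<in> space random_source.
          \<exists>\<eta>. outputs chamfer_estimate \<omega> (input_state d xs ys \<epsilon>) \<eta> \<and>
            (1 - \<epsilon>) * chamfer dX A B \<le> \<eta> \<and> \<eta> \<le> (1 + \<epsilon>) * chamfer dX A B} \<ge> 99 / 100"
proof -
  define l2 where "l2 \<longleftrightarrow> dX = euclidean_dist"
  have dX: "dX = (if l2 then euclidean_dist else manhattan_dist)" using assms by (auto simp: l2_def)
  show ?thesis unfolding dX
    by (intro exI[of _ "estimator.prog (initc l2) l2"] exI[of _ "2 * 10 ^ 21"] allI impI conjI) (elim conjE, rule estimator_correct; assumption)+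
qed

end
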